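(* Let $\Omega\subset\mathbb{R}^N$ be a bounded domain with smooth boundary $\partial\Omega$. Suppose that $2<p<\frac{N}{N-4}+1$ if $N>4$, and $p>2$ if $N\le 4$. Let $(u_0,u_1)\in [H^2(\Omega)\cap H_0^1(\Omega)]\times H_0^1(\Omega)$ satisfy $E(0)<0$, where $$E(0)=\frac12\left(\|u_1\|_2^2+\|\nabla u_0\|_2^2\right)-\frac1p\|u_0\|_p^p .$$ Then the corresponding solution $u$ of $$\begin{cases} u_{tt}-\Delta u+u_t\ln(1+u_t^2)=|u|^{p-2}u, & \text{in } \Omega\times(0,\infty),\\ u(x,t)=0, & \text{on } \partial\Omega,\\ u(x,0)=u_0(x),\quad u_t(x,0)=u_1(x), & \text{in } \Omega,\end{cases}$$ blows up in finite time.
   Context: $\|\cdot\|_q$ denotes the norm of $L^q(\Omega)$, $\ln$ is the natural logarithm, and all functions are real-valued. A solution on $\Omega\times(0,T)$ means a function with $u\in L^\infty(0,T;H^2(\Omega)\cap H_0^1(\Omega))$, $u_t\in L^\infty(0,T;H_0^1(\Omega))$, $u_{tt}\in L^\infty(0,T;L^2(\Omega))$ for which the equation holds almost everywhere in $\Omega\times(0,T)$ and the initial conditions are satisfied. "Blows up in finite time" means that the solution cannot exist for all time: there is a finite time $T^*>0$ (depending on the data) such that no solution with initial data $(u_0,u_1)$ exists on $\Omega\times(0,T)$ for $T>T^*$. *)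

theory Defs
  imports "HOL-Analysis.Analysis"
begin

section \<open>Smooth functions and domains\<close>

primrec C_k :: "nat \<Rightarrow> ('a::euclidean_space \<Rightarrow> real) \<Rightarrow> bool" where
  "C_k 0 f \<longleftrightarrow> continuous_on UNIV f"
| "C_k (Suc k) f \<longleftrightarrow> f differentiable_on UNIV \<and>
     (\<forall>i\<in>Basis. C_k k (\<lambda>x. frechet_derivative f (at x) i))"

definition smooth :: "('a::euclidean_space \<Rightarrow> real) \<Rightarrow> bool" where
  "smooth f \<longleftrightarrow> (\<forall>k. C_k k f)"

text \<open>The boundary is smooth if near each of its points the set is, after a rotation, the region
  above the graph of a smooth function. The direction of the graph is the unit vector \<open>e\<close>, and
  \<open>\<gamma>\<close> is only evaluated on the hyperplane orthogonal to \<open>e\<close>.\<close>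

definition smooth_boundary :: "'a::euclidean_space set \<Rightarrow> bool" where
  "smooth_boundary \<Omega> \<longleftrightarrow>
     (\<forall>y\<in>frontier \<Omega>. \<exists>r>0. \<exists>e \<gamma>. norm e = 1 \<and> smooth \<gamma> \<and>
        \<Omega> \<inter> ball y r = {x \<in> ball y r. x \<bullet> e > \<gamma> (x - (x \<bullet> e) *\<^sub>R e)})"

definition bounded_smooth_domain :: "'a::euclidean_space set \<Rightarrow> bool" where
  "bounded_smooth_domain \<Omega> \<longleftrightarrow>
     open \<Omega> \<and> connected \<Omega> \<and> \<Omega> \<noteq> {} \<and> bounded \<Omega> \<and> smooth_boundary \<Omega>"

section \<open>Lebesgue and Sobolev spaces\<close>

text \<open>Elements of function spaces are represented by functions on the whole type; only their values
  almost everywhere on the domain matter. The norms below are meaningful on the corresponding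
  spaces only, since the Bochner integral of a non-integrable function is \<open>0\<close>.\<close>

definition Lq_space :: "real \<Rightarrow> 'a::euclidean_space set \<Rightarrow> ('a \<Rightarrow> real) set" where
  "Lq_space q \<Omega> = {f \<in> borel_measurable (lebesgue_on \<Omega>).
     integrable (lebesgue_on \<Omega>) (\<lambda>x. \<bar>f x\<bar> powr q)}"

definition Lq_norm :: "real \<Rightarrow> 'a::euclidean_space set \<Rightarrow> ('a \<Rightarrow> real) \<Rightarrow> real" where
  "Lq_norm q \<Omega> f = (LINT x|lebesgue_on \<Omega>. \<bar>f x\<bar> powr q) powr (1 / q)"

definition test_functions :: "'a::euclidean_space set \<Rightarrow> ('a \<Rightarrow> real) set" where
  "test_functions \<Omega> = {\<phi>. smooth \<phi> \<and> (\<exists>K. compact K \<and> K \<subseteq> \<Omega> \<and> (\<forall>x. x \<notin> K \<longrightarrow> \<phi> x = 0))}"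

definition locally_integrable :: "'a::euclidean_space set \<Rightarrow> ('a \<Rightarrow> real) \<Rightarrow> bool" where
  "locally_integrable \<Omega> f \<longleftrightarrow> (\<forall>K. compact K \<and> K \<subseteq> \<Omega> \<longrightarrow> set_integrable lebesgue K f)"

definition has_weak_deriv ::
  "'a::euclidean_space set \<Rightarrow> 'a \<Rightarrow> ('a \<Rightarrow> real) \<Rightarrow> ('a \<Rightarrow> real) \<Rightarrow> bool" where
  "has_weak_deriv \<Omega> i f g \<longleftrightarrow> locally_integrable \<Omega> f \<and> locally_integrable \<Omega> g \<and>
     (\<forall>\<phi>\<in>test_functions \<Omega>.
        (LINT x|lebesgue_on \<Omega>. f x * frechet_derivative \<phi> (at x) i) =
        - (LINT x|lebesgue_on \<Omega>. g x * \<phi> x))"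

text \<open>Some representative of the weak derivative (unique up to null sets when it exists).\<close>

definition weak_deriv :: "'a::euclidean_space set \<Rightarrow> 'a \<Rightarrow> ('a \<Rightarrow> real) \<Rightarrow> 'a \<Rightarrow> real" where
  "weak_deriv \<Omega> i f = (SOME g. has_weak_deriv \<Omega> i f g)"

definition grad_norm :: "'a::euclidean_space set \<Rightarrow> ('a \<Rightarrow> real) \<Rightarrow> real" where
  "grad_norm \<Omega> f = Lq_norm 2 \<Omega> (\<lambda>x. sqrt (\<Sum>i\<in>Basis. (weak_deriv \<Omega> i f x)\<^sup>2))"

definition H1 :: "'a::euclidean_space set \<Rightarrow> ('a \<Rightarrow> real) set" where
  "H1 \<Omega> = {f \<in> Lq_space 2 \<Omega>. \<forall>i\<in>Basis. \<exists>g\<in>Lq_space 2 \<Omega>. has_weak_deriv \<Omega> i f g}"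

definition H1_norm :: "'a::euclidean_space set \<Rightarrow> ('a \<Rightarrow> real) \<Rightarrow> real" where
  "H1_norm \<Omega> f = sqrt ((Lq_norm 2 \<Omega> f)\<^sup>2 + (grad_norm \<Omega> f)\<^sup>2)"

definition H10 :: "'a::euclidean_space set \<Rightarrow> ('a \<Rightarrow> real) set" where
  "H10 \<Omega> = {f \<in> H1 \<Omega>. \<exists>\<phi>. (\<forall>n::nat. \<phi> n \<in> test_functions \<Omega>) \<and>
     (\<lambda>n. H1_norm \<Omega> (\<lambda>x. \<phi> n x - f x)) \<longlonglongrightarrow> 0}"

definition H2 :: "'a::euclidean_space set \<Rightarrow> ('a \<Rightarrow> real) set" where
  "H2 \<Omega> = {f \<in> H1 \<Omega>. \<forall>i\<in>Basis. weak_deriv \<Omega> i f \<in> H1 \<Omega>}"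

definition H2_norm :: "'a::euclidean_space set \<Rightarrow> ('a \<Rightarrow> real) \<Rightarrow> real" where
  "H2_norm \<Omega> f = sqrt ((H1_norm \<Omega> f)\<^sup>2 + (\<Sum>i\<in>Basis. (grad_norm \<Omega> (weak_deriv \<Omega> i f))\<^sup>2))"

section \<open>Functions of time with values in a function space\<close>

text \<open>The Bochner space \<open>L\<^sup>\<infinity>(0,T;X)\<close> for a function space \<open>X\<close> with norm \<open>nrm\<close>: the function is almost
  everywhere a limit of simple functions with values in \<open>X\<close>, and is essentially bounded.\<close>

definition strongly_measurable ::
  "real \<Rightarrow> ('a \<Rightarrow> real) set \<Rightarrow> (('a \<Rightarrow> real) \<Rightarrow> real) \<Rightarrow> (real \<Rightarrow> 'a \<Rightarrow> real) \<Rightarrow> bool" where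
  "strongly_measurable T X nrm f \<longleftrightarrow>
     (\<exists>s :: nat \<Rightarrow> real \<Rightarrow> 'a \<Rightarrow> real.
        (\<forall>n. finite (s n ` {0<..<T}) \<and> s n ` {0<..<T} \<subseteq> X \<and>
             (\<forall>v. {t \<in> {0<..<T}. s n t = v} \<in> sets lebesgue)) \<and>
        (AE t in lebesgue_on {0<..<T}. f t \<in> X \<and> (\<lambda>n. nrm (\<lambda>x. s n t x - f t x)) \<longlonglongrightarrow> 0))"

definition Linfty_Bochner ::
  "real \<Rightarrow> ('a \<Rightarrow> real) set \<Rightarrow> (('a \<Rightarrow> real) \<Rightarrow> real) \<Rightarrow> (real \<Rightarrow> 'a \<Rightarrow> real) set" where
  "Linfty_Bochner T X nrm = {f. strongly_measurable T X nrm f \<and>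
     (\<exists>C. AE t in lebesgue_on {0<..<T}. nrm (f t) \<le> C)}"

text \<open>Functions in the solution class are determined up to null sets, so the value at time \<open>0\<close> is
  that of the representative in \<open>C([0,T);L\<^sup>2(\<Omega>))\<close>.\<close>

definition has_initial_value ::
  "'a::euclidean_space set \<Rightarrow> real \<Rightarrow> ('a \<times> real \<Rightarrow> real) \<Rightarrow> ('a \<Rightarrow> real) \<Rightarrow> bool" where
  "has_initial_value \<Omega> T u w \<longleftrightarrow>
     (\<exists>U :: real \<Rightarrow> 'a \<Rightarrow> real.
        (\<forall>t\<in>{0..<T}. U t \<in> Lq_space 2 \<Omega> \<and>
           ((\<lambda>s. Lq_norm 2 \<Omega> (\<lambda>x. U s x - U t x)) \<longlongrightarrow> 0) (at t within {0..<T})) \<and>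
        (AE t in lebesgue_on {0<..<T}. AE x in lebesgue_on \<Omega>. U t x = u (x, t)) \<and>
        (AE x in lebesgue_on \<Omega>. U 0 x = w x))"

section \<open>The wave equation with logarithmic damping\<close>

text \<open>Weak Laplacian in the space variables of a function on a space-time domain.\<close>

definition has_weak_laplacian ::
  "('a::euclidean_space \<times> real) set \<Rightarrow> ('a \<times> real \<Rightarrow> real) \<Rightarrow> ('a \<times> real \<Rightarrow> real) \<Rightarrow> bool" where
  "has_weak_laplacian Q u L \<longleftrightarrow>
     (\<exists>G H. (\<forall>i\<in>Basis. has_weak_deriv Q (i, 0) u (G i) \<and> has_weak_deriv Q (i, 0) (G i) (H i)) \<and>
            L = (\<lambda>z. \<Sum>i\<in>Basis. H i z))"

text \<open>Below, \<open>u'\<close>, \<open>u''\<close> and \<open>L\<close> are the weak derivatives \<open>u\<^sub>t\<close>, \<open>u\<^sub>t\<^sub>t\<close> and \<open>\<Delta>u\<close>. The boundary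
  condition is contained in the membership in \<open>H10\<close>.\<close>

definition is_solution ::
  "'a::euclidean_space set \<Rightarrow> real \<Rightarrow> ('a \<Rightarrow> real) \<Rightarrow> ('a \<Rightarrow> real) \<Rightarrow> real \<Rightarrow> ('a \<times> real \<Rightarrow> real) \<Rightarrow> bool"
  where
  "is_solution \<Omega> p u0 u1 T u \<longleftrightarrow>
     (\<exists>u' u'' L.
        has_weak_deriv (\<Omega> \<times> {0<..<T}) (0, 1) u u' \<and>
        has_weak_deriv (\<Omega> \<times> {0<..<T}) (0, 1) u' u'' \<and>
        has_weak_laplacian (\<Omega> \<times> {0<..<T}) u L \<and>
        (\<lambda>t x. u (x, t)) \<in> Linfty_Bochner T (H2 \<Omega> \<inter> H10 \<Omega>) (H2_norm \<Omega>) \<and>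
        (\<lambda>t x. u' (x, t)) \<in> Linfty_Bochner T (H10 \<Omega>) (H1_norm \<Omega>) \<and>
        (\<lambda>t x. u'' (x, t)) \<in> Linfty_Bochner T (Lq_space 2 \<Omega>) (Lq_norm 2 \<Omega>) \<and>
        (AE z in lebesgue_on (\<Omega> \<times> {0<..<T}).
           u'' z - L z + u' z * ln (1 + (u' z)\<^sup>2) = \<bar>u z\<bar> powr (p - 2) * u z) \<and>
        has_initial_value \<Omega> T u u0 \<and>
        has_initial_value \<Omega> T u' u1)"

definition blows_up_in_finite_time ::
  "'a::euclidean_space set \<Rightarrow> real \<Rightarrow> ('a \<Rightarrow> real) \<Rightarrow> ('a \<Rightarrow> real) \<Rightarrow> bool" where
  "blows_up_in_finite_time \<Omega> p u0 u1 \<longleftrightarrow>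
     (\<exists>Tstar>0. \<forall>T>Tstar. \<not> (\<exists>u. is_solution \<Omega> p u0 u1 T u))"

definition initial_energy ::
  "'a::euclidean_space set \<Rightarrow> real \<Rightarrow> ('a \<Rightarrow> real) \<Rightarrow> ('a \<Rightarrow> real) \<Rightarrow> real" where
  "initial_energy \<Omega> p u0 u1 =
     1 / 2 * ((Lq_norm 2 \<Omega> u1)\<^sup>2 + (grad_norm \<Omega> u0)\<^sup>2) - 1 / p * Lq_norm p \<Omega> u0 powr p"

end

theory Submission
  imports Defs
begin

text \<open>Let \<open>H = - E\<close>. The energy identity \<open>H' = \<integral> u\<^sub>t\<^sup>2 ln (1 + u\<^sub>t\<^sup>2)\<close> keeps \<open>H\<close> positive. With
  \<open>\<alpha> = 1/2 - 1/p\<close> and \<open>\<epsilon>\<close> small, the functional \<open>\<Lambda> = H\<^bsup>1 - \<alpha>\<^esup> + \<epsilon> \<integral> u u\<^sub>t\<close> starts positive and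
  satisfies \<open>\<Lambda>' \<ge> c \<Lambda>\<^bsup>1 / (1 - \<alpha>)\<^esup>\<close>, which bounds the lifespan; the damping term in \<open>\<Lambda>'\<close> is absorbed
  since \<open>ln (1 + y\<^sup>2)\<close> grows more slowly than any power of \<open>y\<close>.

  To justify the energy identity for solutions of the given regularity, note that functions in
  \<open>H10 \<Omega>\<close> lie in \<open>L\<^bsup>2 + 2/N\<^esup>\<close>, where \<open>N\<close> is the dimension. So the damping term is in \<open>L\<^sup>2\<close> at
  almost every time, and by the equation so is \<open>\<bar>u\<bar>\<^bsup>p - 1\<^esup>\<close>. The time derivative of \<open>\<parallel>\<nabla>u\<parallel>\<^sup>2 = - \<integral> u \<Delta>u\<close>
  comes from the symmetry of the Laplacian: the increment between times \<open>s\<close> and \<open>t\<close> is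
  \<open>- \<integral> (u(t) - u(s)) (\<Delta>u(t) + \<Delta>u(s))\<close>, so \<open>\<nabla>u\<^sub>t\<close> never appears.\<close>

section \<open>Smooth functions\<close>

text \<open>The exponent \<alpha> is dictated by two balances: 1/p + 1/2 = 1 - \<alpha> bounds the
  integral of u u_t by the power 1 - \<alpha> of |u|_p^p + |u_t|_2^2, and 2/p + 2 \<alpha> = 1 makes
  the bound for the damping cross term linear in H, |u|_p^p and |u_t|_2^2. The gradient is
  eliminated through the energy identity, never estimated, and the resulting lifespan bound contains
  the data only. The obstacle is that a solution is known up to null sets, its slices are regular at
  almost every time only, and its weak derivatives are taken jointly in (x, t). Testing with
  products of bumps from a countable family turns this into statements about almost every slice.
  Representatives that are primitives in time then allow one-dimensional calculus for almost every
  x, and Fubini leads back to integrals over the domain. Constants of integration are tied to the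
  data by looking at arbitrarily small times.\<close>

lemma C_k_continuous: "C_k k f \<Longrightarrow> continuous_on UNIV f"
  by (cases k) (auto intro: differentiable_imp_continuous_on)

lemma C_k_SucD: "C_k (Suc k) f \<Longrightarrow> C_k k f"
  by (induction k arbitrary: f) (auto intro: differentiable_imp_continuous_on)

lemma C_k_SucI:
  assumes "\<And>x. (f has_derivative D x) (at x)" and "\<And>i. i \<in> Basis \<Longrightarrow> C_k k (\<lambda>x. D x i)"
  shows "C_k (Suc k) f"
proof -
  have "frechet_derivative f (at x) = D x" for x
    using assms(1)[of x] by (metis frechet_derivative_at)
  moreover have "f differentiable_on UNIV"
    using assms(1) by (auto simp: differentiable_on_def differentiable_def)
  ultimately show ?thesis using assms(2) by simp
qed

lemma C_k_has_derivative:
  assumes "C_k (Suc k) f"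
  shows "(f has_derivative frechet_derivative f (at x)) (at x)"
  using assms by (simp add: differentiable_on_def frechet_derivative_works)

lemma C_k_const: "C_k k (\<lambda>x::'a::euclidean_space. c)"
proof (induction k arbitrary: c)
  case (Suc k)
  show ?case by (rule C_k_SucI[where D="\<lambda>x i. 0"]) (auto intro: Suc)
qed auto

lemma C_k_add: "C_k k f \<Longrightarrow> C_k k g \<Longrightarrow> C_k k (\<lambda>x. f x + g x)"
proof (induction k arbitrary: f g)
  case (Suc k)
  show ?case
    by (rule C_k_SucI[OF has_derivative_add[OF C_k_has_derivative[OF Suc(2)] C_k_has_derivative[OF Suc(3)]]])
       (use Suc in auto)
qed (auto intro: continuous_intros)

lemma C_k_mult: "C_k k f \<Longrightarrow> C_k k g \<Longrightarrow> C_k k (\<lambda>x. f x * g x)"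
proof (induction k arbitrary: f g)
  case (Suc k)
  show ?case
    by (rule C_k_SucI[OF has_derivative_mult[OF C_k_has_derivative[OF Suc(2)] C_k_has_derivative[OF Suc(3)]]])
       (intro C_k_add Suc.IH, use Suc.prems C_k_SucD in auto)
qed (auto intro: continuous_intros)

lemma C_k_sum:
  "finite I \<Longrightarrow> (\<And>i. i \<in> I \<Longrightarrow> C_k k (f i)) \<Longrightarrow> C_k k (\<lambda>x. \<Sum>i\<in>I. f i x)"
  by (induction I rule: finite_induct) (auto intro: C_k_const C_k_add)

lemma C_k_prod:
  "finite I \<Longrightarrow> (\<And>i. i \<in> I \<Longrightarrow> C_k k (f i)) \<Longrightarrow> C_k k (\<lambda>x. \<Prod>i\<in>I. f i x)"
  by (induction I rule: finite_induct) (auto intro: C_k_const C_k_mult)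

lemma C_k_compose_affine:
  fixes A :: "'b::euclidean_space \<Rightarrow> 'a::euclidean_space"
  assumes "bounded_linear A" and "C_k k f"
  shows "C_k k (\<lambda>x. f (A x + c))"
  using assms(2)
proof (induction k arbitrary: f)
  case 0
  then show ?case
    using continuous_on_compose2[of UNIV f UNIV "\<lambda>x. A x + c"]
      continuous_on_add[OF linear_continuous_on[OF assms(1)] continuous_on_const] by (simp only: C_k.simps) blast
next
  case (Suc k)
  let ?D = "\<lambda>x. frechet_derivative f (at (A x + c))"
  have "((\<lambda>x. f (A x + c)) has_derivative (\<lambda>h. ?D x (A h))) (at x)" for x
    by (rule has_derivative_compose[where g=f and f="\<lambda>x. A x + c" and f'=A])
       (use C_k_has_derivative[OF Suc(2)] assms(1) in
          \<open>auto intro!: derivative_eq_intros bounded_linear_imp_has_derivative\<close>)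
  moreover have "C_k k (\<lambda>x. ?D x (A i))" for i
  proof -
    have lin: "linear (?D x)" for x
      using C_k_has_derivative[OF Suc(2)] has_derivative_linear by blast
    \<comment> \<open>\<open>A i\<close> need not be a basis vector, while the induction hypothesis
      speaks of partial derivatives; expanding the direction in the basis reduces to those.\<close>
    have "?D x (A i) = (\<Sum>j\<in>Basis. (A i \<bullet> j) * ?D x j)" for x
    proof -
      have "?D x (A i) = ?D x (\<Sum>j\<in>Basis. (A i \<bullet> j) *\<^sub>R j)" by (simp add: euclidean_representation)
      also have "\<dots> = (\<Sum>j\<in>Basis. (A i \<bullet> j) * ?D x j)"
        by (simp add: linear_sum[OF lin] linear_scale[OF lin])
      finally show ?thesis .
    qed
    moreover have "C_k k (\<lambda>x. \<Sum>j\<in>Basis. (A i \<bullet> j) * ?D x j)"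
      by (intro C_k_sum C_k_mult C_k_const Suc.IH) (use Suc.prems in auto)
    ultimately show ?thesis by simp
  qed
  ultimately show ?case by (rule C_k_SucI)
qed

lemma smooth_has_derivative:
  "smooth f \<Longrightarrow> (f has_derivative frechet_derivative f (at x)) (at x)"
  using C_k_has_derivative[of 0 f] by (simp add: smooth_def del: C_k.simps)

lemma smooth_continuous: "smooth f \<Longrightarrow> continuous_on UNIV f"
  unfolding smooth_def using C_k_continuous by blast

lemma smooth_partial: "smooth f \<Longrightarrow> i \<in> Basis \<Longrightarrow> smooth (\<lambda>x. frechet_derivative f (at x) i)"
  unfolding smooth_def by (metis C_k.simps(2))

lemma smooth_const: "smooth (\<lambda>x. c)"
  by (simp add: smooth_def C_k_const)

lemma smooth_add: "smooth f \<Longrightarrow> smooth g \<Longrightarrow> smooth (\<lambda>x. f x + g x)"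
  by (simp add: smooth_def C_k_add)

lemma smooth_mult: "smooth f \<Longrightarrow> smooth g \<Longrightarrow> smooth (\<lambda>x. f x * g x)"
  by (simp add: smooth_def C_k_mult)

lemma smooth_diff: 
  assumes "smooth f" "smooth g" shows "smooth (\<lambda>x. f x - g x)"
  using smooth_add[OF assms(1) smooth_mult[OF smooth_const[of "-1"] assms(2)]] by simp

lemma smooth_prod:
  "finite I \<Longrightarrow> (\<And>i. i \<in> I \<Longrightarrow> smooth (f i)) \<Longrightarrow> smooth (\<lambda>x. \<Prod>i\<in>I. f i x)"
  by (simp add: smooth_def C_k_prod)

lemma smooth_compose_affine:
  fixes A :: "'b::euclidean_space \<Rightarrow> 'a::euclidean_space"
  shows "bounded_linear A \<Longrightarrow> smooth f \<Longrightarrow> smooth (\<lambda>x. f (A x + c))"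
  by (simp add: smooth_def C_k_compose_affine)

lemma smooth_antiderivative:
  fixes F g :: "real \<Rightarrow> real"
  assumes "\<And>x. (F has_real_derivative g x) (at x)" and "smooth g"
  shows "smooth F"
  unfolding smooth_def
proof
  fix k show "C_k k F"
  proof (cases k)
    case 0
    then show ?thesis using assms(1) by (auto intro!: continuous_at_imp_continuous_on DERIV_isCont)
  next
    case (Suc m)
    show ?thesis unfolding Suc
      by (rule C_k_SucI[where D="\<lambda>x h. g x * h"])
         (use assms in \<open>auto simp: has_field_derivative_def smooth_def\<close>)
  qed
qed

section \<open>Bump functions\<close>

text \<open>The factor s^(-n) makes the family closed under differentiation up to linear
  combinations, so smoothness follows by one induction for all \<open>n\<close>. The rate
  \<open>c\<close> is kept free so that letting it tend to 0 can turn products of such functions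
  into indicators.\<close>

definition flat :: "real \<Rightarrow> nat \<Rightarrow> real \<Rightarrow> real" where
  "flat c n s = (if s > 0 then inverse s ^ n * exp (- c / s) else 0)"

text \<open>Substituting y = 1/s turns this into the decay of y^n exp(- c y) at infinity.\<close>

lemma flat_right_limit:
  assumes "c > 0"
  shows "(flat c n \<longlongrightarrow> 0) (at_right 0)"
proof -
  have "((\<lambda>y::real. (1/c)^n * ((c*y) ^ n / exp (c*y))) \<longlongrightarrow> (1/c)^n * 0) at_top"
    by (intro tendsto_mult tendsto_const filterlim_compose[OF tendsto_power_div_exp_0]
        filterlim_tendsto_pos_mult_at_top[OF tendsto_const assms] filterlim_ident)
  then have "((\<lambda>y::real. (1/c)^n * ((c*y) ^ n / exp (c*y))) \<longlongrightarrow> 0) at_top" by simp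
  then have "((\<lambda>s::real. (1/c)^n * ((c*inverse s) ^ n / exp (c*inverse s))) \<longlongrightarrow> 0) (at_right 0)"
    by (rule filterlim_compose[OF _ filterlim_inverse_at_top_right])
  then show ?thesis
  proof (rule Lim_transform_eventually)
    show "\<forall>\<^sub>F s in at_right 0. (1/c)^n * ((c*inverse s) ^ n / exp (c*inverse s)) = flat c n s"
      using assms eventually_at_right_less[of "0::real"]
      by (elim eventually_mono) (simp add: flat_def exp_minus divide_simps power_mult_distrib)
  qed
qed

lemma flat_has_real_derivative:
  assumes "c > 0"
  shows "(flat c n has_real_derivative (- real n * flat c (Suc n) s + c * flat c (Suc (Suc n)) s)) (at s)"
proof -
  consider "s < 0" | "s = 0" | "s > 0" by linarith
  then show ?thesis
  proof cases
    case 1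
    have "((\<lambda>s. 0) has_real_derivative 0) (at s)" by simp
    then have "(flat c n has_real_derivative 0) (at s)"
      by (rule has_field_derivative_transform_within_open[of _ _ _ "{..<0}"])
         (use 1 in \<open>auto simp: flat_def\<close>)
    then show ?thesis using 1 by (simp add: flat_def)
  next
    case 2
    \<comment> \<open>At 0 the difference quotient of \<open>flat c n\<close> is exactly
      \<open>flat c (Suc n)\<close>, so its limit there is the derivative.\<close>
    have "(flat c (Suc n) \<longlongrightarrow> 0) (at 0)"
    proof (subst filterlim_at_split, intro conjI)
      have "\<forall>\<^sub>F s in at_left 0. 0 = flat c (Suc n) s"
        unfolding eventually_at_filter by (rule always_eventually) (simp add: flat_def)
      then show "(flat c (Suc n) \<longlongrightarrow> 0) (at_left 0)"
        by (rule Lim_transform_eventually[OF tendsto_const])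
    qed (rule flat_right_limit[OF assms])
    then have "(flat c n has_real_derivative 0) (at 0)"
      unfolding has_field_derivative_iff
    proof (rule Lim_transform_eventually)
      show "\<forall>\<^sub>F s in at 0. flat c (Suc n) s = (flat c n s - flat c n 0) / (s - 0)"
        unfolding eventually_at_filter by (rule always_eventually) (simp add: flat_def field_simps)
    qed
    then show ?thesis using 2 by (simp add: flat_def)
  next
    case 3
    have inv: "(inverse has_real_derivative - (inverse s)\<^sup>2) (at s)"
      using DERIV_inverse[of s] 3 by (simp add: power2_eq_square)
    have pow: "((\<lambda>s. inverse s ^ n) has_real_derivative - real n * inverse s ^ Suc n) (at s)"
      using DERIV_power[OF inv, of n] by (cases n) (simp_all add: power2_eq_square algebra_simps)
    have "((\<lambda>s. - c * inverse s) has_real_derivative - c * - (inverse s)\<^sup>2) (at s)"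
      by (rule DERIV_cmult[OF inv])
    from DERIV_mult[OF pow DERIV_fun_exp[OF this]]
    have "((\<lambda>s. inverse s ^ n * exp (- c / s)) has_real_derivative
        (- real n * flat c (Suc n) s + c * flat c (Suc (Suc n)) s)) (at s)"
      using 3 by (simp add: flat_def divide_inverse power2_eq_square algebra_simps)
    then show ?thesis
      by (rule has_field_derivative_transform_within_open[of _ _ _ "{0<..}"])
         (use 3 in \<open>auto simp: flat_def\<close>)
  qed
qed

lemma smooth_flat:
  assumes "c > 0" shows "smooth (flat c n)"
  unfolding smooth_def
proof
  fix k show "C_k k (flat c n)"
  proof (induction k arbitrary: n)
    case 0
    show ?case using flat_has_real_derivative[OF assms]
      by (auto intro!: continuous_at_imp_continuous_on DERIV_isCont)
  next
    case (Suc k)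
    let ?d = "\<lambda>s. - real n * flat c (Suc n) s + c * flat c (Suc (Suc n)) s"
    have "C_k k ?d" by (intro C_k_add C_k_mult C_k_const Suc)
    moreover have "(flat c n has_derivative (\<lambda>h. ?d s * h)) (at s)" for s
      using flat_has_real_derivative[OF assms] by (simp only: has_field_derivative_def)
    ultimately show ?case
      by (intro C_k_SucI[of "flat c n" "\<lambda>s h. ?d s * h" k]) simp_all
  qed
qed

text \<open>The index \<open>n\<close> does not move the support, which is always the box; it only
  sends the rate 1/(n+1) to 0. So the bumps of one box stay between 0 and 1 and converge pointwise
  to its indicator, which replaces mollification.\<close>

definition bump :: "nat \<Rightarrow> 'a::euclidean_space \<Rightarrow> 'a \<Rightarrow> 'a \<Rightarrow> real" where
  "bump n a b x = (\<Prod>i\<in>Basis. flat (1 / Suc n) 0 (x \<bullet> i - a \<bullet> i) * flat (1 / Suc n) 0 (b \<bullet> i - x \<bullet> i))"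

lemma smooth_bump: "smooth (bump n a b)"
proof -
  have "smooth (\<lambda>x. flat (1 / Suc n) 0 (x \<bullet> i - a \<bullet> i) * flat (1 / Suc n) 0 (b \<bullet> i - x \<bullet> i))" for i
  proof (rule smooth_mult)
    show "smooth (\<lambda>x. flat (1 / Suc n) 0 (x \<bullet> i - a \<bullet> i))"
      using smooth_compose_affine[OF bounded_linear_inner_left[of i] smooth_flat[of "1 / Suc n" 0], of "- (a \<bullet> i)"]
      by simp
    show "smooth (\<lambda>x. flat (1 / Suc n) 0 (b \<bullet> i - x \<bullet> i))"
      using smooth_compose_affine[OF bounded_linear_minus[OF bounded_linear_inner_left[of i]]
          smooth_flat[of "1 / Suc n" 0], of "b \<bullet> i"]
      by simp
  qed
  then show ?thesis unfolding bump_def[abs_def] by (intro smooth_prod) auto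
qed

lemma bump_eq_0:
  assumes "x \<notin> box a b" shows "bump n a b x = 0"
proof -
  obtain i where "i \<in> Basis" "x \<bullet> i \<le> a \<bullet> i \<or> b \<bullet> i \<le> x \<bullet> i"
    using assms by (force simp: mem_box)
  then show ?thesis unfolding bump_def by (intro prod_zero bexI[of _ i]) (auto simp: flat_def)
qed

lemma flat_bounds: "c > 0 \<Longrightarrow> 0 \<le> flat c 0 s \<and> flat c 0 s \<le> 1"
  by (auto simp: flat_def)

lemma bump_bounds: "0 \<le> bump n a b x" "bump n a b x \<le> 1"
  using flat_bounds[of "1 / Suc n"] by (auto simp: bump_def intro!: prod_nonneg prod_le_1 mult_le_one)

lemma bump_pos: "x \<in> box a b \<Longrightarrow> 0 < bump n a b x"
  by (auto simp: bump_def mem_box flat_def intro!: prod_pos)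

lemma bump_tendsto: "(\<lambda>n. bump n a b x) \<longlonglongrightarrow> indicator (box a b) x"
proof (cases "x \<in> box a b")
  case True
  have *: "(\<lambda>n. flat (1 / Suc n) 0 s) \<longlonglongrightarrow> 1" if "s > 0" for s
  proof -
    have "(\<lambda>n. exp (- (1 / real (Suc n)) / s)) \<longlonglongrightarrow> exp (- 0 / s)"
      by (intro tendsto_intros LIMSEQ_Suc[OF lim_1_over_n]) (use that in auto)
    then show ?thesis using that by (simp add: flat_def)
  qed
  have "(\<lambda>n. bump n a b x) \<longlonglongrightarrow> (\<Prod>i\<in>(Basis::'a set). 1 * 1)"
    unfolding bump_def by (intro tendsto_prod tendsto_mult *) (use True in \<open>auto simp: mem_box\<close>)
  then show ?thesis using True by simp
qed (simp add: bump_eq_0)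

lemma bump_test_function: "cbox a b \<subseteq> \<Omega> \<Longrightarrow> bump n a b \<in> test_functions \<Omega>"
  unfolding test_functions_def using smooth_bump[of n a b] bump_eq_0[of _ a b n] box_subset_cbox[of a b]
  by (auto intro!: exI[of _ "cbox a b"])

section \<open>Testing against countably many bump functions\<close>

text \<open>Countability is the purpose: it allows "for every test function, at almost every time"
  to be turned into "at almost every time, for every test function". The closed box has to lie in
  the set so that the bumps of the box have compact support there.\<close>

definition rat_boxes :: "'a::euclidean_space set \<Rightarrow> ('a \<times> 'a) set" where
  "rat_boxes \<Omega> = {(a, b). (\<forall>i\<in>Basis. a \<bullet> i \<in> \<rat> \<and> b \<bullet> i \<in> \<rat>) \<and> cbox a b \<subseteq> \<Omega>}"

lemma countable_rat_boxes: "countable (rat_boxes (\<Omega>::'a::euclidean_space set))"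
proof -
  let ?R = "{a::'a. \<forall>i\<in>Basis. a \<bullet> i \<in> \<rat>}"
  have "inj_on (\<lambda>a. \<lambda>i\<in>Basis. a \<bullet> i) ?R"
    by (rule inj_onI) (metis (no_types, lifting) euclidean_eqI restrict_apply')
  moreover have "countable ((\<lambda>a. \<lambda>i\<in>Basis. a \<bullet> i) ` ?R)"
    by (rule countable_subset[OF _ countable_PiE[of Basis "\<lambda>_. \<rat>"]]) (auto simp: countable_rat)
  ultimately have "countable ?R" using countable_image_inj_on by blast
  moreover have "rat_boxes \<Omega> \<subseteq> ?R \<times> ?R" by (auto simp: rat_boxes_def)
  ultimately show ?thesis
    using countable_subset[OF _ countable_SIGMA[of ?R "\<lambda>_. ?R"]] by simp
qed

lemma rat_boxes_cover:
  assumes "open \<Omega>" "x \<in> \<Omega>"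
  obtains a b where "(a, b) \<in> rat_boxes \<Omega>" "x \<in> box a b"
proof -
  obtain e where e: "e > 0" "ball x e \<subseteq> \<Omega>" using openE[OF assms] by auto
  \<comment> \<open>Half the radius leaves room for the closure of the box.\<close>
  obtain a b where ab: "\<forall>i\<in>Basis. a \<bullet> i \<in> \<rat> \<and> b \<bullet> i \<in> \<rat>" "x \<in> box a b" "box a b \<subseteq> ball x (e/2)"
    using rational_boxes[of "e/2" x] e(1) by auto
  have "cbox a b = closure (box a b)" using closure_box[of a b] ab(2) by blast
  also have "\<dots> \<subseteq> closure (ball x (e/2))" by (rule closure_mono[OF ab(3)])
  also have "\<dots> = cball x (e/2)" using e(1) by (intro closure_ball) simp
  also have "\<dots> \<subseteq> ball x e" using e(1) by (auto simp: subset_ball)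
  finally have "(a, b) \<in> rat_boxes \<Omega>" using ab(1) e(2) by (auto simp: rat_boxes_def)
  then show thesis using that ab(2) by blast
qed

text \<open>Dominated convergence as \<open>n\<close> grows: the bumps tend to the indicator of the
  open box and \<open>\<bar>h\<bar>\<close> on the closed box dominates.\<close>

lemma set_integral_bump_zero:
  fixes h :: "'a::euclidean_space \<Rightarrow> real"
  assumes int: "set_integrable lebesgue (cbox a b) h" and sub: "cbox a b \<subseteq> \<Omega>" and "open \<Omega>"
    and zero: "\<And>n. (LINT x|lebesgue_on \<Omega>. h x * bump n a b x) = 0"
  shows "(LINT x|lebesgue. indicator (box a b) x * h x) = 0"
proof -
  let ?h = "\<lambda>x. indicator (cbox a b) x * h x"
  have h: "integrable lebesgue ?h" using int by (simp add: set_integrable_def)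
  have bumpm: "bump n a b \<in> borel_measurable lebesgue" for n
    using borel_measurable_continuous_onI[OF smooth_continuous[OF smooth_bump[of n a b]]]
    by (simp add: measurable_completion)
  have eq: "?h x * bump n a b x = indicator \<Omega> x *\<^sub>R (h x * bump n a b x)" for x n
  proof (cases "x \<in> box a b")
    case True
    then have "x \<in> cbox a b" "x \<in> \<Omega>" using box_subset_cbox sub by auto
    then show ?thesis by simp
  qed (simp add: bump_eq_0)
  have "(LINT x|lebesgue. ?h x * bump n a b x) = (LINT x|lebesgue_on \<Omega>. h x * bump n a b x)" for n
    unfolding eq using \<open>open \<Omega>\<close> by (subst integral_restrict_space) auto
  then have z: "(LINT x|lebesgue. ?h x * bump n a b x) = 0" for n using zero by simp
  have "(\<lambda>n. LINT x|lebesgue. ?h x * bump n a b x) \<longlonglongrightarrow> (LINT x|lebesgue. ?h x * indicator (box a b) x)"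
  proof (rule integral_dominated_convergence[where w="\<lambda>x. \<bar>?h x\<bar>"])
    show "AE x in lebesgue. (\<lambda>n. ?h x * bump n a b x) \<longlonglongrightarrow> ?h x * indicator (box a b) x"
      by (intro AE_I2 tendsto_mult tendsto_const bump_tendsto)
    show "AE x in lebesgue. norm (?h x * bump n a b x) \<le> \<bar>?h x\<bar>" for n
      using bump_bounds[of n a b] by (intro AE_I2) (auto simp: abs_mult intro!: mult_left_le)
    show "(\<lambda>x. ?h x * indicator (box a b) x) \<in> borel_measurable lebesgue"
      by (intro borel_measurable_times[OF borel_measurable_integrable[OF h]] borel_measurable_indicator) simp
    show "(\<lambda>x. ?h x * bump n a b x) \<in> borel_measurable lebesgue" for n
      by (intro borel_measurable_times[OF borel_measurable_integrable[OF h]] bumpm)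
  qed (use h in auto)
  then have "(LINT x|lebesgue. ?h x * indicator (box a b) x) = 0" by (simp add: z LIMSEQ_const_iff)
  moreover have "?h x * indicator (box a b) x = indicator (box a b) x * h x" for x
    using box_subset_cbox[of a b] by (auto simp: indicator_def)
  ultimately show ?thesis by simp
qed

text \<open>Rational boxes are stable under intersection and generate the Borel sets, so by Dynkin's
  argument the integral of \<open>h\<close> vanishes over every Borel set.\<close>

lemma AE_zero_if_rational_box_integrals_zero:
  fixes h :: "'a::euclidean_space \<Rightarrow> real"
  assumes int: "integrable lebesgue h"
    and zero: "\<And>a b. \<forall>i\<in>Basis. a \<bullet> i \<in> \<rat> \<and> b \<bullet> i \<in> \<rat> \<Longrightarrow> (LINT x|lebesgue. indicator (box a b) x * h x) = 0"
  shows "AE x in lebesgue. h x = 0"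
proof -
  \<comment> \<open>A Borel representative moves the argument to \<open>lborel\<close>, where the
    generator argument applies.\<close>
  obtain g where g: "g \<in> borel_measurable lborel" "AE x in lborel. h x = g x"
    using completion_ex_borel_measurable_real[OF borel_measurable_integrable[OF int]] by auto
  have gh: "AE x in lebesgue. h x = g x" using g(2) by (rule AE_completion)
  have gl: "g \<in> borel_measurable lebesgue" using g(1) measurable_completion by blast
  have intg: "integrable lborel g"
    using integrable_cong_AE[OF borel_measurable_integrable[OF int] gl gh] int integrable_completion[OF g(1)] by simp
  let ?P = "\<lambda>A. (LINT x|lborel. indicator A x * g x) = 0"
  have intA: "integrable lborel (\<lambda>x. indicator A x * g x)" if "A \<in> sets borel" for A
    using integrable_mult_indicator[of A lborel g] intg that by simp
  have eq: "(LINT x|lborel. indicator A x * g x) = (LINT x|lebesgue. indicator A x * h x)" if "A \<in> sets borel" for A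
  proof -
    have "(LINT x|lborel. indicator A x * g x) = (LINT x|lebesgue. indicator A x * g x)"
      using integral_completion[of "\<lambda>x. indicator A x * g x" lborel] g(1) that by simp
    also have "\<dots> = (LINT x|lebesgue. indicator A x * h x)"
      using that by (intro integral_cong_AE borel_measurable_times borel_measurable_indicator gl
          borel_measurable_integrable[OF int]) (use gh in \<open>auto elim: AE_mp\<close>)
    finally show ?thesis .
  qed
  define G where "G = {box a b |a b::'a. \<forall>i\<in>Basis. a \<bullet> i \<in> \<rat> \<and> b \<bullet> i \<in> \<rat>}"
  have G_box: "box a b \<in> G" if "\<forall>i\<in>Basis. a \<bullet> i \<in> \<rat> \<and> b \<bullet> i \<in> \<rat>" for a b
    using that by (auto simp: G_def)
  have G0: "?P A" if "A \<in> G" for A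
    using that zero eq by (auto simp: G_def)
  have stable: "Int_stable G"
  proof (rule Int_stableI)
    fix A B assume "A \<in> G" "B \<in> G"
    then obtain a b c d where *: "A = box a b" "B = box c d"
      "\<forall>i\<in>Basis. a \<bullet> i \<in> \<rat> \<and> b \<bullet> i \<in> \<rat>" "\<forall>i\<in>Basis. c \<bullet> i \<in> \<rat> \<and> d \<bullet> i \<in> \<rat>" by (auto simp: G_def)
    show "A \<inter> B \<in> G" unfolding * box_Int_box using *(3,4) by (intro G_box) (auto simp: max_def min_def)
  qed
  have sets: "sets borel = sigma_sets UNIV G"
  proof
    have "S \<in> sigma_sets UNIV G" if "open S" for S
    proof -
      have "S = (\<Union>(a,b)\<in>rat_boxes S. box a b)"
      proof
        show "S \<subseteq> (\<Union>(a,b)\<in>rat_boxes S. box a b)"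
          using rat_boxes_cover[OF that] by blast
        show "(\<Union>(a,b)\<in>rat_boxes S. box a b) \<subseteq> S"
          using box_subset_cbox by (force simp: rat_boxes_def)
      qed
      moreover have "(\<Union>(a,b)\<in>rat_boxes S. box a b) \<in> sigma_sets UNIV G"
        using countable_rat_boxes[of S]
        by (intro sigma_sets_UNION[OF countable_image]) (auto simp: rat_boxes_def intro!: G_box sigma_sets.Basic)
      ultimately show ?thesis by simp
    qed
    then show "sets borel \<subseteq> sigma_sets UNIV G"
      using sigma_sets_mono[of "{S. open S}" UNIV G] by (auto simp: borel_def)
    show "sigma_sets UNIV G \<subseteq> sets borel"
    proof -
      have "G \<subseteq> sets borel" by (auto simp: G_def)
      then show ?thesis using sets.sigma_sets_subset[of G "borel :: 'a measure"] by simp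
    qed
  qed
  \<comment> \<open>Complements in the Dynkin induction are taken in the whole space, which is the
    increasing union of boxes with integer corners.\<close>
  have UN: "?P UNIV"
  proof -
    let ?B = "\<lambda>n. box (\<Sum>i\<in>Basis. (- real n) *\<^sub>R i) (\<Sum>i\<in>Basis. real n *\<^sub>R i) :: 'a set"
    have "(\<lambda>n. LINT x|lborel. indicator (?B n) x * g x) \<longlonglongrightarrow> (LINT x|lborel. indicator UNIV x * g x)"
    proof (rule integral_dominated_convergence[where w="\<lambda>x. \<bar>g x\<bar>"])
      show "AE x in lborel. (\<lambda>n. indicator (?B n) x * g x) \<longlonglongrightarrow> indicator UNIV x * g x"
      proof (intro AE_I2)
        fix x :: 'a
        obtain m where m: "real m > norm x" using reals_Archimedean2 by blast
        have "x \<in> ?B n" if "n \<ge> m" for n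
        proof -
          have "- real n < x \<bullet> i \<and> x \<bullet> i < real n" if "i \<in> Basis" for i
            using Basis_le_norm[OF that, of x] m \<open>n \<ge> m\<close> by linarith
          then show ?thesis by (simp add: mem_box del: scaleR_minus_left)
        qed
        then have "\<forall>\<^sub>F n in sequentially. indicator UNIV x * g x = indicator (?B n) x * g x"
          by (intro eventually_sequentiallyI[of m]) auto
        then show "(\<lambda>n. indicator (?B n) x * g x) \<longlonglongrightarrow> indicator UNIV x * g x"
          by (rule Lim_transform_eventually[OF tendsto_const])
      qed
    qed (use intg g(1) in \<open>auto simp: indicator_def abs_mult\<close>)
    moreover have "?P (?B n)" for n
      by (intro G0 G_box) (simp add: del: scaleR_minus_left)
    ultimately show ?thesis by (simp add: LIMSEQ_const_iff)
  qed
  have "?P A" if "A \<in> sets borel" for A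
  proof -
    have A: "A \<in> sigma_sets UNIV G" using that sets by simp
    have "G \<subseteq> Pow UNIV" by simp
    from stable this A show ?thesis
    proof (induction rule: sigma_sets_induct_disjoint)
      case (compl A)
      have "indicator (UNIV - A) x * g x = indicator UNIV x * g x - indicator A x * g x" for x
        by (auto simp: indicator_def)
      then show ?case using UN compl intA[of A] intg sets by (simp add: Bochner_Integration.integral_diff)
    next
      case (union A)
      have m: "A i \<in> sets borel" for i using union(2) sets by auto
      have "integral\<^sup>L lborel (\<lambda>x. indicator (\<Union>i. A i) x *\<^sub>R g x) = (\<Sum>i. LINT x|lborel. indicator (A i) x *\<^sub>R g x)"
        using lebesgue_integral_countable_add[of A lborel g] union(1) m intA[of "\<Union>i. A i"]
        by (auto simp: disjoint_family_on_def set_integrable_def set_lebesgue_integral_def)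
      then show ?case using union(3) by simp
    qed (use G0 in auto)
  qed
  then have "AE x in lborel. g x = 0"
    by (intro sigma_finite_measure.density_zero[OF lborel.sigma_finite_measure_axioms] intg) (simp add: set_lebesgue_integral_def)
  then have "AE x in lebesgue. g x = 0" by (rule AE_completion)
  then show ?thesis using gh by auto
qed

text \<open>A fundamental lemma of the calculus of variations with countably many test functions. As
  \<open>h\<close> is only integrable on boxes, it is first cut off to one rational box, and these
  boxes cover the open set.\<close>

lemma AE_zero_if_bump_integrals_zero:
  fixes h :: "'a::euclidean_space \<Rightarrow> real"
  assumes "open \<Omega>"
    and int: "\<And>a b. (a, b) \<in> rat_boxes \<Omega> \<Longrightarrow> set_integrable lebesgue (cbox a b) h"
    and zero: "\<And>n a b. (a, b) \<in> rat_boxes \<Omega> \<Longrightarrow> (LINT x|lebesgue_on \<Omega>. h x * bump n a b x) = 0"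
  shows "AE x in lebesgue_on \<Omega>. h x = 0"
proof -
  have box0: "(LINT x|lebesgue. indicator (box a b) x * h x) = 0" if "(a, b) \<in> rat_boxes \<Omega>" for a b
    using that by (intro set_integral_bump_zero[OF int _ assms(1) zero]) (auto simp: rat_boxes_def)
  have "AE x in lebesgue. indicator (box c d) x * h x = 0" if cd: "(c, d) \<in> rat_boxes \<Omega>" for c d
  proof (rule AE_zero_if_rational_box_integrals_zero)
    have "set_integrable lebesgue (box c d) h"
      using int[OF cd] by (rule set_integrable_subset) (auto simp: box_subset_cbox)
    then show "integrable lebesgue (\<lambda>x. indicator (box c d) x * h x)" by (simp add: set_integrable_def)
    fix a b :: 'a assume ab: "\<forall>i\<in>Basis. a \<bullet> i \<in> \<rat> \<and> b \<bullet> i \<in> \<rat>"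
    \<comment> \<open>Corners of the intersection of the two boxes; it is again a rational box, and
      its closure stays inside \<open>cbox c d\<close>.\<close>
    let ?a = "\<Sum>i\<in>Basis. max (a\<bullet>i) (c\<bullet>i) *\<^sub>R i" and ?b = "\<Sum>i\<in>Basis. min (b\<bullet>i) (d\<bullet>i) *\<^sub>R i"
    have "(?a, ?b) \<in> rat_boxes \<Omega>"
    proof -
      have "cbox ?a ?b \<subseteq> cbox c d" by (auto simp: mem_box)
      then show ?thesis using ab cd by (auto simp: rat_boxes_def max_def min_def)
    qed
    from box0[OF this]
    show "(LINT x|lebesgue. indicator (box a b) x * (indicator (box c d) x * h x)) = 0"
      unfolding box_Int_box[symmetric] by (simp add: indicator_inter_arith mult.assoc)
  qed
  then have "AE x in lebesgue. \<forall>z\<in>rat_boxes \<Omega>. indicator (box (fst z) (snd z)) x * h x = 0"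
    by (subst AE_ball_countable[OF countable_rat_boxes]) auto
  then have "AE x in lebesgue. x \<in> \<Omega> \<longrightarrow> h x = 0"
  proof eventually_elim
    case (elim x)
    show ?case
    proof
      assume "x \<in> \<Omega>"
      then obtain a b where "(a, b) \<in> rat_boxes \<Omega>" "x \<in> box a b" using rat_boxes_cover[OF assms(1)] by metis
      then show "h x = 0" using elim by force
    qed
  qed
  then show ?thesis using assms(1) by (subst AE_restrict_space_iff) auto
qed

section \<open>Indefinite integrals\<close>

lemma set_integrable_Icc_mono:
  fixes g :: "real \<Rightarrow> real"
  assumes "set_integrable lborel {0..T} g" "0 \<le> r" "s \<le> T"
  shows "set_integrable lborel {0..s} g" "set_integrable lborel {r<..s} g"
  by (rule set_integrable_subset[OF assms(1)]; use assms in auto)+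

lemma set_integral_Icc_diff:
  fixes g :: "real \<Rightarrow> real"
  assumes g: "set_integrable lborel {0..T} g" and "0 \<le> r" "r \<le> s" "s \<le> T"
  shows "(LBINT x:{0..s}. g x) - (LBINT x:{0..r}. g x) = (LBINT x:{r<..s}. g x)"
proof -
  have "{0..s} = {0..r} \<union> {r<..s}" "{0..r} \<inter> {r<..s} = {}" using assms by auto
  then show ?thesis
    using set_integral_Un[of "{0..r}" "{r<..s}" lborel g] assms
      set_integrable_Icc_mono(1)[OF g, of 0 r] set_integrable_Icc_mono(2)[OF g, of r s] by auto
qed

lemma set_integral_Icc_0: "(LBINT x:{0::real}. g x) = (0::real)"
  unfolding set_lebesgue_integral_def
  by (rule integral_eq_zero_AE) (use AE_lborel_singleton[of "0::real"] in \<open>auto elim!: eventually_mono\<close>)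

lemma continuous_on_set_integral_Icc:
  fixes g :: "real \<Rightarrow> real"
  assumes "set_integrable lborel {0..T} g"
  shows "continuous_on {0..T} (\<lambda>t. LBINT s:{0..t}. g s)"
proof -
  have "continuous_on {0..T} (\<lambda>t. integral {0..t} g)"
    by (intro indefinite_integral_continuous_1 set_borel_integral_eq_integral(1) assms)
  moreover have "(LBINT s:{0..t}. g s) = integral {0..t} g" if "t \<in> {0..T}" for t
    using that by (intro set_borel_integral_eq_integral(2) set_integrable_subset[OF assms]) auto
  ultimately show ?thesis by (metis (no_types, lifting) continuous_on_cong)
qed

lemma set_integrable_continuous_mult:
  fixes g h :: "real \<Rightarrow> real"
  assumes g: "set_integrable lborel {0..T} g" and h: "continuous_on {0..T} h"
  shows "set_integrable lborel {0..T} (\<lambda>s. h s * g s)"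
proof -
  have "bounded (h ` {0..T})" using compact_continuous_image[OF h] compact_imp_bounded by blast
  then have "\<exists>B. \<forall>s\<in>{0..T}. \<bar>h s\<bar> \<le> B" by (auto simp: bounded_iff)
  then obtain B where B: "\<And>s. s \<in> {0..T} \<Longrightarrow> \<bar>h s\<bar> \<le> B" by blast
  have "integrable lborel (\<lambda>s. (indicator {0..T} s *\<^sub>R h s) * (indicator {0..T} s *\<^sub>R g s))"
  proof (rule Bochner_Integration.integrable_bound)
    show "integrable lborel (\<lambda>s. B * (indicator {0..T} s *\<^sub>R g s))"
      using g by (auto simp: set_integrable_def)
    have "(\<lambda>s. indicator {0..T} s *\<^sub>R h s) \<in> borel_measurable lborel"
      using borel_measurable_continuous_on_indicator[OF _ h] by simp
    then show "(\<lambda>s. (indicator {0..T} s *\<^sub>R h s) * (indicator {0..T} s *\<^sub>R g s)) \<in> borel_measurable lborel"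
      using g unfolding set_integrable_def by (intro borel_measurable_times) auto
    show "AE s in lborel. norm ((indicator {0..T} s *\<^sub>R h s) * (indicator {0..T} s *\<^sub>R g s))
        \<le> norm (B * (indicator {0..T} s *\<^sub>R g s))"
    proof (intro AE_I2)
      fix s :: real
      show "norm ((indicator {0..T} s *\<^sub>R h s) * (indicator {0..T} s *\<^sub>R g s))
        \<le> norm (B * (indicator {0..T} s *\<^sub>R g s))"
      proof (cases "s \<in> {0..T}")
        case True
        have "\<bar>h s\<bar> * \<bar>g s\<bar> \<le> \<bar>B\<bar> * \<bar>g s\<bar>" using B[OF True] by (intro mult_right_mono) auto
        then show ?thesis using True by (simp add: abs_mult)
      qed simp
    qed
  qed
  moreover have "(indicator {0..T} s *\<^sub>R h s) * (indicator {0..T} s *\<^sub>R g s) = indicator {0..T} s *\<^sub>R (h s * g s)" for s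
    by (simp add: indicator_def)
  ultimately show ?thesis unfolding set_integrable_def by (simp only:)
qed

text \<open>Telescoping over a fine subdivision of [0, t] gives the bound \<eta> (\<Gamma> t -
  \<Gamma> 0) for the total increment, for every \<eta> > 0.\<close>

lemma eq_if_increments_controlled:
  fixes R \<Gamma> :: "real \<Rightarrow> real"
  assumes t: "0 \<le> t"
    and loc: "\<And>\<eta>. \<eta> > 0 \<Longrightarrow> \<exists>\<delta>>0. \<forall>r s. 0 \<le> r \<and> r \<le> s \<and> s \<le> t \<and> s - r < \<delta> \<longrightarrow> \<bar>R s - R r\<bar> \<le> \<eta> * (\<Gamma> s - \<Gamma> r)"
  shows "R t = R 0"
proof -
  have bound: "\<bar>R t - R 0\<bar> \<le> \<eta> * (\<Gamma> t - \<Gamma> 0)" if \<eta>: "\<eta> > 0" for \<eta>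
  proof -
    obtain \<delta> where \<delta>: "\<delta> > 0"
      "\<And>r s. 0 \<le> r \<Longrightarrow> r \<le> s \<Longrightarrow> s \<le> t \<Longrightarrow> s - r < \<delta> \<Longrightarrow> \<bar>R s - R r\<bar> \<le> \<eta> * (\<Gamma> s - \<Gamma> r)"
      using loc[OF \<eta>] by blast
    obtain n :: nat where n: "real n > t / \<delta>" "n > 0"
      using reals_Archimedean2[of "max 1 (t / \<delta>)"] by (metis max_less_iff_conj of_nat_0_less_iff zero_less_one order_less_trans)
    let ?p = "\<lambda>k. t * real k / real n"
    have "\<bar>R (?p k) - R 0\<bar> \<le> \<eta> * (\<Gamma> (?p k) - \<Gamma> 0)" if "k \<le> n" for k
      using that
    proof (induction k)
      case (Suc k)
      have "?p (Suc k) - ?p k = t / n" by (simp add: distrib_left add_divide_distrib)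
      moreover have "t / n < \<delta>" using n \<delta>(1) by (simp add: field_simps)
      moreover have "?p (Suc k) \<le> t" using Suc.prems t n by (simp add: divide_le_eq mult_left_mono)
      moreover have "0 \<le> ?p k" "?p k \<le> ?p (Suc k)" using t by (auto intro!: divide_right_mono mult_left_mono)
      ultimately have "\<bar>R (?p (Suc k)) - R (?p k)\<bar> \<le> \<eta> * (\<Gamma> (?p (Suc k)) - \<Gamma> (?p k))"
        by (intro \<delta>(2)) auto
      then show ?case using Suc by (auto simp: algebra_simps)
    qed simp
    from this[of n] show ?thesis using n(2) by simp
  qed
  show ?thesis
  proof (rule ccontr)
    assume "R t \<noteq> R 0"
    define d where "d = \<bar>R t - R 0\<bar>"
    have d: "d > 0" using \<open>R t \<noteq> R 0\<close> by (simp add: d_def)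
    define G where "G = \<bar>\<Gamma> t - \<Gamma> 0\<bar> + 1"
    \<comment> \<open>The choice \<eta> = d / (2 G) bounds d by d/2; the 1 added in \<open>G\<close>
      excludes division by 0.\<close>
    have "d \<le> (d / (2 * G)) * (\<Gamma> t - \<Gamma> 0)"
    proof -
      have "d / (2 * G) > 0" using d by (simp add: G_def add_nonneg_pos)
      from bound[OF this] show ?thesis unfolding d_def .
    qed
    also have "\<dots> \<le> (d / (2 * G)) * G" using d by (intro mult_left_mono) (auto simp: G_def)
    also have "\<dots> = d / 2"
    proof -
      have "G \<noteq> 0" by (simp add: G_def add_nonneg_eq_0_iff)
      then show ?thesis by simp
    qed
    finally show False using d by simp
  qed
qed

text \<open>On a short interval the mean value theorem replaces \<open>\<phi> (f s)\<close> by a single value of \<open>\<phi> \<circ> f\<close>,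
  so no differentiability of \<open>f\<close> is needed.\<close>

lemma indefinite_integral_chain_rule:
  fixes f g \<Phi> \<phi> :: "real \<Rightarrow> real"
  assumes g: "set_integrable lborel {0..T} g"
    and f: "\<And>t. t \<in> {0..T} \<Longrightarrow> f t = c + (LBINT s:{0..t}. g s)"
    and S: "is_interval S" "\<And>t. t \<in> {0..T} \<Longrightarrow> f t \<in> S"
    and \<Phi>: "\<And>y. y \<in> S \<Longrightarrow> (\<Phi> has_real_derivative \<phi> y) (at y)" and \<phi>: "continuous_on S \<phi>"
  shows "set_integrable lborel {0..T} (\<lambda>s. \<phi> (f s) * g s)"
    and "t \<in> {0..T} \<Longrightarrow> \<Phi> (f t) - \<Phi> c = (LBINT s:{0..t}. \<phi> (f s) * g s)"
proof -
  have fc: "continuous_on {0..T} f"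
    using continuous_on_add[OF continuous_on_const continuous_on_set_integral_Icc[OF g]] f
    by (metis (no_types, lifting) continuous_on_cong)
  have \<phi>f: "continuous_on {0..T} (\<lambda>s. \<phi> (f s))"
    by (rule continuous_on_compose2[OF \<phi> fc]) (use S(2) in auto)
  show int: "set_integrable lborel {0..T} (\<lambda>s. \<phi> (f s) * g s)"
    by (rule set_integrable_continuous_mult[OF g \<phi>f])
  assume t: "t \<in> {0..T}"
  \<comment> \<open>\<open>R\<close> is the error in the formula to be proved. On a short interval
    its increment is at most the oscillation of \<phi> o f times the integral of
    \<open>\<bar>g\<bar>\<close>, hence the choice of \<Gamma>.\<close>
  define R where "R s = \<Phi> (f s) - (LBINT s:{0..s}. \<phi> (f s) * g s)" for s
  define \<Gamma> where "\<Gamma> s = (LBINT s:{0..s}. \<bar>g s\<bar>)" for s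
  have absg: "set_integrable lborel {0..T} (\<lambda>s. \<bar>g s\<bar>)" by (rule set_integrable_abs[OF g])
  have "R t = R 0"
  proof (rule eq_if_increments_controlled[where \<Gamma>=\<Gamma>])
    fix \<eta> :: real assume \<eta>: "\<eta> > 0"
    have "uniformly_continuous_on {0..T} (\<lambda>s. \<phi> (f s))"
      by (rule compact_uniformly_continuous[OF \<phi>f]) simp
    then obtain \<delta> where \<delta>: "\<delta> > 0"
      "\<And>s r. s \<in> {0..T} \<Longrightarrow> r \<in> {0..T} \<Longrightarrow> \<bar>s - r\<bar> < \<delta> \<Longrightarrow> \<bar>\<phi> (f s) - \<phi> (f r)\<bar> < \<eta>"
      using \<eta> unfolding uniformly_continuous_on_def dist_real_def by metis
    have "\<bar>R s - R r\<bar> \<le> \<eta> * (\<Gamma> s - \<Gamma> r)" if rs: "0 \<le> r" "r \<le> s" "s \<le> t" "s - r < \<delta>" for r s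
    proof -
      have in_T: "x \<in> {0..T}" if "x \<in> {r..s}" for x using that rs t by auto
      have r: "r \<in> {0..T}" and s: "s \<in> {0..T}" using rs t by auto
      \<comment> \<open>The mean value theorem yields a value between \<open>f r\<close> and
        \<open>f s\<close>, and continuity of \<open>f\<close> realises it at some time \<xi> in the
        interval.\<close>
      obtain \<xi> where \<xi>: "\<xi> \<in> {r..s}" "\<Phi> (f s) - \<Phi> (f r) = \<phi> (f \<xi>) * (f s - f r)"
      proof (cases "f r = f s")
        case True
        then show ?thesis using that[of r] rs by simp
      next
        case False
        define a b where "a = min (f r) (f s)" and "b = max (f r) (f s)"
        have "a < b" using False by (auto simp: a_def b_def)
        have abS: "x \<in> S" if "a \<le> x" "x \<le> b" for x
          using S(1) S(2)[OF r] S(2)[OF s] that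
          unfolding is_interval_1 a_def b_def by (metis max_def min_def)
        obtain z where z: "a < z" "z < b" "\<Phi> b - \<Phi> a = (b - a) * \<phi> z"
          using MVT2[OF \<open>a < b\<close>, of \<Phi> \<phi>] \<Phi> abS by blast
        have cont: "continuous_on {r..s} f" by (rule continuous_on_subset[OF fc]) (use in_T in auto)
        obtain \<xi> where "\<xi> \<in> {r..s}" "f \<xi> = z"
        proof (cases "f r \<le> f s")
          case True
          then show ?thesis using IVT'[of f r z s] z rs(2) cont that by (auto simp: a_def b_def)
        next
          case False
          then show ?thesis using IVT2'[of f s z r] z rs(2) cont that by (auto simp: a_def b_def)
        qed
        moreover have "\<Phi> (f s) - \<Phi> (f r) = \<phi> z * (f s - f r)"
          using z(3) by (cases "f r \<le> f s") (auto simp: a_def b_def algebra_simps)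
        ultimately show ?thesis using that by blast
      qed
      have gi: "set_integrable lborel {r<..s} g"
        using set_integrable_Icc_mono(2)[OF g] rs t by auto
      have fi: "set_integrable lborel {r<..s} (\<lambda>s. \<phi> (f s) * g s)"
        using set_integrable_Icc_mono(2)[OF int] rs t by auto
      have ai: "set_integrable lborel {r<..s} (\<lambda>s. \<bar>g s\<bar>)"
        using set_integrable_Icc_mono(2)[OF absg] rs t by auto
      have "R s - R r = \<phi> (f \<xi>) * (f s - f r) - (LBINT x:{r<..s}. \<phi> (f x) * g x)"
        using set_integral_Icc_diff[OF int, of r s] rs t \<xi>(2) by (auto simp: R_def)
      also have "f s - f r = (LBINT x:{r<..s}. g x)"
        using set_integral_Icc_diff[OF g, of r s] rs t f[OF r] f[OF s] by auto
      also have "\<phi> (f \<xi>) * (LBINT x:{r<..s}. g x) - (LBINT x:{r<..s}. \<phi> (f x) * g x)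
          = (LBINT x:{r<..s}. \<phi> (f \<xi>) * g x - \<phi> (f x) * g x)"
        using gi fi by (subst set_integral_diff(2)) auto
      finally have eq: "R s - R r = (LBINT x:{r<..s}. \<phi> (f \<xi>) * g x - \<phi> (f x) * g x)" .
      have "\<bar>R s - R r\<bar> \<le> (LBINT x:{r<..s}. \<bar>\<phi> (f \<xi>) * g x - \<phi> (f x) * g x\<bar>)"
        unfolding eq using set_integral_norm_bound[of lborel "{r<..s}" "\<lambda>x. \<phi> (f \<xi>) * g x - \<phi> (f x) * g x"] gi fi
        by auto
      also have "\<dots> \<le> (LBINT x:{r<..s}. \<eta> * \<bar>g x\<bar>)"
      proof (rule set_integral_mono)
        fix x assume x: "x \<in> {r<..s}"
        have "\<bar>\<phi> (f \<xi>) - \<phi> (f x)\<bar> \<le> \<eta>"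
          using \<delta>(2)[of \<xi> x] in_T[OF \<xi>(1)] in_T[of x] \<xi>(1) x rs(4) by fastforce
        then have "\<bar>\<phi> (f \<xi>) - \<phi> (f x)\<bar> * \<bar>g x\<bar> \<le> \<eta> * \<bar>g x\<bar>" by (intro mult_right_mono) auto
        then show "\<bar>\<phi> (f \<xi>) * g x - \<phi> (f x) * g x\<bar> \<le> \<eta> * \<bar>g x\<bar>"
          by (simp add: abs_mult[symmetric] algebra_simps)
      qed (use gi fi ai in \<open>auto intro!: set_integrable_abs\<close>)
      also have "\<dots> = \<eta> * (\<Gamma> s - \<Gamma> r)"
        using set_integral_Icc_diff[OF absg, of r s] rs t by (simp add: \<Gamma>_def)
      finally show ?thesis .
    qed
    then show "\<exists>\<delta>>0. \<forall>r s. 0 \<le> r \<and> r \<le> s \<and> s \<le> t \<and> s - r < \<delta> \<longrightarrow> \<bar>R s - R r\<bar> \<le> \<eta> * (\<Gamma> s - \<Gamma> r)"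
      using \<delta>(1) by blast
  qed (use t in auto)
  moreover have "f 0 = c" using f[of 0] t set_integral_Icc_0[of g] by simp
  ultimately show "\<Phi> (f t) - \<Phi> c = (LBINT s:{0..t}. \<phi> (f s) * g s)"
    by (simp add: R_def set_integral_Icc_0)
qed

text \<open>Polarisation: the chain rule for the square is applied to \<open>f\<close>,
  \<open>F\<close> and \<open>f + F\<close>.\<close>

lemma indefinite_integral_product_rule:
  fixes f g F G :: "real \<Rightarrow> real"
  assumes g: "set_integrable lborel {0..T} g"
    and f: "\<And>t. t \<in> {0..T} \<Longrightarrow> f t = c + (LBINT s:{0..t}. g s)"
    and G: "set_integrable lborel {0..T} G"
    and F: "\<And>t. t \<in> {0..T} \<Longrightarrow> F t = d + (LBINT s:{0..t}. G s)"
    and t: "t \<in> {0..T}"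
  shows "f t * F t - c * d = (LBINT s:{0..t}. f s * G s + F s * g s)"
proof -
  have sq: "h t ^ 2 - e ^ 2 = (LBINT s:{0..t}. 2 * h s * H s)" "set_integrable lborel {0..T} (\<lambda>s. 2 * h s * H s)"
    if "set_integrable lborel {0..T} H" "\<And>t. t \<in> {0..T} \<Longrightarrow> h t = e + (LBINT s:{0..t}. H s)"
    for h H :: "real \<Rightarrow> real" and e
  proof -
    have "((\<lambda>y::real. y ^ 2) has_real_derivative 2 * y) (at y)" for y
      by (auto intro!: derivative_eq_intros)
    moreover have "continuous_on UNIV (\<lambda>y::real. 2 * y)" by (intro continuous_intros)
    ultimately show "h t ^ 2 - e ^ 2 = (LBINT s:{0..t}. 2 * h s * H s)" "set_integrable lborel {0..T} (\<lambda>s. 2 * h s * H s)"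
      using indefinite_integral_chain_rule[of T H h e UNIV "\<lambda>y. y ^ 2" "\<lambda>y. 2 * y"] that t by auto
  qed
  have sum: "set_integrable lborel {0..T} (\<lambda>s. g s + G s)" "f t + F t = (c + d) + (LBINT s:{0..t}. g s + G s)"
    if "t \<in> {0..T}" for t
    using that g G f[OF that] F[OF that] set_integrable_Icc_mono(1)[OF g, of 0 t] set_integrable_Icc_mono(1)[OF G, of 0 t]
    by auto
  note A = sq[OF g f] and B = sq[OF G F] and C = sq[OF sum(1) sum(2), OF t]
  have res: "set_integrable lborel {0..t} H" if "set_integrable lborel {0..T} H" for H :: "real \<Rightarrow> real"
    using set_integrable_Icc_mono(1)[OF that, of 0 t] t by auto
  have "2 * (f t * F t - c * d) = ((f t + F t)^2 - (c + d)^2) - (f t ^ 2 - c ^ 2) - (F t ^ 2 - d ^ 2)"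
    by (simp add: power2_eq_square algebra_simps)
  also have "\<dots> = (LBINT s:{0..t}. 2 * (f s + F s) * (g s + G s) - 2 * f s * g s - 2 * F s * G s)"
    using A B C res[OF A(2)] res[OF B(2)] res[OF C(2)] by simp
  also have "\<dots> = (LBINT s:{0..t}. 2 * (f s * G s + F s * g s))"
    by (simp add: algebra_simps)
  also have "\<dots> = 2 * (LBINT s:{0..t}. f s * G s + F s * g s)" by (rule set_integral_mult_right)
  finally have "2 * (f t * F t - c * d) = 2 * (LBINT s:{0..t}. f s * G s + F s * g s)" .
  moreover have "x = y" if "2 * x = 2 * y" for x y :: real using that by simp
  ultimately show ?thesis by blast
qed

lemma real_test_function_derivative:
  assumes "\<theta> \<in> test_functions (S :: real set)"
  shows "(\<theta> has_real_derivative frechet_derivative \<theta> (at t) 1) (at t)"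
proof -
  have "(\<theta> has_derivative frechet_derivative \<theta> (at t)) (at t)"
    using assms by (intro smooth_has_derivative) (auto simp: test_functions_def)
  then show ?thesis
    unfolding has_field_derivative_def
  proof (rule has_derivative_eq_rhs)
    interpret linear "frechet_derivative \<theta> (at t)"
      using \<open>(\<theta> has_derivative frechet_derivative \<theta> (at t)) (at t)\<close> by (rule has_derivative_linear)
    show "frechet_derivative \<theta> (at t) = (*) (frechet_derivative \<theta> (at t) 1)"
    proof
      fix h show "frechet_derivative \<theta> (at t) h = frechet_derivative \<theta> (at t) 1 * h"
        using scale[of h 1] by simp
    qed
  qed
qed


section \<open>The lemma of du Bois-Reymond\<close>

lemma test_function_measurable:
  assumes "\<phi> \<in> test_functions \<Omega>"
  shows "\<phi> \<in> borel_measurable borel"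
  using assms by (intro borel_measurable_continuous_onI smooth_continuous) (auto simp: test_functions_def)

lemma continuous_compact_support_bounded:
  fixes \<phi> :: "'a::euclidean_space \<Rightarrow> real"
  assumes "continuous_on UNIV \<phi>" "compact K" "\<And>x. x \<notin> K \<Longrightarrow> \<phi> x = 0"
  obtains B where "B \<ge> 0" "\<And>x. \<bar>\<phi> x\<bar> \<le> B"
proof -
  have "bounded (\<phi> ` K)"
    by (intro compact_imp_bounded compact_continuous_image assms(2) continuous_on_subset[OF assms(1)]) simp
  then have "\<exists>B. \<forall>x\<in>K. \<bar>\<phi> x\<bar> \<le> B" by (auto simp: bounded_iff)
  then obtain B where B: "\<And>x. x \<in> K \<Longrightarrow> \<bar>\<phi> x\<bar> \<le> B" by blast
  have "\<bar>\<phi> x\<bar> \<le> max 0 B" for x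
    using B[of x] assms(3)[of x] by (cases "x \<in> K") auto
  then show thesis using that[of "max 0 B"] by simp
qed

lemma test_function_bounded:
  assumes "\<phi> \<in> test_functions \<Omega>"
  obtains B where "B \<ge> 0" "\<And>x. \<bar>\<phi> x\<bar> \<le> B"
  using assms continuous_compact_support_bounded[OF smooth_continuous]
  unfolding test_functions_def by blast

lemma test_function_partial:
  assumes "\<phi> \<in> test_functions \<Omega>" "i \<in> Basis"
  shows "(\<lambda>x. frechet_derivative \<phi> (at x) i) \<in> test_functions \<Omega>"
proof -
  obtain K where K: "compact K" "K \<subseteq> \<Omega>" "\<And>x. x \<notin> K \<Longrightarrow> \<phi> x = 0" and sm: "smooth \<phi>"
    using assms(1) by (auto simp: test_functions_def)
  have "frechet_derivative \<phi> (at x) i = 0" if "x \<notin> K" for x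
  proof -
    have "(\<phi> has_derivative (\<lambda>h. 0)) (at x)"
    proof (rule has_derivative_transform_within_open)
      show "((\<lambda>x. 0::real) has_derivative (\<lambda>h. 0)) (at x)" by simp
      show "open (- K)" using K(1) by (simp add: compact_imp_closed open_Compl)
    qed (use that K(3) in auto)
    then show ?thesis using frechet_derivative_at by metis
  qed
  then show ?thesis
    unfolding test_functions_def using smooth_partial[OF sm assms(2)] K by blast
qed

lemma integrable_mult_bounded:
  fixes f h :: "'a \<Rightarrow> real"
  assumes "integrable M f" "h \<in> borel_measurable M" "\<And>x. \<bar>h x\<bar> \<le> B"
  shows "integrable M (\<lambda>x. f x * h x)"
proof (rule Bochner_Integration.integrable_bound)
  show "integrable M (\<lambda>x. B * f x)" using assms(1) by simp
  show "AE x in M. norm (f x * h x) \<le> norm (B * f x)"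
  proof (intro AE_I2)
    fix x show "norm (f x * h x) \<le> norm (B * f x)"
      using mult_right_mono[of "\<bar>h x\<bar>" "\<bar>B\<bar>" "\<bar>f x\<bar>"] assms(3)[of x] by (simp add: abs_mult mult.commute)
  qed
qed (use assms in auto)

lemma test_function_measurable_lebesgue_on:
  "\<phi> \<in> test_functions \<Omega> \<Longrightarrow> \<phi> \<in> borel_measurable (lebesgue_on S)"
  using measurable_completion[of \<phi> lborel borel] test_function_measurable[of \<phi> \<Omega>]
  by (intro measurable_restrict_space1) simp

lemma integrable_mult_test_function:
  assumes "integrable (lebesgue_on S) f" "\<phi> \<in> test_functions \<Omega>"
  shows "integrable (lebesgue_on S) (\<lambda>x. f x * \<phi> x)"
proof -
  obtain B where "\<And>x. \<bar>\<phi> x\<bar> \<le> B" using test_function_bounded[OF assms(2)] by metis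
  then show ?thesis
    by (intro integrable_mult_bounded[OF assms(1) test_function_measurable_lebesgue_on[OF assms(2)]])
qed

text \<open>Provides a test function of nonzero mean to normalise by. A zero integral would make the
  open box a null set, as the bump is positive on it.\<close>

lemma bump_integral_pos:
  assumes "box a b \<noteq> {}"
  shows "(LINT x|lebesgue. bump n a b x) > 0"
proof -
  have c: "continuous_on UNIV (bump n a b)" using smooth_continuous[OF smooth_bump] .
  have int: "integrable lborel (bump n a b)"
  proof -
    have "integrable lborel (\<lambda>x. indicator (cbox a b) x *\<^sub>R bump n a b x)"
      by (intro borel_integrable_compact continuous_on_subset[OF c]) auto
    moreover have "indicator (cbox a b) x *\<^sub>R bump n a b x = bump n a b x" for x
      using bump_eq_0[of x a b n] box_subset_cbox[of a b] by (auto simp: indicator_def)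
    ultimately show ?thesis by (simp only:)
  qed
  have "(LINT x|lborel. bump n a b x) \<noteq> 0"
  proof
    assume "(LINT x|lborel. bump n a b x) = 0"
    then have "AE x in lborel. bump n a b x = 0"
      using integral_nonneg_eq_0_iff_AE[OF int] bump_bounds(1)[of n a b] by simp
    then have "AE x in lborel. x \<notin> box a b"
      by eventually_elim (use bump_pos[of _ a b n] in force)
    then have "AE x in lebesgue. x \<notin> box a b" by (rule AE_completion)
    then have "negligible (box a b)"
      by (simp add: negligible_iff_null_sets AE_iff_null_sets)
    then show False using open_not_negligible[OF open_box assms] by simp
  qed
  moreover have "(LINT x|lborel. bump n a b x) \<ge> 0" using bump_bounds(1)[of n a b] by (intro integral_nonneg_AE AE_I2)
  moreover have "(LINT x|lebesgue. bump n a b x) = (LINT x|lborel. bump n a b x)"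
    using borel_measurable_continuous_onI[OF c] by (intro integral_completion) simp
  ultimately show ?thesis by linarith
qed

section \<open>Functions with vanishing weak derivative, and primitives\<close>

text \<open>The primitive from 0 vanishes to the left of the support trivially, and to the right
  because the total integral is 0, so it is again compactly supported.\<close>

lemma ex_test_function_antiderivative:
  fixes g :: "real \<Rightarrow> real"
  assumes g: "smooth g" and "0 < l" "l \<le> r" "r < T" and supp: "\<And>t. t \<notin> {l..r} \<Longrightarrow> g t = 0"
    and zero: "integral {0..T} g = 0"
  obtains \<theta> where "\<theta> \<in> test_functions {0<..<T}" "\<And>t. frechet_derivative \<theta> (at t) 1 = g t"
proof -
  have cont: "continuous_on S g" for S using smooth_continuous[OF g] continuous_on_subset by blast
  define \<theta> where "\<theta> t = integral {0..t} g" for t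
  have outside: "\<theta> t = 0" if "t < l" for t
  proof -
    have "integral {0..t} g = integral {0..t} (\<lambda>_. 0)"
      by (intro integral_cong) (use that supp in auto)
    then show ?thesis by (simp add: \<theta>_def)
  qed
  have right: "\<theta> t = 0" if "t > r" for t
  proof -
    have z: "integral {r..s} g = 0" if "r < s" for s
    proof -
      \<comment> \<open>The support hypothesis says nothing about \<open>g r\<close>, so this one
        point is discarded.\<close>
      have "integral {r..s} g = integral {r..s} (\<lambda>_. 0)"
        by (rule integral_spike[of "{r}"]) (use supp in auto)
      then show ?thesis by simp
    qed
    have split: "integral {0..s} g = integral {0..r} g + integral {r..s} g" if "r < s" for s
      using that assms by (intro Henstock_Kurzweil_Integration.integral_combine[symmetric])
        (auto intro: integrable_continuous_interval cont)
    show ?thesis using split[of t] split[of T] z[of t] z[of T] zero that assms(4) by (simp add: \<theta>_def)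
  qed
  have der: "(\<theta> has_real_derivative g t) (at t)" for t
  proof (cases "t < l")
    case True
    have "((\<lambda>_. 0) has_real_derivative 0) (at t)" by simp
    then have "(\<theta> has_real_derivative 0) (at t)"
      by (rule has_field_derivative_transform_within_open[of _ _ _ "{..<l}"]) (use True outside in auto)
    then show ?thesis using supp[of t] True by simp
  next
    case False
    have "(\<theta> has_real_derivative g t) (at t within {0..t+1})"
      unfolding \<theta>_def[abs_def] by (rule integral_has_real_derivative[OF cont]) (use False assms in auto)
    moreover have "t \<in> interior {0..t+1}" using False assms by (simp add: interior_atLeastAtMost_real)
    ultimately show ?thesis by (metis at_within_interior)
  qed
  have "\<theta> \<in> test_functions {0<..<T}"
    unfolding test_functions_def using smooth_antiderivative[OF der g] outside right assms
    by (auto intro!: exI[of _ "{l..r}"] simp: not_le)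
  moreover have "frechet_derivative \<theta> (at t) 1 = g t" for t
    using DERIV_unique[OF real_test_function_derivative[OF calculation] der] .
  ultimately show thesis using that by blast
qed

lemma lebesgue_on_integral_supported:
  fixes f :: "'a::euclidean_space \<Rightarrow> real"
  assumes "S \<in> sets lebesgue" "\<And>x. x \<notin> S \<Longrightarrow> f x = 0"
  shows "(LINT x|lebesgue_on S. f x) = (LINT x|lebesgue. f x)"
proof -
  have "indicator S x *\<^sub>R f x = f x" for x using assms(2)[of x] by (cases "x \<in> S") auto
  then have "(\<lambda>x. indicator S x *\<^sub>R f x) = f" by auto
  then show ?thesis
    using integral_restrict_space[of S lebesgue f] assms(1) by simp
qed

text \<open>Subtracting a multiple of one fixed bump \<open>?\<rho>\<close> from any bump gives mean
  zero, hence a derivative of a test function, against which \<open>W\<close> integrates to 0. So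
  \<open>W\<close> acts on bumps like a constant.\<close>

lemma du_Bois_Reymond_const:
  fixes W :: "real \<Rightarrow> real"
  assumes T: "0 < T" and W: "integrable (lebesgue_on {0<..<T}) W"
    and zero: "\<And>\<theta>. \<theta> \<in> test_functions {0<..<T} \<Longrightarrow>
      (LINT t|lebesgue_on {0<..<T}. W t * frechet_derivative \<theta> (at t) 1) = 0"
  obtains c where "AE t in lebesgue_on {0<..<T}. W t = c"
proof -
  let ?M = "lebesgue_on {0<..<T}"
  let ?\<rho> = "bump 0 (T/3) (2*T/3)"
  have sub\<rho>: "cbox (T/3) (2*T/3) \<subseteq> {0<..<T}" using T by auto
  have \<rho>: "?\<rho> \<in> test_functions {0<..<T}" by (rule bump_test_function[OF sub\<rho>])
  have intB: "bump n a b integrable_on {0..T}" and eqB: "(LINT t|?M. bump n a b t) = integral {0..T} (bump n a b)"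
    and eqB': "(LINT t|?M. bump n a b t) = (LINT t|lebesgue. bump n a b t)"
    if "cbox a b \<subseteq> {0<..<T}" for n and a b :: real
  proof -
    have c: "continuous_on {0..T} (bump n a b)"
      using smooth_continuous[OF smooth_bump] continuous_on_subset by blast
    show "bump n a b integrable_on {0..T}" using c by (rule integrable_continuous_interval)
    have z: "bump n a b t = 0" if "t \<notin> {0<..<T}" for t
      using that \<open>cbox a b \<subseteq> {0<..<T}\<close> box_subset_cbox[of a b] by (intro bump_eq_0) blast
    have "(LINT t|?M. bump n a b t) = (LINT t|lebesgue. bump n a b t)"
      by (rule lebesgue_on_integral_supported) (use z in auto)
    also have "\<dots> = (LINT t|lebesgue_on {0..T}. bump n a b t)"
      by (rule lebesgue_on_integral_supported[symmetric]) (use z in auto)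
    also have "\<dots> = integral {0..T} (bump n a b)"
      by (intro lebesgue_integral_eq_integral continuous_imp_integrable_real c) auto
    finally show "(LINT t|?M. bump n a b t) = integral {0..T} (bump n a b)" .
    show "(LINT t|?M. bump n a b t) = (LINT t|lebesgue. bump n a b t)" by fact
  qed
  have m: "(LINT t|?M. ?\<rho> t) > 0"
    unfolding eqB'[OF sub\<rho>] by (rule bump_integral_pos) (use T in auto)
  have intM: "integrable ?M (\<lambda>t. bump n a b t)" if "cbox a b \<subseteq> {0<..<T}" for n and a b :: real
    using integrable_mult_test_function[of _ "\<lambda>_. 1", OF _ bump_test_function[OF that]]
    by (simp add: finite_measure.integrable_const finite_measure_lebesgue_on)
  \<comment> \<open>The weighted mean of \<open>W\<close> with respect to \<open>?\<rho>\<close> is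
    the only candidate for the constant.\<close>
  define c where "c = (LINT t|?M. W t * ?\<rho> t) / (LINT t|?M. ?\<rho> t)"
  have "(LINT t|?M. (W t - c) * bump n a b t) = 0" if sub: "cbox a b \<subseteq> {0<..<T}" for n a b
  proof (cases "box a b = {}")
    case True
    then have "bump n a b t = 0" for t by (intro bump_eq_0) auto
    then show ?thesis by simp
  next
    case False
    then have ab: "a < b" by auto
    let ?\<theta> = "bump n a b"
    \<comment> \<open>Chosen so that \<open>?g\<close> has integral 0 and therefore a primitive that
      is a test function.\<close>
    define \<kappa> where "\<kappa> = (LINT t|?M. ?\<theta> t) / (LINT t|?M. ?\<rho> t)"
    let ?g = "\<lambda>t. ?\<theta> t - \<kappa> * ?\<rho> t"
    have "a \<in> cbox a b" "b \<in> cbox a b" using ab by auto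
    then have "0 < a" "b < T" using sub by auto
    obtain \<Theta> where \<Theta>: "\<Theta> \<in> test_functions {0<..<T}" "\<And>t. frechet_derivative \<Theta> (at t) 1 = ?g t"
    proof (rule ex_test_function_antiderivative[of ?g "min a (T/3)" "max b (2*T/3)" T])
      show "smooth ?g" by (intro smooth_diff smooth_mult smooth_const smooth_bump)
      show "?g t = 0" if "t \<notin> {min a (T/3)..max b (2*T/3)}" for t
      proof -
        have "t \<notin> box a b" "t \<notin> box (T/3) (2*T/3)" using that by (auto simp: not_le)
        then show ?thesis by (simp add: bump_eq_0)
      qed
      have "integral {0..T} ?g = integral {0..T} ?\<theta> - \<kappa> * integral {0..T} ?\<rho>"
        using intB[OF sub] intB[OF sub\<rho>]
        by (subst Henstock_Kurzweil_Integration.integral_diff) (auto intro: integrable_on_mult_right)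
      also have "\<dots> = 0" using m unfolding eqB[OF sub, symmetric] eqB[OF sub\<rho>, symmetric] \<kappa>_def by simp
      finally show "integral {0..T} ?g = 0" .
    qed (use ab T \<open>0 < a\<close> \<open>b < T\<close> in auto)
    have I: "integrable ?M (\<lambda>t. W t * ?\<theta> t)" "integrable ?M (\<lambda>t. W t * ?\<rho> t)"
      using integrable_mult_test_function[OF W] bump_test_function[OF sub] \<rho> by auto
    have "0 = (LINT t|?M. W t * ?g t)" using zero[OF \<Theta>(1)] \<Theta>(2) by simp
    also have "\<dots> = (LINT t|?M. W t * ?\<theta> t - \<kappa> * (W t * ?\<rho> t))" by (simp add: algebra_simps)
    also have "\<dots> = (LINT t|?M. W t * ?\<theta> t) - \<kappa> * (LINT t|?M. W t * ?\<rho> t)"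
      using I by (subst Bochner_Integration.integral_diff) auto
    also have "\<kappa> * (LINT t|?M. W t * ?\<rho> t) = c * (LINT t|?M. ?\<theta> t)"
      by (simp add: \<kappa>_def c_def)
    finally have "(LINT t|?M. W t * ?\<theta> t) - c * (LINT t|?M. ?\<theta> t) = 0" by simp
    also have "(LINT t|?M. W t * ?\<theta> t) - c * (LINT t|?M. ?\<theta> t) = (LINT t|?M. W t * ?\<theta> t - c * ?\<theta> t)"
      using I intM[OF sub] by (subst Bochner_Integration.integral_diff) auto
    finally show ?thesis by (simp add: algebra_simps)
  qed
  moreover have "set_integrable lebesgue (cbox a b) (\<lambda>t. W t - c)" if "cbox a b \<subseteq> {0<..<T}" for a b
  proof -
    have "integrable ?M (\<lambda>t. W t - c)"
      using W by (simp add: finite_measure.integrable_const finite_measure_lebesgue_on)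
    then have "set_integrable lebesgue {0<..<T} (\<lambda>t. W t - c)"
      by (simp add: set_integrable_def integrable_restrict_space)
    then show ?thesis by (rule set_integrable_subset) (use that in auto)
  qed
  ultimately have "AE t in ?M. W t - c = 0"
    by (intro AE_zero_if_bump_integrals_zero) (auto simp: rat_boxes_def)
  then show thesis by (intro that[of c]) (auto elim: eventually_mono)
qed

text \<open>The primitive of \<open>G\<close> satisfies the same weak equation by the product rule,
  so its difference to \<open>F\<close> has vanishing weak derivative.\<close>

lemma du_Bois_Reymond:
  fixes F G :: "real \<Rightarrow> real"
  assumes T: "0 < T" and F: "integrable (lebesgue_on {0<..<T}) F" and G: "set_integrable lborel {0..T} G"
    and Gm: "G \<in> borel_measurable borel"
    and weak: "\<And>\<theta>. \<theta> \<in> test_functions {0<..<T} \<Longrightarrow>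
      (LINT t|lebesgue_on {0<..<T}. F t * frechet_derivative \<theta> (at t) 1) = - (LINT t|lebesgue_on {0<..<T}. G t * \<theta> t)"
  obtains c where "AE t in lebesgue_on {0<..<T}. F t = c + (LBINT s:{0..t}. G s)"
proof -
  let ?M = "lebesgue_on {0<..<T}"
  let ?\<Gamma> = "\<lambda>t. LBINT s:{0..t}. G s"
  have \<Gamma>c: "continuous_on {0..T} ?\<Gamma>" by (rule continuous_on_set_integral_Icc[OF G])
  have conv: "integrable ?M h" "(LINT t|?M. h t) = (LBINT t:{0..T}. h t)"
    if "set_integrable lborel {0..T} h" "h \<in> borel_measurable (lebesgue_on {0<..<T})" for h :: "real \<Rightarrow> real"
  proof -
    have "set_integrable lborel {0<..<T} h" by (rule set_integrable_subset[OF that(1)]) auto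
    then have i: "integrable lborel (\<lambda>x. indicator {0<..<T} x *\<^sub>R h x)" by (simp add: set_integrable_def)
    have i': "integrable lebesgue (\<lambda>x. indicator {0<..<T} x *\<^sub>R h x)"
      using i by (subst integrable_completion) auto
    then show "integrable ?M h" by (subst integrable_restrict_space) auto
    have "(LINT t|?M. h t) = (LINT x|lebesgue. indicator {0<..<T} x *\<^sub>R h x)"
      by (subst integral_restrict_space) auto
    also have "\<dots> = (LINT x|lborel. indicator {0<..<T} x *\<^sub>R h x)"
      using i by (intro integral_completion) auto
    also have "\<dots> = (LBINT t:{0..T}. h t)"
      unfolding set_lebesgue_integral_def
    proof (rule integral_cong_AE)
      show "AE x in lborel. indicator {0<..<T} x *\<^sub>R h x = indicator {0..T} x *\<^sub>R h x"
        using AE_lborel_singleton[of 0] AE_lborel_singleton[of T] by eventually_elim (auto simp: indicator_def)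
    qed (use i that(1) in \<open>auto simp: set_integrable_def\<close>)
    finally show "(LINT t|?M. h t) = (LBINT t:{0..T}. h t)" .
  qed
  have \<Gamma>m: "?\<Gamma> \<in> borel_measurable ?M"
    by (rule continuous_imp_measurable_on_sets_lebesgue[OF continuous_on_subset[OF \<Gamma>c]]) auto
  have \<Gamma>i: "integrable ?M ?\<Gamma>"
    using conv(1)[OF borel_integrable_atLeastAtMost'[OF \<Gamma>c] \<Gamma>m] .
  have "(LINT t|?M. (F t - ?\<Gamma> t) * frechet_derivative \<theta> (at t) 1) = 0" if \<theta>: "\<theta> \<in> test_functions {0<..<T}" for \<theta>
  proof -
    let ?\<theta>' = "\<lambda>t. frechet_derivative \<theta> (at t) 1"
    have \<theta>': "?\<theta>' \<in> test_functions {0<..<T}" using test_function_partial[OF \<theta>, of 1] by simp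
    have der: "(\<theta> has_real_derivative ?\<theta>' t) (at t)" for t by (rule real_test_function_derivative[OF \<theta>])
    have \<theta>'c: "continuous_on S ?\<theta>'" for S
      using \<theta>' smooth_continuous continuous_on_subset unfolding test_functions_def by blast
    have \<theta>c: "continuous_on S \<theta>" for S
      using \<theta> smooth_continuous continuous_on_subset unfolding test_functions_def by blast
    have zero: "\<theta> 0 = 0" "\<theta> T = 0" using \<theta> by (auto simp: test_functions_def)
    have \<theta>'i: "set_integrable lborel {0..T} ?\<theta>'" by (rule borel_integrable_atLeastAtMost'[OF \<theta>'c])
    have FTC: "\<theta> t = 0 + (LBINT s:{0..t}. ?\<theta>' s)" if "t \<in> {0..T}" for t
    proof -
      have "(LBINT s:{0..t}. ?\<theta>' s) = \<theta> t - \<theta> 0"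
        unfolding set_lebesgue_integral_def
      proof (rule integral_FTC_atLeastAtMost[OF _ _ \<theta>'c])
        show "(\<theta> has_vector_derivative ?\<theta>' x) (at x within {0..t})" for x
          unfolding has_real_derivative_iff_has_vector_derivative[symmetric]
          by (rule has_field_derivative_at_within[OF der])
      qed (use that in simp)
      then show ?thesis using zero by simp
    qed
    \<comment> \<open>Integration by parts of the primitive against \<theta>; the boundary terms
      vanish as \<theta> is 0 at both ends.\<close>
    have "?\<Gamma> T * \<theta> T - 0 * 0 = (LBINT s:{0..T}. ?\<Gamma> s * ?\<theta>' s + \<theta> s * G s)"
      by (rule indefinite_integral_product_rule[OF G _ \<theta>'i FTC]) (use T in auto)
    then have 0: "0 = (LBINT s:{0..T}. ?\<Gamma> s * ?\<theta>' s + \<theta> s * G s)" using zero by simp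
    have a: "set_integrable lborel {0..T} (\<lambda>s. ?\<Gamma> s * ?\<theta>' s)" 
      by (rule borel_integrable_atLeastAtMost'[OF continuous_on_mult[OF \<Gamma>c \<theta>'c]])
    have b: "set_integrable lborel {0..T} (\<lambda>s. \<theta> s * G s)"
      by (rule set_integrable_continuous_mult[OF G \<theta>c])
    have am: "(\<lambda>s. ?\<Gamma> s * ?\<theta>' s) \<in> borel_measurable ?M"
      by (intro borel_measurable_times \<Gamma>m test_function_measurable_lebesgue_on[OF \<theta>'])
    have "G \<in> borel_measurable ?M"
      by (intro measurable_restrict_space1 measurable_completion) (simp add: Gm)
    then have bm: "(\<lambda>s. \<theta> s * G s) \<in> borel_measurable ?M"
      by (intro borel_measurable_times test_function_measurable_lebesgue_on[OF \<theta>])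
    have "(LBINT s:{0..T}. ?\<Gamma> s * ?\<theta>' s) + (LBINT s:{0..T}. \<theta> s * G s) = 0"
      using 0 a b by simp
    then have *: "(LINT t|?M. ?\<Gamma> t * ?\<theta>' t) + (LINT t|?M. \<theta> t * G t) = 0"
      unfolding conv(2)[OF a am] conv(2)[OF b bm] .
    have "(LINT t|?M. (F t - ?\<Gamma> t) * ?\<theta>' t) = (LINT t|?M. F t * ?\<theta>' t - ?\<Gamma> t * ?\<theta>' t)"
      by (simp add: algebra_simps)
    also have "\<dots> = (LINT t|?M. F t * ?\<theta>' t) - (LINT t|?M. ?\<Gamma> t * ?\<theta>' t)"
      by (intro Bochner_Integration.integral_diff integrable_mult_test_function[OF F \<theta>'] conv(1)[OF a am])
    finally show ?thesis using * weak[OF \<theta>] by (simp add: mult.commute)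
  qed
  then obtain c where "AE t in ?M. F t - ?\<Gamma> t = c"
    using du_Bois_Reymond_const[OF T Bochner_Integration.integrable_diff[OF F \<Gamma>i]] by blast
  then have "AE t in ?M. F t = c + ?\<Gamma> t" by eventually_elim simp
  then show thesis by (rule that)
qed

section \<open>Square-integrable functions\<close>

lemma L2_mult_integrable:
  fixes f g :: "'a \<Rightarrow> real"
  assumes "f \<in> borel_measurable M" "g \<in> borel_measurable M"
    and "integrable M (\<lambda>x. (f x)\<^sup>2)" "integrable M (\<lambda>x. (g x)\<^sup>2)"
  shows "integrable M (\<lambda>x. f x * g x)"
proof (rule Bochner_Integration.integrable_bound)
  show "integrable M (\<lambda>x. (f x)\<^sup>2 + (g x)\<^sup>2)" using assms by simp
  show "AE x in M. norm (f x * g x) \<le> norm ((f x)\<^sup>2 + (g x)\<^sup>2)"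
  proof (intro AE_I2)
    fix x
    have "2 * \<bar>f x * g x\<bar> \<le> (f x)\<^sup>2 + (g x)\<^sup>2"
      using zero_le_power2[of "\<bar>f x\<bar> - \<bar>g x\<bar>"] by (simp add: power2_diff abs_mult)
    then show "norm (f x * g x) \<le> norm ((f x)\<^sup>2 + (g x)\<^sup>2)" by simp
  qed
qed (use assms in auto)

lemma L2_diff_integrable:
  fixes f g :: "'a \<Rightarrow> real"
  assumes "f \<in> borel_measurable M" "g \<in> borel_measurable M"
    and "integrable M (\<lambda>x. (f x)\<^sup>2)" "integrable M (\<lambda>x. (g x)\<^sup>2)"
  shows "integrable M (\<lambda>x. (f x - g x)\<^sup>2)"
proof -
  have "integrable M (\<lambda>x. (f x)\<^sup>2 + (g x)\<^sup>2 - 2 * (f x * g x))"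
    using assms L2_mult_integrable[OF assms] by simp
  then show ?thesis by (simp add: power2_diff mult.assoc)
qed

text \<open>For a > 0 the polynomial is evaluated at its minimum - b / a. For a = 0 it is affine,
  and being bounded below forces the slope to vanish.\<close>

lemma discriminant_bound:
  fixes a b c :: real
  assumes "\<And>r. 0 \<le> a * r\<^sup>2 + 2 * b * r + c" "0 \<le> a"
  shows "b\<^sup>2 \<le> a * c"
proof (cases "a = 0")
  case True
  have "b = 0"
  proof (rule ccontr)
    assume "b \<noteq> 0"
    \<comment> \<open>At this point the affine function takes the value -1.\<close>
    then show False using assms(1)[of "- (c + 1) / (2 * b)"] True by simp
  qed
  then show ?thesis using True by simp
next
  case False
  have "a * (- b / a)\<^sup>2 + 2 * b * (- b / a) + c = c - b\<^sup>2 / a"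
    using False by (simp add: power2_eq_square field_simps)
  then have "b\<^sup>2 / a \<le> c" using assms(1)[of "- b / a"] by simp
  then show ?thesis using False assms(2) by (simp add: field_simps)
qed

lemma L2_Cauchy_Schwarz:
  fixes f g :: "'a \<Rightarrow> real"
  assumes "f \<in> borel_measurable M" "g \<in> borel_measurable M"
    and "integrable M (\<lambda>x. (f x)\<^sup>2)" "integrable M (\<lambda>x. (g x)\<^sup>2)"
  shows "(LINT x|M. f x * g x)\<^sup>2 \<le> (LINT x|M. (f x)\<^sup>2) * (LINT x|M. (g x)\<^sup>2)"
proof (rule discriminant_bound)
  note fg = L2_mult_integrable[OF assms]
  fix r :: real
  have "0 \<le> (LINT x|M. (r * f x + g x)\<^sup>2)" by simp
  also have "\<dots> = (LINT x|M. r\<^sup>2 * (f x)\<^sup>2 + 2 * r * (f x * g x) + (g x)\<^sup>2)"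
    by (simp add: power2_eq_square algebra_simps)
  also have "\<dots> = r\<^sup>2 * (LINT x|M. (f x)\<^sup>2) + 2 * r * (LINT x|M. f x * g x) + (LINT x|M. (g x)\<^sup>2)"
    using assms fg by simp
  finally show "0 \<le> (LINT x|M. (f x)\<^sup>2) * r\<^sup>2 + 2 * (LINT x|M. f x * g x) * r + (LINT x|M. (g x)\<^sup>2)"
    by (simp add: algebra_simps)
qed simp

lemma L2_Cauchy_Schwarz_abs:
  fixes f g :: "'a \<Rightarrow> real"
  assumes "f \<in> borel_measurable M" "g \<in> borel_measurable M"
    and "integrable M (\<lambda>x. (f x)\<^sup>2)" "integrable M (\<lambda>x. (g x)\<^sup>2)"
  shows "\<bar>LINT x|M. f x * g x\<bar> \<le> sqrt (LINT x|M. (f x)\<^sup>2) * sqrt (LINT x|M. (g x)\<^sup>2)"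
proof -
  have "\<bar>LINT x|M. f x * g x\<bar> = sqrt ((LINT x|M. f x * g x)\<^sup>2)" by simp
  also have "\<dots> \<le> sqrt ((LINT x|M. (f x)\<^sup>2) * (LINT x|M. (g x)\<^sup>2))"
    by (rule real_sqrt_le_mono[OF L2_Cauchy_Schwarz[OF assms]])
  finally show ?thesis by (simp add: real_sqrt_mult)
qed

lemma L2_limit_mult:
  fixes f g :: "'a \<Rightarrow> real"
  assumes fn: "\<And>n. fn n \<in> borel_measurable M" "\<And>n. integrable M (\<lambda>x. (fn n x)\<^sup>2)"
    and f: "f \<in> borel_measurable M" "integrable M (\<lambda>x. (f x)\<^sup>2)"
    and g: "g \<in> borel_measurable M" "integrable M (\<lambda>x. (g x)\<^sup>2)"
    and lim: "((\<lambda>n. LINT x|M. (fn n x - f x)\<^sup>2) \<longlongrightarrow> 0) F"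
  shows "((\<lambda>n. LINT x|M. fn n x * g x) \<longlongrightarrow> (LINT x|M. f x * g x)) F"
proof -
  have eq: "(LINT x|M. (fn n x - f x) * g x) = (LINT x|M. fn n x * g x) - (LINT x|M. f x * g x)" for n
    using L2_mult_integrable[OF fn(1) g(1) fn(2) g(2)] L2_mult_integrable[OF f(1) g(1) f(2) g(2)]
    by (simp add: left_diff_distrib)
  have "((\<lambda>n. sqrt (LINT x|M. (fn n x - f x)\<^sup>2) * sqrt (LINT x|M. (g x)\<^sup>2)) \<longlongrightarrow> sqrt 0 * sqrt (LINT x|M. (g x)\<^sup>2)) F"
    by (intro tendsto_mult tendsto_const tendsto_real_sqrt lim)
  then have lim0: "((\<lambda>n. sqrt (LINT x|M. (fn n x - f x)\<^sup>2) * sqrt (LINT x|M. (g x)\<^sup>2)) \<longlongrightarrow> 0) F"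
    by simp
  have "((\<lambda>n. LINT x|M. (fn n x - f x) * g x) \<longlongrightarrow> 0) F"
  proof (rule Lim_null_comparison[OF always_eventually lim0], rule allI)
    fix n
    have "\<bar>LINT x|M. (fn n x - f x) * g x\<bar> \<le> sqrt (LINT x|M. (fn n x - f x)\<^sup>2) * sqrt (LINT x|M. (g x)\<^sup>2)"
      by (intro L2_Cauchy_Schwarz_abs L2_diff_integrable borel_measurable_diff fn f g)
    then show "norm (LINT x|M. (fn n x - f x) * g x) \<le> sqrt (LINT x|M. (fn n x - f x)\<^sup>2) * sqrt (LINT x|M. (g x)\<^sup>2)"
      by simp
  qed
  then show ?thesis unfolding eq by (rule LIM_zero_cancel)
qed

lemma abs_powr_2: "\<bar>y::real\<bar> powr 2 = y\<^sup>2"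
  by (cases "y = 0") (auto simp: powr_numeral)

lemma Lq_space_2: "f \<in> Lq_space 2 \<Omega> \<longleftrightarrow>
    f \<in> borel_measurable (lebesgue_on \<Omega>) \<and> integrable (lebesgue_on \<Omega>) (\<lambda>x. (f x)\<^sup>2)"
  by (simp add: Lq_space_def abs_powr_2)

lemma Lq_norm_2: "Lq_norm 2 \<Omega> f = sqrt (LINT x|lebesgue_on \<Omega>. (f x)\<^sup>2)"
  by (simp add: Lq_norm_def abs_powr_2 powr_half_sqrt)

lemma Lq_norm_2_sq: "(Lq_norm 2 \<Omega> f)\<^sup>2 = (LINT x|lebesgue_on \<Omega>. (f x)\<^sup>2)"
  by (simp add: Lq_norm_2)

section \<open>Weak derivatives\<close>

lemma test_functionE:
  assumes "\<phi> \<in> test_functions \<Omega>"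
  obtains K where "compact K" "K \<subseteq> \<Omega>" "\<And>x. x \<notin> K \<Longrightarrow> \<phi> x = 0"
  using assms by (auto simp: test_functions_def)

lemma test_function_smooth: "\<phi> \<in> test_functions \<Omega> \<Longrightarrow> smooth \<phi>"
  by (simp add: test_functions_def)

lemma test_function_mult:
  assumes "\<phi> \<in> test_functions \<Omega>" "\<psi> \<in> test_functions \<Omega>"
  shows "(\<lambda>x. \<phi> x * \<psi> x) \<in> test_functions \<Omega>"
proof -
  obtain K where "compact K" "K \<subseteq> \<Omega>" "\<And>x. x \<notin> K \<Longrightarrow> \<phi> x = 0" using assms(1) by (auto simp: test_functions_def)
  then show ?thesis
    using assms smooth_mult[of \<phi> \<psi>] unfolding test_functions_def by auto
qed

lemma continuous_compact_support_integrable: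
  fixes \<phi> :: "'a::euclidean_space \<Rightarrow> real"
  assumes "continuous_on UNIV \<phi>" "compact K" "\<And>x. x \<notin> K \<Longrightarrow> \<phi> x = 0"
  shows "integrable lborel \<phi>"
proof -
  have "integrable lborel (\<lambda>x. indicator K x *\<^sub>R \<phi> x)"
    by (intro borel_integrable_compact assms(2) continuous_on_subset[OF assms(1)]) auto
  moreover have "(\<lambda>x. indicator K x *\<^sub>R \<phi> x) = \<phi>" using assms(3) by (auto simp: indicator_def fun_eq_iff)
  ultimately show ?thesis by simp
qed

lemma test_function_integrable: "\<phi> \<in> test_functions \<Omega> \<Longrightarrow> integrable lborel \<phi>"
  using continuous_compact_support_integrable[OF smooth_continuous] unfolding test_functions_def by blast

lemma lebesgue_on_integral_eq_lborel:
  fixes f :: "'a::euclidean_space \<Rightarrow> real"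
  assumes "S \<in> sets lebesgue" "\<And>x. x \<notin> S \<Longrightarrow> f x = 0" "f \<in> borel_measurable borel"
  shows "(LINT x|lebesgue_on S. f x) = (LINT x|lborel. f x)"
  using lebesgue_on_integral_supported[OF assms(1,2)] assms(3) by (simp add: integral_completion)

lemma test_function_zero_outside: "\<phi> \<in> test_functions \<Omega> \<Longrightarrow> x \<notin> \<Omega> \<Longrightarrow> \<phi> x = 0"
  unfolding test_functions_def by blast

text \<open>The difference quotients have integral \<open>0\<close> by translation invariance.\<close>

lemma test_function_integral_partial:
  fixes \<phi> :: "'a::euclidean_space \<Rightarrow> real"
  assumes \<phi>: "\<phi> \<in> test_functions \<Omega>" and i: "i \<in> Basis"
  shows "(LINT x|lborel. frechet_derivative \<phi> (at x) i) = 0"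
proof -
  let ?d = "\<lambda>x. frechet_derivative \<phi> (at x) i"
  have d: "?d \<in> test_functions \<Omega>" by (rule test_function_partial[OF \<phi> i])
  obtain B where B: "B \<ge> 0" "\<And>x. \<bar>?d x\<bar> \<le> B" using test_function_bounded[OF d] by metis
  obtain K where K: "compact K" "\<And>x. x \<notin> K \<Longrightarrow> \<phi> x = 0" using test_functionE[OF \<phi>] by metis
  obtain r where r: "\<And>x. x \<in> K \<Longrightarrow> norm x \<le> r" using compact_imp_bounded[OF K(1)] by (auto simp: bounded_iff)
  have der: "((\<lambda>t. \<phi> (x + t *\<^sub>R i)) has_real_derivative ?d (x + t *\<^sub>R i)) (at t)" for x t
  proof -
    have "(\<phi> has_derivative frechet_derivative \<phi> (at (x + t *\<^sub>R i))) (at (x + t *\<^sub>R i))"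
      by (rule smooth_has_derivative[OF test_function_smooth[OF \<phi>]])
    moreover have "((\<lambda>t. x + t *\<^sub>R i) has_derivative (\<lambda>s. s *\<^sub>R i)) (at t)"
      by (auto intro!: derivative_eq_intros)
    ultimately have "((\<lambda>t. \<phi> (x + t *\<^sub>R i)) has_derivative (\<lambda>s. frechet_derivative \<phi> (at (x + t *\<^sub>R i)) (s *\<^sub>R i))) (at t)"
      by (rule has_derivative_compose[rotated])
    moreover have "(\<lambda>s. frechet_derivative \<phi> (at (x + t *\<^sub>R i)) (s *\<^sub>R i)) = (*) (?d (x + t *\<^sub>R i))"
      using linear_scale[OF has_derivative_linear[OF smooth_has_derivative[OF test_function_smooth[OF \<phi>]]]]
      by (intro ext) (simp add: mult.commute)
    ultimately show ?thesis unfolding has_field_derivative_def by (simp only:)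
  qed
  let ?h = "\<lambda>n::nat. inverse (real (Suc n))"
  let ?q = "\<lambda>n x. (\<phi> (x + ?h n *\<^sub>R i) - \<phi> x) / ?h n"
  have \<phi>m[measurable]: "\<phi> \<in> borel_measurable borel" by (rule test_function_measurable[OF \<phi>])
  have dm[measurable]: "?d \<in> borel_measurable borel" by (rule test_function_measurable[OF d])
  \<comment> \<open>By the mean value theorem \<open>B\<close> bounds the quotients. Steps of length
    at most 1 move the support by at most 1, hence the ball of radius r + 1.\<close>
  have "(\<lambda>n. LINT x|lborel. ?q n x) \<longlonglongrightarrow> (LINT x|lborel. ?d x)"
  proof (rule integral_dominated_convergence[where w="\<lambda>x. B * indicator (cball 0 (r + 1)) x"])
    show "integrable lborel (\<lambda>x. B * indicator (cball 0 (r + 1)) x)"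
      by (intro integrable_mult_right) (auto intro!: integrable_real_indicator emeasure_lborel_cball_finite)
    show "AE x in lborel. (\<lambda>n. ?q n x) \<longlonglongrightarrow> ?d x"
    proof (intro AE_I2)
      fix x
      have "((\<lambda>h. (\<phi> (x + h *\<^sub>R i) - \<phi> x) / h) \<longlongrightarrow> ?d x) (at 0)"
        using der[of x 0] by (simp add: DERIV_def)
      moreover have "filterlim ?h (at 0) sequentially"
        by (intro filterlim_atI LIMSEQ_inverse_real_of_nat) (auto intro!: always_eventually)
      ultimately show "(\<lambda>n. ?q n x) \<longlonglongrightarrow> ?d x" by (rule filterlim_compose)
    qed
    show "AE x in lborel. norm (?q n x) \<le> B * indicator (cball 0 (r + 1)) x" for n
    proof (intro AE_I2)
      fix x :: 'a
      have h: "0 < ?h n" "?h n \<le> 1" by (auto simp: field_simps)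
      obtain z where z: "\<phi> (x + ?h n *\<^sub>R i) - \<phi> (x + 0 *\<^sub>R i) = (?h n - 0) * ?d (x + z *\<^sub>R i)"
        using MVT2[of 0 "?h n" "\<lambda>t. \<phi> (x + t *\<^sub>R i)" "\<lambda>t. ?d (x + t *\<^sub>R i)"] der h by blast
      then have "?q n x = ?d (x + z *\<^sub>R i)" using h by simp
      then have bd: "\<bar>?q n x\<bar> \<le> B" using B(2) by simp
      show "norm (?q n x) \<le> B * indicator (cball 0 (r + 1)) x"
      proof (cases "x \<in> cball 0 (r + 1)")
        case False
        then have nx: "norm x > r + 1" by simp
        have "norm (x + ?h n *\<^sub>R i) \<ge> norm x - norm (?h n *\<^sub>R i)" by (metis norm_diff_ineq)
        moreover have "norm (?h n *\<^sub>R i) \<le> 1" using h i by simp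
        ultimately have "x + ?h n *\<^sub>R i \<notin> K" "x \<notin> K" using r nx by force+
        then show ?thesis using K(2) False by simp
      qed (use bd in simp)
    qed
  qed simp_all
  moreover have "(LINT x|lborel. ?q n x) = 0" for n
  proof -
    have \<phi>i: "integrable lborel \<phi>" by (rule test_function_integrable[OF \<phi>])
    have "integrable (distr lborel borel ((+) (?h n *\<^sub>R i))) \<phi>" using \<phi>i by (simp add: lborel_distr_plus)
    then have si: "integrable lborel (\<lambda>x. \<phi> (x + ?h n *\<^sub>R i))"
      by (subst (asm) integrable_distr_eq) (simp_all add: add.commute)
    have "(LINT x|distr lborel borel ((+) (?h n *\<^sub>R i)). \<phi> x) = (LINT x|lborel. \<phi> (x + ?h n *\<^sub>R i))"
      by (subst integral_distr) (simp_all add: add.commute)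
    then have "(LINT x|lborel. \<phi> (x + ?h n *\<^sub>R i)) = (LINT x|lborel. \<phi> x)" by (simp add: lborel_distr_plus)
    then show ?thesis using \<phi>i si by simp
  qed
  ultimately show ?thesis by (simp add: LIMSEQ_const_iff)
qed

lemma frechet_derivative_mult_smooth:
  assumes "smooth \<phi>" "smooth \<psi>"
  shows "frechet_derivative (\<lambda>x. \<phi> x * \<psi> x) (at x) i =
    \<phi> x * frechet_derivative \<psi> (at x) i + frechet_derivative \<phi> (at x) i * \<psi> x"
  using frechet_derivative_at[OF has_derivative_mult[OF smooth_has_derivative[OF assms(1)] smooth_has_derivative[OF assms(2)]], symmetric]
  by metis

lemma test_function_parts:
  fixes \<phi> \<psi> :: "'a::euclidean_space \<Rightarrow> real"
  assumes \<phi>: "\<phi> \<in> test_functions \<Omega>" and \<psi>: "\<psi> \<in> test_functions \<Omega>" and i: "i \<in> Basis" and \<Omega>: "\<Omega> \<in> sets lebesgue"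
  shows "(LINT x|lebesgue_on \<Omega>. \<phi> x * frechet_derivative \<psi> (at x) i) = - (LINT x|lebesgue_on \<Omega>. frechet_derivative \<phi> (at x) i * \<psi> x)"
proof -
  note d\<phi> = test_function_partial[OF \<phi> i] and d\<psi> = test_function_partial[OF \<psi> i]
  note a = test_function_mult[OF \<phi> d\<psi>] and b = test_function_mult[OF d\<phi> \<psi>]
  have "0 = (LINT x|lborel. \<phi> x * frechet_derivative \<psi> (at x) i + frechet_derivative \<phi> (at x) i * \<psi> x)"
    using test_function_integral_partial[OF test_function_mult[OF \<phi> \<psi>] i]
    by (simp add: frechet_derivative_mult_smooth test_function_smooth[OF \<phi>] test_function_smooth[OF \<psi>])
  also have "\<dots> = (LINT x|lborel. \<phi> x * frechet_derivative \<psi> (at x) i) + (LINT x|lborel. frechet_derivative \<phi> (at x) i * \<psi> x)"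
    using test_function_integrable[OF a] test_function_integrable[OF b] by simp
  finally show ?thesis
    using lebesgue_on_integral_eq_lborel[OF \<Omega> _ test_function_measurable[OF a]] test_function_zero_outside[OF a]
      lebesgue_on_integral_eq_lborel[OF \<Omega> _ test_function_measurable[OF b]] test_function_zero_outside[OF b]
    by auto
qed

lemma locally_integrable_mult_test:
  assumes f: "locally_integrable \<Omega> f" and \<phi>: "\<phi> \<in> test_functions \<Omega>" and \<Omega>: "\<Omega> \<in> sets lebesgue"
  shows "integrable (lebesgue_on \<Omega>) (\<lambda>x. f x * \<phi> x)"
proof -
  obtain K where K: "compact K" "K \<subseteq> \<Omega>" "\<And>x. x \<notin> K \<Longrightarrow> \<phi> x = 0" using test_functionE[OF \<phi>] by metis
  obtain B where B: "\<And>x. \<bar>\<phi> x\<bar> \<le> B" using test_function_bounded[OF \<phi>] by metis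
  have "integrable lebesgue (\<lambda>x. indicator K x *\<^sub>R f x)"
    using f K by (auto simp: locally_integrable_def set_integrable_def)
  then have "integrable lebesgue (\<lambda>x. (indicator K x *\<^sub>R f x) * \<phi> x)"
    using B test_function_measurable[OF \<phi>]
    by (intro integrable_mult_bounded[where B=B]) (auto intro: measurable_completion)
  moreover have "(\<lambda>x. (indicator K x *\<^sub>R f x) * \<phi> x) = (\<lambda>x. indicator \<Omega> x *\<^sub>R (f x * \<phi> x))"
    using K by (auto simp: indicator_def fun_eq_iff)
  ultimately show ?thesis using \<Omega> by (subst integrable_restrict_space) auto
qed

text \<open>Countably many closed boxes cover the open set, and on each of them the function is
  integrable, hence measurable.\<close>

lemma locally_integrable_measurable:
  assumes \<Omega>: "open \<Omega>" and f: "locally_integrable \<Omega> f"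
  shows "f \<in> borel_measurable (lebesgue_on \<Omega>)"
proof (rule measurable_piecewise_restrict)
  let ?X = "(\<lambda>(a, b). cbox a b) ` rat_boxes \<Omega>"
  show "countable ?X" by (intro countable_image countable_rat_boxes)
  show "space (lebesgue_on \<Omega>) \<subseteq> \<Union>?X"
  proof
    fix x assume "x \<in> space (lebesgue_on \<Omega>)"
    then have "x \<in> \<Omega>" by simp
    then obtain a b where ab: "(a, b) \<in> rat_boxes \<Omega>" "x \<in> box a b" using rat_boxes_cover[OF \<Omega>] by metis
    then have "x \<in> cbox a b" using box_subset_cbox by blast
    then show "x \<in> \<Union>?X" using ab(1) by blast
  qed
  fix S assume "S \<in> ?X"
  then obtain a b where S: "S = cbox a b" "cbox a b \<subseteq> \<Omega>" by (auto simp: rat_boxes_def)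
  show "S \<inter> space (lebesgue_on \<Omega>) \<in> sets (lebesgue_on \<Omega>)"
    using S \<Omega> by (auto simp: sets_restrict_space intro!: image_eqI[of _ _ S])
  have "(\<lambda>x. indicator S x *\<^sub>R f x) \<in> borel_measurable lebesgue"
    using f S borel_measurable_integrable[of lebesgue "\<lambda>x. indicator S x *\<^sub>R f x"]
    by (auto simp: locally_integrable_def set_integrable_def)
  then have "f \<in> borel_measurable (lebesgue_on S)"
    using S by (subst borel_measurable_restrict_space_iff) auto
  moreover have "restrict_space (lebesgue_on \<Omega>) S = lebesgue_on S"
    using S \<Omega> by (subst restrict_restrict_space) (auto simp: Int_absorb1)
  ultimately show "f \<in> borel_measurable (restrict_space (lebesgue_on \<Omega>) S)" by simp
qed

text \<open>On a compact set \<open>\<bar>f\<bar>\<close> is dominated by the integrable function 1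
  + f^2.\<close>

lemma L2_locally_integrable:
  assumes f: "f \<in> Lq_space 2 \<Omega>" and \<Omega>: "\<Omega> \<in> sets lebesgue"
  shows "locally_integrable \<Omega> f"
  unfolding locally_integrable_def
proof (intro allI impI)
  fix K assume K: "compact K \<and> K \<subseteq> \<Omega>"
  have fm: "(\<lambda>x. indicator \<Omega> x *\<^sub>R f x) \<in> borel_measurable lebesgue"
    using f \<Omega> by (subst borel_measurable_restrict_space_iff[symmetric]) (auto simp: Lq_space_2)
  have f2: "integrable lebesgue (\<lambda>x. indicator \<Omega> x *\<^sub>R (f x)\<^sup>2)"
    using f \<Omega> by (subst integrable_restrict_space[symmetric]) (auto simp: Lq_space_2)
  have KL: "K \<in> lmeasurable" using K by (simp add: lmeasurable_compact)
  have Ks: "K \<in> sets lebesgue" using KL by (simp add: fmeasurableD)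
  show "set_integrable lebesgue K f"
    unfolding set_integrable_def
  proof (rule Bochner_Integration.integrable_bound)
    show "integrable lebesgue (\<lambda>x. indicator K x + indicator \<Omega> x *\<^sub>R (f x)\<^sup>2)"
      using f2 KL by (intro Bochner_Integration.integrable_add) (auto simp: fmeasurable_def)
    have "(\<lambda>x. indicator K x *\<^sub>R f x) = (\<lambda>x. indicator K x * (indicator \<Omega> x *\<^sub>R f x))"
      using K by (auto simp: indicator_def fun_eq_iff)
    moreover have "(\<lambda>x. indicator K x * (indicator \<Omega> x *\<^sub>R f x)) \<in> borel_measurable lebesgue"
      by (intro borel_measurable_times fm borel_measurable_indicator Ks)
    ultimately show "(\<lambda>x. indicator K x *\<^sub>R f x) \<in> borel_measurable lebesgue" by simp
    show "AE x in lebesgue. norm (indicator K x *\<^sub>R f x) \<le> norm (indicator K x + indicator \<Omega> x *\<^sub>R (f x)\<^sup>2)"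
    proof (intro AE_I2)
      fix x
      have "\<bar>f x\<bar> \<le> 1 + (f x)\<^sup>2" using zero_le_power2[of "\<bar>f x\<bar> - 1"] by (simp add: power2_diff)
      then show "norm (indicator K x *\<^sub>R f x) \<le> norm (indicator K x + indicator \<Omega> x *\<^sub>R (f x)\<^sup>2)"
        using K by (auto simp: indicator_def)
    qed
  qed
qed

lemma test_function_L2: "\<phi> \<in> test_functions \<Omega> \<Longrightarrow> \<Omega> \<in> sets lebesgue \<Longrightarrow> \<phi> \<in> Lq_space 2 \<Omega>"
proof -
  assume \<phi>: "\<phi> \<in> test_functions \<Omega>" and \<Omega>: "\<Omega> \<in> sets lebesgue"
  note \<phi>\<phi> = test_function_mult[OF \<phi> \<phi>]
  have "integrable lebesgue (\<lambda>x. \<phi> x * \<phi> x)"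
    using test_function_integrable[OF \<phi>\<phi>] by (rule integrable_completion[THEN iffD2, rotated]) (use test_function_measurable[OF \<phi>\<phi>] in simp)
  moreover have "(\<lambda>x. indicator \<Omega> x *\<^sub>R (\<phi> x * \<phi> x)) = (\<lambda>x. \<phi> x * \<phi> x)"
    using test_function_zero_outside[OF \<phi>] by (auto simp: indicator_def fun_eq_iff)
  ultimately have "integrable (lebesgue_on \<Omega>) (\<lambda>x. \<phi> x * \<phi> x)"
    using \<Omega> by (subst integrable_restrict_space) auto
  then show ?thesis using test_function_measurable_lebesgue_on[OF \<phi>] by (simp add: Lq_space_2 power2_eq_square)
qed

lemma test_function_weak_deriv:
  assumes \<phi>: "\<phi> \<in> test_functions \<Omega>" and i: "i \<in> Basis" and \<Omega>: "\<Omega> \<in> sets lebesgue"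
  shows "has_weak_deriv \<Omega> i \<phi> (\<lambda>x. frechet_derivative \<phi> (at x) i)"
  unfolding has_weak_deriv_def
  using L2_locally_integrable[OF test_function_L2[OF \<phi> \<Omega>] \<Omega>]
    L2_locally_integrable[OF test_function_L2[OF test_function_partial[OF \<phi> i] \<Omega>] \<Omega>]
    test_function_parts[OF \<phi> _ i \<Omega>] by blast

section \<open>Uniqueness of weak derivatives and their square integrability\<close>

lemma locally_integrable_diff:
  "locally_integrable \<Omega> f \<Longrightarrow> locally_integrable \<Omega> g \<Longrightarrow> locally_integrable \<Omega> (\<lambda>x. f x - g x)"
  by (auto simp: locally_integrable_def)

lemma has_weak_deriv_diff:
  assumes f: "has_weak_deriv \<Omega> i f f'" and g: "has_weak_deriv \<Omega> i g g'" and i: "i \<in> Basis" and \<Omega>: "\<Omega> \<in> sets lebesgue"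
  shows "has_weak_deriv \<Omega> i (\<lambda>x. f x - g x) (\<lambda>x. f' x - g' x)"
proof -
  have li: "locally_integrable \<Omega> f" "locally_integrable \<Omega> g" "locally_integrable \<Omega> f'" "locally_integrable \<Omega> g'"
    using f g by (auto simp: has_weak_deriv_def)
  have "(LINT x|lebesgue_on \<Omega>. (f x - g x) * frechet_derivative \<phi> (at x) i) =
      - (LINT x|lebesgue_on \<Omega>. (f' x - g' x) * \<phi> x)" if \<phi>: "\<phi> \<in> test_functions \<Omega>" for \<phi>
  proof -
    note \<phi>' = test_function_partial[OF \<phi> i]
    have "(LINT x|lebesgue_on \<Omega>. f x * frechet_derivative \<phi> (at x) i) = - (LINT x|lebesgue_on \<Omega>. f' x * \<phi> x)"
      "(LINT x|lebesgue_on \<Omega>. g x * frechet_derivative \<phi> (at x) i) = - (LINT x|lebesgue_on \<Omega>. g' x * \<phi> x)"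
      using f g \<phi> by (auto simp: has_weak_deriv_def)
    then show ?thesis
      using locally_integrable_mult_test[OF li(1) \<phi>' \<Omega>] locally_integrable_mult_test[OF li(2) \<phi>' \<Omega>]
        locally_integrable_mult_test[OF li(3) \<phi> \<Omega>] locally_integrable_mult_test[OF li(4) \<phi> \<Omega>]
      by (simp add: left_diff_distrib)
  qed
  then show ?thesis using li by (simp add: has_weak_deriv_def locally_integrable_diff)
qed

lemma has_weak_deriv_unique:
  assumes "open \<Omega>" and g: "has_weak_deriv \<Omega> i f g" and h: "has_weak_deriv \<Omega> i f h"
  shows "AE x in lebesgue_on \<Omega>. g x = h x"
proof -
  have \<Omega>: "\<Omega> \<in> sets lebesgue" using assms(1) by simp
  have li: "locally_integrable \<Omega> g" "locally_integrable \<Omega> h" using g h by (auto simp: has_weak_deriv_def)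
  have "AE x in lebesgue_on \<Omega>. g x - h x = 0"
  proof (rule AE_zero_if_bump_integrals_zero[OF assms(1)])
    fix n and a b :: 'a assume "(a, b) \<in> rat_boxes \<Omega>"
    then have sub: "cbox a b \<subseteq> \<Omega>" by (auto simp: rat_boxes_def)
    show "set_integrable lebesgue (cbox a b) (\<lambda>x. g x - h x)"
      using locally_integrable_diff[OF li] sub by (auto simp: locally_integrable_def)
    note \<phi> = bump_test_function[OF sub, of n]
    have "(LINT x|lebesgue_on \<Omega>. g x * bump n a b x) = (LINT x|lebesgue_on \<Omega>. h x * bump n a b x)"
      using g h \<phi> unfolding has_weak_deriv_def by (metis neg_equal_iff_equal)
    then show "(LINT x|lebesgue_on \<Omega>. (g x - h x) * bump n a b x) = 0"
      using locally_integrable_mult_test[OF li(1) \<phi> \<Omega>] locally_integrable_mult_test[OF li(2) \<phi> \<Omega>]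
      by (simp add: left_diff_distrib)
  qed
  then show ?thesis by eventually_elim simp
qed

text \<open>\<open>weak_deriv\<close> is an arbitrary choice, and \<open>H1\<close> only asserts
  that some weak derivative is square integrable; uniqueness up to null sets carries this property
  over to the chosen one.\<close>

lemma H1_weak_deriv:
  assumes "open \<Omega>" "f \<in> H1 \<Omega>" "i \<in> Basis"
  shows "has_weak_deriv \<Omega> i f (weak_deriv \<Omega> i f)" "weak_deriv \<Omega> i f \<in> Lq_space 2 \<Omega>"
proof -
  obtain g where g: "g \<in> Lq_space 2 \<Omega>" "has_weak_deriv \<Omega> i f g" using assms by (auto simp: H1_def)
  show *: "has_weak_deriv \<Omega> i f (weak_deriv \<Omega> i f)"
    unfolding weak_deriv_def by (rule someI[of "has_weak_deriv \<Omega> i f", OF g(2)])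
  have ae: "AE x in lebesgue_on \<Omega>. g x = weak_deriv \<Omega> i f x" by (rule has_weak_deriv_unique[OF assms(1) g(2) *])
  have m: "weak_deriv \<Omega> i f \<in> borel_measurable (lebesgue_on \<Omega>)"
    using * by (intro locally_integrable_measurable assms(1)) (simp add: has_weak_deriv_def)
  moreover have "integrable (lebesgue_on \<Omega>) (\<lambda>x. (weak_deriv \<Omega> i f x)\<^sup>2)"
    using g(1) ae m by (subst integrable_cong_AE[where g="\<lambda>x. (g x)\<^sup>2"]) (auto simp: Lq_space_2)
  ultimately show "weak_deriv \<Omega> i f \<in> Lq_space 2 \<Omega>" by (simp add: Lq_space_2)
qed

lemma grad_norm_sq:
  assumes "open \<Omega>" "f \<in> H1 \<Omega>"
  shows "(grad_norm \<Omega> f)\<^sup>2 = (\<Sum>i\<in>Basis. LINT x|lebesgue_on \<Omega>. (weak_deriv \<Omega> i f x)\<^sup>2)"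
  using H1_weak_deriv(2)[OF assms]
  by (simp add: grad_norm_def Lq_norm_2 sum_nonneg Lq_space_2)

lemma weak_deriv_eq:
  assumes "open \<Omega>" "has_weak_deriv \<Omega> i f g"
  shows "AE x in lebesgue_on \<Omega>. weak_deriv \<Omega> i f x = g x"
  using has_weak_deriv_unique[OF assms(1) _ assms(2)] someI[of "has_weak_deriv \<Omega> i f", OF assms(2)]
  by (simp add: weak_deriv_def)

lemma L2_diff: "f \<in> Lq_space 2 \<Omega> \<Longrightarrow> g \<in> Lq_space 2 \<Omega> \<Longrightarrow> (\<lambda>x. f x - g x) \<in> Lq_space 2 \<Omega>"
  by (auto simp: Lq_space_2 intro!: L2_diff_integrable)

text \<open>Splits convergence in the H1 norm into convergence of the function and of each partial
  derivative. The norm involves the chosen weak derivative of the difference, which is first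
  identified almost everywhere with the difference of the derivatives.\<close>

lemma H10_approximation:
  assumes \<Omega>: "open \<Omega>" and f: "f \<in> H10 \<Omega>"
  obtains \<phi> where "\<And>n::nat. \<phi> n \<in> test_functions \<Omega>"
    "(\<lambda>n. LINT x|lebesgue_on \<Omega>. (\<phi> n x - f x)\<^sup>2) \<longlonglongrightarrow> 0"
    "\<And>i. i \<in> Basis \<Longrightarrow> (\<lambda>n. LINT x|lebesgue_on \<Omega>. (frechet_derivative (\<phi> n) (at x) i - weak_deriv \<Omega> i f x)\<^sup>2) \<longlonglongrightarrow> 0"
proof -
  have f1: "f \<in> H1 \<Omega>" using f by (simp add: H10_def)
  have \<Omega>m: "\<Omega> \<in> sets lebesgue" using \<Omega> by simp
  obtain \<phi> where \<phi>: "\<And>n::nat. \<phi> n \<in> test_functions \<Omega>" and lim: "(\<lambda>n. H1_norm \<Omega> (\<lambda>x. \<phi> n x - f x)) \<longlonglongrightarrow> 0"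
    using f by (auto simp: H10_def)
  have lim2: "(\<lambda>n. (H1_norm \<Omega> (\<lambda>x. \<phi> n x - f x))\<^sup>2) \<longlonglongrightarrow> 0"
    using tendsto_power[OF lim, of 2] by simp
  let ?d = "\<lambda>n x. \<phi> n x - f x" and ?D = "\<lambda>i n x. frechet_derivative (\<phi> n) (at x) i - weak_deriv \<Omega> i f x"
  have wd: "has_weak_deriv \<Omega> i (?d n) (?D i n)" if "i \<in> Basis" for i n
    by (intro has_weak_deriv_diff test_function_weak_deriv[OF \<phi>] H1_weak_deriv(1)[OF \<Omega> f1] that \<Omega>m)
  have D2: "?D i n \<in> Lq_space 2 \<Omega>" if "i \<in> Basis" for i n
    by (intro L2_diff test_function_L2 test_function_partial \<phi> that \<Omega>m H1_weak_deriv(2)[OF \<Omega> f1])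
  have d1: "?d n \<in> H1 \<Omega>" for n
  proof -
    have "?d n \<in> Lq_space 2 \<Omega>" using L2_diff[OF test_function_L2[OF \<phi> \<Omega>m], of f] f1 by (simp add: H1_def)
    moreover have "\<exists>g\<in>Lq_space 2 \<Omega>. has_weak_deriv \<Omega> i (?d n) g" if "i \<in> Basis" for i
      using wd[OF that] D2[OF that] by blast
    ultimately show ?thesis by (simp add: H1_def)
  qed
  have sq: "(H1_norm \<Omega> (?d n))\<^sup>2 = (LINT x|lebesgue_on \<Omega>. (?d n x)\<^sup>2) + (\<Sum>i\<in>Basis. LINT x|lebesgue_on \<Omega>. (?D i n x)\<^sup>2)" for n
  proof -
    have "(LINT x|lebesgue_on \<Omega>. (weak_deriv \<Omega> i (?d n) x)\<^sup>2) = (LINT x|lebesgue_on \<Omega>. (?D i n x)\<^sup>2)" if "i \<in> Basis" for i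
    proof (rule integral_cong_AE)
      show "AE x in lebesgue_on \<Omega>. (weak_deriv \<Omega> i (?d n) x)\<^sup>2 = (?D i n x)\<^sup>2"
        using weak_deriv_eq[OF \<Omega> wd[OF that, of n]] by eventually_elim simp
    qed (use H1_weak_deriv(2)[OF \<Omega> d1 that] D2[OF that] in \<open>auto simp: Lq_space_2 simp del: power2_diff\<close>)
    then show ?thesis by (simp add: H1_norm_def grad_norm_sq[OF \<Omega> d1] Lq_norm_2_sq add_nonneg_nonneg sum_nonneg)
  qed
  have "(\<lambda>n. LINT x|lebesgue_on \<Omega>. (?d n x)\<^sup>2) \<longlonglongrightarrow> 0"
  proof (rule tendsto_sandwich[OF _ _ tendsto_const lim2])
    show "\<forall>\<^sub>F n in sequentially. (LINT x|lebesgue_on \<Omega>. (?d n x)\<^sup>2) \<le> (H1_norm \<Omega> (?d n))\<^sup>2"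
      unfolding sq by (simp add: sum_nonneg)
  qed simp
  moreover have "(\<lambda>n. LINT x|lebesgue_on \<Omega>. (?D i n x)\<^sup>2) \<longlonglongrightarrow> 0" if i: "i \<in> Basis" for i
  proof (rule tendsto_sandwich[OF _ _ tendsto_const lim2])
    show "\<forall>\<^sub>F n in sequentially. (LINT x|lebesgue_on \<Omega>. (?D i n x)\<^sup>2) \<le> (H1_norm \<Omega> (?d n))\<^sup>2"
    proof (intro always_eventually allI)
      fix n
      have "(LINT x|lebesgue_on \<Omega>. (?D i n x)\<^sup>2) \<le> (\<Sum>i\<in>Basis. LINT x|lebesgue_on \<Omega>. (?D i n x)\<^sup>2)"
        by (rule member_le_sum[OF i]) auto
      also have "\<dots> \<le> (H1_norm \<Omega> (?d n))\<^sup>2" unfolding sq by simp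
      finally show "(LINT x|lebesgue_on \<Omega>. (?D i n x)\<^sup>2) \<le> (H1_norm \<Omega> (?d n))\<^sup>2" .
    qed
  qed simp
  ultimately show thesis using that \<phi> by blast
qed

section \<open>The Laplacian and Green's formula\<close>

definition laplacian :: "'a::euclidean_space set \<Rightarrow> ('a \<Rightarrow> real) \<Rightarrow> 'a \<Rightarrow> real" where
  "laplacian \<Omega> f x = (\<Sum>i\<in>Basis. weak_deriv \<Omega> i (weak_deriv \<Omega> i f) x)"

lemma laplacian_L2:
  assumes "open \<Omega>" "f \<in> H2 \<Omega>"
  shows "laplacian \<Omega> f \<in> Lq_space 2 \<Omega>"
proof -
  have "(\<lambda>x. \<Sum>i\<in>I. weak_deriv \<Omega> i (weak_deriv \<Omega> i f) x) \<in> Lq_space 2 \<Omega>" if "finite I" "I \<subseteq> Basis" for I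
    using that
  proof (induction I rule: finite_induct)
    case (insert j I)
    let ?S = "\<lambda>x. \<Sum>i\<in>I. weak_deriv \<Omega> i (weak_deriv \<Omega> i f) x" and ?w = "weak_deriv \<Omega> j (weak_deriv \<Omega> j f)"
    have w: "?w \<in> Lq_space 2 \<Omega>" using H1_weak_deriv(2)[OF assms(1), of "weak_deriv \<Omega> j f" j] assms(2) insert by (auto simp: H2_def)
    \<comment> \<open>The new summand is added by subtracting its negative, so that
      \<open>L2_diff\<close> applies.\<close>
    then have A: "(\<lambda>x. 0 - ?w x) \<in> Lq_space 2 \<Omega>" by (simp add: Lq_space_2)
    have B: "?S \<in> Lq_space 2 \<Omega>" using insert by blast
    from L2_diff[OF B A] show ?case using insert by (simp add: add.commute)
  qed (simp add: Lq_space_2)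
  from this[of Basis] show ?thesis by (simp add: laplacian_def[abs_def])
qed

text \<open>If \<open>f\<close> is a test function this is the definition of the weak derivative of
  each partial derivative of \<open>g\<close>. Both sides are continuous in \<open>f\<close> for the
  H1 norm, so it extends to limits of test functions.\<close>

lemma Green_formula:
  assumes \<Omega>: "open \<Omega>" and f: "f \<in> H10 \<Omega>" and g: "g \<in> H2 \<Omega>"
  shows "(LINT x|lebesgue_on \<Omega>. f x * laplacian \<Omega> g x) =
    - (\<Sum>i\<in>Basis. LINT x|lebesgue_on \<Omega>. weak_deriv \<Omega> i f x * weak_deriv \<Omega> i g x)"
proof -
  have \<Omega>m: "\<Omega> \<in> sets lebesgue" using \<Omega> by simp
  have f1: "f \<in> H1 \<Omega>" using f by (simp add: H10_def)
  have f2: "f \<in> Lq_space 2 \<Omega>" using f1 by (simp add: H1_def)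
  have g1: "g \<in> H1 \<Omega>" and gi: "\<And>i. i \<in> Basis \<Longrightarrow> weak_deriv \<Omega> i g \<in> H1 \<Omega>" using g by (auto simp: H2_def)
  obtain \<phi> where \<phi>: "\<And>n::nat. \<phi> n \<in> test_functions \<Omega>"
    "(\<lambda>n. LINT x|lebesgue_on \<Omega>. (\<phi> n x - f x)\<^sup>2) \<longlonglongrightarrow> 0"
    "\<And>i. i \<in> Basis \<Longrightarrow> (\<lambda>n. LINT x|lebesgue_on \<Omega>. (frechet_derivative (\<phi> n) (at x) i - weak_deriv \<Omega> i f x)\<^sup>2) \<longlonglongrightarrow> 0"
    by (rule H10_approximation[OF \<Omega> f], rule that)
  have parts: "(LINT x|lebesgue_on \<Omega>. f x * weak_deriv \<Omega> i (weak_deriv \<Omega> i g) x) =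
      - (LINT x|lebesgue_on \<Omega>. weak_deriv \<Omega> i f x * weak_deriv \<Omega> i g x)"
    and wwi: "integrable (lebesgue_on \<Omega>) (\<lambda>x. f x * weak_deriv \<Omega> i (weak_deriv \<Omega> i g) x)" if i: "i \<in> Basis" for i
  proof -
    let ?w = "weak_deriv \<Omega> i g" and ?ww = "weak_deriv \<Omega> i (weak_deriv \<Omega> i g)"
    have w: "?w \<in> Lq_space 2 \<Omega>" "?ww \<in> Lq_space 2 \<Omega>" "weak_deriv \<Omega> i f \<in> Lq_space 2 \<Omega>"
      using H1_weak_deriv(2)[OF \<Omega>] g1 gi f1 i by auto
    show "integrable (lebesgue_on \<Omega>) (\<lambda>x. f x * ?ww x)"
      using w f2 by (intro L2_mult_integrable) (auto simp: Lq_space_2)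
    have t: "\<phi> n \<in> Lq_space 2 \<Omega>" "(\<lambda>x. frechet_derivative (\<phi> n) (at x) i) \<in> Lq_space 2 \<Omega>" for n
      by (intro test_function_L2 test_function_partial \<phi> i \<Omega>m)+
    have A: "(\<lambda>n. LINT x|lebesgue_on \<Omega>. \<phi> n x * ?ww x) \<longlonglongrightarrow> (LINT x|lebesgue_on \<Omega>. f x * ?ww x)"
      by (rule L2_limit_mult[OF _ _ _ _ _ _ \<phi>(2)]) (use w t f2 in \<open>auto simp: Lq_space_2\<close>)
    have B: "(\<lambda>n. LINT x|lebesgue_on \<Omega>. frechet_derivative (\<phi> n) (at x) i * ?w x) \<longlonglongrightarrow> (LINT x|lebesgue_on \<Omega>. weak_deriv \<Omega> i f x * ?w x)"
      by (rule L2_limit_mult[OF _ _ _ _ _ _ \<phi>(3)[OF i]]) (use w t f2 in \<open>auto simp: Lq_space_2\<close>)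
    have "(LINT x|lebesgue_on \<Omega>. \<phi> n x * ?ww x) = - (LINT x|lebesgue_on \<Omega>. frechet_derivative (\<phi> n) (at x) i * ?w x)" for n
      using H1_weak_deriv(1)[OF \<Omega> gi[OF i] i] \<phi>(1)[of n] by (simp add: has_weak_deriv_def mult.commute)
    then have "(\<lambda>n. LINT x|lebesgue_on \<Omega>. \<phi> n x * ?ww x) \<longlonglongrightarrow> - (LINT x|lebesgue_on \<Omega>. weak_deriv \<Omega> i f x * ?w x)"
      using tendsto_minus[OF B] by simp
    then show "(LINT x|lebesgue_on \<Omega>. f x * ?ww x) = - (LINT x|lebesgue_on \<Omega>. weak_deriv \<Omega> i f x * ?w x)"
      using A LIMSEQ_unique by blast
  qed
  have "(LINT x|lebesgue_on \<Omega>. f x * laplacian \<Omega> g x) = (\<Sum>i\<in>Basis. LINT x|lebesgue_on \<Omega>. f x * weak_deriv \<Omega> i (weak_deriv \<Omega> i g) x)"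
    using wwi by (simp add: laplacian_def sum_distrib_left)
  also have "\<dots> = - (\<Sum>i\<in>Basis. LINT x|lebesgue_on \<Omega>. weak_deriv \<Omega> i f x * weak_deriv \<Omega> i g x)"
    using parts by (simp add: sum_negf)
  finally show ?thesis .
qed

lemma laplacian_symmetric:
  assumes "open \<Omega>" "f \<in> H2 \<Omega> \<inter> H10 \<Omega>" "g \<in> H2 \<Omega> \<inter> H10 \<Omega>"
  shows "(LINT x|lebesgue_on \<Omega>. f x * laplacian \<Omega> g x) = (LINT x|lebesgue_on \<Omega>. g x * laplacian \<Omega> f x)"
  using Green_formula[of \<Omega> f g] Green_formula[of \<Omega> g f] assms by (simp add: mult.commute)

lemma laplacian_grad_norm:
  assumes "open \<Omega>" "f \<in> H2 \<Omega> \<inter> H10 \<Omega>"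
  shows "(LINT x|lebesgue_on \<Omega>. f x * laplacian \<Omega> f x) = - (grad_norm \<Omega> f)\<^sup>2"
  using Green_formula[of \<Omega> f f] assms grad_norm_sq[of \<Omega> f] by (simp add: power2_eq_square H10_def)

section \<open>Higher integrability\<close>

lemma smooth_derivative_expand:
  fixes \<phi> :: "'a::euclidean_space \<Rightarrow> real"
  assumes "smooth \<phi>"
  shows "frechet_derivative \<phi> (at x) h = (\<Sum>i\<in>Basis. (h \<bullet> i) * frechet_derivative \<phi> (at x) i)"
proof -
  have lin: "linear (frechet_derivative \<phi> (at x))"
    using smooth_has_derivative[OF assms] has_derivative_linear by blast
  have "frechet_derivative \<phi> (at x) h = frechet_derivative \<phi> (at x) (\<Sum>i\<in>Basis. (h \<bullet> i) *\<^sub>R i)"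
    by (simp add: euclidean_representation)
  then show ?thesis by (simp add: linear_sum[OF lin] linear_scale[OF lin])
qed

text \<open>The increment is the mean of the directional derivative over the segment. Jensen's
  inequality for the square, and then Cauchy-Schwarz over the coordinates, give the bound.\<close>

lemma smooth_increment_sq_le:
  fixes \<phi> :: "'a::euclidean_space \<Rightarrow> real"
  assumes \<phi>: "smooth \<phi>"
  shows "(\<phi> (x + h) - \<phi> x)\<^sup>2 \<le>
    (LBINT s:{0..1}. (norm h)\<^sup>2 * (\<Sum>i\<in>Basis. (frechet_derivative \<phi> (at (x + s *\<^sub>R h)) i)\<^sup>2))"
proof -
  let ?F = "\<lambda>s. \<phi> (x + s *\<^sub>R h)" and ?F' = "\<lambda>s. frechet_derivative \<phi> (at (x + s *\<^sub>R h)) h"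
  have pc: "continuous_on S (\<lambda>s. frechet_derivative \<phi> (at (x + s *\<^sub>R h)) i)" if "i \<in> Basis" for i and S :: "real set"
    by (rule continuous_on_compose2[OF smooth_continuous[OF smooth_partial[OF \<phi> that]]]) (auto intro!: continuous_intros)
  have F'c: "continuous_on S ?F'" for S :: "real set"
    unfolding smooth_derivative_expand[OF \<phi>, of _ h] by (intro continuous_intros pc)
  have gc: "continuous_on S (\<lambda>s. (norm h)\<^sup>2 * (\<Sum>i\<in>Basis. (frechet_derivative \<phi> (at (x + s *\<^sub>R h)) i)\<^sup>2))" for S :: "real set"
    by (intro continuous_intros pc)
  have der: "(?F has_vector_derivative ?F' s) (at s within S)" for s S
  proof -
    have "((\<lambda>t. x + t *\<^sub>R h) has_derivative (\<lambda>t. t *\<^sub>R h)) (at s within S)"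
      by (auto intro!: derivative_eq_intros)
    from has_derivative_compose[OF this smooth_has_derivative[OF \<phi>]]
    show ?thesis
      using linear_scale[OF has_derivative_linear[OF smooth_has_derivative[OF \<phi>]]]
      by (simp add: has_vector_derivative_def)
  qed
  define m where "m = \<phi> (x + h) - \<phi> x"
  have "(LBINT s:{0..1}. ?F' s) = ?F 1 - ?F 0"
    unfolding set_lebesgue_integral_def by (rule integral_FTC_atLeastAtMost[OF _ der F'c]) simp
  then have m: "(LBINT s:{0..1}. ?F' s) = m" by (simp add: m_def)
  have int: "set_integrable lborel {0..1} u" if "continuous_on {0..1} u" for u :: "real \<Rightarrow> real"
    by (rule borel_integrable_atLeastAtMost'[OF that])
  have one: "(LBINT s:{0..1::real}. c) = c" for c :: real
    by (simp add: set_integral_const)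
  \<comment> \<open>Nonnegativity of the variance along the segment; this is Jensen's inequality for
    the square.\<close>
  have "0 \<le> (LBINT s:{0..1}. (?F' s - m)\<^sup>2)" unfolding set_lebesgue_integral_def by (intro integral_nonneg_AE AE_I2) simp
  also have "\<dots> = (LBINT s:{0..1}. ((?F' s)\<^sup>2 - 2 * m * ?F' s) + m\<^sup>2)"
    by (simp add: power2_diff algebra_simps)
  also have "\<dots> = (LBINT s:{0..1}. (?F' s)\<^sup>2) - 2 * m * m + m\<^sup>2"
    by (subst set_integral_add set_integral_diff, (intro int continuous_intros F'c)+)+ (simp add: m one)
  finally have "m\<^sup>2 \<le> (LBINT s:{0..1}. (?F' s)\<^sup>2)" by (simp add: power2_eq_square)
  also have "\<dots> \<le> (LBINT s:{0..1}. (norm h)\<^sup>2 * (\<Sum>i\<in>Basis. (frechet_derivative \<phi> (at (x + s *\<^sub>R h)) i)\<^sup>2))"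
  proof (rule set_integral_mono)
    fix s :: real
    have "(?F' s)\<^sup>2 \<le> (\<Sum>i\<in>Basis. (h \<bullet> i)\<^sup>2) * (\<Sum>i\<in>Basis. (frechet_derivative \<phi> (at (x + s *\<^sub>R h)) i)\<^sup>2)"
      unfolding smooth_derivative_expand[OF \<phi>, of _ h] by (rule Cauchy_Schwarz_ineq_sum)
    also have "(\<Sum>i\<in>Basis. (h \<bullet> i)\<^sup>2) = (norm h)\<^sup>2"
      by (simp add: power2_norm_eq_inner euclidean_inner[of h h] power2_eq_square[symmetric])
    finally show "(?F' s)\<^sup>2 \<le> (norm h)\<^sup>2 * (\<Sum>i\<in>Basis. (frechet_derivative \<phi> (at (x + s *\<^sub>R h)) i)\<^sup>2)" .
  qed (intro int continuous_intros F'c pc gc)+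
  finally show ?thesis by (simp add: m_def)
qed

lemma nn_integral_lborel_translate:
  fixes g :: "'a::euclidean_space \<Rightarrow> ennreal"
  assumes "g \<in> borel_measurable borel"
  shows "(\<integral>\<^sup>+x. g (x + c) \<partial>lborel) = (\<integral>\<^sup>+x. g x \<partial>lborel)"
proof -
  have "(\<integral>\<^sup>+x. g x \<partial>distr lborel borel ((+) c)) = (\<integral>\<^sup>+x. g (c + x) \<partial>lborel)"
    using assms by (intro nn_integral_distr) auto
  then show ?thesis by (simp add: lborel_distr_plus add.commute)
qed

lemma nn_integral_set_integral_le:
  fixes f :: "real \<Rightarrow> real"
  assumes "set_integrable lborel S f" "\<And>s. s \<in> S \<Longrightarrow> 0 \<le> f s"
  shows "ennreal (LBINT s:S. f s) = (\<integral>\<^sup>+s. indicator S s * ennreal (f s) \<partial>lborel)"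
proof -
  have "(\<integral>\<^sup>+s. ennreal (indicator S s *\<^sub>R f s) \<partial>lborel) = ennreal (LBINT s:S. f s)"
    unfolding set_lebesgue_integral_def
    by (rule nn_integral_eq_integral) (use assms in \<open>auto simp: set_integrable_def indicator_def intro!: AE_I2\<close>)
  moreover have "ennreal (indicator S s *\<^sub>R f s) = indicator S s * ennreal (f s)" for s
    by (auto simp: indicator_def)
  ultimately show ?thesis by simp
qed

definition grad_sq :: "('a::euclidean_space \<Rightarrow> real) \<Rightarrow> 'a \<Rightarrow> real" where
  "grad_sq \<phi> x = (\<Sum>i\<in>Basis. (frechet_derivative \<phi> (at x) i)\<^sup>2)"

lemma grad_sq_nonneg: "0 \<le> grad_sq \<phi> x"
  by (simp add: grad_sq_def sum_nonneg)

lemma grad_sq_continuous: "smooth \<phi> \<Longrightarrow> continuous_on UNIV (grad_sq \<phi>)"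
  unfolding grad_sq_def[abs_def] by (intro continuous_intros smooth_continuous smooth_partial)

text \<open>The pointwise bound is integrated over x and the two integrals are exchanged; by
  translation invariance each point of the segment contributes the same gradient integral.
  Nonnegative integrals avoid all integrability questions.\<close>

lemma translation_estimate:
  fixes \<phi> :: "'a::euclidean_space \<Rightarrow> real"
  assumes \<phi>: "smooth \<phi>"
  shows "(\<integral>\<^sup>+x. ennreal ((\<phi> (x + h) - \<phi> x)\<^sup>2) \<partial>lborel) \<le> ennreal ((norm h)\<^sup>2) * (\<integral>\<^sup>+x. ennreal (grad_sq \<phi> x) \<partial>lborel)"
proof -
  have gm[measurable]: "grad_sq \<phi> \<in> borel_measurable borel"
    by (rule borel_measurable_continuous_onI[OF grad_sq_continuous[OF \<phi>]])
  have "ennreal ((\<phi> (x + h) - \<phi> x)\<^sup>2) \<le> (\<integral>\<^sup>+s. indicator {0..1} s * (ennreal ((norm h)\<^sup>2) * ennreal (grad_sq \<phi> (x + s *\<^sub>R h))) \<partial>lborel)" for x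
  proof -
    have "continuous_on {0..1} (\<lambda>s. (norm h)\<^sup>2 * grad_sq \<phi> (x + s *\<^sub>R h))"
      by (intro continuous_intros continuous_on_compose2[OF grad_sq_continuous[OF \<phi>]]) auto
    note int = borel_integrable_atLeastAtMost'[OF this]
    have "ennreal ((\<phi> (x + h) - \<phi> x)\<^sup>2) \<le> ennreal (LBINT s:{0..1}. (norm h)\<^sup>2 * grad_sq \<phi> (x + s *\<^sub>R h))"
      using smooth_increment_sq_le[OF \<phi>] by (intro ennreal_leI) (simp add: grad_sq_def)
    also have "\<dots> = (\<integral>\<^sup>+s. indicator {0..1} s * ennreal ((norm h)\<^sup>2 * grad_sq \<phi> (x + s *\<^sub>R h)) \<partial>lborel)"
      by (rule nn_integral_set_integral_le[OF int]) (simp add: grad_sq_nonneg)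
    finally show ?thesis by (simp add: ennreal_mult grad_sq_nonneg)
  qed
  then have "(\<integral>\<^sup>+x. ennreal ((\<phi> (x + h) - \<phi> x)\<^sup>2) \<partial>lborel) \<le>
      (\<integral>\<^sup>+x. (\<integral>\<^sup>+s. indicator {0..1} s * (ennreal ((norm h)\<^sup>2) * ennreal (grad_sq \<phi> (x + s *\<^sub>R h))) \<partial>lborel) \<partial>lborel)"
    by (intro nn_integral_mono)
  also have "\<dots> = (\<integral>\<^sup>+s. (\<integral>\<^sup>+x. indicator {0..1} s * (ennreal ((norm h)\<^sup>2) * ennreal (grad_sq \<phi> (x + s *\<^sub>R h))) \<partial>lborel) \<partial>lborel)"
    by (rule lborel_pair.Fubini'[symmetric]) measurable
  also have "\<dots> = (\<integral>\<^sup>+s. indicator {0..1::real} s * (ennreal ((norm h)\<^sup>2) * (\<integral>\<^sup>+x. ennreal (grad_sq \<phi> x) \<partial>lborel)) \<partial>lborel)"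
  proof (rule nn_integral_cong)
    fix s :: real
    have "(\<integral>\<^sup>+x. indicator {0..1} s * (ennreal ((norm h)\<^sup>2) * ennreal (grad_sq \<phi> (x + s *\<^sub>R h))) \<partial>lborel) =
        indicator {0..1} s * (ennreal ((norm h)\<^sup>2) * (\<integral>\<^sup>+x. ennreal (grad_sq \<phi> (x + s *\<^sub>R h)) \<partial>lborel))"
      by (simp add: nn_integral_cmult)
    then show "(\<integral>\<^sup>+x. indicator {0..1} s * (ennreal ((norm h)\<^sup>2) * ennreal (grad_sq \<phi> (x + s *\<^sub>R h))) \<partial>lborel) =
        indicator {0..1} s * (ennreal ((norm h)\<^sup>2) * (\<integral>\<^sup>+x. ennreal (grad_sq \<phi> x) \<partial>lborel))"
      by (simp add: nn_integral_lborel_translate[of "\<lambda>x. ennreal (grad_sq \<phi> x)"])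
  qed
  also have "\<dots> = ennreal ((norm h)\<^sup>2) * (\<integral>\<^sup>+x. ennreal (grad_sq \<phi> x) \<partial>lborel)"
    by (simp add: nn_integral_multc)
  finally show ?thesis .
qed

section \<open>A weak-type bound for large values\<close>

lemma nn_integral_lborel_affine:
  fixes f :: "'a::euclidean_space \<Rightarrow> ennreal"
  assumes [measurable]: "f \<in> borel_measurable borel" and "\<epsilon> > 0"
  shows "(\<integral>\<^sup>+x. f x \<partial>lborel) = ennreal (\<epsilon> ^ DIM('a)) * (\<integral>\<^sup>+y. f (x + \<epsilon> *\<^sub>R y) \<partial>lborel)"
  using \<open>\<epsilon> > 0\<close>
  by (subst lborel_affine[of \<epsilon> x]) (simp_all add: nn_integral_density nn_integral_distr nn_integral_cmult)

lemma norm_unit_cube_le: "y \<in> cbox 0 (One::'a::euclidean_space) \<Longrightarrow> norm y \<le> DIM('a)"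
proof -
  assume y: "y \<in> cbox 0 (One::'a)"
  have "norm y \<le> (\<Sum>i\<in>Basis. \<bar>y \<bullet> i\<bar>)" by (rule norm_le_l1)
  also have "\<dots> \<le> (\<Sum>i\<in>(Basis::'a set). 1)" by (intro sum_mono) (use y in \<open>auto simp: mem_box\<close>)
  finally show ?thesis by simp
qed

text \<open>Where \<open>\<bar>\<phi> x\<bar> > 2 * l\<close>, the mean of \<open>\<phi>\<close> over a cube of side \<open>\<epsilon>\<close> at \<open>x\<close> is small
  compared with \<open>\<phi> x\<close>, so \<open>\<phi>\<close> must vary there, which costs gradient.\<close>

lemma test_function_weak_type:
  fixes \<phi> :: "'a::euclidean_space \<Rightarrow> real"
  assumes \<phi>: "smooth \<phi>" and l: "l > 0" and \<epsilon>: "\<epsilon> > 0"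
    and small: "(\<integral>\<^sup>+x. ennreal ((\<phi> x)\<^sup>2) \<partial>lborel) \<le> ennreal (\<epsilon> ^ DIM('a) * l\<^sup>2)"
  shows "ennreal (l\<^sup>2) * emeasure lborel {x. 2 * l < \<bar>\<phi> x\<bar>} \<le>
    ennreal ((\<epsilon> * DIM('a))\<^sup>2) * (\<integral>\<^sup>+x. ennreal (grad_sq \<phi> x) \<partial>lborel)"
proof -
  let ?Y = "cbox 0 One :: 'a set"
  let ?G = "\<integral>\<^sup>+x. ennreal (grad_sq \<phi> x) \<partial>lborel"
  have \<phi>m[measurable]: "\<phi> \<in> borel_measurable borel"
    by (rule borel_measurable_continuous_onI[OF smooth_continuous[OF \<phi>]])
  have Y1: "emeasure lborel ?Y = 1" by (simp add: emeasure_lborel_cbox)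
  let ?d = "\<lambda>x y. ennreal ((\<phi> (x + \<epsilon> *\<^sub>R y) - \<phi> x)\<^sup>2)"
  have point: "ennreal (l\<^sup>2) * indicator {x. 2 * l < \<bar>\<phi> x\<bar>} x \<le> (\<integral>\<^sup>+y. indicator ?Y y * ?d x y \<partial>lborel)" for x
  proof (cases "2 * l < \<bar>\<phi> x\<bar>")
    case True
    \<comment> \<open>After rescaling by \<epsilon>, \<open>small\<close> bounds the mean square
      near any point by l^2, a quarter of the value (2 l)^2 that (\<phi> x)^2 exceeds.\<close>
    have mean: "(\<integral>\<^sup>+y. ennreal ((\<phi> (x + \<epsilon> *\<^sub>R y))\<^sup>2) \<partial>lborel) \<le> ennreal (l\<^sup>2)"
    proof -
      have "ennreal (\<epsilon> ^ DIM('a)) * (\<integral>\<^sup>+y. ennreal ((\<phi> (x + \<epsilon> *\<^sub>R y))\<^sup>2) \<partial>lborel) \<le> ennreal (\<epsilon> ^ DIM('a)) * ennreal (l\<^sup>2)"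
        using small nn_integral_lborel_affine[of "\<lambda>x. ennreal ((\<phi> x)\<^sup>2)" \<epsilon> x] \<epsilon> by (simp add: ennreal_mult)
      moreover have "0 < ennreal (\<epsilon> ^ DIM('a))" "ennreal (\<epsilon> ^ DIM('a)) < top" using \<epsilon> by auto
      ultimately show ?thesis using ennreal_mult_le_mult_iff[of "ennreal (\<epsilon> ^ DIM('a))"] by auto
    qed
    have "(2 * l)\<^sup>2 \<le> (\<phi> x)\<^sup>2"
      using True l by (intro abs_le_square_iff[THEN iffD1]) simp
    \<comment> \<open>With a = \<phi> x and b the shifted value, 2 b^2 + 2 (b - a)^2 - a^2 is the
      square of 2 b - a. After averaging over y, the first term accounts for at most half of 4
      l^2.\<close>
    have pw: "4 * l\<^sup>2 \<le> 2 * (\<phi> (x + \<epsilon> *\<^sub>R y))\<^sup>2 + 2 * (\<phi> (x + \<epsilon> *\<^sub>R y) - \<phi> x)\<^sup>2" for y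
    proof -
      let ?b = "\<phi> (x + \<epsilon> *\<^sub>R y)"
      have "2 * ?b\<^sup>2 + 2 * (?b - \<phi> x)\<^sup>2 - (\<phi> x)\<^sup>2 = (2 * ?b - \<phi> x)\<^sup>2"
        by (simp add: power2_eq_square algebra_simps)
      moreover have "(2 * l)\<^sup>2 = 4 * l\<^sup>2" by (simp add: power_mult_distrib)
      ultimately show ?thesis using \<open>(2 * l)\<^sup>2 \<le> (\<phi> x)\<^sup>2\<close> zero_le_power2[of "2 * ?b - \<phi> x"]
        by linarith
    qed
    have "ennreal (4 * l\<^sup>2) = (\<integral>\<^sup>+y. indicator ?Y y * ennreal (4 * l\<^sup>2) \<partial>lborel)"
      using Y1 by (simp add: nn_integral_multc)
    also have "\<dots> \<le> (\<integral>\<^sup>+y. 2 * ennreal ((\<phi> (x + \<epsilon> *\<^sub>R y))\<^sup>2) + 2 * (indicator ?Y y * ?d x y) \<partial>lborel)"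
    proof (rule nn_integral_mono)
      fix y :: 'a
      have "ennreal (4 * l\<^sup>2) \<le> ennreal (2 * (\<phi> (x + \<epsilon> *\<^sub>R y))\<^sup>2 + 2 * (\<phi> (x + \<epsilon> *\<^sub>R y) - \<phi> x)\<^sup>2)"
        by (rule ennreal_leI[OF pw])
      also have "\<dots> = 2 * ennreal ((\<phi> (x + \<epsilon> *\<^sub>R y))\<^sup>2) + 2 * ?d x y"
        by (simp add: ennreal_plus ennreal_mult)
      finally show "indicator ?Y y * ennreal (4 * l\<^sup>2) \<le> 2 * ennreal ((\<phi> (x + \<epsilon> *\<^sub>R y))\<^sup>2) + 2 * (indicator ?Y y * ?d x y)"
        by (cases "y \<in> ?Y") auto
    qed
    also have "\<dots> = 2 * (\<integral>\<^sup>+y. ennreal ((\<phi> (x + \<epsilon> *\<^sub>R y))\<^sup>2) \<partial>lborel) + 2 * (\<integral>\<^sup>+y. indicator ?Y y * ?d x y \<partial>lborel)"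
      by (simp add: nn_integral_add nn_integral_cmult)
    also have "\<dots> \<le> 2 * ennreal (l\<^sup>2) + 2 * (\<integral>\<^sup>+y. indicator ?Y y * ?d x y \<partial>lborel)"
      by (intro add_right_mono mult_left_mono mean) simp
    finally have le: "ennreal (4 * l\<^sup>2) \<le> 2 * ennreal (l\<^sup>2) + 2 * (\<integral>\<^sup>+y. indicator ?Y y * ?d x y \<partial>lborel)" .
    have "ennreal (l\<^sup>2) \<le> (\<integral>\<^sup>+y. indicator ?Y y * ?d x y \<partial>lborel)"
    proof (cases "(\<integral>\<^sup>+y. indicator ?Y y * ?d x y \<partial>lborel)")
      case (real I)
      have "2 * ennreal (l\<^sup>2) + 2 * ennreal I = ennreal (2 * l\<^sup>2 + 2 * I)"
        using real(1) by (simp add: ennreal_plus ennreal_mult)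
      then have "ennreal (4 * l\<^sup>2) \<le> ennreal (2 * l\<^sup>2 + 2 * I)" using le unfolding real(2) by simp
      then have "4 * l\<^sup>2 \<le> 2 * l\<^sup>2 + 2 * I" using real(1) by (subst (asm) ennreal_le_iff) auto
      then show ?thesis unfolding real(2) by (intro ennreal_leI) simp
    qed simp
    then show ?thesis using True by simp
  qed simp
  have "ennreal (l\<^sup>2) * emeasure lborel {x. 2 * l < \<bar>\<phi> x\<bar>} = (\<integral>\<^sup>+x. ennreal (l\<^sup>2) * indicator {x. 2 * l < \<bar>\<phi> x\<bar>} x \<partial>lborel)"
    by (simp add: nn_integral_cmult)
  also have "\<dots> \<le> (\<integral>\<^sup>+x. (\<integral>\<^sup>+y. indicator ?Y y * ?d x y \<partial>lborel) \<partial>lborel)"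
    by (intro nn_integral_mono point)
  also have "\<dots> = (\<integral>\<^sup>+y. (\<integral>\<^sup>+x. indicator ?Y y * ?d x y \<partial>lborel) \<partial>lborel)"
    by (rule lborel_pair.Fubini'[symmetric]) measurable
  also have "\<dots> \<le> (\<integral>\<^sup>+y. indicator ?Y y * (ennreal ((\<epsilon> * DIM('a))\<^sup>2) * ?G) \<partial>lborel)"
  proof (rule nn_integral_mono)
    fix y :: 'a
    show "(\<integral>\<^sup>+x. indicator ?Y y * ?d x y \<partial>lborel) \<le> indicator ?Y y * (ennreal ((\<epsilon> * DIM('a))\<^sup>2) * ?G)"
    proof (cases "y \<in> ?Y")
      case True
      have "(\<integral>\<^sup>+x. ?d x y \<partial>lborel) \<le> ennreal ((norm (\<epsilon> *\<^sub>R y))\<^sup>2) * ?G"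
        by (rule translation_estimate[OF \<phi>])
      also have "\<dots> \<le> ennreal ((\<epsilon> * DIM('a))\<^sup>2) * ?G"
        using norm_unit_cube_le[OF True] \<epsilon> by (intro mult_right_mono ennreal_leI power_mono) auto
      finally show ?thesis using True by simp
    qed simp
  qed
  also have "\<dots> = ennreal ((\<epsilon> * DIM('a))\<^sup>2) * ?G"
    using Y1 by (simp add: nn_integral_multc)
  finally show ?thesis .
qed

lemma L2_norm_limit:
  fixes f :: "'a \<Rightarrow> real"
  assumes fn: "\<And>n. fn n \<in> borel_measurable M" "\<And>n. integrable M (\<lambda>x. (fn n x)\<^sup>2)"
    and f: "f \<in> borel_measurable M" "integrable M (\<lambda>x. (f x)\<^sup>2)"
    and lim: "((\<lambda>n. LINT x|M. (fn n x - f x)\<^sup>2) \<longlongrightarrow> 0) F"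
  shows "((\<lambda>n. LINT x|M. (fn n x)\<^sup>2) \<longlongrightarrow> (LINT x|M. (f x)\<^sup>2)) F"
proof -
  have eq: "(LINT x|M. (fn n x)\<^sup>2) = (LINT x|M. (fn n x - f x)\<^sup>2) + 2 * (LINT x|M. fn n x * f x) - (LINT x|M. (f x)\<^sup>2)" for n
  proof -
    have "(LINT x|M. (fn n x - f x)\<^sup>2) = (LINT x|M. (fn n x)\<^sup>2 + (f x)\<^sup>2 - 2 * (fn n x * f x))"
      by (simp add: power2_diff mult.assoc)
    also have "\<dots> = (LINT x|M. (fn n x)\<^sup>2) + (LINT x|M. (f x)\<^sup>2) - 2 * (LINT x|M. fn n x * f x)"
      using fn f L2_mult_integrable[OF fn(1) f(1) fn(2) f(2)] by simp
    finally show ?thesis by simp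
  qed
  have "((\<lambda>n. (LINT x|M. (fn n x - f x)\<^sup>2) + 2 * (LINT x|M. fn n x * f x) - (LINT x|M. (f x)\<^sup>2)) \<longlongrightarrow>
      0 + 2 * (LINT x|M. f x * f x) - (LINT x|M. (f x)\<^sup>2)) F"
    by (intro tendsto_intros lim L2_limit_mult fn f)
  then show ?thesis unfolding eq by (simp add: power2_eq_square)
qed

lemma nn_integral_test_function_sq:
  fixes \<phi> :: "'a::euclidean_space \<Rightarrow> real"
  assumes \<phi>: "\<phi> \<in> test_functions \<Omega>" and \<Omega>: "\<Omega> \<in> sets lebesgue"
  shows "(\<integral>\<^sup>+x. ennreal ((\<phi> x)\<^sup>2) \<partial>lborel) = ennreal (LINT x|lebesgue_on \<Omega>. (\<phi> x)\<^sup>2)"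
proof -
  note \<phi>\<phi> = test_function_mult[OF \<phi> \<phi>]
  have "(LINT x|lebesgue_on \<Omega>. (\<phi> x)\<^sup>2) = (LINT x|lborel. (\<phi> x)\<^sup>2)"
    using lebesgue_on_integral_eq_lborel[OF \<Omega> _ test_function_measurable[OF \<phi>\<phi>]] test_function_zero_outside[OF \<phi>\<phi>]
    by (simp add: power2_eq_square)
  then show ?thesis
    using test_function_integrable[OF \<phi>\<phi>] by (subst nn_integral_eq_integral) (auto simp: power2_eq_square)
qed

lemma test_function_weak_type_measure:
  fixes \<phi> :: "'a::euclidean_space \<Rightarrow> real"
  assumes \<phi>: "\<phi> \<in> test_functions \<Omega>" and \<Omega>: "\<Omega> \<in> lmeasurable" and l: "l > 0" and \<epsilon>: "\<epsilon> > 0"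
    and small: "(LINT x|lebesgue_on \<Omega>. (\<phi> x)\<^sup>2) \<le> \<epsilon> ^ DIM('a) * l\<^sup>2"
  shows "measure (lebesgue_on \<Omega>) {x\<in>\<Omega>. 2 * l < \<bar>\<phi> x\<bar>} \<le>
    (\<epsilon> * DIM('a))\<^sup>2 * (\<Sum>i\<in>Basis. LINT x|lebesgue_on \<Omega>. (frechet_derivative \<phi> (at x) i)\<^sup>2) / l\<^sup>2"
proof -
  have \<Omega>s: "\<Omega> \<in> sets lebesgue" using \<Omega> by (rule fmeasurableD)
  let ?G = "\<Sum>i\<in>Basis. LINT x|lebesgue_on \<Omega>. (frechet_derivative \<phi> (at x) i)\<^sup>2"
  have sm: "smooth \<phi>" by (rule test_function_smooth[OF \<phi>])
  have \<phi>m[measurable]: "\<phi> \<in> borel_measurable borel" by (rule test_function_measurable[OF \<phi>])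
  have G: "(\<integral>\<^sup>+x. ennreal (grad_sq \<phi> x) \<partial>lborel) = ennreal ?G"
  proof -
    have "(\<integral>\<^sup>+x. ennreal (grad_sq \<phi> x) \<partial>lborel) = (\<integral>\<^sup>+x. (\<Sum>i\<in>Basis. ennreal ((frechet_derivative \<phi> (at x) i)\<^sup>2)) \<partial>lborel)"
      by (simp add: grad_sq_def sum_ennreal)
    also have "\<dots> = (\<Sum>i\<in>Basis. \<integral>\<^sup>+x. ennreal ((frechet_derivative \<phi> (at x) i)\<^sup>2) \<partial>lborel)"
      using test_function_measurable[OF test_function_partial[OF \<phi>]] by (intro nn_integral_sum) auto
    also have "\<dots> = (\<Sum>i\<in>Basis. ennreal (LINT x|lebesgue_on \<Omega>. (frechet_derivative \<phi> (at x) i)\<^sup>2))"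
      by (intro sum.cong refl nn_integral_test_function_sq test_function_partial \<phi> \<Omega>s)
    finally show ?thesis by (simp add: sum_ennreal)
  qed
  have G0: "?G \<ge> 0" by (intro sum_nonneg) simp
  have "ennreal (l\<^sup>2) * emeasure lborel {x. 2 * l < \<bar>\<phi> x\<bar>} \<le> ennreal ((\<epsilon> * DIM('a))\<^sup>2) * ennreal ?G"
    using test_function_weak_type[OF sm l \<epsilon>] small nn_integral_test_function_sq[OF \<phi> \<Omega>s] unfolding G
    by (simp add: ennreal_leI)
  moreover have "emeasure lborel {x. 2 * l < \<bar>\<phi> x\<bar>} = ennreal (measure (lebesgue_on \<Omega>) {x\<in>\<Omega>. 2 * l < \<bar>\<phi> x\<bar>})"
  proof -
    have eq: "{x. 2 * l < \<bar>\<phi> x\<bar>} = {x\<in>\<Omega>. 2 * l < \<bar>\<phi> x\<bar>}"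
      using test_function_zero_outside[OF \<phi>] l by force
    have m: "{x. 2 * l < \<bar>\<phi> x\<bar>} \<in> sets borel" by measurable
    have "emeasure lborel {x. 2 * l < \<bar>\<phi> x\<bar>} = emeasure lebesgue {x\<in>\<Omega>. 2 * l < \<bar>\<phi> x\<bar>}"
      using m eq by simp
    also have "\<dots> = emeasure (lebesgue_on \<Omega>) {x\<in>\<Omega>. 2 * l < \<bar>\<phi> x\<bar>}"
      using \<Omega>s by (intro emeasure_restrict_space[symmetric]) auto
    also have "\<dots> = ennreal (measure (lebesgue_on \<Omega>) {x\<in>\<Omega>. 2 * l < \<bar>\<phi> x\<bar>})"
      by (rule finite_measure.emeasure_eq_measure[OF finite_measure_lebesgue_on[OF \<Omega>]])
    finally show ?thesis .
  qed
  ultimately have "ennreal (l\<^sup>2 * measure (lebesgue_on \<Omega>) {x\<in>\<Omega>. 2 * l < \<bar>\<phi> x\<bar>}) \<le> ennreal ((\<epsilon> * DIM('a))\<^sup>2 * ?G)"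
    using G0 by (simp add: ennreal_mult)
  then have "l\<^sup>2 * measure (lebesgue_on \<Omega>) {x\<in>\<Omega>. 2 * l < \<bar>\<phi> x\<bar>} \<le> (\<epsilon> * DIM('a))\<^sup>2 * ?G"
    using G0 by (subst (asm) ennreal_le_iff) auto
  then show ?thesis using l by (simp add: field_simps)
qed

text \<open>Where \<open>\<bar>f\<bar>\<close> exceeds 3 l, either an approximating test function
  exceeds 2 l or it differs from \<open>f\<close> by at least l. Chebyshev's inequality makes the
  second set negligible in the limit; strictness in \<open>small\<close> lets the hypothesis pass to
  the approximations.\<close>

lemma H10_weak_type:
  fixes f :: "'a::euclidean_space \<Rightarrow> real"
  assumes \<Omega>: "open \<Omega>" "bounded \<Omega>" and f: "f \<in> H10 \<Omega>" and l: "l > 0" and \<epsilon>: "\<epsilon> > 0"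
    and small: "(LINT x|lebesgue_on \<Omega>. (f x)\<^sup>2) < \<epsilon> ^ DIM('a) * l\<^sup>2"
  shows "measure (lebesgue_on \<Omega>) {x\<in>\<Omega>. 3 * l < \<bar>f x\<bar>} \<le> (\<epsilon> * DIM('a))\<^sup>2 * (grad_norm \<Omega> f)\<^sup>2 / l\<^sup>2"
proof -
  let ?M = "lebesgue_on \<Omega>"
  have \<Omega>l: "\<Omega> \<in> lmeasurable" using \<Omega> by (intro bounded_set_imp_lmeasurable) auto
  have \<Omega>s: "\<Omega> \<in> sets lebesgue" using \<Omega> by simp
  interpret finite_measure ?M by (rule finite_measure_lebesgue_on[OF \<Omega>l])
  have f1: "f \<in> H1 \<Omega>" using f by (simp add: H10_def)
  have f2: "f \<in> Lq_space 2 \<Omega>" using f1 by (simp add: H1_def)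
  have fm[measurable]: "f \<in> borel_measurable ?M" using f2 by (simp add: Lq_space_2)
  obtain \<phi> where \<phi>: "\<And>n::nat. \<phi> n \<in> test_functions \<Omega>"
    "(\<lambda>n. LINT x|?M. (\<phi> n x - f x)\<^sup>2) \<longlonglongrightarrow> 0"
    "\<And>i. i \<in> Basis \<Longrightarrow> (\<lambda>n. LINT x|?M. (frechet_derivative (\<phi> n) (at x) i - weak_deriv \<Omega> i f x)\<^sup>2) \<longlonglongrightarrow> 0"
    by (rule H10_approximation[OF \<Omega>(1) f], rule that)
  have t: "\<phi> n \<in> Lq_space 2 \<Omega>" for n by (intro test_function_L2 \<phi> \<Omega>s)
  have tm[measurable]: "\<phi> n \<in> borel_measurable ?M" for n using t by (simp add: Lq_space_2)
  have dt: "(\<lambda>x. frechet_derivative (\<phi> n) (at x) i) \<in> Lq_space 2 \<Omega>" if "i \<in> Basis" for n i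
    by (intro test_function_L2 test_function_partial \<phi> that \<Omega>s)
  let ?G = "\<lambda>n. \<Sum>i\<in>Basis. LINT x|?M. (frechet_derivative (\<phi> n) (at x) i)\<^sup>2"
  have "(\<lambda>n. LINT x|?M. (\<phi> n x)\<^sup>2) \<longlonglongrightarrow> (LINT x|?M. (f x)\<^sup>2)"
    by (rule L2_norm_limit[OF _ _ _ _ \<phi>(2)]) (use t f2 in \<open>auto simp: Lq_space_2\<close>)
  then have ev: "\<forall>\<^sub>F n in sequentially. (LINT x|?M. (\<phi> n x)\<^sup>2) < \<epsilon> ^ DIM('a) * l\<^sup>2"
    using small by (rule order_tendstoD(2))
  have limG: "?G \<longlonglongrightarrow> (grad_norm \<Omega> f)\<^sup>2"
    unfolding grad_norm_sq[OF \<Omega>(1) f1]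
  proof (rule tendsto_sum)
    fix i :: 'a assume i: "i \<in> Basis"
    show "(\<lambda>n. LINT x|?M. (frechet_derivative (\<phi> n) (at x) i)\<^sup>2) \<longlonglongrightarrow> (LINT x|?M. (weak_deriv \<Omega> i f x)\<^sup>2)"
      by (rule L2_norm_limit[OF _ _ _ _ \<phi>(3)[OF i]])
         (use dt[OF i] H1_weak_deriv(2)[OF \<Omega>(1) f1 i] in \<open>auto simp: Lq_space_2\<close>)
  qed
  have bound: "measure ?M {x\<in>\<Omega>. 3 * l < \<bar>f x\<bar>} \<le>
      (\<epsilon> * DIM('a))\<^sup>2 * ?G n / l\<^sup>2 + (LINT x|?M. (\<phi> n x - f x)\<^sup>2) / l\<^sup>2"
    if n: "(LINT x|?M. (\<phi> n x)\<^sup>2) < \<epsilon> ^ DIM('a) * l\<^sup>2" for n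
  proof -
    have sp: "space ?M = \<Omega>" by simp
    have m1: "{x\<in>\<Omega>. 2 * l < \<bar>\<phi> n x\<bar>} \<in> sets ?M"
      using measurable_sets_Collect[of "\<lambda>x. \<bar>\<phi> n x\<bar>" ?M borel "\<lambda>y. 2 * l < y"] by (simp add: sp)
    have m2: "{x\<in>space ?M. l\<^sup>2 \<le> (\<phi> n x - f x)\<^sup>2} \<in> sets ?M" by measurable
    have "{x\<in>\<Omega>. 3 * l < \<bar>f x\<bar>} \<subseteq> {x\<in>\<Omega>. 2 * l < \<bar>\<phi> n x\<bar>} \<union> {x\<in>space ?M. l\<^sup>2 \<le> (\<phi> n x - f x)\<^sup>2}"
    proof
      fix x assume x: "x \<in> {x\<in>\<Omega>. 3 * l < \<bar>f x\<bar>}"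
      show "x \<in> {x\<in>\<Omega>. 2 * l < \<bar>\<phi> n x\<bar>} \<union> {x\<in>space ?M. l\<^sup>2 \<le> (\<phi> n x - f x)\<^sup>2}"
      proof (cases "2 * l < \<bar>\<phi> n x\<bar>")
        case False
        then have "\<bar>l\<bar> \<le> \<bar>\<phi> n x - f x\<bar>" using x l by auto
        then have "l\<^sup>2 \<le> (\<phi> n x - f x)\<^sup>2" by (simp only: abs_le_square_iff)
        then show ?thesis using x by simp
      qed (use x in simp)
    qed
    then have "measure ?M {x\<in>\<Omega>. 3 * l < \<bar>f x\<bar>} \<le>
        measure ?M ({x\<in>\<Omega>. 2 * l < \<bar>\<phi> n x\<bar>} \<union> {x\<in>space ?M. l\<^sup>2 \<le> (\<phi> n x - f x)\<^sup>2})"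
      using m1 m2 by (intro finite_measure_mono) auto
    also have "\<dots> \<le> measure ?M {x\<in>\<Omega>. 2 * l < \<bar>\<phi> n x\<bar>} + measure ?M {x\<in>space ?M. l\<^sup>2 \<le> (\<phi> n x - f x)\<^sup>2}"
      using m1 m2 by (rule measure_subadditive) (simp_all add: emeasure_eq_measure)
    also have "measure ?M {x\<in>\<Omega>. 2 * l < \<bar>\<phi> n x\<bar>} \<le> (\<epsilon> * DIM('a))\<^sup>2 * ?G n / l\<^sup>2"
      by (rule test_function_weak_type_measure[OF \<phi>(1) \<Omega>l l \<epsilon>]) (use n in simp)
    also have "measure ?M {x\<in>space ?M. l\<^sup>2 \<le> (\<phi> n x - f x)\<^sup>2} \<le> (LINT x|?M. (\<phi> n x - f x)\<^sup>2) / l\<^sup>2"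
      by (rule integral_Markov_inequality_measure[where A="{}"])
         (use l t f2 in \<open>auto simp: Lq_space_2 intro!: L2_diff_integrable\<close>)
    finally show ?thesis by simp
  qed
  have "(\<lambda>n. (\<epsilon> * DIM('a))\<^sup>2 * ?G n / l\<^sup>2 + (LINT x|?M. (\<phi> n x - f x)\<^sup>2) / l\<^sup>2) \<longlonglongrightarrow>
      (\<epsilon> * DIM('a))\<^sup>2 * (grad_norm \<Omega> f)\<^sup>2 / l\<^sup>2 + 0 / l\<^sup>2"
    by (intro tendsto_intros limG \<phi>(2)) (use l in auto)
  then have "measure ?M {x\<in>\<Omega>. 3 * l < \<bar>f x\<bar>} \<le> (\<epsilon> * DIM('a))\<^sup>2 * (grad_norm \<Omega> f)\<^sup>2 / l\<^sup>2 + 0 / l\<^sup>2"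
  proof (rule tendsto_lowerbound)
    show "\<forall>\<^sub>F n in sequentially. measure ?M {x\<in>\<Omega>. 3 * l < \<bar>f x\<bar>} \<le>
        (\<epsilon> * DIM('a))\<^sup>2 * ?G n / l\<^sup>2 + (LINT x|?M. (\<phi> n x - f x)\<^sup>2) / l\<^sup>2"
      using ev by eventually_elim (rule bound)
  qed simp
  then show ?thesis by simp
qed

section \<open>From the weak-type bound to an integral bound\<close>

text \<open>A discrete layer-cake bound: for y > 3 the single term with 3 * 2^k < y and y at most 3
  * 2^(k+1) already dominates y^q.\<close>

lemma dyadic_powr_bound:
  assumes "q > 0" "0 \<le> y"
  shows "ennreal (y powr q) \<le> ennreal (3 powr q) + (\<Sum>k. ennreal ((3 * 2 ^ Suc k) powr q) * indicator {3 * 2 ^ k<..} (y::real))"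
proof (cases "y \<le> 3")
  case True
  then have "ennreal (y powr q) \<le> ennreal (3 powr q)" using assms by (intro ennreal_leI powr_mono2) auto
  then show ?thesis by (rule order_trans) simp
next
  case False
  define m where "m = (LEAST m. y \<le> 3 * 2 ^ m)"
  obtain m0 where "y / 3 < 2 ^ m0" using real_arch_pow[of 2 "y/3"] by auto
  then have ex: "y \<le> 3 * 2 ^ m0" by simp
  have m: "y \<le> 3 * 2 ^ m" unfolding m_def by (rule LeastI[of "\<lambda>m. y \<le> 3 * 2 ^ m", OF ex])
  have "m \<noteq> 0"
  proof
    assume "m = 0"
    then show False using m False by simp
  qed
  then obtain k where k: "m = Suc k" using not0_implies_Suc by blast
  have "\<not> y \<le> 3 * 2 ^ k" unfolding m_def[symmetric] using not_less_Least[of k "\<lambda>m. y \<le> 3 * 2 ^ m"] k m_def by auto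
  then have "ennreal (y powr q) \<le> ennreal ((3 * 2 ^ Suc k) powr q) * indicator {3 * 2 ^ k<..} y"
    using m k False assms by (auto intro!: ennreal_leI powr_mono2)
  also have "\<dots> \<le> (\<Sum>k. ennreal ((3 * 2 ^ Suc k) powr q) * indicator {3 * 2 ^ k<..} y)"
  proof -
    define g where "g k = ennreal ((3 * 2 ^ Suc k) powr q) * indicator {3 * 2 ^ k<..} y" for k :: nat
    have "sum g {k} \<le> suminf g" by (rule sum_le_suminf) auto
    then have "g k \<le> suminf g" by simp
    then show ?thesis unfolding g_def .
  qed
  finally show ?thesis by (rule order_trans) simp
qed

text \<open>The weak-type bound at height l, with the optimal scale, decays like l^(- (2 + 4/N)).
  Summed over dyadic heights this controls every power below 2 + 4/N, in particular 2 + 2/N; any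
  gain over 2 suffices for the logarithm.\<close>

lemma H10_higher_integrability:
  fixes \<Omega> :: "'a::euclidean_space set"
  assumes \<Omega>: "open \<Omega>" "bounded \<Omega>"
  obtains K :: real where "\<And>f. f \<in> H10 \<Omega> \<Longrightarrow> H1_norm \<Omega> f \<le> C \<Longrightarrow>
    (\<integral>\<^sup>+x. ennreal (\<bar>f x\<bar> powr (2 + 2 / DIM('a))) \<partial>lebesgue_on \<Omega>) \<le> ennreal K"
proof -
  let ?M = "lebesgue_on \<Omega>" and ?N = "real DIM('a)"
  have \<Omega>l: "\<Omega> \<in> lmeasurable" using \<Omega> by (intro bounded_set_imp_lmeasurable) auto
  interpret finite_measure ?M by (rule finite_measure_lebesgue_on[OF \<Omega>l])
  define q where "q = 2 + 2 / ?N"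
  \<comment> \<open>The 1 provides the strict inequality that the weak-type bound asks for.\<close>
  define A where "A = C\<^sup>2 + 1"
  define K0 where "K0 = (A powr (1 / ?N) * ?N)\<^sup>2 * C\<^sup>2"
  define r where "r = (2::real) powr (- 2 / ?N)"
  have N: "?N > 0" by simp
  have A: "A > 0" by (simp add: A_def add_nonneg_pos)
  have r: "0 < r" "r < 1" using N by (auto simp: r_def intro!: powr_less_one)
  have K0: "K0 \<ge> 0" by (simp add: K0_def)
  have q: "q > 0" using N by (simp add: q_def add_pos_pos)
  have weak: "measure ?M {x\<in>\<Omega>. 3 * 2 ^ k < \<bar>f x\<bar>} \<le> K0 * 2 powr (- (2 + 4 / ?N) * k)"
    if f: "f \<in> H10 \<Omega>" "H1_norm \<Omega> f \<le> C" for f k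
  proof -
    let ?l = "2 ^ k :: real"
    \<comment> \<open>The scale solves \<epsilon>^N l^2 = A, the smallest cubes to which the
      smallness condition with constant \<open>A\<close> applies.\<close>
    define \<epsilon> where "\<epsilon> = (A / ?l\<^sup>2) powr (1 / ?N)"
    have "H1_norm \<Omega> f \<ge> 0" by (simp add: H1_norm_def)
    then have "(H1_norm \<Omega> f)\<^sup>2 \<le> C\<^sup>2" using f(2) by (intro power_mono)
    then have n: "(LINT x|?M. (f x)\<^sup>2) + (grad_norm \<Omega> f)\<^sup>2 \<le> C\<^sup>2"
      by (simp add: H1_norm_def Lq_norm_2_sq add_nonneg_nonneg)
    have "\<epsilon> ^ DIM('a) = A / ?l\<^sup>2"
      using A by (simp add: \<epsilon>_def powr_realpow[symmetric] powr_powr)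
    moreover have "(LINT x|?M. (f x)\<^sup>2) < A"
      using n zero_le_power2[of "grad_norm \<Omega> f"] unfolding A_def by linarith
    ultimately have "(LINT x|?M. (f x)\<^sup>2) < \<epsilon> ^ DIM('a) * ?l\<^sup>2" by simp
    then have "measure ?M {x\<in>\<Omega>. 3 * ?l < \<bar>f x\<bar>} \<le> (\<epsilon> * DIM('a))\<^sup>2 * (grad_norm \<Omega> f)\<^sup>2 / ?l\<^sup>2"
      by (intro H10_weak_type[OF \<Omega> f(1)]) (use A in \<open>auto simp: \<epsilon>_def\<close>)
    also have "\<dots> \<le> (\<epsilon> * DIM('a))\<^sup>2 * C\<^sup>2 / ?l\<^sup>2"
      using n by (intro divide_right_mono mult_left_mono) (auto intro: order_trans[rotated])
    also have "\<dots> = K0 * 2 powr (- (2 + 4 / ?N) * k)"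
    proof -
      have l: "?l = 2 powr real k" by (simp add: powr_realpow)
      have "A / ?l\<^sup>2 = A * 2 powr (- (2 * real k))"
        by (simp add: l powr_power powr_minus divide_inverse mult.commute)
      then have "\<epsilon> = A powr (1 / ?N) * 2 powr (- 2 * k / ?N)"
        using A by (simp only: \<epsilon>_def powr_mult powr_powr powr_ge_zero) simp
      then have "\<epsilon>\<^sup>2 = (A powr (1 / ?N))\<^sup>2 * 2 powr (- 4 * k / ?N)"
        by (simp add: power_mult_distrib powr_power)
      moreover have "2 powr (- (2 + 4 / ?N) * k) = 2 powr (- 4 * k / ?N) * 2 powr (- (2 * real k))"
        by (simp add: powr_add[symmetric] algebra_simps)
      moreover have "1 / ?l\<^sup>2 = 2 powr (- (2 * real k))"
        by (simp add: l powr_power powr_minus divide_inverse mult.commute)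
      ultimately show ?thesis by (simp add: K0_def power_mult_distrib divide_inverse)
    qed
    finally show ?thesis .
  qed
  have sums: "(\<lambda>k. 6 powr q * K0 * r ^ k) sums (6 powr q * K0 * (1 / (1 - r)))"
    using r by (intro sums_mult geometric_sums) auto
  define K where "K = 3 powr q * measure ?M \<Omega> + 6 powr q * K0 * (1 / (1 - r))"
  have "(\<integral>\<^sup>+x. ennreal (\<bar>f x\<bar> powr q) \<partial>?M) \<le> ennreal K" if f: "f \<in> H10 \<Omega>" "H1_norm \<Omega> f \<le> C" for f
  proof -
    have fm[measurable]: "f \<in> borel_measurable ?M" using f(1) by (simp add: H10_def H1_def Lq_space_2)
    let ?c = "\<lambda>k::nat. ennreal ((3 * 2 ^ Suc k) powr q)"
    have "(\<integral>\<^sup>+x. ennreal (\<bar>f x\<bar> powr q) \<partial>?M) \<le>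
        (\<integral>\<^sup>+x. ennreal (3 powr q) + (\<Sum>k. ?c k * indicator {3 * 2 ^ k<..} \<bar>f x\<bar>) \<partial>?M)"
      by (intro nn_integral_mono dyadic_powr_bound q abs_ge_zero)
    also have "\<dots> = ennreal (3 powr q) * emeasure ?M \<Omega> + (\<Sum>k. ?c k * (\<integral>\<^sup>+x. indicator {3 * 2 ^ k<..} \<bar>f x\<bar> \<partial>?M))"
      by (simp add: nn_integral_add nn_integral_suminf nn_integral_cmult)
    also have "\<dots> \<le> ennreal (3 powr q) * emeasure ?M \<Omega> + (\<Sum>k. ennreal (6 powr q * K0 * r ^ k))"
    proof (intro add_left_mono suminf_le)
      fix k :: nat
      have "(\<integral>\<^sup>+x. indicator {3 * 2 ^ k<..} \<bar>f x\<bar> \<partial>?M) = (\<integral>\<^sup>+x. indicator {x\<in>space ?M. 3 * 2 ^ k < \<bar>f x\<bar>} x \<partial>?M)"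
        by (intro nn_integral_cong) (auto simp: indicator_def)
      also have "\<dots> = emeasure ?M {x\<in>space ?M. 3 * 2 ^ k < \<bar>f x\<bar>}"
        by (intro nn_integral_indicator) measurable
      also have "\<dots> = ennreal (measure ?M {x\<in>\<Omega>. 3 * 2 ^ k < \<bar>f x\<bar>})" by (simp add: emeasure_eq_measure)
      also have "\<dots> \<le> ennreal (K0 * 2 powr (- (2 + 4 / ?N) * k))" by (intro ennreal_leI weak f)
      finally have "?c k * (\<integral>\<^sup>+x. indicator {3 * 2 ^ k<..} \<bar>f x\<bar> \<partial>?M) \<le> ?c k * ennreal (K0 * 2 powr (- (2 + 4 / ?N) * k))"
        by (intro mult_left_mono) auto
      also have "\<dots> = ennreal (6 powr q * K0 * r ^ k)"
      proof -
        have "(3 * 2 ^ Suc k) powr q = 6 powr q * 2 powr (q * k)"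
          by (simp add: powr_mult powr_realpow[symmetric] powr_powr mult.commute mult.assoc[symmetric])
        \<comment> \<open>The exponent q - (2 + 4/N) equals - 2/N, which makes the series geometric
          with ratio \<open>r\<close> < 1.\<close>
        moreover have "r ^ k = 2 powr (q * k) * 2 powr (- (2 + 4 / ?N) * k)"
          using N by (simp add: r_def powr_power q_def powr_add[symmetric] algebra_simps add_divide_distrib[symmetric])
        ultimately show ?thesis using K0 by (simp add: ennreal_mult[symmetric] mult_ac)
      qed
      finally show "?c k * (\<integral>\<^sup>+x. indicator {3 * 2 ^ k<..} \<bar>f x\<bar> \<partial>?M) \<le> ennreal (6 powr q * K0 * r ^ k)" .
    qed auto
    also have "(\<Sum>k. ennreal (6 powr q * K0 * r ^ k)) = ennreal (6 powr q * K0 * (1 / (1 - r)))"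
      using r K0 by (intro suminf_ennreal_eq sums) auto
    also have "ennreal (3 powr q) * emeasure ?M \<Omega> = ennreal (3 powr q * measure ?M \<Omega>)"
      by (simp add: emeasure_eq_measure ennreal_mult)
    also have "ennreal (3 powr q * measure ?M \<Omega>) + ennreal (6 powr q * K0 * (1 / (1 - r))) = ennreal K"
      using r K0 unfolding K_def by (intro ennreal_plus[symmetric]) auto
    finally show ?thesis .
  qed
  then show thesis using that[of K] unfolding q_def by blast
qed

section \<open>A differential inequality\<close>

text \<open>A crude three-factor Young inequality: each factor is replaced by the sum, and the
  exponents add up to 1.\<close>

lemma powr_mult3_le:
  fixes x y z :: real
  assumes "0 \<le> x" "0 \<le> y" "0 \<le> z" "0 \<le> a" "0 \<le> b" "0 \<le> c" "a + b + c = 1"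
  shows "x powr a * y powr b * z powr c \<le> x + y + z"
proof (cases "x + y + z = 0")
  case True
  then have "x = 0" "y = 0" "z = 0" using assms by linarith+
  then show ?thesis by simp
next
  case False
  let ?s = "x + y + z"
  have s: "?s > 0" using False assms by linarith
  have "x powr a * y powr b * z powr c \<le> ?s powr a * ?s powr b * ?s powr c"
    using assms by (intro mult_mono powr_mono2) auto
  also have "\<dots> = ?s" using assms(7) s by (simp add: powr_add[symmetric])
  finally show ?thesis .
qed

text \<open>Dividing by 1 + s leaves two fractions with sum 1, and a number in [0, 1] does not
  decrease when raised to a power at most 1.\<close>

lemma powr_one_plus_le:
  fixes s a :: real
  assumes "0 \<le> s" "0 < a" "a \<le> 1"
  shows "(1 + s) powr a \<le> 1 + s powr a"
proof -
  let ?r = "1 + s"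
  have r: "?r > 0" using assms by simp
  have *: "y \<le> y powr a" if "0 \<le> y" "y \<le> 1" for y :: real
    using powr_mono'[of a 1 y] that assms by (cases "y = 0") auto
  have "1 = 1 / ?r + s / ?r" using r by (simp add: field_simps)
  also have "\<dots> \<le> (1 / ?r) powr a + (s / ?r) powr a" using assms by (intro add_mono *) auto
  also have "\<dots> = (1 + s powr a) / ?r powr a" using assms by (simp add: powr_divide add_divide_distrib)
  finally show ?thesis using r by (simp add: field_simps)
qed

text \<open>The factor \<open>a\<close> is moved into the logarithm as an exponent and ln (1 + s) is
  bounded by s. The right-hand side is a pure power, as the homogeneous three-factor estimate of the
  damping term requires.\<close>

lemma ln_one_plus_square_le:
  fixes y a :: real
  assumes "0 < a" "a \<le> 1"
  shows "ln (1 + y\<^sup>2) \<le> (y\<^sup>2) powr a / a"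
proof -
  have "1 + y\<^sup>2 > 0" by (rule add_pos_nonneg) auto
  then have "a * ln (1 + y\<^sup>2) = ln ((1 + y\<^sup>2) powr a)" by (simp add: ln_powr)
  also have "\<dots> \<le> ln (1 + (y\<^sup>2) powr a)"
    using powr_one_plus_le[of "y\<^sup>2" a] assms \<open>1 + y\<^sup>2 > 0\<close> by (intro ln_mono) auto
  also have "\<dots> \<le> (y\<^sup>2) powr a" by (rule ln_add_one_self_le_self) simp
  finally show ?thesis using assms by (simp add: field_simps)
qed

text \<open>The function \<Lambda>^(- \<beta>) falls at rate at least \<beta> c and cannot become
  negative. Since \<open>ineq\<close> is conditional on positivity of \<Lambda>, that is obtained
  first, from \<open>nonneg\<close>.\<close>

lemma differential_inequality_blow_up:
  fixes \<Lambda> l :: "real \<Rightarrow> real"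
  assumes T: "0 < T" and int: "set_integrable lborel {0..T} l"
    and \<Lambda>: "\<And>t. t \<in> {0..T} \<Longrightarrow> \<Lambda> t = \<Lambda>0 + (LBINT s:{0..t}. l s)" and \<Lambda>0: "\<Lambda>0 > 0"
    and c: "c > 0" and \<beta>: "\<beta> > 0"
    and nonneg: "AE s in lborel. s \<in> {0..T} \<longrightarrow> 0 \<le> l s"
    and ineq: "AE s in lborel. s \<in> {0..T} \<longrightarrow> 0 < \<Lambda> s \<longrightarrow> c * \<Lambda> s powr (1 + \<beta>) \<le> l s"
  shows "T \<le> \<Lambda>0 powr (- \<beta>) / (\<beta> * c)"
proof -
  have pos: "\<Lambda> t > 0" if t: "t \<in> {0..T}" for t
  proof -
    have "0 \<le> (LBINT s:{0..t}. l s)"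
      unfolding set_lebesgue_integral_def
      by (rule integral_nonneg_AE) (use nonneg in eventually_elim, use t in \<open>auto simp: indicator_def\<close>)
    then show ?thesis using \<Lambda>[OF t] \<Lambda>0 by simp
  qed
  let ?\<phi> = "\<lambda>y. - \<beta> * y powr (- \<beta> - 1)"
  have d: "((\<lambda>y. y powr (- \<beta>)) has_real_derivative ?\<phi> y) (at y)" if "y \<in> {0<..}" for y
    using that by (auto intro!: derivative_eq_intros)
  have cont: "continuous_on {0<..} ?\<phi>" by (auto intro!: continuous_intros)
  note chain = indefinite_integral_chain_rule[OF int \<Lambda> _ _ d cont]
  have int': "set_integrable lborel {0..T} (\<lambda>s. ?\<phi> (\<Lambda> s) * l s)" by (rule chain(1)) (use pos in auto)
  have "\<Lambda> T powr (- \<beta>) - \<Lambda>0 powr (- \<beta>) = (LBINT s:{0..T}. ?\<phi> (\<Lambda> s) * l s)"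
    by (rule chain(2)) (use pos T in auto)
  also have "\<dots> \<le> (LBINT s:{0..T}. - \<beta> * c)"
  proof (rule set_integral_mono_AE[OF int'])
    show "set_integrable lborel {0..T} (\<lambda>s. - \<beta> * c)"
      by (rule borel_integrable_atLeastAtMost'[OF continuous_on_const])
    show "AE s\<in>{0..T} in lborel. ?\<phi> (\<Lambda> s) * l s \<le> - \<beta> * c"
      using ineq
    proof eventually_elim
      case (elim s)
      show ?case
      proof
        assume s: "s \<in> {0..T}"
        have "\<Lambda> s powr (- \<beta> - 1) * (c * \<Lambda> s powr (1 + \<beta>)) \<le> \<Lambda> s powr (- \<beta> - 1) * l s"
          using elim s pos[OF s] by (intro mult_left_mono) auto
        moreover have "\<Lambda> s powr (- \<beta> - 1) * (c * \<Lambda> s powr (1 + \<beta>)) = c"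
          using pos[OF s] by (simp add: powr_add[symmetric] mult.left_commute)
        ultimately show "?\<phi> (\<Lambda> s) * l s \<le> - \<beta> * c" using \<beta> by (simp add: mult.assoc)
      qed
    qed
  qed
  also have "\<dots> = - \<beta> * c * T" using T by (simp add: set_integral_const)
  finally have "\<beta> * c * T \<le> \<Lambda>0 powr (- \<beta>)" using powr_ge_zero[of "\<Lambda> T" "- \<beta>"] by linarith
  then show ?thesis using c \<beta> by (simp add: field_simps)
qed

section \<open>Estimates for the Lyapunov functional and its derivative\<close>

lemma scaled_Young:
  fixes r y z :: real
  assumes "r > 0"
  shows "2 * \<bar>y * z\<bar> \<le> r * z\<^sup>2 + y\<^sup>2 / r"
proof -
  have "0 \<le> (r * \<bar>z\<bar> - \<bar>y\<bar>)\<^sup>2" by simp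
  also have "\<dots> = r\<^sup>2 * z\<^sup>2 + y\<^sup>2 - 2 * r * \<bar>y * z\<bar>"
    by (simp add: power2_diff power_mult_distrib abs_mult)
  also have "\<dots> = (r * z\<^sup>2 + y\<^sup>2 / r) * r - (2 * \<bar>y * z\<bar>) * r"
    using assms by (simp add: distrib_right power2_eq_square)
  finally have "(2 * \<bar>y * z\<bar>) * r \<le> (r * z\<^sup>2 + y\<^sup>2 / r) * r" by simp
  then show ?thesis using assms by (rule mult_right_le_imp_le)
qed

text \<open>Young's inequality with weight \<kappa> H^(- \<alpha>) splits the cross term. The part
  with b^2 carries the same factor H^(- \<alpha>) as the dissipation in the derivative of H^(1 -
  \<alpha>) and can be absorbed there. In the part with a^2 the logarithm is bounded by
  (b^2)^\<alpha> / \<alpha>, leaving H^\<alpha> a^2 (b^2)^\<alpha>, whose exponents \<alpha> + 2/p +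
  \<alpha> sum to 1.\<close>

lemma (in finite_measure) damping_term_bound:
  fixes a b :: "'a \<Rightarrow> real"
  assumes [measurable]: "a \<in> borel_measurable M" "b \<in> borel_measurable M"
    and a: "integrable M (\<lambda>x. \<bar>a x\<bar> powr p)" and b: "integrable M (\<lambda>x. (b x)\<^sup>2)"
    and d: "integrable M (\<lambda>x. (b x)\<^sup>2 * ln (1 + (b x)\<^sup>2))"
    and p: "2 < p" and \<alpha>: "\<alpha> = 1 / 2 - 1 / p" and H: "0 < H" and \<kappa>: "0 < \<kappa>"
  shows "integrable M (\<lambda>x. a x * b x * ln (1 + (b x)\<^sup>2))"
    and "\<bar>LINT x|M. a x * b x * ln (1 + (b x)\<^sup>2)\<bar> \<le>
      \<kappa> / 2 * H powr (- \<alpha>) * (LINT x|M. (b x)\<^sup>2 * ln (1 + (b x)\<^sup>2)) +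
      1 / (2 * \<kappa> * \<alpha>) * (measure M (space M) * H + (LINT x|M. \<bar>a x\<bar> powr p) + (LINT x|M. (b x)\<^sup>2))"
proof -
  have \<alpha>0: "0 < \<alpha>" "\<alpha> \<le> 1" using p by (auto simp: \<alpha> field_simps)
  let ?l = "\<lambda>x. ln (1 + (b x)\<^sup>2)"
  let ?g = "\<lambda>x. \<kappa> / 2 * H powr (- \<alpha>) * ((b x)\<^sup>2 * ?l x) + 1 / (2 * \<kappa> * \<alpha>) * (H + \<bar>a x\<bar> powr p + (b x)\<^sup>2)"
  have gi: "integrable M ?g" using a b d by simp
  have pw: "\<bar>a x * b x * ?l x\<bar> \<le> ?g x" for x
  proof -
    have l0: "0 \<le> ?l x" by simp
    let ?r = "\<kappa> * H powr (- \<alpha>)"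
    have r: "?r > 0" using \<kappa> H by simp
    have "2 * \<bar>a x * b x\<bar> \<le> ?r * (b x)\<^sup>2 + (a x)\<^sup>2 / ?r" by (rule scaled_Young[OF r])
    then have "2 * \<bar>a x * b x\<bar> * ?l x \<le> (?r * (b x)\<^sup>2 + (a x)\<^sup>2 / ?r) * ?l x"
      using l0 by (rule mult_right_mono)
    then have 1: "2 * \<bar>a x * b x * ?l x\<bar> \<le> ?r * ((b x)\<^sup>2 * ?l x) + (a x)\<^sup>2 * ?l x / ?r"
      using l0 by (simp add: abs_mult algebra_simps)
    have "(a x)\<^sup>2 * ?l x / ?r = (1 / \<kappa>) * (H powr \<alpha> * (a x)\<^sup>2 * ?l x)"
      by (simp add: powr_minus divide_inverse)
    also have "\<dots> \<le> (1 / \<kappa>) * (H powr \<alpha> * (a x)\<^sup>2 * (((b x)\<^sup>2) powr \<alpha> / \<alpha>))"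
      using \<kappa> \<alpha>0 by (intro mult_left_mono ln_one_plus_square_le) auto
    also have "\<dots> = 1 / (\<kappa> * \<alpha>) * (H powr \<alpha> * (\<bar>a x\<bar> powr p) powr (2 / p) * ((b x)\<^sup>2) powr \<alpha>)"
      using p by (simp add: powr_powr abs_powr_2)
    also have "\<dots> \<le> 1 / (\<kappa> * \<alpha>) * (H + \<bar>a x\<bar> powr p + (b x)\<^sup>2)"
      using \<kappa> \<alpha>0 H p by (intro mult_left_mono powr_mult3_le) (auto simp: \<alpha> field_simps)
    finally have 2: "(a x)\<^sup>2 * ?l x / ?r \<le> 1 / (\<kappa> * \<alpha>) * (H + \<bar>a x\<bar> powr p + (b x)\<^sup>2)" .
    have "1 / (2 * \<kappa> * \<alpha>) * (H + \<bar>a x\<bar> powr p + (b x)\<^sup>2) = (1 / (\<kappa> * \<alpha>) * (H + \<bar>a x\<bar> powr p + (b x)\<^sup>2)) / 2"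
      "\<kappa> / 2 * H powr (- \<alpha>) * ((b x)\<^sup>2 * ?l x) = ?r * ((b x)\<^sup>2 * ?l x) / 2" by simp_all
    moreover have "t \<le> P + Q" if "2 * t \<le> X + Y" "Y \<le> Z" "Q = Z / 2" "P = X / 2" for t P Q X Y Z :: real
      using that by linarith
    ultimately show ?thesis using 1 2 by blast
  qed
  show int: "integrable M (\<lambda>x. a x * b x * ?l x)"
    by (rule Bochner_Integration.integrable_bound[OF gi])
       (measurable, intro AE_I2 order_trans[OF pw[folded real_norm_def] ], simp)
  have "\<bar>LINT x|M. a x * b x * ?l x\<bar> \<le> (LINT x|M. \<bar>a x * b x * ?l x\<bar>)" by (rule integral_abs_bound)
  also have "\<dots> \<le> (LINT x|M. ?g x)" by (rule integral_mono[OF integrable_abs[OF int] gi pw])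
  also have "\<dots> = \<kappa> / 2 * H powr (- \<alpha>) * (LINT x|M. (b x)\<^sup>2 * ?l x) +
      1 / (2 * \<kappa> * \<alpha>) * (measure M (space M) * H + (LINT x|M. \<bar>a x\<bar> powr p) + (LINT x|M. (b x)\<^sup>2))"
    using a b d by simp
  finally show "\<bar>LINT x|M. a x * b x * ?l x\<bar> \<le> \<kappa> / 2 * H powr (- \<alpha>) * (LINT x|M. (b x)\<^sup>2 * ?l x) +
      1 / (2 * \<kappa> * \<alpha>) * (measure M (space M) * H + (LINT x|M. \<bar>a x\<bar> powr p) + (LINT x|M. (b x)\<^sup>2))" .
qed

text \<open>Pointwise \<open>\<bar>a b\<bar>\<close> is at most g^(1/p) g^(1/2) = g^(1 - \<alpha>)
  with g = \<open>\<bar>a\<bar> powr p\<close> + b^2. In place of Jensen's inequality for the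
  concave power, g^(1 - \<alpha>) is bounded by m^(- \<alpha>) (g + m), where m is the integral of
  g.\<close>

lemma (in finite_measure) product_integral_bound:
  fixes a b :: "'a \<Rightarrow> real"
  assumes [measurable]: "a \<in> borel_measurable M" "b \<in> borel_measurable M"
    and a: "integrable M (\<lambda>x. \<bar>a x\<bar> powr p)" and b: "integrable M (\<lambda>x. (b x)\<^sup>2)"
    and p: "2 < p" and \<alpha>: "\<alpha> = 1 / 2 - 1 / p"
  shows "\<bar>LINT x|M. a x * b x\<bar> \<le> (1 + measure M (space M)) * ((LINT x|M. \<bar>a x\<bar> powr p) + (LINT x|M. (b x)\<^sup>2)) powr (1 - \<alpha>)"
proof -
  have \<alpha>0: "0 < \<alpha>" "\<alpha> < 1" using p by (auto simp: \<alpha> field_simps)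
  let ?g = "\<lambda>x. \<bar>a x\<bar> powr p + (b x)\<^sup>2"
  define m where "m = (LINT x|M. ?g x)"
  have gi: "integrable M ?g" using a b by simp
  have m_eq: "m = (LINT x|M. \<bar>a x\<bar> powr p) + (LINT x|M. (b x)\<^sup>2)" using a b by (simp add: m_def)
  have m0: "m \<ge> 0" unfolding m_def by (rule integral_nonneg_AE) simp
  have ab: "\<bar>a x * b x\<bar> \<le> ?g x powr (1 - \<alpha>)" for x
  proof (cases "?g x = 0")
    case True
    then have "(b x)\<^sup>2 = 0" by (smt (verit) powr_ge_zero zero_le_power2)
    then show ?thesis using True by simp
  next
    case False
    have "\<bar>a x * b x\<bar> = (\<bar>a x\<bar> powr p) powr (1 / p) * ((b x)\<^sup>2) powr (1 / 2)"
      using p by (simp add: powr_powr abs_mult powr_half_sqrt)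
    also have "\<dots> \<le> ?g x powr (1 / p) * ?g x powr (1 / 2)" using p by (intro mult_mono powr_mono2) auto
    also have "\<dots> = ?g x powr (1 - \<alpha>)" by (simp add: powr_add[symmetric] \<alpha> add.commute)
    finally show ?thesis .
  qed
  show ?thesis
  proof (cases "m = 0")
    case True
    have "AE x in M. ?g x = 0"
      using integral_nonneg_eq_0_iff_AE[OF gi] True by (simp add: m_def)
    then have "AE x in M. a x * b x = 0"
    proof eventually_elim
      case (elim x)
      then show ?case using ab[of x] by simp
    qed
    then have "(LINT x|M. a x * b x) = 0" by (rule integral_eq_zero_AE)
    then show ?thesis by simp
  next
    case False
    then have m: "m > 0" using m0 by simp
    have pw: "\<bar>a x * b x\<bar> \<le> m powr (- \<alpha>) * (?g x + m)" for x
    proof (cases "?g x = 0")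
      case True
      then have "\<bar>a x * b x\<bar> \<le> 0" using ab[of x] by simp
      moreover have "0 \<le> m powr (- \<alpha>) * (?g x + m)" using m by (intro mult_nonneg_nonneg add_nonneg_nonneg) auto
      ultimately show ?thesis by linarith
    next
      case False
      have g0: "?g x \<ge> 0" by simp
      have "?g x powr (1 - \<alpha>) * m powr \<alpha> \<le> (?g x + m) powr (1 - \<alpha>) * (?g x + m) powr \<alpha>"
        using \<alpha>0 m g0 by (intro mult_mono powr_mono2) auto
      also have "\<dots> = ?g x + m" using m g0 by (simp add: powr_add[symmetric] add_nonneg_pos)
      finally have "?g x powr (1 - \<alpha>) \<le> m powr (- \<alpha>) * (?g x + m)"
        using m by (simp add: powr_minus field_simps)
      then show ?thesis using ab[of x] by linarith
    qed
    have bi: "integrable M (\<lambda>x. m powr (- \<alpha>) * (?g x + m))" using gi by simp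
    have int: "integrable M (\<lambda>x. a x * b x)"
    proof (rule Bochner_Integration.integrable_bound[OF bi])
      show "AE x in M. norm (a x * b x) \<le> norm (m powr (- \<alpha>) * (?g x + m))"
        using pw by (intro AE_I2) (metis abs_ge_self order_trans real_norm_def)
    qed measurable
    have "\<bar>LINT x|M. a x * b x\<bar> \<le> (LINT x|M. \<bar>a x * b x\<bar>)" by (rule integral_abs_bound)
    also have "\<dots> \<le> (LINT x|M. m powr (- \<alpha>) * (?g x + m))" by (rule integral_mono[OF integrable_abs[OF int] bi pw])
    also have "\<dots> = m powr (- \<alpha>) * (m + m * measure M (space M))"
      using a b gi by (simp add: m_def[symmetric] m_eq[symmetric])
    also have "\<dots> = (1 + measure M (space M)) * (m powr (- \<alpha>) * m powr 1)" using m by (simp add: algebra_simps)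
    also have "m powr (- \<alpha>) * m powr 1 = m powr (1 - \<alpha>)" unfolding powr_add[symmetric] by simp
    finally show ?thesis by (simp add: m_eq)
  qed
qed

text \<open>The numbers stand for values at one time: \<open>A\<close> = |u|_p^p, \<open>V\<close> =
  |u_t|_2^2, \<open>e\<close> = |grad u|_2^2, \<open>D\<close> the dissipation, \<open>I\<close> and
  \<open>J\<close> the integrals of u u_t ln (1 + u_t^2) and u u_t, and \<open>l\<close> for the
  derivative of the functional. Both claims come from l \<ge> \<epsilon> \<alpha> (H + A + V): the
  functional itself is at most a constant times the power 1 - \<alpha> of that sum.\<close>

lemma Lyapunov_derivative_bound:
  fixes A V D I J H e \<mu> \<epsilon> \<kappa> p \<alpha> :: real
  assumes p: "2 < p" and \<alpha>: "\<alpha> = 1 / 2 - 1 / p" and nn: "0 \<le> A" "0 \<le> V" "0 \<le> D" "0 \<le> \<mu>" and H: "0 < H"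
    and He: "H = A / p - V / 2 - e / 2" and \<kappa>: "\<kappa> = (1 + \<mu>) / (2 * \<alpha>\<^sup>2)" and \<epsilon>: "0 < \<epsilon>" "\<epsilon> * \<kappa> \<le> 2 * (1 - \<alpha>)"
    and I: "\<bar>I\<bar> \<le> \<kappa> / 2 * H powr (- \<alpha>) * D + 1 / (2 * \<kappa> * \<alpha>) * (\<mu> * H + A + V)"
    and J: "\<bar>J\<bar> \<le> (1 + \<mu>) * (A + V) powr (1 - \<alpha>)"
  defines "l \<equiv> (1 - \<alpha>) * H powr (- \<alpha>) * D + \<epsilon> * (V - e - I + A)"
  shows "0 \<le> l"
    and "0 < H powr (1 - \<alpha>) + \<epsilon> * J \<Longrightarrow>
      \<epsilon> * \<alpha> / (1 + \<epsilon> * (1 + \<mu>)) powr (1 / (1 - \<alpha>)) * (H powr (1 - \<alpha>) + \<epsilon> * J) powr (1 / (1 - \<alpha>)) \<le> l"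
proof -
  have \<alpha>0: "0 < \<alpha>" "\<alpha> < 1 / 2" using p by (auto simp: \<alpha> field_simps)
  let ?S = "H + A + V"
  have S: "?S > 0" using H nn by simp
  have "1 / (2 * \<kappa> * \<alpha>) * (\<mu> * H + A + V) \<le> \<alpha> * ?S"
  proof -
    \<comment> \<open>The choice of \<kappa> makes the prefactor equal to \<alpha> / (1 + \<mu>), so
      the non-dissipative part of the bound on \<open>I\<close> costs only \<alpha> (H + A +
      V).\<close>
    have "2 * \<kappa> * \<alpha> = (1 + \<mu>) / \<alpha>" using \<alpha>0 by (simp add: \<kappa> power2_eq_square field_simps)
    then have "1 / (2 * \<kappa> * \<alpha>) = \<alpha> / (1 + \<mu>)" by simp
    moreover have "\<mu> * H + A + V \<le> (1 + \<mu>) * ?S"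
      using nn H mult_nonneg_nonneg[of \<mu> A] mult_nonneg_nonneg[of \<mu> V] by (simp add: algebra_simps)
    ultimately have "1 / (2 * \<kappa> * \<alpha>) * (\<mu> * H + A + V) \<le> \<alpha> / (1 + \<mu>) * ((1 + \<mu>) * ?S)"
      using \<alpha>0 nn by (simp only:) (intro mult_left_mono, auto)
    also have "\<dots> = \<alpha> * ?S" using nn by simp
    finally show ?thesis .
  qed
  then have I': "I \<le> \<kappa> / 2 * (H powr (- \<alpha>) * D) + \<alpha> * ?S" using I by (simp add: mult.assoc)
  \<comment> \<open>\<open>He\<close> eliminates \<open>e\<close>; the coefficient of
    \<open>A\<close> becomes 1 - 2/p = 2 \<alpha>, positive because p > 2. Half of it pays for
    \<open>I\<close>.\<close>
  have "V - e - I + A = 2 * \<alpha> * A + 2 * V + 2 * H - I"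
    using p by (simp add: He \<alpha> field_simps)
  moreover have "2 * \<alpha> * V \<le> 2 * V" "2 * \<alpha> * H \<le> 2 * H"
    using \<alpha>0 nn H by (simp_all add: mult_left_le_one_le)
  ultimately have j: "\<alpha> * ?S - \<kappa> / 2 * (H powr (- \<alpha>) * D) \<le> V - e - I + A"
    using I' by (simp add: algebra_simps)
  have HD: "0 \<le> H powr (- \<alpha>) * D" using nn by simp
  \<comment> \<open>The bound on \<epsilon> keeps a nonnegative coefficient for the dissipation
    after \<open>I\<close> has taken its share.\<close>
  have "\<epsilon> * \<alpha> * ?S \<le> ((1 - \<alpha>) - \<epsilon> * \<kappa> / 2) * (H powr (- \<alpha>) * D) + \<epsilon> * (\<alpha> * ?S)"
    using HD \<epsilon>(2) by simp
  also have "\<dots> = (1 - \<alpha>) * (H powr (- \<alpha>) * D) + \<epsilon> * (\<alpha> * ?S - \<kappa> / 2 * (H powr (- \<alpha>) * D))"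
    by (simp add: algebra_simps)
  also have "\<dots> \<le> (1 - \<alpha>) * (H powr (- \<alpha>) * D) + \<epsilon> * (V - e - I + A)"
    using j \<epsilon>(1) by (intro add_left_mono mult_left_mono) auto
  finally have main: "\<epsilon> * \<alpha> * ?S \<le> l" by (simp add: l_def mult.assoc)
  have "0 \<le> \<epsilon> * \<alpha> * ?S" using \<epsilon>(1) \<alpha>0 S by simp
  then show "0 \<le> l" using main by linarith
  assume pos: "0 < H powr (1 - \<alpha>) + \<epsilon> * J"
  let ?b = "1 + \<epsilon> * (1 + \<mu>)"
  have b: "?b > 0" using \<epsilon>(1) nn by (simp add: add_pos_nonneg)
  have "H powr (1 - \<alpha>) + \<epsilon> * J \<le> ?S powr (1 - \<alpha>) + \<epsilon> * ((1 + \<mu>) * ?S powr (1 - \<alpha>))"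
  proof (intro add_mono mult_left_mono)
    show "H powr (1 - \<alpha>) \<le> ?S powr (1 - \<alpha>)" using H nn \<alpha>0 by (intro powr_mono2) auto
    have "(A + V) powr (1 - \<alpha>) \<le> ?S powr (1 - \<alpha>)" using H nn \<alpha>0 by (intro powr_mono2) auto
    then have "(1 + \<mu>) * (A + V) powr (1 - \<alpha>) \<le> (1 + \<mu>) * ?S powr (1 - \<alpha>)" using nn by (intro mult_left_mono) auto
    then show "J \<le> (1 + \<mu>) * ?S powr (1 - \<alpha>)" using J by linarith
  qed (use \<epsilon> in simp)
  also have "\<dots> = ?b * ?S powr (1 - \<alpha>)" by (simp add: algebra_simps)
  finally have "(H powr (1 - \<alpha>) + \<epsilon> * J) powr (1 / (1 - \<alpha>)) \<le> (?b * ?S powr (1 - \<alpha>)) powr (1 / (1 - \<alpha>))"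
    using pos \<alpha>0 by (intro powr_mono2) auto
  also have "\<dots> = ?b powr (1 / (1 - \<alpha>)) * ?S"
    using b S \<alpha>0 by (simp add: powr_mult powr_powr)
  finally have "\<epsilon> * \<alpha> / ?b powr (1 / (1 - \<alpha>)) * (H powr (1 - \<alpha>) + \<epsilon> * J) powr (1 / (1 - \<alpha>))
      \<le> \<epsilon> * \<alpha> / ?b powr (1 / (1 - \<alpha>)) * (?b powr (1 / (1 - \<alpha>)) * ?S)"
    using \<epsilon>(1) \<alpha>0 by (intro mult_left_mono) auto
  also have "\<dots> = \<epsilon> * \<alpha> * ?S" using b by simp
  finally show "\<epsilon> * \<alpha> / ?b powr (1 / (1 - \<alpha>)) * (H powr (1 - \<alpha>) + \<epsilon> * J) powr (1 / (1 - \<alpha>)) \<le> l"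
    using main by linarith
qed

section \<open>Differentiating a quadratic form\<close>

text \<open>The increments of \<open>e\<close> are controlled at almost all times only and \<open>k\<close> need not be continuous,
  so the derivative \<open>- 2 * k\<close> of \<open>e\<close> is identified in the weak sense.\<close>

lemma indefinite_integral_from_increments:
  fixes e k :: "real \<Rightarrow> real"
  assumes T: "0 < T" and em[measurable]: "e \<in> borel_measurable borel" and km[measurable]: "k \<in> borel_measurable borel"
    and bd: "\<And>t. \<bar>e t\<bar> \<le> B" "\<And>t. \<bar>k t\<bar> \<le> B"
    and G: "AE t in lborel. t \<in> {0<..<T} \<longrightarrow> t \<in> G"
    and incr: "\<And>s t. s \<in> G \<Longrightarrow> t \<in> G \<Longrightarrow> 0 < s \<Longrightarrow> s \<le> t \<Longrightarrow> t < T \<Longrightarrow>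
      \<bar>e t - e s + (t - s) * (k t + k s)\<bar> \<le> B * (t - s)\<^sup>2"
  obtains c where "AE t in lebesgue_on {0<..<T}. e t = c - 2 * (LBINT s:{0..t}. k s)"
proof -
  have B: "B \<ge> 0" using bd(1)[of 0] by linarith
  have ki: "set_integrable lborel {0..T} (\<lambda>t. - 2 * k t)"
    unfolding set_integrable_def
  proof (rule Bochner_Integration.integrable_bound)
    show "integrable lborel (\<lambda>t. indicator {0..T} t *\<^sub>R (2 * B))"
      using borel_integrable_atLeastAtMost'[OF continuous_on_const] by (simp only: set_integrable_def)
    show "AE t in lborel. norm (indicator {0..T} t *\<^sub>R (- 2 * k t)) \<le> norm (indicator {0..T} t *\<^sub>R (2 * B))"
    proof (intro AE_I2)
      fix t show "norm (indicator {0..T} t *\<^sub>R (- 2 * k t)) \<le> norm (indicator {0..T} t *\<^sub>R (2 * B))"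
        using bd(2)[of t] B by (simp add: indicator_def abs_mult)
    qed
  qed measurable
  have cI: "integrable lborel (\<lambda>t. c * indicator {0..T} t)" for c :: real
    using borel_integrable_atLeastAtMost'[OF continuous_on_const, of 0 T c]
    by (simp add: set_integrable_def mult.commute)
  have fin: "finite_measure (lebesgue_on {0<..<T})" by (intro finite_measure_lebesgue_on) simp
  have ei: "integrable (lebesgue_on {0<..<T}) e"
  proof (rule finite_measure.integrable_const_bound[OF fin, where B=B])
    show "e \<in> borel_measurable (lebesgue_on {0<..<T})"
      by (intro measurable_restrict_space1 measurable_completion) simp
  qed (use bd in auto)
  have key: "(LINT t|lebesgue_on {0<..<T}. e t * frechet_derivative \<theta> (at t) 1) =
      - (LINT t|lebesgue_on {0<..<T}. (- 2 * k t) * \<theta> t)" if \<theta>: "\<theta> \<in> test_functions {0<..<T}" for \<theta>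
  proof -
    let ?d = "\<lambda>t. frechet_derivative \<theta> (at t) 1"
    have d: "?d \<in> test_functions {0<..<T}" using test_function_partial[OF \<theta>, of 1] by simp
    have \<theta>m[measurable]: "\<theta> \<in> borel_measurable borel" by (rule test_function_measurable[OF \<theta>])
    have dm[measurable]: "?d \<in> borel_measurable borel" by (rule test_function_measurable[OF d])
    obtain K where K: "compact K" "K \<subseteq> {0<..<T}" "\<And>t. t \<notin> K \<Longrightarrow> \<theta> t = 0" using test_functionE[OF \<theta>] by metis
    obtain b0 where b0: "b0 < T" "0 < b0" "\<And>t. t \<in> K \<Longrightarrow> t \<le> b0"
    proof (cases "K = {}")
      case True
      then show ?thesis using that[of "T/2"] T by auto
    next
      case False
      then obtain m where "m \<in> K" "\<And>t. t \<in> K \<Longrightarrow> t \<le> m" using compact_attains_sup[OF K(1)] by blast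
      then show ?thesis using that[of m] K(2) by auto
    qed
    have supp: "\<theta> t = 0" if "t \<notin> {0<..b0}" for t using K b0(3) that by fastforce
    obtain B1 where B1: "\<And>t. \<bar>\<theta> t\<bar> \<le> B1" using test_function_bounded[OF \<theta>] by metis
    obtain B2 where B2: "B2 \<ge> 0" "\<And>t. \<bar>?d t\<bar> \<le> B2" using test_function_bounded[OF d] by metis
    have B1': "B1 \<ge> 0" using B1[of 0] by linarith
    have der: "(\<theta> has_real_derivative ?d t) (at t)" for t by (rule real_test_function_derivative[OF \<theta>])
    have lip: "\<bar>\<theta> t - \<theta> (t - h)\<bar> \<le> B2 * h" if hp: "h > 0" for t h
    proof -
      obtain z where "\<theta> t - \<theta> (t - h) = (t - (t - h)) * ?d z" using MVT2[of "t - h" t \<theta> ?d] der hp by auto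
      then show ?thesis using B2(2)[of z] hp by (simp add: abs_mult mult.commute)
    qed
    have \<theta>i: "integrable lborel \<theta>" by (rule test_function_integrable[OF \<theta>])
    have shift: "integrable lborel (\<lambda>t. g (t + h))" "(LINT t|lborel. g (t + h)) = (LINT t|lborel. g t)"
      if "integrable lborel g" for g :: "real \<Rightarrow> real" and h
      using that lborel_integrable_real_affine[of g 1 h] lborel_integral_real_affine[of 1 g h] by (simp_all add: add.commute)
    have \<theta>hi: "integrable lborel (\<lambda>t. \<theta> (t - h))" for h using shift(1)[OF \<theta>i, of "- h"] by simp
    have mi: "integrable lborel (\<lambda>t. g t * \<theta> (t - h))" if "g \<in> borel_measurable borel" "\<And>t. \<bar>g t\<bar> \<le> B" for g :: "real \<Rightarrow> real" and h
      using integrable_mult_bounded[OF \<theta>hi[of h], of g B] that by (simp add: mult.commute)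
    define hs where "hs n = (T - b0) / 2 * inverse (real (Suc n))" for n
    have hpos: "hs n > 0" for n using b0 by (simp add: hs_def)
    have hle: "hs n \<le> (T - b0) / 2" for n unfolding hs_def using b0 by (intro mult_left_le) (auto simp: field_simps)
    have hlim: "hs \<longlonglongrightarrow> 0" unfolding hs_def[abs_def] using tendsto_mult[OF tendsto_const LIMSEQ_inverse_real_of_nat, of "(T - b0) / 2"] by simp
    \<comment> \<open>A backward difference quotient of \<theta> is used because a change of
      variables turns it into a forward increment of \<open>e\<close>.\<close>
    have lim1: "(\<lambda>n. LINT t|lborel. indicator {0..T} t * e t * ((\<theta> t - \<theta> (t - hs n)) / hs n)) \<longlonglongrightarrow> (LINT t|lborel. indicator {0..T} t * e t * ?d t)"
    proof (rule integral_dominated_convergence[where w="\<lambda>t. B * B2 * indicator {0..T} t"])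
      show "integrable lborel (\<lambda>t. B * B2 * indicator {0..T} t)"
        by (rule cI)
      show "AE t in lborel. (\<lambda>n. indicator {0..T} t * e t * ((\<theta> t - \<theta> (t - hs n)) / hs n)) \<longlonglongrightarrow> indicator {0..T} t * e t * ?d t"
      proof (intro AE_I2 tendsto_mult tendsto_const)
        fix t
        have "((\<lambda>h. (\<theta> (t + h) - \<theta> t) / h) \<longlongrightarrow> ?d t) (at 0)" using der[of t] by (simp add: DERIV_def)
        moreover have "filterlim (\<lambda>n. - hs n) (at 0) sequentially"
          using tendsto_minus[OF hlim] hpos by (intro filterlim_atI) (auto intro!: always_eventually simp: less_imp_neq[symmetric])
        ultimately have "(\<lambda>n. (\<theta> (t + - hs n) - \<theta> t) / (- hs n)) \<longlonglongrightarrow> ?d t" by (rule filterlim_compose)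
        then show "(\<lambda>n. (\<theta> t - \<theta> (t - hs n)) / hs n) \<longlonglongrightarrow> ?d t"
          by (simp add: minus_divide_left[symmetric] minus_divide_right[symmetric] diff_divide_distrib)
      qed
      show "AE t in lborel. norm (indicator {0..T} t * e t * ((\<theta> t - \<theta> (t - hs n)) / hs n)) \<le> B * B2 * indicator {0..T} t" for n
      proof (intro AE_I2)
        fix t
        have "\<bar>(\<theta> t - \<theta> (t - hs n)) / hs n\<bar> \<le> B2"          unfolding abs_divide abs_of_pos[OF hpos[of n]] pos_divide_le_eq[OF hpos[of n]] by (rule lip[OF hpos])
        then have "\<bar>e t\<bar> * \<bar>(\<theta> t - \<theta> (t - hs n)) / hs n\<bar> \<le> B * B2" using bd(1) B by (intro mult_mono) auto
        then show "norm (indicator {0..T} t * e t * ((\<theta> t - \<theta> (t - hs n)) / hs n)) \<le> B * B2 * indicator {0..T} t"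
          by (simp add: abs_mult indicator_def)
      qed
    qed measurable
    have lim2: "(\<lambda>n. (LINT t|lborel. k t * \<theta> (t - hs n)) + (LINT t|lborel. k t * \<theta> t)) \<longlonglongrightarrow> 2 * (LINT t|lborel. k t * \<theta> t)"
    proof -
      have "(\<lambda>n. LINT t|lborel. k t * \<theta> (t - hs n)) \<longlonglongrightarrow> (LINT t|lborel. k t * \<theta> t)"
      proof (rule integral_dominated_convergence[where w="\<lambda>t. B * B1 * indicator {0..T} t"])
        show "integrable lborel (\<lambda>t. B * B1 * indicator {0..T} t)"
          by (rule cI)
        show "AE t in lborel. (\<lambda>n. k t * \<theta> (t - hs n)) \<longlonglongrightarrow> k t * \<theta> t"
        proof (intro AE_I2 tendsto_mult tendsto_const)
          fix t
          have "(\<lambda>n. t - hs n) \<longlonglongrightarrow> t - 0" by (intro tendsto_intros hlim)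
          then show "(\<lambda>n. \<theta> (t - hs n)) \<longlonglongrightarrow> \<theta> t"
            using isCont_tendsto_compose[OF DERIV_isCont[OF der]] by simp
        qed
        show "AE t in lborel. norm (k t * \<theta> (t - hs n)) \<le> B * B1 * indicator {0..T} t" for n
        proof (intro AE_I2)
          fix t
          have 1: "\<bar>k t\<bar> * \<bar>\<theta> (t - hs n)\<bar> \<le> B * B1" using bd(2) B1 B by (intro mult_mono) auto
          have "\<theta> (t - hs n) = 0" if "t \<notin> {0..T}"
            using that hle[of n] hpos[of n] by (intro supp) auto
          then show "norm (k t * \<theta> (t - hs n)) \<le> B * B1 * indicator {0..T} t"
            using 1 by (cases "t \<in> {0..T}") (auto simp: abs_mult)
        qed
      qed measurable
      from tendsto_add[OF this tendsto_const] show ?thesis unfolding mult_2 .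
    qed
    \<comment> \<open>Summation by parts: after shifting, only \<theta> t times the increment of
      \<open>e\<close> and of the trapezoidal sum of \<open>k\<close> remains, to which
      \<open>incr\<close> applies. Dividing its quadratic bound by the step leaves an error linear
      in the step.\<close>
    have close: "\<bar>(LINT t|lborel. indicator {0..T} t * e t * ((\<theta> t - \<theta> (t - hs n)) / hs n)) -
        ((LINT t|lborel. k t * \<theta> (t - hs n)) + (LINT t|lborel. k t * \<theta> t))\<bar> \<le> B * B1 * T * hs n" for n
    proof -
      let ?\<delta> = "hs n"
      note h = hpos[of n] hle[of n]
      have \<theta>T: "indicator {0..T} t * \<theta> t = \<theta> t" "indicator {0..T} t * \<theta> (t - ?\<delta>) = \<theta> (t - ?\<delta>)" for t
      proof -
        show "indicator {0..T} t * \<theta> t = \<theta> t"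
          using supp[of t] b0(1) by (cases "t \<in> {0<..b0}") auto
        have "t \<in> {0..T}" if "t - ?\<delta> \<in> {0<..b0}"
        proof -
          have "0 < t - ?\<delta>" "t - ?\<delta> \<le> b0" using that by auto
          then have "0 \<le> t" "t \<le> T" using b0(1) h by (auto simp: field_simps)
          then show ?thesis by simp
        qed
        then show "indicator {0..T} t * \<theta> (t - ?\<delta>) = \<theta> (t - ?\<delta>)"
          using supp[of "t - ?\<delta>"] by (cases "t - ?\<delta> \<in> {0<..b0}") auto
      qed
      have em0: "integrable lborel (\<lambda>t. e t * \<theta> t)" using mi[of e 0] bd by simp
      have km0: "integrable lborel (\<lambda>t. k t * \<theta> t)" using mi[of k 0] bd by simp
      have eh: "integrable lborel (\<lambda>t. e t * \<theta> (t - ?\<delta>))" using mi[of e] bd by simp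
      have kh: "integrable lborel (\<lambda>t. k t * \<theta> (t - ?\<delta>))" using mi[of k] bd by simp
      have seh: "(LINT t|lborel. e t * \<theta> (t - ?\<delta>)) = (LINT t|lborel. e (t + ?\<delta>) * \<theta> t)" "integrable lborel (\<lambda>t. e (t + ?\<delta>) * \<theta> t)"
        using shift[OF eh, of ?\<delta>] by simp_all
      have skh: "(LINT t|lborel. k t * \<theta> (t - ?\<delta>)) = (LINT t|lborel. k (t + ?\<delta>) * \<theta> t)" "integrable lborel (\<lambda>t. k (t + ?\<delta>) * \<theta> t)"
        using shift[OF kh, of ?\<delta>] by simp_all
      have "(LINT t|lborel. indicator {0..T} t * e t * ((\<theta> t - \<theta> (t - ?\<delta>)) / ?\<delta>)) = (LINT t|lborel. (e t * \<theta> t - e t * \<theta> (t - ?\<delta>)) / ?\<delta>)"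
      proof (rule arg_cong[where f="integral\<^sup>L lborel"], rule ext)
        fix t
        have "indicator {0..T} t * e t * ((\<theta> t - \<theta> (t - ?\<delta>)) / ?\<delta>) =
            e t * ((indicator {0..T} t * \<theta> t - indicator {0..T} t * \<theta> (t - ?\<delta>)) / ?\<delta>)"
          by (simp add: diff_divide_distrib algebra_simps)
        also have "\<dots> = (e t * \<theta> t - e t * \<theta> (t - ?\<delta>)) / ?\<delta>"
          unfolding \<theta>T by (simp add: diff_divide_distrib right_diff_distrib)
        finally show "indicator {0..T} t * e t * ((\<theta> t - \<theta> (t - ?\<delta>)) / ?\<delta>) = (e t * \<theta> t - e t * \<theta> (t - ?\<delta>)) / ?\<delta>" .
      qed
      also have "\<dots> = ((LINT t|lborel. e t * \<theta> t) - (LINT t|lborel. e (t + ?\<delta>) * \<theta> t)) / ?\<delta>"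
        using em0 eh seh by simp
      finally have A: "(LINT t|lborel. indicator {0..T} t * e t * ((\<theta> t - \<theta> (t - ?\<delta>)) / ?\<delta>)) =
        ((LINT t|lborel. e t * \<theta> t) - (LINT t|lborel. e (t + ?\<delta>) * \<theta> t)) / ?\<delta>" .
      have "((LINT t|lborel. e t * \<theta> t) - (LINT t|lborel. e (t + ?\<delta>) * \<theta> t)) / ?\<delta> -
          ((LINT t|lborel. k t * \<theta> (t - ?\<delta>)) + (LINT t|lborel. k t * \<theta> t)) =
          (LINT t|lborel. (e t * \<theta> t - e (t + ?\<delta>) * \<theta> t) / ?\<delta> - (k (t + ?\<delta>) * \<theta> t + k t * \<theta> t))"
        using em0 seh km0 skh by simp
      then have eq: "(LINT t|lborel. indicator {0..T} t * e t * ((\<theta> t - \<theta> (t - ?\<delta>)) / ?\<delta>)) -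
        ((LINT t|lborel. k t * \<theta> (t - ?\<delta>)) + (LINT t|lborel. k t * \<theta> t)) =
          (LINT t|lborel. (e t * \<theta> t - e (t + ?\<delta>) * \<theta> t) / ?\<delta> - (k (t + ?\<delta>) * \<theta> t + k t * \<theta> t))"
        unfolding A .
      have Gh: "AE t in lborel. t + ?\<delta> \<in> {0<..<T} \<longrightarrow> t + ?\<delta> \<in> G"
      proof -
        have "AE t in distr lborel borel ((+) ?\<delta>). t \<in> {0<..<T} \<longrightarrow> t \<in> G" by (subst lborel_distr_plus) (rule G)
        from AE_distrD[OF _ this] have "AE t in lborel. ?\<delta> + t \<in> {0<..<T} \<longrightarrow> ?\<delta> + t \<in> G" by simp
        then show ?thesis by (simp only: add.commute)
      qed
      let ?E = "\<lambda>t. (e t * \<theta> t - e (t + ?\<delta>) * \<theta> t) / ?\<delta> - (k (t + ?\<delta>) * \<theta> t + k t * \<theta> t)"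
      have Ei: "integrable lborel ?E" using em0 seh km0 skh by simp
      have "\<bar>LINT t|lborel. ?E t\<bar> \<le> (LINT t|lborel. norm (?E t))"
        using integral_norm_bound[of lborel ?E] by (simp only: real_norm_def)
      also have "\<dots> \<le> (LINT t|lborel. B * B1 * ?\<delta> * indicator {0..T} t)"
      proof (rule integral_mono_AE)
        show "integrable lborel (\<lambda>t. norm (?E t))" using Ei by (rule integrable_norm)
        show "integrable lborel (\<lambda>t. B * B1 * ?\<delta> * indicator {0..T} t)"
          by (rule cI)
        have "AE t in lborel. \<bar>(e t * \<theta> t - e (t + ?\<delta>) * \<theta> t) / ?\<delta> - (k (t + ?\<delta>) * \<theta> t + k t * \<theta> t)\<bar> \<le> B * B1 * ?\<delta> * indicator {0..T} t"
          using G Gh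
        proof eventually_elim
          case (elim t)
          show ?case
          proof (cases "t \<in> {0<..b0}")
            case True
            have "t + ?\<delta> < T" using True b0(1) h(2) by (auto simp: field_simps)
            then have t: "0 < t" "t < T" "t + ?\<delta> < T" "t \<in> G" "t + ?\<delta> \<in> G"
          proof -
            have 1: "0 < t" "t \<le> b0" using True by auto
            then have 2: "t < T" "0 < t + ?\<delta>" using b0(1) h(1) by auto
            show "0 < t" "t < T" "t + ?\<delta> < T" "t \<in> G" "t + ?\<delta> \<in> G"
              using elim 1 2 \<open>t + ?\<delta> < T\<close> by auto
          qed
            have "\<bar>e (t + ?\<delta>) - e t + ?\<delta> * (k (t + ?\<delta>) + k t)\<bar> \<le> B * ?\<delta>\<^sup>2"
              using incr[OF t(4,5) t(1) _ t(3)] h(1) by simp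
            moreover have "(e t * \<theta> t - e (t + ?\<delta>) * \<theta> t) / ?\<delta> - (k (t + ?\<delta>) * \<theta> t + k t * \<theta> t) =
                - (\<theta> t * (e (t + ?\<delta>) - e t + ?\<delta> * (k (t + ?\<delta>) + k t))) / ?\<delta>"
              using h by (simp add: field_simps)
            ultimately have "\<bar>(e t * \<theta> t - e (t + ?\<delta>) * \<theta> t) / ?\<delta> - (k (t + ?\<delta>) * \<theta> t + k t * \<theta> t)\<bar> \<le> B1 * (B * ?\<delta>\<^sup>2) / ?\<delta>"
              using B1[of t] h B1' by (auto simp: abs_mult intro!: divide_right_mono mult_mono)
            also have "\<dots> = B * B1 * ?\<delta>" using h by (simp add: power2_eq_square)
            finally show ?thesis using t by simp
          next
            case False
            then have "\<theta> t = 0" by (rule supp)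
            moreover have "0 \<le> B * B1 * ?\<delta> * indicator {0..T} t"
              using B B1' h(1) by (intro mult_nonneg_nonneg) auto
            ultimately show ?thesis by simp
          qed
        qed
        then show "AE t in lborel. norm ((e t * \<theta> t - e (t + ?\<delta>) * \<theta> t) / ?\<delta> - (k (t + ?\<delta>) * \<theta> t + k t * \<theta> t)) \<le> B * B1 * ?\<delta> * indicator {0..T} t"
          by (simp only: real_norm_def)
      qed
      also have "\<dots> = B * B1 * T * ?\<delta>" using T by (simp add: mult_ac)
      finally show ?thesis unfolding eq .
    qed
    have "(\<lambda>n. B * B1 * T * hs n) \<longlonglongrightarrow> B * B1 * T * 0" by (intro tendsto_mult tendsto_const hlim)
    then have lim0: "(\<lambda>n. B * B1 * T * hs n) \<longlonglongrightarrow> 0" by simp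
    have "(\<lambda>n. (LINT t|lborel. indicator {0..T} t * e t * ((\<theta> t - \<theta> (t - hs n)) / hs n)) -
        ((LINT t|lborel. k t * \<theta> (t - hs n)) + (LINT t|lborel. k t * \<theta> t))) \<longlonglongrightarrow> 0"
      by (rule Lim_null_comparison[OF always_eventually lim0], rule allI) (simp only: real_norm_def close)
    from LIMSEQ_unique[OF this tendsto_diff[OF lim1 lim2]]
    have *: "(LINT t|lborel. indicator {0..T} t * e t * ?d t) = 2 * (LINT t|lborel. k t * \<theta> t)" by simp
    have S: "{0<..<T} \<in> sets lebesgue" by simp
    have "(LINT t|lebesgue_on {0<..<T}. e t * ?d t) = (LINT t|lborel. e t * ?d t)"
      using test_function_zero_outside[OF d] by (intro lebesgue_on_integral_eq_lborel[OF S]) auto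
    also have "\<dots> = (LINT t|lborel. indicator {0..T} t * e t * ?d t)"
    proof (rule Bochner_Integration.integral_cong[OF refl])
      fix t show "e t * ?d t = indicator {0..T} t * e t * ?d t"
        using test_function_zero_outside[OF d, of t] by (cases "t \<in> {0<..<T}") auto
    qed
    also have "\<dots> = 2 * (LINT t|lborel. k t * \<theta> t)" by (rule *)
    also have "(LINT t|lborel. k t * \<theta> t) = (LINT t|lebesgue_on {0<..<T}. k t * \<theta> t)"
      using test_function_zero_outside[OF \<theta>] by (intro lebesgue_on_integral_eq_lborel[OF S, symmetric]) auto
    finally show ?thesis
      using integral_mult_right_zero[of "lebesgue_on {0<..<T}" "-2" "\<lambda>t. k t * \<theta> t"]
      by (simp only: mult.assoc)
  qed
  have m: "(\<lambda>t. - 2 * k t) \<in> borel_measurable borel" by measurable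
  obtain c where c: "AE t in lebesgue_on {0<..<T}. e t = c + (LBINT s:{0..t}. - 2 * k s)"
    by (rule du_Bois_Reymond[OF T ei ki m key])
  have "c + (LBINT s:{0..t}. - 2 * k s) = c - 2 * (LBINT s:{0..t}. k s)" for t
    using set_integral_mult_right[of lborel "{0..t}" "-2" k] by simp
  with c have "AE t in lebesgue_on {0<..<T}. e t = c - 2 * (LBINT s:{0..t}. k s)"
    by (simp only:)
  then show thesis by (rule that)
qed

section \<open>The energy identity\<close>

lemma abs_powr_has_real_derivative:
  fixes y :: real
  assumes "1 < p"
  shows "((\<lambda>y. \<bar>y\<bar> powr p) has_real_derivative p * (\<bar>y\<bar> powr (p - 2) * y)) (at y)"
proof -
  consider "y > 0" | "y < 0" | "y = 0" by linarith
  then show ?thesis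
  proof cases
    case 1
    have "((\<lambda>y. y powr p) has_real_derivative p * y powr (p - 1)) (at y)"
      using has_real_derivative_powr[OF 1] by simp
    moreover have "y powr (p - 1) = y powr (p - 2) * y"
      using 1 powr_add[of y "p - 2" 1] by simp
    ultimately have "((\<lambda>y. y powr p) has_real_derivative p * (\<bar>y\<bar> powr (p - 2) * y)) (at y)" using 1 by simp
    then show ?thesis
      by (rule has_field_derivative_transform_within_open[of _ _ _ "{0<..}"]) (use 1 in auto)
  next
    case 2
    have "((\<lambda>y. (- y) powr p) has_real_derivative p * (- y) powr (p - 1) * (- 1)) (at y)"
      by (rule DERIV_chain2[where f="\<lambda>y. y powr p" and g="\<lambda>y. - y"])
         (use 2 has_real_derivative_powr[of "- y" p] in \<open>auto intro!: derivative_eq_intros\<close>)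
    moreover have "(- y) powr (p - 1) = (- y) powr (p - 2) * (- y)"
      using 2 powr_add[of "- y" "p - 2" 1] by simp
    ultimately have "((\<lambda>y. (- y) powr p) has_real_derivative p * (\<bar>y\<bar> powr (p - 2) * y)) (at y)" using 2 by simp
    then show ?thesis
      by (rule has_field_derivative_transform_within_open[of _ _ _ "{..<0}"]) (use 2 in auto)
  next
    case 3
    \<comment> \<open>At 0 the difference quotient has modulus
      \<open>\<bar>h\<bar> powr (p - 1)\<close>, which tends to 0 since p > 1.\<close>
    have "((\<lambda>h::real. \<bar>h\<bar> powr (p - 1)) \<longlongrightarrow> \<bar>0\<bar> powr (p - 1)) (at 0)"
      by (rule tendsto_powr2) (use assms in \<open>auto intro!: tendsto_intros tendsto_rabs_zero\<close>)
    then have "((\<lambda>h::real. \<bar>h\<bar> powr (p - 1)) \<longlongrightarrow> 0) (at 0)" using assms by simp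
    moreover have "\<forall>\<^sub>F h in at 0. norm ((\<bar>0 + h\<bar> powr p - \<bar>0\<bar> powr p) / h) \<le> \<bar>h\<bar> powr (p - 1)"
      unfolding eventually_at_filter
    proof (intro always_eventually allI impI)
      fix h :: real assume "h \<noteq> 0"
      then show "norm ((\<bar>0 + h\<bar> powr p - \<bar>0\<bar> powr p) / h) \<le> \<bar>h\<bar> powr (p - 1)"
        using assms by (simp add: powr_diff)
    qed
    ultimately have "((\<lambda>h. (\<bar>0 + h\<bar> powr p - \<bar>0\<bar> powr p) / h) \<longlongrightarrow> 0) (at (0::real))"
      by (rule Lim_null_comparison[rotated])
    then show ?thesis using 3 by (simp add: DERIV_def)
  qed
qed

lemma continuous_on_abs_powr_mult: "2 < p \<Longrightarrow> continuous_on S (\<lambda>y::real. p * (\<bar>y\<bar> powr (p - 2) * y))"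
  by (intro continuous_intros continuous_on_powr') auto

text \<open>Used to identify constants of integration: properties known at almost all times are
  evaluated at times tending to 0.\<close>

lemma ex_small_time:
  fixes P :: "real \<Rightarrow> bool"
  assumes "AE t in lborel. t \<in> {0<..<T} \<longrightarrow> P t" "0 < \<delta>" "\<delta> \<le> T"
  obtains t where "0 < t" "t < \<delta>" "P t"
proof (rule ccontr)
  assume "\<not> thesis"
  then have *: "\<And>t. 0 < t \<Longrightarrow> t < \<delta> \<Longrightarrow> \<not> P t" using that by blast
  have "AE t in lborel. t \<notin> {0<..<\<delta>}"
    using assms(1) by eventually_elim (use * assms(3) in auto)
  then have "{0<..<\<delta>} \<in> null_sets lborel" by (subst AE_iff_null_sets) auto
  then show False using assms(2) null_setsD1[of "{0<..<\<delta>}" lborel] by simp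
qed

section \<open>Integration over the product of time and space\<close>

locale space_time = finite_measure M for M :: "'a measure" and T :: real +
  assumes T: "0 < T"
begin

text \<open>Borel sets in time keep the product with \<open>M\<close> compatible with joint
  measurability. The interval is closed to match the integrals over \<open>{0..t}\<close>; its
  endpoints are null.\<close>

definition N :: "real measure" where "N = restrict_space lborel {0..T}"

lemma space_N[simp]: "space N = {0..T}"
  by (simp add: N_def)

lemma finite_N: "finite_measure N"
  unfolding N_def by (intro finite_measureI) (use T in \<open>simp add: emeasure_restrict_space\<close>)

lemma sigma_finite_NM: "pair_sigma_finite N M"
proof -
  interpret N: finite_measure N by (rule finite_N)
  show ?thesis by unfold_locales
qed

lemma AE_N: "(AE t in N. P t) \<longleftrightarrow> (AE t in lborel. t \<in> {0<..<T} \<longrightarrow> P t)"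
proof -
  have "(AE t in N. P t) \<longleftrightarrow> (AE t in lborel. t \<in> {0..T} \<longrightarrow> P t)"
    unfolding N_def by (subst AE_restrict_space_iff) auto
  also have "\<dots> \<longleftrightarrow> (AE t in lborel. t \<in> {0<..<T} \<longrightarrow> P t)"
  proof
    assume "AE t in lborel. t \<in> {0..T} \<longrightarrow> P t"
    then show "AE t in lborel. t \<in> {0<..<T} \<longrightarrow> P t" by eventually_elim auto
  next
    assume "AE t in lborel. t \<in> {0<..<T} \<longrightarrow> P t"
    then show "AE t in lborel. t \<in> {0..T} \<longrightarrow> P t"
      using AE_lborel_singleton[of 0] AE_lborel_singleton[of T] by eventually_elim auto
  qed
  finally show ?thesis .
qed

abbreviation Q :: "(real \<times> 'a) measure" where "Q \<equiv> N \<Otimes>\<^sub>M M"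

lemma measurable_Q:
  assumes "(\<lambda>(t, x). h t x) \<in> borel_measurable (lborel \<Otimes>\<^sub>M M)"
  shows "(\<lambda>(t, x). h t x) \<in> borel_measurable Q"
proof -
  have "(\<lambda>z. (fst z, snd z)) \<in> Q \<rightarrow>\<^sub>M lborel \<Otimes>\<^sub>M M"
    by (intro measurable_Pair measurable_snd measurable_compose[OF measurable_fst])
       (auto simp: N_def intro!: measurable_restrict_space1)
  from measurable_compose[OF this assms] show ?thesis by simp
qed

lemma N_eq_set_integral:
  fixes f :: "real \<Rightarrow> real"
  shows "integrable N f \<longleftrightarrow> set_integrable lborel {0..T} f"
    and "t \<le> T \<Longrightarrow> (LINT s|N. indicator {0..t} s * f s) = (LBINT s:{0..t}. f s)"
proof -
  show "integrable N f \<longleftrightarrow> set_integrable lborel {0..T} f"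
    unfolding N_def set_integrable_def by (subst integrable_restrict_space) auto
  assume t: "t \<le> T"
  have "(LINT s|N. indicator {0..t} s * f s) = (LINT s|lborel. indicator {0..T} s *\<^sub>R (indicator {0..t} s * f s))"
    unfolding N_def by (subst integral_restrict_space) auto
  also have "\<dots> = (LBINT s:{0..t}. f s)"
    unfolding set_lebesgue_integral_def
    by (intro Bochner_Integration.integral_cong) (use t in \<open>auto simp: indicator_def\<close>)
  finally show "(LINT s|N. indicator {0..t} s * f s) = (LBINT s:{0..t}. f s)" .
qed

lemma Fubini_Q:
  fixes h :: "real \<Rightarrow> 'a \<Rightarrow> real"
  assumes h: "integrable Q (\<lambda>(t, x). h t x)" and t: "t \<in> {0..T}"
  shows "integrable M (\<lambda>x. LBINT s:{0..t}. h s x)"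
    and "(LINT x|M. (LBINT s:{0..t}. h s x)) = (LBINT s:{0..t}. (LINT x|M. h s x))"
    and "set_integrable lborel {0..T} (\<lambda>s. LINT x|M. h s x)"
    and "AE x in M. set_integrable lborel {0..T} (\<lambda>s. h s x)"
    and "AE s in N. integrable M (h s)"
proof -
  interpret Q: pair_sigma_finite N M by (rule sigma_finite_NM)
  show "set_integrable lborel {0..T} (\<lambda>s. LINT x|M. h s x)"
    using Q.integrable_fst[OF h] by (simp add: N_eq_set_integral)
  show "AE x in M. set_integrable lborel {0..T} (\<lambda>s. h s x)"
    using Q.AE_integrable_snd[OF h] by (simp add: N_eq_set_integral)
  show "AE s in N. integrable M (h s)" using Q.AE_integrable_fst[OF h] by simp
  have "integrable Q (\<lambda>z. (case z of (s, x) \<Rightarrow> h s x) * indicator {0..t} (fst z))"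
    by (rule integrable_mult_bounded[OF h, where B=1])
       (auto simp: indicator_def N_def intro!: measurable_If measurable_compose[OF measurable_fst] measurable_restrict_space1)
  then have ht: "integrable Q (\<lambda>(s, x). indicator {0..t} s * h s x)"
    by (simp add: case_prod_beta' mult.commute)
  have tT: "t \<le> T" using t by simp
  show "integrable M (\<lambda>x. LBINT s:{0..t}. h s x)"
    using Q.integrable_snd[OF ht] by (simp add: N_eq_set_integral(2)[OF tT])
  show "(LINT x|M. (LBINT s:{0..t}. h s x)) = (LBINT s:{0..t}. (LINT x|M. h s x))"
    using Q.Fubini_integral[OF ht] by (simp add: N_eq_set_integral(2)[OF tT])
qed

text \<open>A bound on almost all slices, uniform in time, suffices because the time interval has
  finite length.\<close>

lemma integrable_Q_bounded:
  fixes h :: "real \<Rightarrow> 'a \<Rightarrow> real"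
  assumes "(\<lambda>(t, x). h t x) \<in> borel_measurable Q"
    and "AE t in N. (\<integral>\<^sup>+x. ennreal \<bar>h t x\<bar> \<partial>M) \<le> ennreal K"
  shows "integrable Q (\<lambda>(t, x). h t x)"
proof (rule integrableI_bounded[OF assms(1)])
  interpret N: finite_measure N by (rule finite_N)
  have "(\<integral>\<^sup>+z. ennreal (norm (case z of (t, x) \<Rightarrow> h t x)) \<partial>Q) = (\<integral>\<^sup>+t. \<integral>\<^sup>+x. ennreal (norm (h t x)) \<partial>M \<partial>N)"
    using assms(1) by (subst nn_integral_fst[symmetric]) (auto simp: case_prod_beta)
  also have "\<dots> \<le> (\<integral>\<^sup>+t. ennreal K \<partial>N)"
    by (rule nn_integral_mono_AE) (use assms(2) in simp)
  also have "\<dots> = ennreal K * emeasure N (space N)" by simp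
  also have "\<dots> < \<infinity>"
    using N.emeasure_finite[of "space N"] by (auto simp: ennreal_mult_eq_top_iff less_top[symmetric])
  finally show "(\<integral>\<^sup>+z. ennreal (norm (case z of (t, x) \<Rightarrow> h t x)) \<partial>Q) < \<infinity>" .
qed

text \<open>Joint measurability of both functions makes the set of equality measurable, so that
  slicewise null sets combine to a null set of the product.\<close>

lemma AE_Q:
  assumes "(\<lambda>(t, x). f t x) \<in> borel_measurable Q" "(\<lambda>(t, x). g t x) \<in> borel_measurable Q"
    and "AE t in N. AE x in M. f t x = (g t x :: real)"
  shows "AE z in Q. f (fst z) (snd z) = g (fst z) (snd z)"
proof -
  interpret Q: pair_sigma_finite N M by (rule sigma_finite_NM)
  have "{z \<in> space Q. (case z of (t, x) \<Rightarrow> f t x) = (case z of (t, x) \<Rightarrow> g t x)} \<in> sets Q"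
    using assms(1,2) by measurable
  then show ?thesis
    using assms(3) by (intro Q.AE_pair_measure) (auto simp: case_prod_beta)
qed

lemma L2_slice:
  fixes f :: "'a \<Rightarrow> real"
  assumes "(\<integral>\<^sup>+x. ennreal ((f x)\<^sup>2) \<partial>M) \<le> ennreal C" "f \<in> borel_measurable M"
  shows "integrable M (\<lambda>x. (f x)\<^sup>2)" "(LINT x|M. (f x)\<^sup>2) \<le> max 0 C"
proof -
  have "(\<integral>\<^sup>+x. ennreal (norm ((f x)\<^sup>2)) \<partial>M) < \<infinity>"
    using assms(1) by (simp add: le_less_trans)
  then show *: "integrable M (\<lambda>x. (f x)\<^sup>2)"
    using assms(2) by (intro integrableI_bounded) auto
  have "ennreal (LINT x|M. (f x)\<^sup>2) \<le> ennreal (max 0 C)"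
    using assms(1) nn_integral_eq_integral[OF *] by (simp add: ennreal_max_0)
  then show "(LINT x|M. (f x)\<^sup>2) \<le> max 0 C" by (subst (asm) ennreal_le_iff) auto
qed

text \<open>With the upper limit moved into the integrand as the condition s \<le> t, this is an
  ordinary integral depending on a parameter.\<close>

lemma set_integral_measurable:
  fixes h :: "real \<Rightarrow> 'a \<Rightarrow> real"
  assumes "(\<lambda>(t, x). h t x) \<in> borel_measurable (lborel \<Otimes>\<^sub>M M)"
  shows "(\<lambda>(t, x). LBINT s:{0..t}. (h s x :: real)) \<in> borel_measurable (lborel \<Otimes>\<^sub>M M)"
proof -
  note assms[measurable]
  have hm: "(\<lambda>z. h (snd z) (snd (fst z))) \<in> borel_measurable ((lborel \<Otimes>\<^sub>M M) \<Otimes>\<^sub>M lborel)"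
    using measurable_compose[OF _ assms, of "\<lambda>z. (snd z, snd (fst z))" "(lborel \<Otimes>\<^sub>M M) \<Otimes>\<^sub>M lborel"] by simp
  have m1[measurable]: "(\<lambda>z. fst (fst z)) \<in> borel_measurable (((lborel :: real measure) \<Otimes>\<^sub>M M) \<Otimes>\<^sub>M lborel)"
    using measurable_compose[OF measurable_fst measurable_fst, of "lborel :: real measure" M "lborel :: real measure"] by simp
  have m2[measurable]: "(\<lambda>z. snd z) \<in> borel_measurable (((lborel :: real measure) \<Otimes>\<^sub>M M) \<Otimes>\<^sub>M (lborel :: real measure))"
    using measurable_snd[of "(lborel :: real measure) \<Otimes>\<^sub>M M" "lborel :: real measure"] by simp
  have "(\<lambda>z. LINT s|lborel. (if 0 \<le> s \<and> s \<le> fst z then h s (snd z) else 0)) \<in> borel_measurable (lborel \<Otimes>\<^sub>M M)"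
  proof (rule lborel.borel_measurable_lebesgue_integral)
    let ?S = "((lborel :: real measure) \<Otimes>\<^sub>M M) \<Otimes>\<^sub>M (lborel :: real measure)"
    let ?A = "{z \<in> space ?S. 0 \<le> snd z} \<inter> {z \<in> space ?S. snd z \<le> fst (fst z)}"
    have "?A \<in> sets ?S"
      by (intro sets.Int borel_measurable_le[OF borel_measurable_const m2] borel_measurable_le[OF m2 m1])
    then have "(\<lambda>z. indicator ?A z * h (snd z) (snd (fst z))) \<in> borel_measurable ?S"
      by (intro borel_measurable_times borel_measurable_indicator hm)
    then show "(\<lambda>(z, s). if 0 \<le> s \<and> s \<le> fst z then h s (snd z) else 0) \<in> borel_measurable ?S"
      by (rule measurable_cong[THEN iffD1, rotated]) (auto simp: indicator_def)
  qed
  moreover have "(LINT s|lborel. (if 0 \<le> s \<and> s \<le> fst z then h s (snd z) else 0)) = (LBINT s:{0..fst z}. h s (snd z))" for z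
    unfolding set_lebesgue_integral_def by (intro Bochner_Integration.integral_cong) (auto simp: indicator_def)
  ultimately show ?thesis by (simp add: case_prod_beta)
qed

lemma prod_Q:
  fixes f g :: "real \<Rightarrow> 'a \<Rightarrow> real"
  assumes "(\<lambda>(t, x). f t x) \<in> borel_measurable Q" "(\<lambda>(t, x). g t x) \<in> borel_measurable Q"
    "integrable Q (\<lambda>(t, x). (f t x)\<^sup>2)" "integrable Q (\<lambda>(t, x). (g t x)\<^sup>2)"
  shows "integrable Q (\<lambda>(t, x). f t x * g t x)"
  using L2_mult_integrable[of "\<lambda>(t, x). f t x" Q "\<lambda>(t, x). g t x"] assms by (simp add: case_prod_beta')

end

section \<open>The equation over an abstract space variable\<close>

text \<open>\<open>v\<close>, \<open>w\<close> and \<open>L\<close> stand for \<open>u\<^sub>t\<close>, \<open>u\<^sub>t\<^sub>t\<close> and \<open>\<Delta>u\<close>. The space variable enters through the measure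
  \<open>M\<close> only: integration by parts in space is condensed into \<open>sym\<close> and \<open>sym0\<close>.\<close>

locale damped_wave = space_time M T for M :: "'a measure" and T :: real +
  fixes p q C :: real and u v w L :: "real \<Rightarrow> 'a \<Rightarrow> real" and u0 u1 L0 :: "'a \<Rightarrow> real" and G :: "real set"
  assumes p: "2 < p" and q: "2 < q"
    and meas[measurable]: "(\<lambda>(t, x). u t x) \<in> borel_measurable (lborel \<Otimes>\<^sub>M M)" "(\<lambda>(t, x). v t x) \<in> borel_measurable (lborel \<Otimes>\<^sub>M M)"
      "(\<lambda>(t, x). w t x) \<in> borel_measurable (lborel \<Otimes>\<^sub>M M)" "(\<lambda>(t, x). L t x) \<in> borel_measurable (lborel \<Otimes>\<^sub>M M)"
    and init_meas[measurable]: "u0 \<in> borel_measurable M" "u1 \<in> borel_measurable M" "L0 \<in> borel_measurable M"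
    and init_L2: "integrable M (\<lambda>x. (u0 x)\<^sup>2)" "integrable M (\<lambda>x. (u1 x)\<^sup>2)" "integrable M (\<lambda>x. (L0 x)\<^sup>2)"
    and L2: "AE t in lborel. t \<in> {0<..<T} \<longrightarrow> (\<integral>\<^sup>+x. ennreal ((u t x)\<^sup>2) \<partial>M) \<le> ennreal C"
      "AE t in lborel. t \<in> {0<..<T} \<longrightarrow> (\<integral>\<^sup>+x. ennreal ((v t x)\<^sup>2) \<partial>M) \<le> ennreal C"
      "AE t in lborel. t \<in> {0<..<T} \<longrightarrow> (\<integral>\<^sup>+x. ennreal ((w t x)\<^sup>2) \<partial>M) \<le> ennreal C"
      "AE t in lborel. t \<in> {0<..<T} \<longrightarrow> (\<integral>\<^sup>+x. ennreal ((L t x)\<^sup>2) \<partial>M) \<le> ennreal C"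
    and Lq: "AE t in lborel. t \<in> {0<..<T} \<longrightarrow> (\<integral>\<^sup>+x. ennreal (\<bar>v t x\<bar> powr q) \<partial>M) \<le> ennreal C"
    and equation: "AE t in lborel. t \<in> {0<..<T} \<longrightarrow> (AE x in M. w t x - L t x + v t x * ln (1 + (v t x)\<^sup>2) = \<bar>u t x\<bar> powr (p - 2) * u t x)"
    and u_rep: "AE t in lborel. t \<in> {0<..<T} \<longrightarrow> (AE x in M. u t x = u0 x + (LBINT s:{0..t}. v s x))"
    and v_rep: "AE t in lborel. t \<in> {0<..<T} \<longrightarrow> (AE x in M. v t x = u1 x + (LBINT s:{0..t}. w s x))"
    and G: "AE t in lborel. t \<in> {0<..<T} \<longrightarrow> t \<in> G"
    and sym: "\<And>s t. s \<in> G \<Longrightarrow> t \<in> G \<Longrightarrow> (LINT x|M. L s x * u t x) = (LINT x|M. L t x * u s x)"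
    and sym0: "\<And>t. t \<in> G \<Longrightarrow> (LINT x|M. L0 x * u t x) = (LINT x|M. L t x * u0 x)"
begin

lemmas L2_N = L2[folded AE_N] and Lq_N = Lq[folded AE_N] and equation_N = equation[folded AE_N]
  and u_rep_N = u_rep[folded AE_N] and v_rep_N = v_rep[folded AE_N] and G_N = G[folded AE_N]

text \<open>\<open>U\<close> and \<open>V\<close> represent u and u_t by primitives defined for all
  t and x. For almost every x the integrand is integrable in time, so the one-dimensional chain and
  product rules apply to them.\<close>

definition U :: "real \<Rightarrow> 'a \<Rightarrow> real" where "U t x = u0 x + (LBINT s:{0..t}. v s x)"
definition V :: "real \<Rightarrow> 'a \<Rightarrow> real" where "V t x = u1 x + (LBINT s:{0..t}. w s x)"

lemma UV_meas[measurable]: "(\<lambda>(t, x). U t x) \<in> borel_measurable (lborel \<Otimes>\<^sub>M M)" "(\<lambda>(t, x). V t x) \<in> borel_measurable (lborel \<Otimes>\<^sub>M M)"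
proof -
  note [measurable] = set_integral_measurable[OF meas(2)] set_integral_measurable[OF meas(3)]
  show "(\<lambda>(t, x). U t x) \<in> borel_measurable (lborel \<Otimes>\<^sub>M M)" unfolding U_def by measurable
  show "(\<lambda>(t, x). V t x) \<in> borel_measurable (lborel \<Otimes>\<^sub>M M)" unfolding V_def by measurable
qed

lemmas meas_Q[measurable] = meas[THEN measurable_Q] UV_meas[THEN measurable_Q]

lemma slice_meas[measurable]:
  "u t \<in> borel_measurable M" "v t \<in> borel_measurable M" "w t \<in> borel_measurable M" "L t \<in> borel_measurable M"
  "U t \<in> borel_measurable M" "V t \<in> borel_measurable M"
  using measurable_compose[OF measurable_Pair1' meas(1), of t] measurable_compose[OF measurable_Pair1' meas(2), of t]
    measurable_compose[OF measurable_Pair1' meas(3), of t] measurable_compose[OF measurable_Pair1' meas(4), of t]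
    measurable_compose[OF measurable_Pair1' UV_meas(1), of t] measurable_compose[OF measurable_Pair1' UV_meas(2), of t]
  by simp_all

lemma uU: "AE t in N. AE x in M. u t x = U t x" and vV: "AE t in N. AE x in M. v t x = V t x"
  using u_rep_N v_rep_N by (simp_all add: U_def V_def)

lemma L2_UV: "AE t in N. (\<integral>\<^sup>+x. ennreal ((U t x)\<^sup>2) \<partial>M) \<le> ennreal C" "AE t in N. (\<integral>\<^sup>+x. ennreal ((V t x)\<^sup>2) \<partial>M) \<le> ennreal C"
  and Lq_V: "AE t in N. (\<integral>\<^sup>+x. ennreal (\<bar>V t x\<bar> powr q) \<partial>M) \<le> ennreal C"
proof -
  show "AE t in N. (\<integral>\<^sup>+x. ennreal ((U t x)\<^sup>2) \<partial>M) \<le> ennreal C"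
    using L2_N(1) uU
  proof eventually_elim
    case (elim t)
    have "(\<integral>\<^sup>+x. ennreal ((U t x)\<^sup>2) \<partial>M) = (\<integral>\<^sup>+x. ennreal ((u t x)\<^sup>2) \<partial>M)"
      by (rule nn_integral_cong_AE) (use elim(2) in \<open>eventually_elim, simp\<close>)
    then show ?case using elim(1) by simp
  qed
  show "AE t in N. (\<integral>\<^sup>+x. ennreal ((V t x)\<^sup>2) \<partial>M) \<le> ennreal C"
    using L2_N(2) vV
  proof eventually_elim
    case (elim t)
    have "(\<integral>\<^sup>+x. ennreal ((V t x)\<^sup>2) \<partial>M) = (\<integral>\<^sup>+x. ennreal ((v t x)\<^sup>2) \<partial>M)"
      by (rule nn_integral_cong_AE) (use elim(2) in \<open>eventually_elim, simp\<close>)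
    then show ?case using elim(1) by simp
  qed
  show "AE t in N. (\<integral>\<^sup>+x. ennreal (\<bar>V t x\<bar> powr q) \<partial>M) \<le> ennreal C"
    using Lq_N vV
  proof eventually_elim
    case (elim t)
    have "(\<integral>\<^sup>+x. ennreal (\<bar>V t x\<bar> powr q) \<partial>M) = (\<integral>\<^sup>+x. ennreal (\<bar>v t x\<bar> powr q) \<partial>M)"
      by (rule nn_integral_cong_AE) (use elim(2) in \<open>eventually_elim, simp\<close>)
    then show ?case using elim(1) by simp
  qed
qed

lemma sq_Q: "integrable Q (\<lambda>(t, x). (u t x)\<^sup>2)" "integrable Q (\<lambda>(t, x). (v t x)\<^sup>2)" "integrable Q (\<lambda>(t, x). (w t x)\<^sup>2)"
  "integrable Q (\<lambda>(t, x). (L t x)\<^sup>2)" "integrable Q (\<lambda>(t, x). (U t x)\<^sup>2)" "integrable Q (\<lambda>(t, x). (V t x)\<^sup>2)"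
  by (rule integrable_Q_bounded[where K=C], measurable, use L2_N L2_UV in simp)+

lemma vw_int: "AE x in M. set_integrable lborel {0..T} (\<lambda>s. v s x)" "AE x in M. set_integrable lborel {0..T} (\<lambda>s. w s x)"
proof -
  interpret N: finite_measure N by (rule finite_N)
  interpret Q: finite_measure Q by (intro finite_measure_pair_measure) unfold_locales
  have "integrable Q (\<lambda>(t, x). (1::real)\<^sup>2)" using Q.integrable_const[of "1::real"] by (simp add: case_prod_beta')
  then have *: "integrable Q (\<lambda>(t, x). h t x)" if "(\<lambda>(t, x). h t x) \<in> borel_measurable Q" "integrable Q (\<lambda>(t, x). (h t x)\<^sup>2)"
    for h :: "real \<Rightarrow> 'a \<Rightarrow> real"
    using prod_Q[of h "\<lambda>_ _. 1"] that by (simp add: case_prod_beta')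
  have T0: "0 \<in> {0..T}" using T by simp
  show "AE x in M. set_integrable lborel {0..T} (\<lambda>s. v s x)"
    by (rule Fubini_Q(4)[OF *[OF meas_Q(2) sq_Q(2)] T0])
  show "AE x in M. set_integrable lborel {0..T} (\<lambda>s. w s x)"
    by (rule Fubini_Q(4)[OF *[OF meas_Q(3) sq_Q(3)] T0])
qed

definition damp :: "real \<Rightarrow> real" where "damp y = y * ln (1 + y\<^sup>2)"

lemma damp_meas[measurable]: "damp \<in> borel_measurable borel"
  unfolding damp_def by measurable

text \<open>The exponent a = (q - 2) / 4 is fitted to q: the squared logarithm is bounded by a
  multiple of (1 + y^2)^(2 a), and y^2 (y^2)^(2 a) is \<open>\<bar>y\<bar> powr q\<close>.\<close>

lemma damp_sq_bound: "\<exists>K\<ge>0. \<forall>y. (damp y)\<^sup>2 \<le> K * (y\<^sup>2 + \<bar>y\<bar> powr q)"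
proof -
  define a where "a = (q - 2) / 4"
  have a: "a > 0" using q by (simp add: a_def)
  have "(damp y)\<^sup>2 \<le> (2 powr (2 * a) / a\<^sup>2) * (y\<^sup>2 + \<bar>y\<bar> powr q)" for y
  proof -
    have one: "1 \<le> 1 + y\<^sup>2" by simp
    have "ln (1 + y\<^sup>2) \<le> (1 + y\<^sup>2) powr a / a" by (rule ln_powr_bound[OF one a])
    then have "(ln (1 + y\<^sup>2))\<^sup>2 \<le> ((1 + y\<^sup>2) powr a / a)\<^sup>2" by (intro power_mono) auto
    also have "\<dots> = (1 + y\<^sup>2) powr (2 * a) / a\<^sup>2" by (simp add: power_divide) (simp add: power2_eq_square powr_add[symmetric])
    also have "\<dots> \<le> (2 powr (2 * a) * (1 + (y\<^sup>2) powr (2 * a))) / a\<^sup>2"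
    proof (intro divide_right_mono)
      show "(1 + y\<^sup>2) powr (2 * a) \<le> 2 powr (2 * a) * (1 + (y\<^sup>2) powr (2 * a))"
      proof (cases "y\<^sup>2 \<le> 1")
        case True
        then have "(1 + y\<^sup>2) powr (2 * a) \<le> 2 powr (2 * a)" using a by (intro powr_mono2) auto
        also have "\<dots> \<le> 2 powr (2 * a) * (1 + (y\<^sup>2) powr (2 * a))" by simp
        finally show ?thesis .
      next
        case False
        then have "(1 + y\<^sup>2) powr (2 * a) \<le> (2 * y\<^sup>2) powr (2 * a)" using a by (intro powr_mono2) auto
        also have "\<dots> = 2 powr (2 * a) * (y\<^sup>2) powr (2 * a)" by (simp add: powr_mult)
        also have "\<dots> \<le> 2 powr (2 * a) * (1 + (y\<^sup>2) powr (2 * a))" by simp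
        finally show ?thesis .
      qed
    qed simp
    finally have "y\<^sup>2 * (ln (1 + y\<^sup>2))\<^sup>2 \<le> y\<^sup>2 * ((2 powr (2 * a) * (1 + (y\<^sup>2) powr (2 * a))) / a\<^sup>2)"
      by (intro mult_left_mono) auto
    also have "\<dots> = (2 powr (2 * a) / a\<^sup>2) * (y\<^sup>2 + y\<^sup>2 * (y\<^sup>2) powr (2 * a))" by (simp add: algebra_simps add_divide_distrib)
    also have "y\<^sup>2 * (y\<^sup>2) powr (2 * a) = \<bar>y\<bar> powr q"
    proof -
      have "y\<^sup>2 * (y\<^sup>2) powr (2 * a) = \<bar>y\<bar> powr 2 * (\<bar>y\<bar> powr 2) powr (2 * a)" by (simp only: abs_powr_2)
      also have "\<dots> = \<bar>y\<bar> powr (2 + 2 * (2 * a))" by (simp only: powr_add powr_powr)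
      also have "2 + 2 * (2 * a) = q" by (simp add: a_def field_simps)
      finally show ?thesis .
    qed
    finally show ?thesis by (simp add: damp_def power_mult_distrib)
  qed
  then show ?thesis by (intro exI[of _ "2 powr (2 * a) / a\<^sup>2"]) auto
qed

lemma damp_Q: "integrable Q (\<lambda>(t, x). (damp (V t x))\<^sup>2)"
proof -
  obtain K where K: "K \<ge> 0" "\<And>y. (damp y)\<^sup>2 \<le> K * (y\<^sup>2 + \<bar>y\<bar> powr q)" using damp_sq_bound by blast
  have "integrable Q (\<lambda>(t, x). \<bar>V t x\<bar> powr q)"
    by (rule integrable_Q_bounded[where K=C], measurable, use Lq_V in simp)
  then have "integrable Q (\<lambda>z. K * ((case z of (t, x) \<Rightarrow> (V t x)\<^sup>2) + (case z of (t, x) \<Rightarrow> \<bar>V t x\<bar> powr q)))"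
    using sq_Q(6) by simp
  then show ?thesis
  proof (rule Bochner_Integration.integrable_bound)
    show "AE z in Q. norm (case z of (t, x) \<Rightarrow> (damp (V t x))\<^sup>2) \<le>
        norm (K * ((case z of (t, x) \<Rightarrow> (V t x)\<^sup>2) + (case z of (t, x) \<Rightarrow> \<bar>V t x\<bar> powr q)))"
      using K by (intro AE_I2) (auto simp: case_prod_beta)
  qed measurable
qed

definition src :: "real \<Rightarrow> real" where "src y = \<bar>y\<bar> powr (p - 2) * y"

lemma src_meas[measurable]: "src \<in> borel_measurable borel"
  unfolding src_def by measurable

lemma equation_UV: "AE t in N. AE x in M. src (U t x) = w t x - L t x + damp (V t x)"
  using equation_N uU vV
proof eventually_elim
  case (elim t)
  from elim(1) elim(2) elim(3) show ?case by eventually_elim (simp add: src_def damp_def)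
qed

lemma src_Q: "integrable Q (\<lambda>(t, x). (src (U t x))\<^sup>2)"
proof -
  let ?g = "\<lambda>t x. w t x - L t x + damp (V t x)"
  have i: "integrable Q (\<lambda>z. 3 * ((case z of (t, x) \<Rightarrow> (w t x)\<^sup>2) + (case z of (t, x) \<Rightarrow> (L t x)\<^sup>2) + (case z of (t, x) \<Rightarrow> (damp (V t x))\<^sup>2)))"
    using sq_Q(3,4) damp_Q by simp
  have ae: "AE z in Q. src (U (fst z) (snd z)) = ?g (fst z) (snd z)"
    by (rule AE_Q[OF _ _ equation_UV]) measurable
  show ?thesis
  proof (rule Bochner_Integration.integrable_bound[OF i])
    show "AE z in Q. norm (case z of (t, x) \<Rightarrow> (src (U t x))\<^sup>2) \<le>
        norm (3 * ((case z of (t, x) \<Rightarrow> (w t x)\<^sup>2) + (case z of (t, x) \<Rightarrow> (L t x)\<^sup>2) + (case z of (t, x) \<Rightarrow> (damp (V t x))\<^sup>2)))"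
      using ae
    proof eventually_elim
      case (elim z)
      have "(a - b + c)\<^sup>2 \<le> 3 * (a\<^sup>2 + b\<^sup>2 + c\<^sup>2)" for a b c :: real
        using zero_le_power2[of "a + b"] zero_le_power2[of "a - c"] zero_le_power2[of "b + c"]
        by (simp add: power2_eq_square algebra_simps)
      then show ?case using elim by (simp add: case_prod_beta)
    qed
  qed measurable
qed

end

section \<open>Evolution of kinetic, mixed and potential terms\<close>

context damped_wave
begin

lemma integrated_identity:
  assumes F: "F \<in> borel_measurable M" and F0: "integrable M F0" and h: "integrable Q (\<lambda>(t, x). h t x)" and t: "t \<in> {0..T}"
    and id: "AE x in M. F x = F0 x + (LBINT s:{0..t}. (h s x :: real))"
  shows "integrable M F" and "(LINT x|M. F x) = (LINT x|M. F0 x) + (LBINT s:{0..t}. (LINT x|M. h s x))"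
proof -
  have i: "integrable M (\<lambda>x. F0 x + (LBINT s:{0..t}. h s x))" using F0 Fubini_Q(1)[OF h t] by simp
  show "integrable M F" using i id F borel_measurable_integrable[OF i] by (subst integrable_cong_AE) auto
  have "(LINT x|M. F x) = (LINT x|M. F0 x + (LBINT s:{0..t}. h s x))"
    using id F borel_measurable_integrable[OF i] by (intro integral_cong_AE) auto
  then show "(LINT x|M. F x) = (LINT x|M. F0 x) + (LBINT s:{0..t}. (LINT x|M. h s x))"
    using F0 Fubini_Q(1,2)[OF h t] by simp
qed

lemma Vw_Q: "integrable Q (\<lambda>(t, x). 2 * V t x * w t x)"
proof -
  have "integrable Q (\<lambda>z. 2 * (case z of (t, x) \<Rightarrow> V t x * w t x))"
    using prod_Q[OF _ _ sq_Q(6,3)] by simp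
  then show ?thesis by (simp add: case_prod_beta' mult.assoc)
qed

lemma kinetic:
  assumes t: "t \<in> {0..T}"
  shows "integrable M (\<lambda>x. (V t x)\<^sup>2)"
    and "(LINT x|M. (V t x)\<^sup>2) = (LINT x|M. (u1 x)\<^sup>2) + (LBINT s:{0..t}. (LINT x|M. 2 * V s x * w s x))"
proof -
  have der: "((\<lambda>y::real. y ^ 2) has_real_derivative 2 * y) (at y)" for y
    by (auto intro!: derivative_eq_intros)
  have cont: "continuous_on UNIV (\<lambda>y::real. 2 * y)" by (intro continuous_intros)
  have "AE x in M. (V t x)\<^sup>2 = (u1 x)\<^sup>2 + (LBINT s:{0..t}. 2 * V s x * w s x)"
    using vw_int(2)
  proof eventually_elim
    case (elim x)
    have "(V t x)\<^sup>2 - (u1 x)\<^sup>2 = (LBINT s:{0..t}. 2 * V s x * w s x)"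
      by (rule indefinite_integral_chain_rule(2)[OF elim _ _ _ der cont t]) (auto simp: V_def)
    then show ?case by linarith
  qed
  note id = this
  have m: "(\<lambda>x. (V t x)\<^sup>2) \<in> borel_measurable M" by measurable
  show "integrable M (\<lambda>x. (V t x)\<^sup>2)"
    and "(LINT x|M. (V t x)\<^sup>2) = (LINT x|M. (u1 x)\<^sup>2) + (LBINT s:{0..t}. (LINT x|M. 2 * V s x * w s x))"
    by (fact integrated_identity[OF m init_L2(2) Vw_Q t id])+
qed

lemma UwVv_Q: "integrable Q (\<lambda>(t, x). U t x * w t x + V t x * v t x)"
proof -
  have "integrable Q (\<lambda>z. (case z of (t, x) \<Rightarrow> U t x * w t x) + (case z of (t, x) \<Rightarrow> V t x * v t x))"
    using prod_Q[OF _ _ sq_Q(5,3)] prod_Q[OF _ _ sq_Q(6,2)] by simp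
  then show ?thesis by (simp add: case_prod_beta')
qed

lemma mixed:
  assumes t: "t \<in> {0..T}"
  shows "(LINT x|M. U t x * V t x) = (LINT x|M. u0 x * u1 x) + (LBINT s:{0..t}. (LINT x|M. U s x * w s x + V s x * v s x))"
proof -
  have "AE x in M. U t x * V t x = u0 x * u1 x + (LBINT s:{0..t}. U s x * w s x + V s x * v s x)"
    using vw_int
  proof eventually_elim
    case (elim x)
    show ?case
      using indefinite_integral_product_rule[OF elim(1) _ elim(2) _ t, of "\<lambda>t. U t x" "u0 x" "\<lambda>t. V t x" "u1 x"]
      by (simp add: U_def V_def)
  qed
  note id = this
  have m: "(\<lambda>x. U t x * V t x) \<in> borel_measurable M" by measurable
  show ?thesis
    by (rule integrated_identity(2)[OF m L2_mult_integrable[OF init_meas(1,2) init_L2(1,2)] UwVv_Q t id])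
qed

text \<open>\<open>\<bar>U\<bar> powr p\<close> is the product of \<open>src U\<close> and
  \<open>U\<close>, both square integrable over space-time.\<close>

lemma potential_Q: "integrable Q (\<lambda>(t, x). \<bar>U t x\<bar> powr p)" and srcv_Q: "integrable Q (\<lambda>(t, x). p * src (U t x) * v t x)"
proof -
  have "\<bar>y\<bar> powr p = src y * y" for y :: real
  proof (cases "y = 0")
    case False
    have "\<bar>y\<bar> powr p = \<bar>y\<bar> powr (p - 2) * \<bar>y\<bar> powr 2" unfolding powr_add[symmetric] by simp
    then show ?thesis by (simp only: abs_powr_2) (simp add: src_def power2_eq_square)
  qed (use p in \<open>simp add: src_def\<close>)
  then show "integrable Q (\<lambda>(t, x). \<bar>U t x\<bar> powr p)"
    using prod_Q[OF _ _ src_Q sq_Q(5)] by simp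
  have "integrable Q (\<lambda>z. p * (case z of (t, x) \<Rightarrow> src (U t x) * v t x))"
    using prod_Q[OF _ _ src_Q sq_Q(2)] by simp
  then show "integrable Q (\<lambda>(t, x). p * src (U t x) * v t x)" by (simp add: case_prod_beta' mult.assoc)
qed

lemma potential_pointwise:
  "AE x in M. \<forall>t\<in>{0..T}. \<bar>U t x\<bar> powr p - \<bar>u0 x\<bar> powr p = (LBINT s:{0..t}. p * src (U s x) * v s x)"
  using vw_int(1)
proof eventually_elim
  case (elim x)
  have p1: "1 < p" using p by simp
  show ?case
  proof
    fix t assume t: "t \<in> {0..T}"
    show "\<bar>U t x\<bar> powr p - \<bar>u0 x\<bar> powr p = (LBINT s:{0..t}. p * src (U s x) * v s x)"
      using indefinite_integral_chain_rule(2)[OF elim, of "\<lambda>t. U t x" "u0 x" UNIV "\<lambda>y. \<bar>y\<bar> powr p" "\<lambda>y. p * (\<bar>y\<bar> powr (p - 2) * y)" t]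
        abs_powr_has_real_derivative[OF p1] continuous_on_abs_powr_mult[OF p] t
      by (simp add: U_def src_def)
  qed
qed

lemma ex_time:
  assumes "AE t in N. P t" "0 < \<delta>" "\<delta> \<le> T"
  obtains t where "0 < t" "t < \<delta>" "P t"
  using ex_small_time[OF assms(1)[unfolded AE_N] assms(2,3)] by blast

text \<open>The potential is integrable at some positive time because it is so at almost all times;
  the pointwise evolution formula carries integrability back to time 0.\<close>

lemma u0_potential: "integrable M (\<lambda>x. \<bar>u0 x\<bar> powr p)"
proof -
  have T0: "0 \<in> {0..T}" using T by simp
  obtain t where t: "0 < t" "t < T" and i: "integrable M (\<lambda>x. \<bar>U t x\<bar> powr p)"
    using ex_time[OF Fubini_Q(5)[OF potential_Q T0] T order_refl] by blast
  have t': "t \<in> {0..T}" using t by simp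
  have i': "integrable M (\<lambda>x. \<bar>U t x\<bar> powr p - (LBINT s:{0..t}. p * src (U s x) * v s x))"
    using i Fubini_Q(1)[OF srcv_Q t'] by simp
  have "AE x in M. \<bar>U t x\<bar> powr p - (LBINT s:{0..t}. p * src (U s x) * v s x) = \<bar>u0 x\<bar> powr p"
    using potential_pointwise by eventually_elim (use t' in \<open>auto simp: algebra_simps\<close>)
  then show ?thesis using i' borel_measurable_integrable[OF i'] by (subst (asm) integrable_cong_AE) auto
qed

lemma potential:
  assumes t: "t \<in> {0..T}"
  shows "integrable M (\<lambda>x. \<bar>U t x\<bar> powr p)"
    and "(LINT x|M. \<bar>U t x\<bar> powr p) = (LINT x|M. \<bar>u0 x\<bar> powr p) + (LBINT s:{0..t}. (LINT x|M. p * src (U s x) * v s x))"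
proof -
  have "AE x in M. \<bar>U t x\<bar> powr p = \<bar>u0 x\<bar> powr p + (LBINT s:{0..t}. p * src (U s x) * v s x)"
    using potential_pointwise by eventually_elim (use t in \<open>auto simp: algebra_simps\<close>)
  note id = this
  have m: "(\<lambda>x. \<bar>U t x\<bar> powr p) \<in> borel_measurable M" by measurable
  show "integrable M (\<lambda>x. \<bar>U t x\<bar> powr p)"
    and "(LINT x|M. \<bar>U t x\<bar> powr p) = (LINT x|M. \<bar>u0 x\<bar> powr p) + (LBINT s:{0..t}. (LINT x|M. p * src (U s x) * v s x))"
    by (fact integrated_identity[OF m u0_potential srcv_Q t id])+
qed

section \<open>Increments in time\<close>

definition C0 :: real where "C0 = max 0 C"

lemma C0: "C0 \<ge> 0" by (simp add: C0_def)

text \<open>Collects all conditions valid at almost every time, with norm bounds independent of the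
  time, so that two such times can be compared.\<close>

definition good :: "real \<Rightarrow> bool" where
  "good t \<longleftrightarrow> t \<in> G \<and> (AE x in M. u t x = U t x) \<and> (AE x in M. v t x = V t x) \<and>
    integrable M (\<lambda>x. (w t x)\<^sup>2) \<and> (LINT x|M. (w t x)\<^sup>2) \<le> C0 \<and>
    integrable M (\<lambda>x. (L t x)\<^sup>2) \<and> (LINT x|M. (L t x)\<^sup>2) \<le> C0 \<and>
    integrable M (\<lambda>x. (U t x)\<^sup>2) \<and> (LINT x|M. (U t x)\<^sup>2) \<le> C0 \<and>
    integrable M (\<lambda>x. (V t x)\<^sup>2) \<and> (LINT x|M. (V t x)\<^sup>2) \<le> C0 \<and>
    (LINT x|M. (v t x)\<^sup>2) \<le> C0"

lemma AE_good: "AE t in N. good t"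
  using G_N uU vV L2_N(2) L2_N(3) L2_N(4) L2_UV
proof eventually_elim
  case (elim t)
  note a = L2_slice[OF elim(4) slice_meas(2)] L2_slice[OF elim(5) slice_meas(3)] L2_slice[OF elim(6) slice_meas(4)]
    L2_slice[OF elim(7) slice_meas(5)] L2_slice[OF elim(8) slice_meas(6)]
  show ?case unfolding good_def C0_def by (intro conjI elim(1-3) a)
qed

lemma L2_bound:
  fixes f g :: "'a \<Rightarrow> real"
  assumes "f \<in> borel_measurable M" "g \<in> borel_measurable M" "integrable M (\<lambda>x. (f x)\<^sup>2)" "integrable M (\<lambda>x. (g x)\<^sup>2)"
    and "(LINT x|M. (f x)\<^sup>2) \<le> a\<^sup>2" "(LINT x|M. (g x)\<^sup>2) \<le> b\<^sup>2" "0 \<le> a" "0 \<le> b"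
  shows "\<bar>LINT x|M. f x * g x\<bar> \<le> a * b"
proof -
  have "\<bar>LINT x|M. f x * g x\<bar> \<le> sqrt (LINT x|M. (f x)\<^sup>2) * sqrt (LINT x|M. (g x)\<^sup>2)"
    by (rule L2_Cauchy_Schwarz_abs[OF assms(1-4)])
  also have "\<dots> \<le> a * b" using assms by (intro mult_mono real_le_lsqrt) auto
  finally show ?thesis .
qed

text \<open>For almost every x, Cauchy-Schwarz in time on (s, t] gives one factor t - s; integrating
  over x and bounding the slices by \<open>K\<close> gives the other.\<close>

lemma increment_L2:
  fixes h :: "real \<Rightarrow> 'a \<Rightarrow> real"
  assumes hm: "(\<lambda>(t, x). h t x) \<in> borel_measurable (lborel \<Otimes>\<^sub>M M)" and h2: "integrable Q (\<lambda>(t, x). (h t x)\<^sup>2)"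
    and st: "0 \<le> s" "s \<le> t" "t \<le> T" and K: "AE \<tau> in N. \<tau> \<in> {s<..t} \<longrightarrow> (LINT x|M. (h \<tau> x)\<^sup>2) \<le> K"
  shows "integrable M (\<lambda>x. ((LBINT \<tau>:{0..t}. h \<tau> x) - (LBINT \<tau>:{0..s}. h \<tau> x))\<^sup>2)"
    and "(LINT x|M. ((LBINT \<tau>:{0..t}. h \<tau> x) - (LBINT \<tau>:{0..s}. h \<tau> x))\<^sup>2) \<le> K * (t - s)\<^sup>2"
proof -
  interpret N: finite_measure N by (rule finite_N)
  interpret Q: finite_measure Q by (intro finite_measure_pair_measure) unfold_locales
  have one: "integrable Q (\<lambda>(t, x). (1::real)\<^sup>2)" using Q.integrable_const[of "1::real"] by (simp add: case_prod_beta')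
  have h1: "integrable Q (\<lambda>(t, x). h t x)"
    using prod_Q[OF measurable_Q[OF hm] _ h2, of "\<lambda>_ _. 1"] one by (simp add: case_prod_beta')
  have tT: "t \<in> {0..T}" and sT: "s \<in> {0..T}" using st by auto
  let ?F = "\<lambda>x. (LBINT \<tau>:{0..t}. h \<tau> x) - (LBINT \<tau>:{0..s}. h \<tau> x)"
  let ?H = "\<lambda>x. (t - s) * ((LBINT \<tau>:{0..t}. (h \<tau> x)\<^sup>2) - (LBINT \<tau>:{0..s}. (h \<tau> x)\<^sup>2))"
  have Fm: "?F \<in> borel_measurable M"
    using Fubini_Q(1)[OF h1 tT] Fubini_Q(1)[OF h1 sT] by (intro borel_measurable_diff borel_measurable_integrable)
  have Hi: "integrable M ?H" using Fubini_Q(1)[OF h2 tT] Fubini_Q(1)[OF h2 sT] by simp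
  have pw: "AE x in M. (?F x)\<^sup>2 \<le> ?H x"
    using Fubini_Q(4)[OF h1 tT] Fubini_Q(4)[OF h2 tT]
  proof eventually_elim
    case (elim x)
    have hi: "set_integrable lborel {s<..t} (\<lambda>\<tau>. h \<tau> x)" "set_integrable lborel {s<..t} (\<lambda>\<tau>. (h \<tau> x)\<^sup>2)"
      using set_integrable_Icc_mono(2)[OF elim(1)] set_integrable_Icc_mono(2)[OF elim(2)] st by auto
    let ?f = "\<lambda>\<tau>. indicator {s<..t} \<tau> *\<^sub>R h \<tau> x" and ?g = "\<lambda>\<tau>. indicator {s<..t} \<tau> :: real"
    have fsq: "(?f \<tau>)\<^sup>2 = indicator {s<..t} \<tau> *\<^sub>R (h \<tau> x)\<^sup>2" "(?g \<tau>)\<^sup>2 = ?g \<tau>" "?f \<tau> * ?g \<tau> = ?f \<tau>" for \<tau>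
      by (auto simp: indicator_def)
    have gi: "integrable lborel ?g" using st by (intro integrable_real_indicator) auto
    have "(LINT \<tau>|lborel. ?f \<tau> * ?g \<tau>)\<^sup>2 \<le> (LINT \<tau>|lborel. (?f \<tau>)\<^sup>2) * (LINT \<tau>|lborel. (?g \<tau>)\<^sup>2)"
      by (rule L2_Cauchy_Schwarz) (use hi gi in \<open>auto simp only: fsq set_integrable_def intro!: borel_measurable_integrable\<close>)
    then have "(LBINT \<tau>:{s<..t}. h \<tau> x)\<^sup>2 \<le> (LBINT \<tau>:{s<..t}. (h \<tau> x)\<^sup>2) * (t - s)"
      unfolding fsq set_lebesgue_integral_def using st by simp
    then show ?case
      using set_integral_Icc_diff[OF elim(1), of s t] set_integral_Icc_diff[OF elim(2), of s t] st by (simp add: mult.commute)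
  qed
  show i: "integrable M (\<lambda>x. (?F x)\<^sup>2)"
    by (rule Bochner_Integration.integrable_bound[OF Hi])
       (use Fm in measurable, use pw in \<open>eventually_elim, simp\<close>)
  have "(LINT x|M. (?F x)\<^sup>2) \<le> (LINT x|M. ?H x)" by (rule integral_mono_AE[OF i Hi pw])
  also have "\<dots> = (t - s) * ((LBINT \<tau>:{0..t}. (LINT x|M. (h \<tau> x)\<^sup>2)) - (LBINT \<tau>:{0..s}. (LINT x|M. (h \<tau> x)\<^sup>2)))"
    using Fubini_Q(1,2)[OF h2 tT] Fubini_Q(1,2)[OF h2 sT] by simp
  also have "\<dots> = (t - s) * (LBINT \<tau>:{s<..t}. (LINT x|M. (h \<tau> x)\<^sup>2))"
    using set_integral_Icc_diff[OF Fubini_Q(3)[OF h2 tT], of s t] st by simp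
  also have "\<dots> \<le> (t - s) * (LBINT \<tau>:{s<..t}. K)"
  proof (intro mult_left_mono set_integral_mono_AE)
    show "set_integrable lborel {s<..t} (\<lambda>\<tau>. LINT x|M. (h \<tau> x)\<^sup>2)"
      using set_integrable_Icc_mono(2)[OF Fubini_Q(3)[OF h2 tT]] st by auto
    show "set_integrable lborel {s<..t} (\<lambda>\<tau>. K)"
      using set_integrable_Icc_mono(2)[OF borel_integrable_atLeastAtMost'[OF continuous_on_const]] st by auto
    have "AE \<tau> in lborel. \<tau> \<in> {0<..<T} \<longrightarrow> \<tau> \<in> {s<..t} \<longrightarrow> (LINT x|M. (h \<tau> x)\<^sup>2) \<le> K" using K by (simp only: AE_N)
    then show "AE \<tau>\<in>{s<..t} in lborel. (LINT x|M. (h \<tau> x)\<^sup>2) \<le> K"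
      using AE_lborel_singleton[of T] by eventually_elim (use st in auto)
  qed (use st in auto)
  also have "\<dots> = K * (t - s)\<^sup>2" using st by (simp add: set_integral_const power2_eq_square)
  finally show "(LINT x|M. (?F x)\<^sup>2) \<le> K * (t - s)\<^sup>2" .
qed

lemma V_Lipschitz:
  assumes st: "0 \<le> s" "s \<le> t" "t \<le> T"
  shows "integrable M (\<lambda>x. (V t x - V s x)\<^sup>2)" "(LINT x|M. (V t x - V s x)\<^sup>2) \<le> C0 * (t - s)\<^sup>2"
proof -
  have "AE \<tau> in N. \<tau> \<in> {s<..t} \<longrightarrow> (LINT x|M. (w \<tau> x)\<^sup>2) \<le> C0"
    using AE_good by eventually_elim (simp add: good_def)
  from increment_L2[OF meas(3) sq_Q(3) st this]
  show "integrable M (\<lambda>x. (V t x - V s x)\<^sup>2)" "(LINT x|M. (V t x - V s x)\<^sup>2) \<le> C0 * (t - s)\<^sup>2"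
    by (simp_all add: V_def)
qed

lemma U_Lipschitz:
  assumes st: "0 \<le> s" "s \<le> t" "t \<le> T"
  shows "integrable M (\<lambda>x. (U t x - U s x)\<^sup>2)" "(LINT x|M. (U t x - U s x)\<^sup>2) \<le> C0 * (t - s)\<^sup>2"
proof -
  have "AE \<tau> in N. \<tau> \<in> {s<..t} \<longrightarrow> (LINT x|M. (v \<tau> x)\<^sup>2) \<le> C0"
    using AE_good by eventually_elim (simp add: good_def)
  from increment_L2[OF meas(2) sq_Q(2) st this]
  show "integrable M (\<lambda>x. (U t x - U s x)\<^sup>2)" "(LINT x|M. (U t x - U s x)\<^sup>2) \<le> C0 * (t - s)\<^sup>2"
    by (simp_all add: U_def)
qed

lemma U_Taylor:
  assumes st: "0 \<le> s" "s \<le> t" "t \<le> T" and r: "r = s \<or> r = t"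
  shows "integrable M (\<lambda>x. (U t x - U s x - (t - s) * V r x)\<^sup>2)"
    and "(LINT x|M. (U t x - U s x - (t - s) * V r x)\<^sup>2) \<le> (sqrt C0 * (t - s)\<^sup>2)\<^sup>2"
proof -
  have rT: "r \<in> {0..T}" using r st by auto
  let ?h = "\<lambda>\<tau> x. v \<tau> x - V r x"
  have hm: "(\<lambda>(\<tau>, x). ?h \<tau> x) \<in> borel_measurable (lborel \<Otimes>\<^sub>M M)" by measurable
  have Vr: "integrable Q (\<lambda>(\<tau>, x). (V r x)\<^sup>2)"
  proof (rule integrable_Q_bounded[where K="LINT x|M. (V r x)\<^sup>2"])
    show "AE t in N. (\<integral>\<^sup>+x. ennreal \<bar>(V r x)\<^sup>2\<bar> \<partial>M) \<le> ennreal (LINT x|M. (V r x)\<^sup>2)"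
      using nn_integral_eq_integral[OF kinetic(1)[OF rT]] by simp
  qed measurable
  have h2: "integrable Q (\<lambda>(\<tau>, x). (?h \<tau> x)\<^sup>2)"
    using L2_diff_integrable[of "\<lambda>(\<tau>, x). v \<tau> x" Q "\<lambda>(\<tau>, x). V r x"] sq_Q(2) Vr by (simp add: case_prod_beta')
  have "AE \<tau> in N. \<tau> \<in> {s<..t} \<longrightarrow> (LINT x|M. (?h \<tau> x)\<^sup>2) \<le> C0 * (t - s)\<^sup>2"
    using AE_good
  proof eventually_elim
    case (elim \<tau>)
    show ?case
    proof
      assume \<tau>: "\<tau> \<in> {s<..t}"
      have "(LINT x|M. (?h \<tau> x)\<^sup>2) = (LINT x|M. (V \<tau> x - V r x)\<^sup>2)"
      proof (rule integral_cong_AE)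
        have "AE x in M. v \<tau> x = V \<tau> x" using elim by (simp add: good_def)
        then show "AE x in M. (?h \<tau> x)\<^sup>2 = (V \<tau> x - V r x)\<^sup>2" by eventually_elim simp
      qed measurable
      also have "\<dots> \<le> C0 * (t - s)\<^sup>2"
        using r
      proof
        assume [simp]: "r = s"
        have "(LINT x|M. (V \<tau> x - V r x)\<^sup>2) \<le> C0 * (\<tau> - s)\<^sup>2" using V_Lipschitz(2)[of s \<tau>] st \<tau> by simp
        also have "\<dots> \<le> C0 * (t - s)\<^sup>2" using \<tau> C0 by (intro mult_left_mono power_mono) auto
        finally show ?thesis .
      next
        assume [simp]: "r = t"
        have "(LINT x|M. (V \<tau> x - V r x)\<^sup>2) = (LINT x|M. (V t x - V \<tau> x)\<^sup>2)" by (simp add: power2_commute)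
        also have "\<dots> \<le> C0 * (t - \<tau>)\<^sup>2" using V_Lipschitz(2)[of \<tau> t] st \<tau> by simp
        also have "\<dots> \<le> C0 * (t - s)\<^sup>2" using \<tau> C0 by (intro mult_left_mono power_mono) auto
        finally show ?thesis .
      qed
      finally show "(LINT x|M. (?h \<tau> x)\<^sup>2) \<le> C0 * (t - s)\<^sup>2" .
    qed
  qed
  note inc = increment_L2[OF hm h2 st this]
  let ?F = "\<lambda>x. (LBINT \<tau>:{0..t}. ?h \<tau> x) - (LBINT \<tau>:{0..s}. ?h \<tau> x)"
  have eq: "AE x in M. (?F x)\<^sup>2 = (U t x - U s x - (t - s) * V r x)\<^sup>2"
    using vw_int(1)
  proof eventually_elim
    case (elim x)
    have "(LBINT \<tau>:{0..a}. ?h \<tau> x) = (LBINT \<tau>:{0..a}. v \<tau> x) - a * V r x" if "0 \<le> a" "a \<le> T" for a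
    proof -
      have "set_integrable lborel {0..a} (\<lambda>\<tau>. v \<tau> x)" using set_integrable_Icc_mono(1)[OF elim, of 0 a] that by simp
      moreover have "set_integrable lborel {0..a} (\<lambda>\<tau>. V r x)" by (rule borel_integrable_atLeastAtMost'[OF continuous_on_const])
      ultimately show ?thesis using that by (simp add: set_integral_const)
    qed
    from this[of t] this[of s] have "?F x = U t x - U s x - (t - s) * V r x"
      using st by (simp only: U_def) (simp add: algebra_simps)
    then show ?case by (simp only:)
  qed
  have m: "(\<lambda>x. (U t x - U s x - (t - s) * V r x)\<^sup>2) \<in> borel_measurable M" by measurable
  show "integrable M (\<lambda>x. (U t x - U s x - (t - s) * V r x)\<^sup>2)"
    using inc(1) eq m borel_measurable_integrable[OF inc(1)] by (subst (asm) integrable_cong_AE) auto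
  have "(LINT x|M. (U t x - U s x - (t - s) * V r x)\<^sup>2) = (LINT x|M. (?F x)\<^sup>2)"
    using eq m borel_measurable_integrable[OF inc(1)] by (intro integral_cong_AE) (auto elim: eventually_mono)
  also have "\<dots> \<le> C0 * (t - s)\<^sup>2 * (t - s)\<^sup>2" by (rule inc(2))
  also have "\<dots> = (sqrt C0 * (t - s)\<^sup>2)\<^sup>2" using C0 by (simp add: power_mult_distrib power2_eq_square)
  finally show "(LINT x|M. (U t x - U s x - (t - s) * V r x)\<^sup>2) \<le> (sqrt C0 * (t - s)\<^sup>2)\<^sup>2" .
qed

text \<open>The truncation is inactive at almost all times; it makes the bounds on \<open>e\<close> and \<open>k\<close> hold at every time.\<close>

definition clamp :: "real \<Rightarrow> real" where "clamp y = max (- (C0 + 2 * C0)) (min (C0 + 2 * C0) y)"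

text \<open>By Green's formula \<open>e\<close> represents |grad u|_2^2. Correspondingly
  \<open>k\<close>, the integral of u_t times the Laplacian of u, is minus one half of its time
  derivative.\<close>

definition e :: "real \<Rightarrow> real" where "e t = clamp (- (LINT x|M. L t x * U t x))"
definition k :: "real \<Rightarrow> real" where "k t = clamp (LINT x|M. L t x * V t x)"
definition e0 :: real where "e0 = - (LINT x|M. L0 x * u0 x)"

lemma ek_meas[measurable]: "e \<in> borel_measurable borel" "k \<in> borel_measurable borel"
proof -
  have "(\<lambda>t. LINT x|M. L t x * U t x) \<in> borel_measurable lborel" "(\<lambda>t. LINT x|M. L t x * V t x) \<in> borel_measurable lborel"
    by (rule borel_measurable_lebesgue_integral, measurable)+
  then show "e \<in> borel_measurable borel" "k \<in> borel_measurable borel"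
    unfolding e_def[abs_def] k_def[abs_def] clamp_def by simp_all
qed

lemma ek_good:
  assumes "good t"
  shows "e t = - (LINT x|M. L t x * U t x)" "k t = (LINT x|M. L t x * V t x)"
proof -
  have "\<bar>LINT x|M. L t x * U t x\<bar> \<le> sqrt C0 * sqrt C0" "\<bar>LINT x|M. L t x * V t x\<bar> \<le> sqrt C0 * sqrt C0"
    by (rule L2_bound; use assms C0 in \<open>simp add: good_def\<close>)+
  then show "e t = - (LINT x|M. L t x * U t x)" "k t = (LINT x|M. L t x * V t x)"
    using C0 by (auto simp: e_def k_def clamp_def max_def min_def)
qed

lemma good_sym:
  assumes "good s" "good t"
  shows "(LINT x|M. L s x * U t x) = (LINT x|M. L t x * U s x)"
proof -
  have "(LINT x|M. L a x * U b x) = (LINT x|M. L a x * u b x)" if "good b" for a b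
  proof (rule integral_cong_AE)
    have "AE x in M. u b x = U b x" using that by (simp add: good_def)
    then show "AE x in M. L a x * U b x = L a x * u b x" by eventually_elim simp
  qed measurable
  then show ?thesis using assms sym[of s t] by (simp add: good_def)
qed

lemma good_sym0:
  assumes "good t"
  shows "(LINT x|M. L0 x * U t x) = (LINT x|M. L t x * u0 x)"
proof -
  have "(LINT x|M. L0 x * U t x) = (LINT x|M. L0 x * u t x)"
  proof (rule integral_cong_AE)
    have "AE x in M. u t x = U t x" using assms by (simp add: good_def)
    then show "AE x in M. L0 x * U t x = L0 x * u t x" by eventually_elim simp
  qed measurable
  then show ?thesis using assms sym0[of t] by (simp add: good_def)
qed

text \<open>In the symmetric form of the increment, \<open>U t\<close> - \<open>U s\<close> is
  replaced by (t - s) \<open>V t\<close> against \<open>L t\<close> and by (t - s)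
  \<open>V s\<close> against \<open>L s\<close>. The main parts give the terms in \<open>k\<close>,
  and both Taylor remainders are quadratic in t - s.\<close>

lemma e_increment:
  assumes s: "good s" and t: "good t" and st: "0 < s" "s \<le> t" "t < T"
  shows "\<bar>e t - e s + (t - s) * (k t + k s)\<bar> \<le> (C0 + 2 * C0) * (t - s)\<^sup>2"
proof -
  have st': "0 \<le> s" "s \<le> t" "t \<le> T" using st by auto
  have LU: "integrable M (\<lambda>x. L a x * U b x)" "integrable M (\<lambda>x. L a x * V b x)" if "good a" "good b" for a b
    using that by (auto simp: good_def intro!: L2_mult_integrable)
  have R: "(LINT x|M. L a x * (U t x - U s x - (t - s) * V r x)) =
      (LINT x|M. L a x * U t x) - (LINT x|M. L a x * U s x) - (t - s) * (LINT x|M. L a x * V r x)"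
    "\<bar>LINT x|M. L a x * (U t x - U s x - (t - s) * V r x)\<bar> \<le> sqrt C0 * (sqrt C0 * (t - s)\<^sup>2)"
    if a: "good a" and r: "r = s \<or> r = t" for a r
  proof -
    have gr: "good r" using r s t by auto
    have "(LINT x|M. L a x * (U t x - U s x - (t - s) * V r x)) = (LINT x|M. L a x * U t x - L a x * U s x - (t - s) * (L a x * V r x))"
      by (simp add: algebra_simps)
    also have "\<dots> = (LINT x|M. L a x * U t x) - (LINT x|M. L a x * U s x) - (t - s) * (LINT x|M. L a x * V r x)"
      using LU(1)[OF a t] LU(1)[OF a s] LU(2)[OF a gr] by simp
    finally show "(LINT x|M. L a x * (U t x - U s x - (t - s) * V r x)) =
      (LINT x|M. L a x * U t x) - (LINT x|M. L a x * U s x) - (t - s) * (LINT x|M. L a x * V r x)" .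
    show "\<bar>LINT x|M. L a x * (U t x - U s x - (t - s) * V r x)\<bar> \<le> sqrt C0 * (sqrt C0 * (t - s)\<^sup>2)"
      by (rule L2_bound) (use a C0 U_Taylor[OF st' r] in \<open>auto simp: good_def\<close>)
  qed
  have "e t - e s + (t - s) * (k t + k s) =
      - (LINT x|M. L t x * (U t x - U s x - (t - s) * V t x)) - (LINT x|M. L s x * (U t x - U s x - (t - s) * V s x))"
    unfolding R(1)[OF t disjI2[OF refl]] R(1)[OF s disjI1[OF refl]] ek_good[OF s] ek_good[OF t]
    using good_sym[OF s t] by (simp add: algebra_simps)
  then have "\<bar>e t - e s + (t - s) * (k t + k s)\<bar> \<le> sqrt C0 * (sqrt C0 * (t - s)\<^sup>2) + sqrt C0 * (sqrt C0 * (t - s)\<^sup>2)"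
    using R(2)[OF t disjI2[OF refl]] R(2)[OF s disjI1[OF refl]] by linarith
  also have "\<dots> = 2 * C0 * (t - s)\<^sup>2" using C0 by (simp add: mult.assoc[symmetric])
  \<comment> \<open>Enlarged to the truncation level of \<open>clamp\<close>, because
    \<open>indefinite_integral_from_increments\<close> takes one constant for the functions and for
    their increments.\<close>
  also have "\<dots> \<le> (C0 + 2 * C0) * (t - s)\<^sup>2" using C0 by (intro mult_right_mono) auto
  finally show ?thesis .
qed

lemma k_int: "set_integrable lborel {0..T} k" and k_bound: "\<bar>k t\<bar> \<le> C0 + 2 * C0"
proof -
  show kb: "\<bar>k t\<bar> \<le> C0 + 2 * C0" for t using C0 by (auto simp: k_def clamp_def)
  show "set_integrable lborel {0..T} k"
    unfolding set_integrable_def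
  proof (rule Bochner_Integration.integrable_bound)
    show "integrable lborel (\<lambda>t. indicator {0..T} t *\<^sub>R (C0 + 2 * C0))"
      using borel_integrable_atLeastAtMost'[OF continuous_on_const] by (simp only: set_integrable_def)
    show "AE t in lborel. norm (indicator {0..T} t *\<^sub>R k t) \<le> norm (indicator {0..T} t *\<^sub>R (C0 + 2 * C0))"
    proof (intro AE_I2)
      fix t show "norm (indicator {0..T} t *\<^sub>R k t) \<le> norm (indicator {0..T} t *\<^sub>R (C0 + 2 * C0))"
        using kb[of t] C0 by (simp add: indicator_def)
    qed
  qed measurable
qed

text \<open>The weak argument determines \<open>e\<close> only up to a constant \<open>c\<close>. To
  see that it is \<open>e0\<close>, the increment formula is used between time 0, with
  \<open>L0\<close> and \<open>sym0\<close>, and a small good time t: both \<open>e t\<close> -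
  \<open>e0\<close> and the integral of \<open>k\<close> are O(t).\<close>

lemma gradient: "AE t in N. e t = e0 - 2 * (LBINT s:{0..t}. k s)"
proof -
  have eb: "\<bar>e t\<bar> \<le> C0 + 2 * C0" for t using C0 by (auto simp: e_def clamp_def)
  have g: "AE t in lborel. t \<in> {0<..<T} \<longrightarrow> t \<in> {t. good t}" using AE_good by (simp add: AE_N)
  obtain c where "AE t in lebesgue_on {0<..<T}. e t = c - 2 * (LBINT s:{0..t}. k s)"
    by (rule indefinite_integral_from_increments[OF T ek_meas eb k_bound g]) (use e_increment in auto)
  then have c: "AE t in N. e t = c - 2 * (LBINT s:{0..t}. k s)"
    unfolding AE_N by (subst (asm) AE_restrict_space_iff) (auto simp: AE_completion_iff)
  define K where "K = sqrt C0 * (sqrt C0 + sqrt (LINT x|M. (L0 x)\<^sup>2)) + 2 * (C0 + 2 * C0)"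
  have K0: "K \<ge> 0" using C0 by (simp add: K_def)
  have near: "\<bar>c - e0\<bar> \<le> K * t" if t: "0 < t" "t < T" "good t" "e t = c - 2 * (LBINT s:{0..t}. k s)" for t
  proof -
    have U0: "U 0 x = u0 x" for x using set_integral_Icc_0[of "\<lambda>s. v s x"] by (simp add: U_def)
    have d: "integrable M (\<lambda>x. (U t x - u0 x)\<^sup>2)" "(LINT x|M. (U t x - u0 x)\<^sup>2) \<le> (sqrt C0 * t)\<^sup>2"
      using U_Lipschitz[of 0 t] t C0 by (auto simp: U0 power_mult_distrib)
    have Li: "integrable M (\<lambda>x. (L t x)\<^sup>2)" "(LINT x|M. (L t x)\<^sup>2) \<le> (sqrt C0)\<^sup>2" "integrable M (\<lambda>x. (U t x)\<^sup>2)"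
      using t(3) C0 by (auto simp: good_def)
    have b1: "\<bar>LINT x|M. (U t x - u0 x) * L t x\<bar> \<le> sqrt C0 * t * sqrt C0"
      by (rule L2_bound) (use d Li C0 t in auto)
    have b2: "\<bar>LINT x|M. (U t x - u0 x) * L0 x\<bar> \<le> sqrt C0 * t * sqrt (LINT x|M. (L0 x)\<^sup>2)"
      by (rule L2_bound) (use d init_L2 C0 t in auto)
    have "e t - e0 = - (LINT x|M. (U t x - u0 x) * L t x) - (LINT x|M. (U t x - u0 x) * L0 x)"
    proof -
      have "(LINT x|M. (U t x - u0 x) * L t x) = (LINT x|M. L t x * U t x - L t x * u0 x)" by (simp add: algebra_simps)
      also have "\<dots> = (LINT x|M. L t x * U t x) - (LINT x|M. L t x * u0 x)"
        using Li init_L2 by (intro Bochner_Integration.integral_diff L2_mult_integrable) auto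
      finally have 1: "(LINT x|M. (U t x - u0 x) * L t x) = (LINT x|M. L t x * U t x) - (LINT x|M. L t x * u0 x)" .
      have "(LINT x|M. (U t x - u0 x) * L0 x) = (LINT x|M. L0 x * U t x - L0 x * u0 x)" by (simp add: algebra_simps)
      also have "\<dots> = (LINT x|M. L0 x * U t x) - (LINT x|M. L0 x * u0 x)"
        using Li init_L2 by (intro Bochner_Integration.integral_diff L2_mult_integrable) auto
      finally have 2: "(LINT x|M. (U t x - u0 x) * L0 x) = (LINT x|M. L0 x * U t x) - (LINT x|M. L0 x * u0 x)" .
      show ?thesis using 1 2 good_sym0[OF t(3)] ek_good(1)[OF t(3)] by (simp add: e0_def)
    qed
    then have a: "\<bar>e t - e0\<bar> \<le> sqrt C0 * (sqrt C0 + sqrt (LINT x|M. (L0 x)\<^sup>2)) * t"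
      using b1 b2 by (simp add: algebra_simps)
    have ki: "set_integrable lborel {0..t} k" using set_integrable_Icc_mono(1)[OF k_int, of 0 t] t by simp
    have "\<bar>LBINT s:{0..t}. k s\<bar> \<le> (LBINT s:{0..t}. \<bar>k s\<bar>)"
      using set_integral_norm_bound[of lborel "{0..t}" k] ki by simp
    also have "\<dots> \<le> (LBINT s:{0..t}. C0 + 2 * C0)"
      by (rule set_integral_mono[OF set_integrable_abs[OF ki] borel_integrable_atLeastAtMost'[OF continuous_on_const] k_bound])
    also have "\<dots> = (C0 + 2 * C0) * t" using t by (simp add: set_integral_const)
    finally have b: "\<bar>LBINT s:{0..t}. k s\<bar> \<le> (C0 + 2 * C0) * t" .
    have "\<bar>c - e0\<bar> \<le> \<bar>e t - e0\<bar> + 2 * \<bar>LBINT s:{0..t}. k s\<bar>" using t(4) by linarith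
    also have "\<dots> \<le> K * t" using a b by (simp add: K_def algebra_simps)
    finally show ?thesis .
  qed
  have "c = e0"
  proof (rule ccontr)
    assume "c \<noteq> e0"
    \<comment> \<open>Below this time K t is less than the supposed gap, contradicting
      \<open>near\<close>.\<close>
    define \<delta> where "\<delta> = min T (\<bar>c - e0\<bar> / (K + 1))"
    have \<delta>: "0 < \<delta>" "\<delta> \<le> T" using \<open>c \<noteq> e0\<close> K0 T by (auto simp: \<delta>_def)
    have "AE t in N. good t \<and> e t = c - 2 * (LBINT s:{0..t}. k s)" using AE_good c by eventually_elim simp
    from ex_time[OF this \<delta>] obtain t where t: "0 < t" "t < \<delta>" "good t" "e t = c - 2 * (LBINT s:{0..t}. k s)"
      by blast
    have "\<bar>c - e0\<bar> \<le> K * t" using near t \<delta> by simp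
    also have "\<dots> \<le> (K + 1) * t" using t(1) by (simp add: algebra_simps)
    also have "\<dots> < (K + 1) * (\<bar>c - e0\<bar> / (K + 1))" using t K0 by (intro mult_strict_left_mono) (auto simp: \<delta>_def)
    also have "\<dots> = \<bar>c - e0\<bar>" using K0 by simp
    finally show False by simp
  qed
  then show ?thesis using c by simp
qed

end

section \<open>Finite time of existence\<close>

context damped_wave
begin

definition D :: "real \<Rightarrow> real" where "D s = (LINT x|M. (V s x)\<^sup>2 * ln (1 + (V s x)\<^sup>2))"

lemma damp_V: "(V s x)\<^sup>2 * ln (1 + (V s x)\<^sup>2) = damp (V s x) * V s x"
  by (simp add: damp_def power2_eq_square)

lemma D_Q: "integrable Q (\<lambda>(t, x). (V t x)\<^sup>2 * ln (1 + (V t x)\<^sup>2))"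
  unfolding damp_V by (rule prod_Q[OF _ _ damp_Q sq_Q(6)]) measurable

lemma D_nonneg: "0 \<le> D s"
  unfolding D_def by (intro integral_nonneg_AE AE_I2 mult_nonneg_nonneg) auto

lemma D_int: "set_integrable lborel {0..T} D"
  unfolding D_def[abs_def] by (rule Fubini_Q(3)[OF D_Q, of 0]) (use T in simp)

lemma AE_D: "AE s in N. integrable M (\<lambda>x. (V s x)\<^sup>2 * ln (1 + (V s x)\<^sup>2))"
  by (rule Fubini_Q(5)[OF D_Q, of 0]) (use T in simp)

definition A :: "real \<Rightarrow> real" where "A s = (LINT x|M. \<bar>U s x\<bar> powr p)"
definition K :: "real \<Rightarrow> real" where "K s = (LINT x|M. (V s x)\<^sup>2)"
definition I :: "real \<Rightarrow> real" where "I s = (LINT x|M. U s x * V s x * ln (1 + (V s x)\<^sup>2))"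
definition J :: "real \<Rightarrow> real" where "J s = (LINT x|M. U s x * V s x)"
definition j :: "real \<Rightarrow> real" where "j s = (LINT x|M. U s x * w s x + V s x * v s x)"
definition H0 :: real where
  "H0 = 1 / p * (LINT x|M. \<bar>u0 x\<bar> powr p) - 1 / 2 * ((LINT x|M. (u1 x)\<^sup>2) + e0)"
text \<open>Defined from the dissipation and not as minus the energy, so that monotonicity and the
  integral representation hold at every time; \<open>energy\<close> identifies the two at almost
  every time.\<close>

definition H :: "real \<Rightarrow> real" where "H t = H0 + (LBINT s:{0..t}. D s)"

lemma energy: "AE t in N. H t = A t / p - K t / 2 - e t / 2"
proof -
  have T0: "0 \<in> {0..T}" using T by simp
  let ?a = "\<lambda>s. LINT x|M. p * src (U s x) * v s x" and ?b = "\<lambda>s. LINT x|M. 2 * V s x * w s x"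
  have ai: "set_integrable lborel {0..T} ?a" by (rule Fubini_Q(3)[OF srcv_Q T0])
  have bi: "set_integrable lborel {0..T} ?b" by (rule Fubini_Q(3)[OF Vw_Q T0])
  \<comment> \<open>The equation multiplied by u_t and integrated over space, at almost every
    time.\<close>
  have power: "AE s in N. D s = ?a s / p - ?b s / 2 + k s"
    using AE_good equation_UV AE_D
  proof eventually_elim
    case (elim s)
    have g: "integrable M (\<lambda>x. (w s x)\<^sup>2)" "integrable M (\<lambda>x. (L s x)\<^sup>2)" "integrable M (\<lambda>x. (V s x)\<^sup>2)"
      "AE x in M. v s x = V s x"
      using elim(1) by (auto simp: good_def)
    have wV: "integrable M (\<lambda>x. w s x * V s x)" and LV: "integrable M (\<lambda>x. L s x * V s x)"
      using g by (auto intro!: L2_mult_integrable)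
    have "?a s = (LINT x|M. p * (w s x * V s x - L s x * V s x + (V s x)\<^sup>2 * ln (1 + (V s x)\<^sup>2)))"
    proof (rule integral_cong_AE)
      show "AE x in M. p * src (U s x) * v s x = p * (w s x * V s x - L s x * V s x + (V s x)\<^sup>2 * ln (1 + (V s x)\<^sup>2))"
        using g(4) elim(2)
      proof eventually_elim
        case (elim x)
        show ?case unfolding damp_V elim by (simp add: algebra_simps)
      qed
    qed measurable
    also have "\<dots> = p * ((LINT x|M. w s x * V s x) - (LINT x|M. L s x * V s x) + D s)"
      using wV LV elim(3) by (simp add: D_def)
    finally have "?a s / p = (LINT x|M. w s x * V s x) - (LINT x|M. L s x * V s x) + D s" using p by simp
    moreover have "?b s = 2 * (LINT x|M. w s x * V s x)"
      by (simp add: mult.commute mult.left_commute)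
    ultimately show ?case using ek_good(2)[OF elim(1)] by simp
  qed
  show ?thesis
    using gradient AE_space
  proof eventually_elim
    case (elim t)
    then have t: "t \<in> {0..T}" by simp
    have i: "set_integrable lborel {0..t} ?a" "set_integrable lborel {0..t} ?b" "set_integrable lborel {0..t} k"
      using set_integrable_Icc_mono(1)[OF ai, of 0 t] set_integrable_Icc_mono(1)[OF bi, of 0 t]
        set_integrable_Icc_mono(1)[OF k_int, of 0 t] t by auto
    have "(LBINT s:{0..t}. D s) = (LBINT s:{0..t}. ?a s / p - ?b s / 2 + k s)"
    proof (rule set_lebesgue_integral_cong_AE)
      have "AE s in lborel. s \<in> {0<..<T} \<longrightarrow> D s = ?a s / p - ?b s / 2 + k s" using power by (simp only: AE_N)
      then show "AE s \<in> {0..t} in lborel. D s = ?a s / p - ?b s / 2 + k s"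
        using AE_lborel_singleton[of 0] AE_lborel_singleton[of T] by eventually_elim (use t in auto)
      show "D \<in> borel_measurable lborel" unfolding D_def[abs_def] by (rule borel_measurable_lebesgue_integral) measurable
      have "?a \<in> borel_measurable lborel" by (rule borel_measurable_lebesgue_integral) measurable
      moreover have "?b \<in> borel_measurable lborel" by (rule borel_measurable_lebesgue_integral) measurable
      ultimately show "(\<lambda>s. ?a s / p - ?b s / 2 + k s) \<in> borel_measurable lborel" using ek_meas by simp
    qed simp
    also have "\<dots> = (LBINT s:{0..t}. ?a s) / p - (LBINT s:{0..t}. ?b s) / 2 + (LBINT s:{0..t}. k s)"
      using i by (simp add: set_integral_add set_integral_diff)
    finally have "(LBINT s:{0..t}. D s) = (LBINT s:{0..t}. ?a s) / p - (LBINT s:{0..t}. ?b s) / 2 + (LBINT s:{0..t}. k s)" .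
    moreover have "1 / p * a - 1 / 2 * (b + c) + (x / p - y / 2 + z) = (a + x) / p - (b + y) / 2 - (c - 2 * z) / 2"
      for a b c x y z :: real by (simp add: add_divide_distrib diff_divide_distrib)
    ultimately show ?case
      unfolding H_def H0_def A_def K_def potential(2)[OF t] kinetic(2)[OF t] elim(1) by presburger
  qed
qed

text \<open>The equation multiplied by u and integrated over space: the Laplacian contributes - e,
  the damping - I and the source A.\<close>

lemma mixed_rate: "AE s in N. j s = K s - e s - I s + A s"
proof -
  have T0: "0 \<in> {0..T}" using T by simp
  have UdV: "integrable Q (\<lambda>(t, x). U t x * damp (V t x))" by (rule prod_Q[OF _ _ sq_Q(5) damp_Q]) measurable
  show ?thesis
    using AE_good equation_UV Fubini_Q(5)[OF UdV T0] Fubini_Q(5)[OF potential_Q T0]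
  proof eventually_elim
    case (elim s)
    have g: "integrable M (\<lambda>x. (U s x)\<^sup>2)" "integrable M (\<lambda>x. (L s x)\<^sup>2)" "integrable M (\<lambda>x. (V s x)\<^sup>2)"
      "AE x in M. v s x = V s x"
      using elim(1) by (auto simp: good_def)
    have LU: "integrable M (\<lambda>x. L s x * U s x)" using g by (auto intro!: L2_mult_integrable)
    have src: "src y * y = \<bar>y\<bar> powr p" for y
    proof (cases "y = 0")
      case False
      have "\<bar>y\<bar> powr p = \<bar>y\<bar> powr (p - 2) * \<bar>y\<bar> powr 2" unfolding powr_add[symmetric] by simp
      then show ?thesis by (simp only: abs_powr_2) (simp add: src_def power2_eq_square)
    qed (use p in \<open>simp add: src_def\<close>)
    have "j s = (LINT x|M. \<bar>U s x\<bar> powr p + L s x * U s x - U s x * damp (V s x) + (V s x)\<^sup>2)"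
      unfolding j_def
    proof (rule integral_cong_AE)
      show "AE x in M. U s x * w s x + V s x * v s x = \<bar>U s x\<bar> powr p + L s x * U s x - U s x * damp (V s x) + (V s x)\<^sup>2"
        using g(4) elim(2)
      proof eventually_elim
        case (elim x)
        have "w s x = src (U s x) + L s x - damp (V s x)" using elim(2) by simp
        moreover have "U s x * src (U s x) = \<bar>U s x\<bar> powr p" using src[of "U s x"] by (simp only: mult.commute)
        moreover have "a * (b + c - d) = a * b + c * a - a * d" for a b c d :: real by (simp add: algebra_simps)
        ultimately show ?case unfolding elim(1) power2_eq_square by simp
      qed
    qed measurable
    also have "\<dots> = A s + (LINT x|M. L s x * U s x) - (LINT x|M. U s x * damp (V s x)) + K s"
      using elim(3,4) LU g(3) by (simp add: A_def K_def)
    also have "(LINT x|M. U s x * damp (V s x)) = I s"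
      unfolding I_def by (intro Bochner_Integration.integral_cong) (auto simp: damp_def mult.assoc)
    finally show ?case using ek_good(1)[OF elim(1)] by simp
  qed
qed

text \<open>The differential inequality with exponent 1 / (1 - \<alpha>) = 1 + \<beta>, where
  \<beta> = \<alpha> / (1 - \<alpha>). The bound is independent of \<open>T\<close>, of the a priori
  constant \<open>C\<close> and of the solution except through its initial values.\<close>

lemma blow_up_time_bound:
  fixes \<alpha> \<kappa> \<epsilon> :: real
  defines "\<mu> \<equiv> measure M (space M)"
  defines "\<Lambda>0 \<equiv> H0 powr (1 - \<alpha>) + \<epsilon> * (LINT x|M. u0 x * u1 x)"
  assumes \<alpha>: "\<alpha> = 1 / 2 - 1 / p" and \<kappa>: "\<kappa> = (1 + \<mu>) / (2 * \<alpha>\<^sup>2)"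
    and \<epsilon>: "0 < \<epsilon>" "\<epsilon> * \<kappa> \<le> 2 * (1 - \<alpha>)" and H0: "0 < H0" and \<Lambda>0: "0 < \<Lambda>0"
  shows "T \<le> \<Lambda>0 powr (- (\<alpha> / (1 - \<alpha>))) / (\<alpha> / (1 - \<alpha>) * (\<epsilon> * \<alpha> / (1 + \<epsilon> * (1 + \<mu>)) powr (1 / (1 - \<alpha>))))"
proof -
  have \<alpha>0: "0 < \<alpha>" "\<alpha> < 1 / 2" using p by (auto simp: \<alpha> field_simps)
  have \<mu>: "0 \<le> \<mu>" by (simp add: \<mu>_def)
  have \<kappa>0: "0 < \<kappa>" using \<alpha>0 \<mu> by (simp add: \<kappa>)
  have T0: "0 \<in> {0..T}" using T by simp
  have Hpos: "0 < H t" if "t \<in> {0..T}" for t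
  proof -
    have "0 \<le> (LBINT s:{0..t}. D s)"
      unfolding set_lebesgue_integral_def by (intro integral_nonneg_AE AE_I2) (simp add: D_nonneg)
    then show ?thesis using H0 by (simp add: H_def)
  qed
  let ?\<phi> = "\<lambda>y. (1 - \<alpha>) * y powr (- \<alpha>)"
  have der: "((\<lambda>y. y powr (1 - \<alpha>)) has_real_derivative ?\<phi> y) (at y)" if "y \<in> {0<..}" for y
    using has_real_derivative_powr[of y "1 - \<alpha>"] that by simp
  have cont: "continuous_on {0<..} ?\<phi>" by (auto intro!: continuous_intros)
  have iv: "is_interval {0::real<..}" by (simp add: is_interval_1)
  have HS: "H t \<in> {0<..}" if "t \<in> {0..T}" for t using Hpos[OF that] by simp
  have Hrep: "H t = H0 + (LBINT s:{0..t}. D s)" if "t \<in> {0..T}" for t by (simp add: H_def)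
  have chain1: "set_integrable lborel {0..T} (\<lambda>s. ?\<phi> (H s) * D s)"
    by (rule indefinite_integral_chain_rule(1)[OF D_int Hrep iv HS der cont])
  have chain2: "H t powr (1 - \<alpha>) - H0 powr (1 - \<alpha>) = (LBINT s:{0..t}. ?\<phi> (H s) * D s)" if "t \<in> {0..T}" for t
    by (rule indefinite_integral_chain_rule(2)[OF D_int Hrep iv HS der cont that])
  let ?l = "\<lambda>s. ?\<phi> (H s) * D s + \<epsilon> * j s"
  let ?\<Lambda> = "\<lambda>t. H t powr (1 - \<alpha>) + \<epsilon> * J t"
  have ji: "set_integrable lborel {0..T} j" unfolding j_def[abs_def] by (rule Fubini_Q(3)[OF UwVv_Q T0])
  have lint: "set_integrable lborel {0..T} ?l" using chain1 ji by simp
  have Lrep: "?\<Lambda> t = \<Lambda>0 + (LBINT s:{0..t}. ?l s)" if t: "t \<in> {0..T}" for t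
  proof -
    have i: "set_integrable lborel {0..t} (\<lambda>s. ?\<phi> (H s) * D s)" "set_integrable lborel {0..t} j"
      using set_integrable_Icc_mono(1)[OF chain1, of 0 t] set_integrable_Icc_mono(1)[OF ji, of 0 t] t by auto
    have "(LBINT s:{0..t}. ?l s) = (LBINT s:{0..t}. ?\<phi> (H s) * D s) + \<epsilon> * (LBINT s:{0..t}. j s)"
      using i by (simp add: set_integral_add)
    moreover have "J t = (LINT x|M. u0 x * u1 x) + (LBINT s:{0..t}. j s)"
      using mixed[OF t] by (simp add: J_def j_def)
    ultimately show ?thesis using chain2[OF t] by (simp add: \<Lambda>0_def algebra_simps)
  qed
  define c where "c = \<epsilon> * \<alpha> / (1 + \<epsilon> * (1 + \<mu>)) powr (1 / (1 - \<alpha>))"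
  have bound: "AE s in N. 0 \<le> ?l s \<and> (0 < ?\<Lambda> s \<longrightarrow> c * ?\<Lambda> s powr (1 / (1 - \<alpha>)) \<le> ?l s)"
    using energy mixed_rate AE_D AE_space
  proof eventually_elim
    case (elim s)
    then have s: "s \<in> {0..T}" by simp
    note pots = potential(1)[OF s] kinetic(1)[OF s]
    have nn: "0 \<le> A s" "0 \<le> K s" by (auto simp: A_def K_def intro!: integral_nonneg_AE)
    have Ib: "\<bar>I s\<bar> \<le> \<kappa> / 2 * H s powr (- \<alpha>) * D s + 1 / (2 * \<kappa> * \<alpha>) * (\<mu> * H s + A s + K s)"
      unfolding I_def D_def A_def K_def \<mu>_def
      by (rule damping_term_bound(2)[OF slice_meas(5,6) pots elim(3) p \<alpha> Hpos[OF s] \<kappa>0])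
    have Jb: "\<bar>J s\<bar> \<le> (1 + \<mu>) * (A s + K s) powr (1 - \<alpha>)"
      unfolding J_def A_def K_def \<mu>_def by (rule product_integral_bound[OF slice_meas(5,6) pots p \<alpha>])
    note B = Lyapunov_derivative_bound[OF p \<alpha> nn D_nonneg[of s] \<mu> Hpos[OF s] elim(1) \<kappa> \<epsilon> Ib Jb]
    show ?case using B elim(2) by (simp add: c_def)
  qed
  have "0 < 1 + \<epsilon> * (1 + \<mu>)" using \<epsilon>(1) \<mu> by (intro add_pos_nonneg mult_nonneg_nonneg) auto
  then have c0: "c > 0" unfolding c_def using \<epsilon>(1) \<alpha>0 by (intro divide_pos_pos mult_pos_pos) auto
  have \<beta>: "1 + \<alpha> / (1 - \<alpha>) = 1 / (1 - \<alpha>)" using \<alpha>0 by (simp add: field_simps)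
  have ends: "AE s in lborel. s \<in> {0..T} \<longrightarrow> s \<in> {0<..<T}"
    using AE_lborel_singleton[of 0] AE_lborel_singleton[of T] by eventually_elim auto
  have bound': "AE s in lborel. s \<in> {0<..<T} \<longrightarrow> 0 \<le> ?l s \<and> (0 < ?\<Lambda> s \<longrightarrow> c * ?\<Lambda> s powr (1 / (1 - \<alpha>)) \<le> ?l s)"
    using bound by (simp only: AE_N)
  have "T \<le> \<Lambda>0 powr (- (\<alpha> / (1 - \<alpha>))) / (\<alpha> / (1 - \<alpha>) * c)"
  proof (rule differential_inequality_blow_up[OF T lint Lrep \<Lambda>0 c0])
    show "0 < \<alpha> / (1 - \<alpha>)" using \<alpha>0 by simp
    show "AE s in lborel. s \<in> {0..T} \<longrightarrow> 0 \<le> ?l s"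
      using bound' ends by eventually_elim blast
    show "AE s in lborel. s \<in> {0..T} \<longrightarrow> 0 < ?\<Lambda> s \<longrightarrow> c * ?\<Lambda> s powr (1 + \<alpha> / (1 - \<alpha>)) \<le> ?l s"
      unfolding \<beta> using bound' ends by eventually_elim blast
  qed
  then show ?thesis by (simp only: c_def)
qed

end

section \<open>Time slices of functions on a space-time cylinder\<close>

text \<open>Solutions take (x, t) as argument, whereas the abstract equation is formulated with time
  first.\<close>

lemma AE_lborel_swap:
  fixes P :: "'a::euclidean_space \<times> real \<Rightarrow> bool"
  assumes "AE z in lborel. P z"
  shows "AE t in lborel. AE x in lborel. P (x, t)"
proof -
  have "AE z in distr (lborel \<Otimes>\<^sub>M lborel) (lborel \<Otimes>\<^sub>M lborel) (\<lambda>(t::real, x::'a). (x, t)). P z"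
    using assms by (subst lborel_pair.distr_pair_swap[symmetric], subst lborel_prod)
  then have "AE z in (lborel :: real measure) \<Otimes>\<^sub>M (lborel :: 'a measure). P (case z of (t, x) \<Rightarrow> (x, t))"
    by (intro AE_distrD[of "\<lambda>(t, x). (x, t)"]) measurable
  from lborel_pair.AE_pair[OF this] show ?thesis by simp
qed

text \<open>Lebesgue measurability on the product does not give measurability for the product of the
  sigma-algebras, which Fubini and the abstract locale work with; a Borel representative does. The
  arguments are curried with time first.\<close>

definition borel_version :: "'a::euclidean_space set \<Rightarrow> real \<Rightarrow> ('a \<times> real \<Rightarrow> real) \<Rightarrow> (real \<Rightarrow> 'a \<Rightarrow> real) \<Rightarrow> bool" where
  "borel_version \<Omega> T f g \<longleftrightarrow> (\<lambda>z. g (snd z) (fst z)) \<in> borel_measurable borel \<and>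
    (AE z in lebesgue. z \<in> \<Omega> \<times> {0<..<T} \<longrightarrow> f z = g (snd z) (fst z))"

lemma borel_version_slice:
  assumes "open \<Omega>" "borel_version \<Omega> T f g"
  shows "AE t in lborel. t \<in> {0<..<T} \<longrightarrow> (AE x in lebesgue_on \<Omega>. f (x, t) = g t x)"
proof -
  have "AE z in lborel. z \<in> \<Omega> \<times> {0<..<T} \<longrightarrow> f z = g (snd z) (fst z)"
    using assms(2) by (simp add: borel_version_def AE_completion_iff)
  from AE_lborel_swap[OF this] show ?thesis
  proof eventually_elim
    case (elim t)
    have "AE x in lebesgue. (x, t) \<in> \<Omega> \<times> {0<..<T} \<longrightarrow> f (x, t) = g t x"
      using AE_completion[OF elim] by simp
    then show ?case using assms(1) by (auto simp: AE_restrict_space_iff)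
  qed
qed

lemma ex_borel_version:
  assumes \<Omega>: "open \<Omega>" and f: "locally_integrable (\<Omega> \<times> {0<..<T}) f"
  obtains g where "borel_version \<Omega> T f g"
proof -
  let ?Q = "\<Omega> \<times> {0<..<T}"
  have Q: "open ?Q" using \<Omega> by (intro open_Times) auto
  have "(\<lambda>z. indicator ?Q z *\<^sub>R f z) \<in> borel_measurable lebesgue"
    using locally_integrable_measurable[OF Q f] Q by (subst (asm) borel_measurable_restrict_space_iff) auto
  then obtain g where g: "g \<in> borel_measurable lborel" "AE z in lborel. indicator ?Q z *\<^sub>R f z = g z"
    using completion_ex_borel_measurable_real by blast
  have "AE z in lebesgue. z \<in> ?Q \<longrightarrow> f z = g z"
    using AE_completion[OF g(2)] by eventually_elim auto
  then have "borel_version \<Omega> T f (\<lambda>t x. g (x, t))" using g(1) by (simp add: borel_version_def)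
  then show thesis by (rule that)
qed

lemma borel_version_measurable:
  assumes "borel_version \<Omega> T f g"
  shows "(\<lambda>(t, x). g t x) \<in> borel_measurable (lborel \<Otimes>\<^sub>M lebesgue_on \<Omega>)"
proof -
  have "(\<lambda>x. x) \<in> lebesgue_on \<Omega> \<rightarrow>\<^sub>M borel"
    by (intro measurable_restrict_space1 measurable_completion) simp
  then have "(\<lambda>z. (snd z, fst z)) \<in> lborel \<Otimes>\<^sub>M lebesgue_on \<Omega> \<rightarrow>\<^sub>M borel \<Otimes>\<^sub>M borel"
    by (intro measurable_Pair measurable_compose[OF measurable_snd] measurable_compose[OF measurable_fst]) auto
  from measurable_compose[OF this, of "\<lambda>z. g (snd z) (fst z)" borel] assms show ?thesis
    by (simp add: borel_version_def borel_prod case_prod_beta')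
qed

text \<open>The weights are merely bounded, Borel and compactly supported, so that test functions as
  well as indicators of closed boxes can be inserted.\<close>

lemma slice_Fubini:
  fixes \<Omega> :: "'a::euclidean_space set" and \<phi> :: "'a \<Rightarrow> real" and \<psi> :: "real \<Rightarrow> real"
  assumes \<Omega>: "open \<Omega>" and f: "locally_integrable (\<Omega> \<times> {0<..<T}) f" and g: "borel_version \<Omega> T f g"
    and \<phi>: "\<phi> \<in> borel_measurable borel" "compact K" "K \<subseteq> \<Omega>" "\<And>x. x \<notin> K \<Longrightarrow> \<phi> x = 0" "\<And>x. \<bar>\<phi> x\<bar> \<le> B"
    and \<psi>: "\<psi> \<in> borel_measurable borel" "compact S" "S \<subseteq> {0<..<T}" "\<And>t. t \<notin> S \<Longrightarrow> \<psi> t = 0" "\<And>t. \<bar>\<psi> t\<bar> \<le> B'"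
  shows "(LINT z|lebesgue_on (\<Omega> \<times> {0<..<T}). f z * (\<phi> (fst z) * \<psi> (snd z))) = (LINT t|lborel. (LINT x|lebesgue_on \<Omega>. g t x * \<phi> x) * \<psi> t)"
    and "integrable lborel (\<lambda>t. (LINT x|lebesgue_on \<Omega>. g t x * \<phi> x) * \<psi> t)"
    and "AE t in lborel. \<psi> t \<noteq> 0 \<longrightarrow> integrable lborel (\<lambda>x. g t x * \<phi> x)"
proof -
  let ?Q = "\<Omega> \<times> {0<..<T}"
  let ?w = "\<lambda>z. \<phi> (fst z) * \<psi> (snd z)"
  have Q: "open ?Q" using \<Omega> by (intro open_Times) auto
  have Qs: "?Q \<in> sets lebesgue" using Q by simp
  have gm[measurable]: "(\<lambda>z. g (snd z) (fst z)) \<in> borel_measurable borel" using g by (simp add: borel_version_def)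
  have wm: "?w \<in> borel_measurable borel"
  proof -
    have "?w \<in> borel_measurable (borel \<Otimes>\<^sub>M borel)"
      by (intro borel_measurable_times measurable_compose[OF measurable_fst \<phi>(1)] measurable_compose[OF measurable_snd \<psi>(1)])
    then show ?thesis by (simp add: borel_prod)
  qed
  have wb: "\<bar>?w z\<bar> \<le> B * B'" for z
  proof -
    have "0 \<le> B" using \<phi>(5)[of undefined] by linarith
    then show ?thesis using \<phi>(5)[of "fst z"] \<psi>(5)[of "snd z"] by (simp add: abs_mult mult_mono)
  qed
  have "compact (K \<times> S)" "K \<times> S \<subseteq> ?Q" using \<phi> \<psi> by (auto intro: compact_Times)
  then have "integrable lebesgue (\<lambda>z. indicator (K \<times> S) z *\<^sub>R f z)"
    using f by (auto simp: locally_integrable_def set_integrable_def)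
  then have "integrable lebesgue (\<lambda>z. (indicator (K \<times> S) z *\<^sub>R f z) * ?w z)"
    by (rule integrable_mult_bounded[OF _ _ wb]) (use wm in \<open>auto intro: measurable_completion\<close>)
  moreover have eqf: "(indicator (K \<times> S) z *\<^sub>R f z) * ?w z = f z * ?w z" for z
    using \<phi>(4)[of "fst z"] \<psi>(4)[of "snd z"] by (cases "z \<in> K \<times> S") (auto simp: mem_Times_iff)
  ultimately have fi: "integrable lebesgue (\<lambda>z. f z * ?w z)" by (simp only: eqf)
  have w0: "?w z = 0" if "z \<notin> ?Q" for z
    using that \<phi>(3,4) \<psi>(3,4) by (cases "fst z \<in> K"; cases "snd z \<in> S") (auto simp: mem_Times_iff)
  have ae: "AE z in lebesgue. f z * ?w z = g (snd z) (fst z) * ?w z"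
    using g[unfolded borel_version_def, THEN conjunct2] by eventually_elim (use w0 in auto)
  have gwm: "(\<lambda>z. g (snd z) (fst z) * ?w z) \<in> borel_measurable borel" using gm wm by (rule borel_measurable_times)
  have gwl: "(\<lambda>z. g (snd z) (fst z) * ?w z) \<in> borel_measurable lebesgue"
    using gwm by (intro measurable_completion) simp
  have gi: "integrable lborel (\<lambda>z. g (snd z) (fst z) * ?w z)"
    using integrable_cong_AE[OF borel_measurable_integrable[OF fi] gwl ae] fi gwm
    by (simp add: integrable_completion)
  have "(LINT z|lebesgue_on ?Q. f z * ?w z) = (LINT z|lebesgue. f z * ?w z)"
    by (rule lebesgue_on_integral_supported[OF Qs]) (simp add: w0)
  also have "\<dots> = (LINT z|lebesgue. g (snd z) (fst z) * ?w z)"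
    by (rule integral_cong_AE[OF borel_measurable_integrable[OF fi] gwl ae])
  also have "\<dots> = (LINT z|lborel. g (snd z) (fst z) * ?w z)"
    using gwm by (intro integral_completion) simp
  finally have 1: "(LINT z|lebesgue_on ?Q. f z * ?w z) = (LINT z|lborel. g (snd z) (fst z) * ?w z)" .
  have gi': "integrable (lborel \<Otimes>\<^sub>M lborel) (\<lambda>(x, t). g t x * (\<phi> x * \<psi> t))"
    using gi by (simp add: lborel_prod case_prod_beta')
  have sl: "(LINT x|lborel. g t x * (\<phi> x * \<psi> t)) = (LINT x|lebesgue_on \<Omega>. g t x * \<phi> x) * \<psi> t" for t
  proof -
    have "(\<lambda>x. g t x) \<in> borel_measurable borel"
    proof -
      have "(\<lambda>x::'a. (x, t)) \<in> borel \<rightarrow>\<^sub>M borel \<Otimes>\<^sub>M borel" by measurable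
      then have "(\<lambda>x::'a. (x, t)) \<in> borel \<rightarrow>\<^sub>M borel" by (simp only: borel_prod)
      from measurable_compose[OF this gm] show ?thesis by simp
    qed
    then have "(LINT x|lebesgue_on \<Omega>. g t x * \<phi> x) = (LINT x|lborel. g t x * \<phi> x)"
      using \<Omega> \<phi>(1,3,4) by (intro lebesgue_on_integral_eq_lborel borel_measurable_times) auto
    then show ?thesis by (simp add: mult.assoc[symmetric])
  qed
  have "(LINT z|lborel. g (snd z) (fst z) * ?w z) = (LINT z|(lborel \<Otimes>\<^sub>M lborel). (case z of (x, t) \<Rightarrow> g t x * (\<phi> x * \<psi> t)))"
    by (simp add: lborel_prod case_prod_beta')
  also have "\<dots> = (LINT t|lborel. (LINT x|lborel. g t x * (\<phi> x * \<psi> t)))"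
    using lborel_pair.integral_snd[OF gi'] by simp
  finally show "(LINT z|lebesgue_on ?Q. f z * ?w z) = (LINT t|lborel. (LINT x|lebesgue_on \<Omega>. g t x * \<phi> x) * \<psi> t)"
    using 1 by (simp only: sl)
  show "integrable lborel (\<lambda>t. (LINT x|lebesgue_on \<Omega>. g t x * \<phi> x) * \<psi> t)"
    using lborel_pair.integrable_snd[OF gi'] by (simp only: sl)
  show "AE t in lborel. \<psi> t \<noteq> 0 \<longrightarrow> integrable lborel (\<lambda>x. g t x * \<phi> x)"
    using lborel_pair.AE_integrable_snd[OF gi']
  proof eventually_elim
    case (elim t)
    show ?case
    proof
      assume "\<psi> t \<noteq> 0"
      have "integrable lborel (\<lambda>x. (1 / \<psi> t) * (g t x * (\<phi> x * \<psi> t)))" using elim by (rule integrable_mult_right)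
      then show "integrable lborel (\<lambda>x. g t x * \<phi> x)" using \<open>\<psi> t \<noteq> 0\<close> by simp
    qed
  qed
qed

section \<open>Testing with products of functions of space and of time\<close>

lemma product_test_function:
  fixes \<phi> :: "'a::euclidean_space \<Rightarrow> real" and \<theta> :: "real \<Rightarrow> real"
  assumes \<phi>: "\<phi> \<in> test_functions \<Omega>" and \<theta>: "\<theta> \<in> test_functions S"
  shows "(\<lambda>z. \<phi> (fst z) * \<theta> (snd z)) \<in> test_functions (\<Omega> \<times> S)"
    and "i \<in> Basis \<Longrightarrow> frechet_derivative (\<lambda>z. \<phi> (fst z) * \<theta> (snd z)) (at z) (i, 0) = frechet_derivative \<phi> (at (fst z)) i * \<theta> (snd z)"
    and "frechet_derivative (\<lambda>z. \<phi> (fst z) * \<theta> (snd z)) (at z) (0, 1) = \<phi> (fst z) * frechet_derivative \<theta> (at (snd z)) 1"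
proof -
  obtain K where K: "compact K" "K \<subseteq> \<Omega>" "\<And>x. x \<notin> K \<Longrightarrow> \<phi> x = 0" using test_functionE[OF \<phi>] by metis
  obtain J where J: "compact J" "J \<subseteq> S" "\<And>x. x \<notin> J \<Longrightarrow> \<theta> x = 0" using test_functionE[OF \<theta>] by metis
  have s1: "smooth (\<lambda>z::'a \<times> real. \<phi> (fst z))"
    using smooth_compose_affine[OF bounded_linear_fst test_function_smooth[OF \<phi>], of 0] by simp
  have s2: "smooth (\<lambda>z::'a \<times> real. \<theta> (snd z))"
    using smooth_compose_affine[OF bounded_linear_snd test_function_smooth[OF \<theta>], of 0] by simp
  have "smooth (\<lambda>z. \<phi> (fst z) * \<theta> (snd z))" by (rule smooth_mult[OF s1 s2])
  moreover have "compact (K \<times> J)" "K \<times> J \<subseteq> \<Omega> \<times> S" using K J by (auto intro: compact_Times)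
  moreover have "\<phi> (fst z) * \<theta> (snd z) = 0" if "z \<notin> K \<times> J" for z using that K(3) J(3) by (auto simp: mem_Times_iff)
  ultimately show "(\<lambda>z. \<phi> (fst z) * \<theta> (snd z)) \<in> test_functions (\<Omega> \<times> S)"
    unfolding test_functions_def by blast
  have "((\<lambda>z. \<phi> (fst z)) has_derivative (\<lambda>h. frechet_derivative \<phi> (at (fst z)) (fst h))) (at z)"
    by (rule has_derivative_compose[OF has_derivative_fst[OF has_derivative_ident] smooth_has_derivative[OF test_function_smooth[OF \<phi>]]])
  moreover have "((\<lambda>z. \<theta> (snd z)) has_derivative (\<lambda>h. frechet_derivative \<theta> (at (snd z)) (snd h))) (at z)"
    by (rule has_derivative_compose[OF has_derivative_snd[OF has_derivative_ident] smooth_has_derivative[OF test_function_smooth[OF \<theta>]]])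
  ultimately have "((\<lambda>z. \<phi> (fst z) * \<theta> (snd z)) has_derivative
      (\<lambda>h. \<phi> (fst z) * frechet_derivative \<theta> (at (snd z)) (snd h) + frechet_derivative \<phi> (at (fst z)) (fst h) * \<theta> (snd z))) (at z)"
    by (rule has_derivative_mult)
  then have eq: "frechet_derivative (\<lambda>z. \<phi> (fst z) * \<theta> (snd z)) (at z) =
      (\<lambda>h. \<phi> (fst z) * frechet_derivative \<theta> (at (snd z)) (snd h) + frechet_derivative \<phi> (at (fst z)) (fst h) * \<theta> (snd z))"
    by (rule frechet_derivative_at[symmetric])
  have z1: "frechet_derivative \<phi> (at x) 0 = 0" for x
    using linear_0[OF has_derivative_linear[OF smooth_has_derivative[OF test_function_smooth[OF \<phi>]]]] .
  have z2: "frechet_derivative \<theta> (at x) 0 = 0" for x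
    using linear_0[OF has_derivative_linear[OF smooth_has_derivative[OF test_function_smooth[OF \<theta>]]]] .
  show "i \<in> Basis \<Longrightarrow> frechet_derivative (\<lambda>z. \<phi> (fst z) * \<theta> (snd z)) (at z) (i, 0) = frechet_derivative \<phi> (at (fst z)) i * \<theta> (snd z)"
    "frechet_derivative (\<lambda>z. \<phi> (fst z) * \<theta> (snd z)) (at z) (0, 1) = \<phi> (fst z) * frechet_derivative \<theta> (at (snd z)) 1"
    by (simp_all add: eq z1 z2)
qed


lemma AE_lebesgue_on_interval:
  "(AE t in lebesgue_on {0<..<T}. P t) \<longleftrightarrow> (AE t in lborel. t \<in> {0<..<T::real} \<longrightarrow> P t)"
  by (subst AE_restrict_space_iff) (auto simp: AE_completion_iff)

lemma rat_boxes_test: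
  "z \<in> rat_boxes \<Omega> \<Longrightarrow> bump n (fst z) (snd z) \<in> test_functions \<Omega>"
  by (rule bump_test_function) (auto simp: rat_boxes_def)

lemma test_product_integral:
  fixes \<Omega> :: "'a::euclidean_space set"
  assumes \<Omega>: "open \<Omega>" and f: "locally_integrable (\<Omega> \<times> {0<..<T}) f" and g: "borel_version \<Omega> T f g"
    and \<phi>: "\<phi> \<in> test_functions \<Omega>" and \<theta>: "\<theta> \<in> test_functions {0<..<T}"
  shows "(LINT z|lebesgue_on (\<Omega> \<times> {0<..<T}). f z * (\<phi> (fst z) * \<theta> (snd z))) =
      (LINT t|lebesgue_on {0<..<T}. (LINT x|lebesgue_on \<Omega>. g t x * \<phi> x) * \<theta> t)"
    and "integrable (lebesgue_on {0<..<T}) (\<lambda>t. (LINT x|lebesgue_on \<Omega>. g t x * \<phi> x) * \<theta> t)"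
proof -
  obtain K where K: "compact K" "K \<subseteq> \<Omega>" "\<And>x. x \<notin> K \<Longrightarrow> \<phi> x = 0" using test_functionE[OF \<phi>] by metis
  obtain J where J: "compact J" "J \<subseteq> {0<..<T}" "\<And>x. x \<notin> J \<Longrightarrow> \<theta> x = 0" using test_functionE[OF \<theta>] by metis
  obtain B where B: "\<And>x. \<bar>\<phi> x\<bar> \<le> B" using test_function_bounded[OF \<phi>] by metis
  obtain B' where B': "\<And>x. \<bar>\<theta> x\<bar> \<le> B'" using test_function_bounded[OF \<theta>] by metis
  note F = slice_Fubini[OF \<Omega> f g test_function_measurable[OF \<phi>] K B test_function_measurable[OF \<theta>] J B']
  let ?h = "\<lambda>t. (LINT x|lebesgue_on \<Omega>. g t x * \<phi> x) * \<theta> t"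
  have hm: "?h \<in> borel_measurable lborel" by (rule borel_measurable_integrable[OF F(2)])
  have z: "?h t = 0" if "t \<notin> {0<..<T}" for t using test_function_zero_outside[OF \<theta> that] by simp
  have "(LINT t|lebesgue_on {0<..<T}. ?h t) = (LINT t|lborel. ?h t)"
    by (rule lebesgue_on_integral_eq_lborel) (use z hm in auto)
  then show "(LINT z|lebesgue_on (\<Omega> \<times> {0<..<T}). f z * (\<phi> (fst z) * \<theta> (snd z))) = (LINT t|lebesgue_on {0<..<T}. ?h t)"
    using F(1) by simp
  have "integrable lebesgue ?h" using F(2) hm by (simp add: integrable_completion)
  moreover have "(\<lambda>t. indicator {0<..<T} t *\<^sub>R ?h t) = ?h" using z by (auto simp: indicator_def fun_eq_iff)
  ultimately have "integrable lebesgue (\<lambda>t. indicator {0<..<T} t *\<^sub>R ?h t)" by (simp only:)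
  then show "integrable (lebesgue_on {0<..<T}) ?h" by (subst integrable_restrict_space) auto
qed

text \<open>Testing the weak time derivative with \<phi>(x) \<theta>(t) puts the integral of g t
  against \<phi> under the lemma of du Bois-Reymond. The continuous representative in
  \<open>has_initial_value\<close> gives the constant, and countably many bumps \<phi> then recover
  the identity for almost every x.\<close>

lemma time_representation:
  fixes \<Omega> :: "'a::euclidean_space set"
  assumes \<Omega>: "open \<Omega>" "bounded \<Omega>" and T: "0 < T"
    and wd: "has_weak_deriv (\<Omega> \<times> {0<..<T}) (0, 1) f f'"
    and g: "borel_version \<Omega> T f g" and g': "borel_version \<Omega> T f' g'"
    and b: "AE t in lborel. t \<in> {0<..<T} \<longrightarrow> (\<integral>\<^sup>+x. ennreal ((g t x)\<^sup>2) \<partial>lebesgue_on \<Omega>) \<le> ennreal C"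
    and b': "AE t in lborel. t \<in> {0<..<T} \<longrightarrow> (\<integral>\<^sup>+x. ennreal ((g' t x)\<^sup>2) \<partial>lebesgue_on \<Omega>) \<le> ennreal C"
    and iv: "has_initial_value \<Omega> T f w0" and w0: "w0 \<in> Lq_space 2 \<Omega>"
  shows "AE t in lborel. t \<in> {0<..<T} \<longrightarrow> (AE x in lebesgue_on \<Omega>. g t x = w0 x + (LBINT s:{0..t}. g' s x))"
proof -
  let ?M = "lebesgue_on \<Omega>"
  have \<Omega>l: "\<Omega> \<in> lmeasurable" using \<Omega> by (intro bounded_set_imp_lmeasurable) auto
  have \<Omega>s: "\<Omega> \<in> sets lebesgue" using \<Omega> by simp
  interpret fM: finite_measure ?M by (rule finite_measure_lebesgue_on[OF \<Omega>l])
  interpret S: space_time ?M T by unfold_locales (rule T)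
  have gm: "(\<lambda>(t, x). g t x) \<in> borel_measurable (lborel \<Otimes>\<^sub>M ?M)" and gm': "(\<lambda>(t, x). g' t x) \<in> borel_measurable (lborel \<Otimes>\<^sub>M ?M)"
    by (rule borel_version_measurable[OF g], rule borel_version_measurable[OF g'])
  have sm[measurable]: "g t \<in> borel_measurable ?M" "g' t \<in> borel_measurable ?M" for t
    using measurable_compose[OF measurable_Pair1' gm, of t] measurable_compose[OF measurable_Pair1' gm', of t] by simp_all
  have li: "locally_integrable (\<Omega> \<times> {0<..<T}) f" "locally_integrable (\<Omega> \<times> {0<..<T}) f'"
    using wd by (auto simp: has_weak_deriv_def)
  have w0m: "w0 \<in> borel_measurable ?M" and w02: "integrable ?M (\<lambda>x. (w0 x)\<^sup>2)" using w0 by (auto simp: Lq_space_2)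
  have one: "integrable ?M (\<lambda>x. (1::real)\<^sup>2)" by simp
  have L1: "integrable ?M h" if "h \<in> borel_measurable ?M" "integrable ?M (\<lambda>x. (h x)\<^sup>2)" for h :: "'a \<Rightarrow> real"
    using L2_mult_integrable[OF that(1) _ that(2) one] by simp
  obtain U where U: "\<And>t. t \<in> {0..<T} \<Longrightarrow> U t \<in> Lq_space 2 \<Omega>"
      "\<And>t. t \<in> {0..<T} \<Longrightarrow> ((\<lambda>s. Lq_norm 2 \<Omega> (\<lambda>x. U s x - U t x)) \<longlongrightarrow> 0) (at t within {0..<T})"
      "AE t in lebesgue_on {0<..<T}. AE x in ?M. U t x = f (x, t)" "AE x in ?M. U 0 x = w0 x"
    using iv unfolding has_initial_value_def by blast
  have Ug: "AE t in lborel. t \<in> {0<..<T} \<longrightarrow> (AE x in ?M. U t x = g t x)"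
    using U(3)[unfolded AE_lebesgue_on_interval] borel_version_slice[OF \<Omega>(1) g]
  proof eventually_elim
    case (elim t)
    show ?case
    proof
      assume "t \<in> {0<..<T}"
      then have "AE x in ?M. U t x = f (x, t)" "AE x in ?M. f (x, t) = g t x" using elim by auto
      then show "AE x in ?M. U t x = g t x" by eventually_elim simp
    qed
  qed
  have key: "AE t in lborel. t \<in> {0<..<T} \<longrightarrow> (LINT x|?M. g t x * \<phi> x) = (LINT x|?M. w0 x * \<phi> x) + (LBINT s:{0..t}. (LINT x|?M. g' s x * \<phi> x))"
    if \<phi>: "\<phi> \<in> test_functions \<Omega>" for \<phi>
  proof -
    have \<phi>m[measurable]: "\<phi> \<in> borel_measurable ?M" by (rule test_function_measurable_lebesgue_on[OF \<phi>])
    have \<phi>2: "integrable ?M (\<lambda>x. (\<phi> x)\<^sup>2)" using test_function_L2[OF \<phi> \<Omega>s] by (simp add: Lq_space_2)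
    let ?F = "\<lambda>t. LINT x|?M. g t x * \<phi> x" and ?F' = "\<lambda>t. LINT x|?M. g' t x * \<phi> x"
    have Fm: "?F \<in> borel_measurable borel" "?F' \<in> borel_measurable borel"
    proof -
      note [measurable] = gm gm'
      have "?F \<in> borel_measurable lborel" "?F' \<in> borel_measurable lborel"
        by (rule fM.borel_measurable_lebesgue_integral, measurable)+
      then show "?F \<in> borel_measurable borel" "?F' \<in> borel_measurable borel" by simp_all
    qed
    define B where "B = sqrt (max 0 C) * sqrt (LINT x|?M. (\<phi> x)\<^sup>2)"
    have bound: "\<bar>LINT x|?M. h x * \<phi> x\<bar> \<le> B"
      if "(\<integral>\<^sup>+x. ennreal ((h x)\<^sup>2) \<partial>?M) \<le> ennreal C" "h \<in> borel_measurable ?M" for h :: "'a \<Rightarrow> real"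
    proof -
      note h = S.L2_slice[OF that]
      have "\<bar>LINT x|?M. h x * \<phi> x\<bar> \<le> sqrt (LINT x|?M. (h x)\<^sup>2) * sqrt (LINT x|?M. (\<phi> x)\<^sup>2)"
        by (rule L2_Cauchy_Schwarz_abs[OF that(2) \<phi>m h(1) \<phi>2])
      also have "\<dots> \<le> B" unfolding B_def using h(2) by (intro mult_right_mono real_sqrt_le_mono) auto
      finally show ?thesis .
    qed
    have B0: "B \<ge> 0" by (simp add: B_def)
    have Fb: "AE t in lborel. t \<in> {0<..<T} \<longrightarrow> \<bar>?F t\<bar> \<le> B" using b by eventually_elim (use bound sm in blast)
    have Fb': "AE t in lborel. t \<in> {0<..<T} \<longrightarrow> \<bar>?F' t\<bar> \<le> B" using b' by eventually_elim (use bound sm in blast)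
    have fin: "finite_measure (lebesgue_on {0<..<T})" by (intro finite_measure_lebesgue_on) simp
    have Fi: "integrable (lebesgue_on {0<..<T}) ?F"
    proof (rule finite_measure.integrable_const_bound[OF fin])
      show "AE t in lebesgue_on {0<..<T}. norm (?F t) \<le> B" using Fb by (simp add: AE_lebesgue_on_interval)
      show "?F \<in> borel_measurable (lebesgue_on {0<..<T})"
        by (intro measurable_restrict_space1 measurable_completion) (use Fm in simp)
    qed
    have Fi': "set_integrable lborel {0..T} ?F'"
      unfolding set_integrable_def
    proof (rule Bochner_Integration.integrable_bound)
      show "integrable lborel (\<lambda>t. indicator {0..T} t *\<^sub>R B)"
        using borel_integrable_atLeastAtMost'[OF continuous_on_const] by (simp only: set_integrable_def)
      show "(\<lambda>t. indicator {0..T} t *\<^sub>R ?F' t) \<in> borel_measurable lborel"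
        using Fm(2) by (intro borel_measurable_scaleR borel_measurable_indicator) auto
      show "AE t in lborel. norm (indicator {0..T} t *\<^sub>R ?F' t) \<le> norm (indicator {0..T} t *\<^sub>R B)"
        using Fb' AE_lborel_singleton[of 0] AE_lborel_singleton[of T] by eventually_elim (use B0 in \<open>auto simp: indicator_def\<close>)
    qed
    have weak: "(LINT t|lebesgue_on {0<..<T}. ?F t * frechet_derivative \<theta> (at t) 1) = - (LINT t|lebesgue_on {0<..<T}. ?F' t * \<theta> t)"
      if \<theta>: "\<theta> \<in> test_functions {0<..<T}" for \<theta>
    proof -
      have d: "(\<lambda>t. frechet_derivative \<theta> (at t) 1) \<in> test_functions {0<..<T}" using test_function_partial[OF \<theta>, of 1] by simp
      have "(LINT z|lebesgue_on (\<Omega> \<times> {0<..<T}). f z * (\<phi> (fst z) * frechet_derivative \<theta> (at (snd z)) 1)) =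
          - (LINT z|lebesgue_on (\<Omega> \<times> {0<..<T}). f' z * (\<phi> (fst z) * \<theta> (snd z)))"
        using wd product_test_function(1)[OF \<phi> \<theta>] unfolding has_weak_deriv_def product_test_function(3)[OF \<phi> \<theta>, symmetric] by blast
      then show ?thesis
        unfolding test_product_integral(1)[OF \<Omega>(1) li(1) g \<phi> d] test_product_integral(1)[OF \<Omega>(1) li(2) g' \<phi> \<theta>] .
    qed
    obtain c where c: "AE t in lebesgue_on {0<..<T}. ?F t = c + (LBINT s:{0..t}. ?F' s)"
      by (rule du_Bois_Reymond[OF T Fi Fi' Fm(2) weak])
    define c0 where "c0 = (LINT x|?M. w0 x * \<phi> x)"
    \<comment> \<open>The 1 keeps \<open>m\<close> positive even if \<phi> vanishes.\<close>
    define m where "m = sqrt (LINT x|?M. (\<phi> x)\<^sup>2) + 1"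
    have m: "m > 0" by (simp add: m_def add_nonneg_pos)
    have T0: "0 \<in> {0..<T}" using T by simp
    have "c = c0"
    proof (rule ccontr)
      assume "c \<noteq> c0"
      \<comment> \<open>Half the gap: the distance of the initial value and the integral over a
        short time each contribute less than this.\<close>
      define \<eta> where "\<eta> = \<bar>c - c0\<bar> / 2"
      have \<eta>: "\<eta> > 0" using \<open>c \<noteq> c0\<close> by (simp add: \<eta>_def)
      have ev1: "\<forall>\<^sub>F s in at 0 within {0..<T}. Lq_norm 2 \<Omega> (\<lambda>x. U s x - U 0 x) < \<eta> / m"
        by (rule order_tendstoD(2)[OF U(2)[OF T0]]) (use \<eta> m in simp)
      have "((\<lambda>t. LBINT s:{0..t}. ?F' s) \<longlongrightarrow> (LBINT s:{0..0}. ?F' s)) (at 0 within {0..T})"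
        using continuous_on_set_integral_Icc[OF Fi', unfolded continuous_on_def, THEN bspec, of 0] T by simp
      then have "((\<lambda>t. LBINT s:{0..t}. ?F' s) \<longlongrightarrow> (LBINT s:{0..0}. ?F' s)) (at 0 within {0..<T})"
        by (rule tendsto_within_subset) auto
      then have "((\<lambda>t. LBINT s:{0..t}. ?F' s) \<longlongrightarrow> 0) (at 0 within {0..<T})"
        using set_integral_Icc_0[of ?F'] by simp
      from tendsto_rabs_zero[OF this] have ev2: "\<forall>\<^sub>F t in at 0 within {0..<T}. \<bar>LBINT s:{0..t}. ?F' s\<bar> < \<eta>"
        using \<eta> by (rule order_tendstoD(2))
      from eventually_conj[OF ev1 ev2] obtain d where d: "d > 0"
        "\<And>s. s \<in> {0..<T} \<Longrightarrow> s \<noteq> 0 \<Longrightarrow> dist s 0 < d \<Longrightarrow> Lq_norm 2 \<Omega> (\<lambda>x. U s x - U 0 x) < \<eta> / m \<and> \<bar>LBINT t:{0..s}. ?F' t\<bar> < \<eta>"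
        unfolding eventually_at by blast
      have "AE t in lborel. t \<in> {0<..<T} \<longrightarrow> (AE x in ?M. U t x = g t x) \<and> ?F t = c + (LBINT s:{0..t}. ?F' s)"
        using Ug c[unfolded AE_lebesgue_on_interval] by eventually_elim blast
      from ex_small_time[OF this, of "min d T"] obtain t where
        t: "0 < t" "t < min d T" "AE x in ?M. U t x = g t x" "?F t = c + (LBINT s:{0..t}. ?F' s)"
        using d(1) T by auto
      have tT: "t \<in> {0..<T}" using t by simp
      note Ut = U(1)[OF tT] and U0 = U(1)[OF T0]
      have e1: "?F t = (LINT x|?M. U t x * \<phi> x)"
      proof (rule integral_cong_AE)
        show "AE x in ?M. g t x * \<phi> x = U t x * \<phi> x" using t(3) by eventually_elim simp
      qed (use Ut in \<open>auto simp: Lq_space_2\<close>)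
      have e2: "c0 = (LINT x|?M. U 0 x * \<phi> x)"
        unfolding c0_def
      proof (rule integral_cong_AE)
        show "AE x in ?M. w0 x * \<phi> x = U 0 x * \<phi> x" using U(4) by eventually_elim simp
      qed (use U0 w0m in \<open>auto simp: Lq_space_2\<close>)
      have "?F t - c0 = (LINT x|?M. (U t x - U 0 x) * \<phi> x)"
        unfolding e1 e2 left_diff_distrib using Ut U0 \<phi>2
        by (intro Bochner_Integration.integral_diff[symmetric] L2_mult_integrable) (auto simp: Lq_space_2)
      also have "\<bar>\<dots>\<bar> \<le> sqrt (LINT x|?M. (U t x - U 0 x)\<^sup>2) * sqrt (LINT x|?M. (\<phi> x)\<^sup>2)"
        using Ut U0 \<phi>2 L2_diff[OF Ut U0] by (intro L2_Cauchy_Schwarz_abs) (auto simp: Lq_space_2)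
      also have "\<dots> \<le> Lq_norm 2 \<Omega> (\<lambda>x. U t x - U 0 x) * m"
        unfolding Lq_norm_2 m_def by (intro mult_left_mono) auto
      also have "\<dots> < \<eta> / m * m" using d(2)[OF tT] t m by (intro mult_strict_right_mono) (auto simp: dist_real_def)
      also have "\<dots> = \<eta>" using m by simp
      finally have 1: "\<bar>?F t - c0\<bar> < \<eta>" .
      have 2: "\<bar>LBINT s:{0..t}. ?F' s\<bar> < \<eta>" using d(2)[OF tT] t by (auto simp: dist_real_def)
      have "\<bar>c - c0\<bar> < 2 * \<eta>" using 1 2 t(4) by linarith
      then show False by (simp add: \<eta>_def)
    qed
    then show ?thesis using c[unfolded AE_lebesgue_on_interval] unfolding c0_def by (simp only:)
  qed
  \<comment> \<open>The exceptional null set of times in \<open>key\<close> depends on \<phi>; for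
    the countable family one null set serves all.\<close>
  have "AE t in lborel. \<forall>z\<in>rat_boxes \<Omega>. \<forall>n. t \<in> {0<..<T} \<longrightarrow> (LINT x|?M. g t x * bump n (fst z) (snd z) x) =
      (LINT x|?M. w0 x * bump n (fst z) (snd z) x) + (LBINT s:{0..t}. (LINT x|?M. g' s x * bump n (fst z) (snd z) x))"
    by (subst AE_ball_countable[OF countable_rat_boxes], rule ballI, subst AE_all_countable, intro allI key rat_boxes_test)
  then show ?thesis
    using b
  proof eventually_elim
    case (elim t)
    show ?case
    proof
      assume t: "t \<in> {0<..<T}"
      then have tT: "t \<in> {0..T}" by simp
      have gi2: "integrable ?M (\<lambda>x. (g t x)\<^sup>2)" using S.L2_slice(1)[OF _ sm(1)] elim(2) t by blast
      have g'Q: "integrable S.Q (\<lambda>(t, x). (g' t x)\<^sup>2)"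
      proof (rule S.integrable_Q_bounded)
        show "(\<lambda>(t, x). (g' t x)\<^sup>2) \<in> borel_measurable S.Q"
          using S.measurable_Q[OF gm'] by (simp add: case_prod_beta')
        show "AE t in S.N. (\<integral>\<^sup>+ x. ennreal \<bar>(g' t x)\<^sup>2\<bar> \<partial>?M) \<le> ennreal C" using b' by (simp add: S.AE_N)
      qed
      have prodQ: "integrable S.Q (\<lambda>(t, x). g' t x * \<phi> x)" if \<phi>: "\<phi> \<in> borel_measurable ?M" "integrable ?M (\<lambda>x. (\<phi> x)\<^sup>2)" for \<phi>
      proof (rule S.prod_Q[OF S.measurable_Q[OF gm'] _ g'Q])
        show \<phi>m: "(\<lambda>(t, x). \<phi> x) \<in> borel_measurable S.Q"
          using measurable_compose[OF measurable_snd \<phi>(1)] by (simp add: case_prod_beta')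
        show "integrable S.Q (\<lambda>(t, x). (\<phi> x)\<^sup>2)"
        proof (rule S.integrable_Q_bounded)
          show "(\<lambda>(t, x). (\<phi> x)\<^sup>2) \<in> borel_measurable S.Q"
            using borel_measurable_power[OF \<phi>m, of 2] by (simp add: case_prod_beta')
          show "AE t in S.N. (\<integral>\<^sup>+ x. ennreal \<bar>(\<phi> x)\<^sup>2\<bar> \<partial>?M) \<le> ennreal (LINT x|?M. (\<phi> x)\<^sup>2)"
            using nn_integral_eq_integral[OF \<phi>(2)] by simp
        qed
      qed
      have hint: "integrable ?M (\<lambda>x. LBINT s:{0..t}. g' s x)"
        using S.Fubini_Q(1)[OF prodQ[of "\<lambda>_. 1"] tT] by simp
      let ?h = "\<lambda>x. g t x - (w0 x + (LBINT s:{0..t}. g' s x))"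
      have hi: "integrable ?M ?h" using L1[OF sm(1) gi2] L1[OF w0m w02] hint by simp
      have "AE x in ?M. ?h x = 0"
      proof (rule AE_zero_if_bump_integrals_zero[OF \<Omega>(1)])
        fix n and a b :: 'a assume ab: "(a, b) \<in> rat_boxes \<Omega>"
        have "set_integrable lebesgue \<Omega> ?h"
          using hi \<Omega> by (simp add: set_integrable_def integrable_restrict_space)
        then show "set_integrable lebesgue (cbox a b) ?h"
          by (rule set_integrable_subset) (use ab in \<open>auto simp: rat_boxes_def\<close>)
        have \<phi>: "bump n a b \<in> test_functions \<Omega>" using rat_boxes_test[OF ab, of n] by simp
        have \<phi>m: "bump n a b \<in> borel_measurable ?M" by (rule test_function_measurable_lebesgue_on[OF \<phi>])
        have \<phi>2: "integrable ?M (\<lambda>x. (bump n a b x)\<^sup>2)" using test_function_L2[OF \<phi> \<Omega>s] by (simp add: Lq_space_2)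
        have i1: "integrable ?M (\<lambda>x. g t x * bump n a b x)" by (rule L2_mult_integrable[OF sm(1) \<phi>m gi2 \<phi>2])
        have i2: "integrable ?M (\<lambda>x. w0 x * bump n a b x)" by (rule L2_mult_integrable[OF w0m \<phi>m w02 \<phi>2])
        have i3: "integrable ?M (\<lambda>x. (LBINT s:{0..t}. g' s x) * bump n a b x)"
          using S.Fubini_Q(1)[OF prodQ[OF \<phi>m \<phi>2] tT] by simp
        have "(LINT x|?M. (LBINT s:{0..t}. g' s x) * bump n a b x) = (LBINT s:{0..t}. (LINT x|?M. g' s x * bump n a b x))"
          using S.Fubini_Q(2)[OF prodQ[OF \<phi>m \<phi>2] tT] by simp
        moreover have "(LINT x|?M. g t x * bump n a b x) = (LINT x|?M. w0 x * bump n a b x) + (LBINT s:{0..t}. (LINT x|?M. g' s x * bump n a b x))"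
          using elim(1) ab t by fastforce
        moreover have "(LINT x|?M. ?h x * bump n a b x) = (LINT x|?M. g t x * bump n a b x) -
            ((LINT x|?M. w0 x * bump n a b x) + (LINT x|?M. (LBINT s:{0..t}. g' s x) * bump n a b x))"
          unfolding left_diff_distrib distrib_right using i1 i2 i3 by simp
        ultimately show "(LINT x|?M. ?h x * bump n a b x) = 0" by simp
      qed
      then show "AE x in ?M. g t x = w0 x + (LBINT s:{0..t}. g' s x)" by eventually_elim simp
    qed
  qed
qed

lemma second_weak_deriv_slice:
  fixes \<Omega> :: "'a::euclidean_space set"
  assumes \<Omega>: "open \<Omega>" and i: "i \<in> Basis"
    and wd: "has_weak_deriv (\<Omega> \<times> {0<..<T}) (i, 0) u G" "has_weak_deriv (\<Omega> \<times> {0<..<T}) (i, 0) G H"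
    and ug: "borel_version \<Omega> T u ug" and Hg: "borel_version \<Omega> T H Hg"
    and H2: "AE t in lborel. t \<in> {0<..<T} \<longrightarrow> (\<lambda>x. u (x, t)) \<in> H2 \<Omega>"
  shows "AE t in lborel. t \<in> {0<..<T} \<longrightarrow> (AE x in lebesgue_on \<Omega>. Hg t x = weak_deriv \<Omega> i (weak_deriv \<Omega> i (\<lambda>x. u (x, t))) x)"
proof -
  let ?M = "lebesgue_on \<Omega>"
  have \<Omega>s: "\<Omega> \<in> sets lebesgue" using \<Omega> by simp
  have li: "locally_integrable (\<Omega> \<times> {0<..<T}) u" "locally_integrable (\<Omega> \<times> {0<..<T}) H"
    using wd by (auto simp: has_weak_deriv_def)
  have ugm: "ug t \<in> borel_measurable ?M" "Hg t \<in> borel_measurable ?M" for t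
    using measurable_compose[OF measurable_Pair1' borel_version_measurable[OF ug], of t]
      measurable_compose[OF measurable_Pair1' borel_version_measurable[OF Hg], of t] by simp_all
  have key: "AE t in lborel. t \<in> {0<..<T} \<longrightarrow> (LINT x|?M. ug t x * frechet_derivative (\<lambda>x. frechet_derivative \<phi> (at x) i) (at x) i) = (LINT x|?M. Hg t x * \<phi> x)"
    if \<phi>: "\<phi> \<in> test_functions \<Omega>" for \<phi>
  proof -
    let ?d = "\<lambda>x. frechet_derivative \<phi> (at x) i" 
    let ?dd = "\<lambda>x. frechet_derivative ?d (at x) i"
    note d = test_function_partial[OF \<phi> i]
    note dd = test_function_partial[OF d i]
    let ?F = "\<lambda>t. LINT x|?M. ug t x * ?dd x" and ?F2 = "\<lambda>t. LINT x|?M. Hg t x * \<phi> x"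
    have loc: "set_integrable lebesgue (cbox a b) (\<lambda>t. LINT x|?M. h t x * \<psi> x)"
      if ab: "cbox a b \<subseteq> {0<..<T}" and f: "locally_integrable (\<Omega> \<times> {0<..<T}) f" and h: "borel_version \<Omega> T f h" and \<psi>: "\<psi> \<in> test_functions \<Omega>"
      for a b f h \<psi>
    proof -
      obtain K where K: "compact K" "K \<subseteq> \<Omega>" "\<And>x. x \<notin> K \<Longrightarrow> \<psi> x = 0" using test_functionE[OF \<psi>] by metis
      obtain B where B: "\<And>x. \<bar>\<psi> x\<bar> \<le> B" using test_function_bounded[OF \<psi>] by metis
      have "integrable lborel (\<lambda>t. (LINT x|?M. h t x * \<psi> x) * indicator (cbox a b) t)"
        by (rule slice_Fubini(2)[OF \<Omega> f h test_function_measurable[OF \<psi>] K B, of "indicator (cbox a b)" "cbox a b" 1])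
           (use ab in \<open>auto simp: indicator_def\<close>)
      then have "integrable lebesgue (\<lambda>t. (LINT x|?M. h t x * \<psi> x) * indicator (cbox a b) t)"
        by (subst integrable_completion) (auto simp: borel_measurable_integrable)
      then show ?thesis by (simp add: set_integrable_def mult.commute)
    qed
    have "AE t in lebesgue_on {0<..<T}. ?F t - ?F2 t = 0"
    proof (rule AE_zero_if_bump_integrals_zero)
      fix n and a b :: real assume ab: "(a, b) \<in> rat_boxes {0<..<T}"
      then have sub: "cbox a b \<subseteq> {0<..<T}" by (auto simp: rat_boxes_def)
      show "set_integrable lebesgue (cbox a b) (\<lambda>t. ?F t - ?F2 t)"
        using loc[OF sub li(1) ug dd] loc[OF sub li(2) Hg \<phi>] by (rule set_integral_diff(1))
      have \<theta>: "bump n a b \<in> test_functions {0<..<T}" by (rule bump_test_function[OF sub])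
      let ?\<theta> = "bump n a b"
      \<comment> \<open>Two integrations by parts in space-time; the signs cancel.\<close>
      have "(LINT z|lebesgue_on (\<Omega> \<times> {0<..<T}). u z * (?dd (fst z) * ?\<theta> (snd z))) =
          - (LINT z|lebesgue_on (\<Omega> \<times> {0<..<T}). G z * (?d (fst z) * ?\<theta> (snd z)))"
        using wd(1) product_test_function(1)[OF d \<theta>] unfolding has_weak_deriv_def product_test_function(2)[OF d \<theta> i, symmetric] by blast
      also have "(LINT z|lebesgue_on (\<Omega> \<times> {0<..<T}). G z * (?d (fst z) * ?\<theta> (snd z))) =
          - (LINT z|lebesgue_on (\<Omega> \<times> {0<..<T}). H z * (\<phi> (fst z) * ?\<theta> (snd z)))"
        using wd(2) product_test_function(1)[OF \<phi> \<theta>] unfolding has_weak_deriv_def product_test_function(2)[OF \<phi> \<theta> i, symmetric] by blast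
      finally have "(LINT t|lebesgue_on {0<..<T}. ?F t * ?\<theta> t) = (LINT t|lebesgue_on {0<..<T}. ?F2 t * ?\<theta> t)"
        unfolding test_product_integral(1)[OF \<Omega> li(1) ug dd \<theta>] test_product_integral(1)[OF \<Omega> li(2) Hg \<phi> \<theta>] by simp
      then show "(LINT t|lebesgue_on {0<..<T}. (?F t - ?F2 t) * ?\<theta> t) = 0"
        using test_product_integral(2)[OF \<Omega> li(1) ug dd \<theta>] test_product_integral(2)[OF \<Omega> li(2) Hg \<phi> \<theta>]
        by (simp add: left_diff_distrib)
    qed simp
    then show ?thesis unfolding AE_lebesgue_on_interval by eventually_elim simp
  qed
  have all: "AE t in lborel. \<forall>z\<in>rat_boxes \<Omega>. \<forall>n. t \<in> {0<..<T} \<longrightarrow>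
      (LINT x|?M. ug t x * frechet_derivative (\<lambda>x. frechet_derivative (bump n (fst z) (snd z)) (at x) i) (at x) i) = (LINT x|?M. Hg t x * bump n (fst z) (snd z) x)"
    by (subst AE_ball_countable[OF countable_rat_boxes], rule ballI, subst AE_all_countable, intro allI key rat_boxes_test)
  \<comment> \<open>Integrability of the slices of \<open>Hg\<close> on boxes. Time weights must
    have compact support in the open interval, so the interval is exhausted by countably many closed
    rational intervals.\<close>
  have Hloc: "AE t in lborel. \<forall>z\<in>rat_boxes \<Omega>. t \<in> {0<..<T} \<longrightarrow> integrable lborel (\<lambda>x. Hg t x * indicator (cbox (fst z) (snd z)) x)"
  proof (subst AE_ball_countable[OF countable_rat_boxes], rule ballI)
    fix z assume z: "z \<in> rat_boxes \<Omega>"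
    have "AE t in lborel. \<forall>y\<in>rat_boxes {0<..<T}. indicator (cbox (fst y) (snd y)) t \<noteq> (0::real) \<longrightarrow> integrable lborel (\<lambda>x. Hg t x * indicator (cbox (fst z) (snd z)) x)"
    proof (subst AE_ball_countable[OF countable_rat_boxes], rule ballI)
      fix y :: "real \<times> real" assume y: "y \<in> rat_boxes {0<..<T}"
      show "AE t in lborel. indicator (cbox (fst y) (snd y)) t \<noteq> (0::real) \<longrightarrow> integrable lborel (\<lambda>x. Hg t x * indicator (cbox (fst z) (snd z)) x)"
        by (rule slice_Fubini(3)[OF \<Omega> li(2) Hg, of "indicator (cbox (fst z) (snd z))" "cbox (fst z) (snd z)" 1
              "indicator (cbox (fst y) (snd y))" "cbox (fst y) (snd y)" 1])
           (use y z in \<open>auto simp: rat_boxes_def indicator_def\<close>)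
    qed
    then show "AE t in lborel. t \<in> {0<..<T} \<longrightarrow> integrable lborel (\<lambda>x. Hg t x * indicator (cbox (fst z) (snd z)) x)"
    proof eventually_elim
      case (elim t)
      show ?case
      proof
        assume "t \<in> {0<..<T}"
        then obtain a b where ab: "(a, b) \<in> rat_boxes {0<..<T}" "t \<in> box a b"
          using rat_boxes_cover[of "{0<..<T}" t] by auto
        then have "t \<in> cbox a b" using box_subset_cbox by blast
        then show "integrable lborel (\<lambda>x. Hg t x * indicator (cbox (fst z) (snd z)) x)"
          using elim ab(1) by force
      qed
    qed
  qed
  show ?thesis
    using all Hloc H2 borel_version_slice[OF \<Omega> ug]
  proof eventually_elim
    case (elim t)
    show ?case
    proof
      assume t: "t \<in> {0<..<T}"
      let ?ut = "\<lambda>x. u (x, t)"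
      let ?D = "weak_deriv \<Omega> i ?ut" and ?DD = "weak_deriv \<Omega> i (weak_deriv \<Omega> i ?ut)"
      have ut: "?ut \<in> H2 \<Omega>" and ae: "AE x in ?M. ?ut x = ug t x" using elim t by auto
      have ut1: "?ut \<in> H1 \<Omega>" and D1: "?D \<in> H1 \<Omega>" using ut i by (auto simp: H2_def)
      have utm: "?ut \<in> borel_measurable ?M" using ut1 by (simp add: H1_def Lq_space_2)
      note W = H1_weak_deriv[OF \<Omega> ut1 i] and WW = H1_weak_deriv[OF \<Omega> D1 i]
      have DDl: "locally_integrable \<Omega> ?DD" using WW(1) by (simp add: has_weak_deriv_def)
      have "AE x in ?M. Hg t x - ?DD x = 0"
      proof (rule AE_zero_if_bump_integrals_zero[OF \<Omega>])
        fix n and a b :: 'a assume ab: "(a, b) \<in> rat_boxes \<Omega>"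
        have sub: "cbox a b \<subseteq> \<Omega>" using ab by (auto simp: rat_boxes_def)
        have Hi: "integrable lborel (\<lambda>x. Hg t x * indicator (cbox a b) x)" using elim(2) ab t by fastforce
        then have "integrable lebesgue (\<lambda>x. Hg t x * indicator (cbox a b) x)"
          by (subst integrable_completion) (auto simp: borel_measurable_integrable)
        then have Hs: "set_integrable lebesgue (cbox a b) (Hg t)" by (simp add: set_integrable_def mult.commute)
        have "set_integrable lebesgue (cbox a b) ?DD" using DDl sub by (auto simp: locally_integrable_def)
        then show "set_integrable lebesgue (cbox a b) (\<lambda>x. Hg t x - ?DD x)" using Hs by (intro set_integral_diff(1))
        have \<phi>: "bump n a b \<in> test_functions \<Omega>" by (rule bump_test_function[OF sub])
        let ?\<phi> = "bump n a b"
        let ?d = "\<lambda>x. frechet_derivative ?\<phi> (at x) i" 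
        note d = test_function_partial[OF \<phi> i]
        note dd = test_function_partial[OF d i]
        have "(LINT x|?M. Hg t x * ?\<phi> x) = (LINT x|?M. ug t x * frechet_derivative ?d (at x) i)"
          using elim(1) ab t by fastforce
        also have "\<dots> = (LINT x|?M. ?ut x * frechet_derivative ?d (at x) i)"
        proof (rule integral_cong_AE)
          show "AE x in ?M. ug t x * frechet_derivative ?d (at x) i = ?ut x * frechet_derivative ?d (at x) i"
            using ae by eventually_elim simp
        qed (intro borel_measurable_times ugm utm test_function_measurable_lebesgue_on[OF dd])+
        also have "\<dots> = - (LINT x|?M. ?D x * ?d x)" using W(1) d by (simp add: has_weak_deriv_def)
        also have "(LINT x|?M. ?D x * ?d x) = - (LINT x|?M. ?DD x * ?\<phi> x)" using WW(1) \<phi> by (simp add: has_weak_deriv_def)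
        finally have eq: "(LINT x|?M. Hg t x * ?\<phi> x) = (LINT x|?M. ?DD x * ?\<phi> x)" by simp
        have Hint: "integrable ?M (\<lambda>x. Hg t x * ?\<phi> x)"
        proof -
          obtain B where B: "\<And>x. \<bar>?\<phi> x\<bar> \<le> B" using test_function_bounded[OF \<phi>] by metis
          have "integrable lebesgue (\<lambda>x. (indicator (cbox a b) x *\<^sub>R Hg t x) * ?\<phi> x)"
            by (rule integrable_mult_bounded[OF _ _ B])
               (use Hs test_function_measurable[OF \<phi>] in \<open>auto simp: set_integrable_def intro: measurable_completion\<close>)
          moreover have "(indicator (cbox a b) x *\<^sub>R Hg t x) * ?\<phi> x = indicator \<Omega> x *\<^sub>R (Hg t x * ?\<phi> x)" for x
          proof (cases "x \<in> box a b")
            case True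
            then have "x \<in> cbox a b" "x \<in> \<Omega>" using box_subset_cbox sub by auto
            then show ?thesis by simp
          qed (simp add: bump_eq_0)
          ultimately show ?thesis using \<Omega>s by (subst integrable_restrict_space) (simp_all only: sets_completionI_sets, auto)
        qed
        show "(LINT x|?M. (Hg t x - ?DD x) * ?\<phi> x) = 0"
          using eq Hint locally_integrable_mult_test[OF DDl \<phi> \<Omega>s] by (simp add: left_diff_distrib)
      qed
      then show "AE x in ?M. Hg t x = ?DD x" by eventually_elim simp
    qed
  qed
qed

section \<open>Blow-up\<close>

lemma slice_AE:
  fixes \<Omega> :: "'a::euclidean_space set" and T :: real and P :: "'a \<times> real \<Rightarrow> bool"
  assumes "open \<Omega>" "AE z in lebesgue_on (\<Omega> \<times> {0<..<T}). P z"
  shows "AE t in lborel. t \<in> {0<..<T} \<longrightarrow> (AE x in lebesgue_on \<Omega>. P (x, t))"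
proof -
  have "open (\<Omega> \<times> {0<..<T})" using assms(1) by (intro open_Times) auto
  then have "AE z in lborel. z \<in> \<Omega> \<times> {0<..<T} \<longrightarrow> P z"
    using assms(2) by (subst (asm) AE_restrict_space_iff) (auto simp: AE_completion_iff)
  from AE_lborel_swap[OF this] show ?thesis
  proof eventually_elim
    case (elim t)
    have "AE x in lebesgue. (x, t) \<in> \<Omega> \<times> {0<..<T} \<longrightarrow> P (x, t)"
      using AE_completion[OF elim] by simp
    then show ?case using assms(1) by (auto simp: AE_restrict_space_iff)
  qed
qed

lemma Linfty_BochnerD:
  assumes "f \<in> Linfty_Bochner T X nrm"
  obtains C where "AE t in lborel. t \<in> {0<..<T} \<longrightarrow> f t \<in> X \<and> nrm (f t) \<le> C"
proof -
  obtain s C where "AE t in lebesgue_on {0<..<T}. f t \<in> X \<and> (\<lambda>n::nat. nrm (\<lambda>x. s n t x - f t x)) \<longlonglongrightarrow> 0"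
    and "AE t in lebesgue_on {0<..<T}. nrm (f t) \<le> C"
    using assms unfolding Linfty_Bochner_def strongly_measurable_def by blast
  then have "AE t in lebesgue_on {0<..<T}. f t \<in> X \<and> nrm (f t) \<le> C" by eventually_elim simp
  then show thesis unfolding AE_lebesgue_on_interval by (rule that)
qed

lemma nn_integral_sq_le:
  assumes f: "f \<in> Lq_space 2 \<Omega>" and c: "Lq_norm 2 \<Omega> f \<le> c" and ae: "AE x in lebesgue_on \<Omega>. f x = g x"
  shows "(\<integral>\<^sup>+x. ennreal ((g x)\<^sup>2) \<partial>lebesgue_on \<Omega>) \<le> ennreal (c\<^sup>2)"
proof -
  have "(\<integral>\<^sup>+x. ennreal ((g x)\<^sup>2) \<partial>lebesgue_on \<Omega>) = (\<integral>\<^sup>+x. ennreal ((f x)\<^sup>2) \<partial>lebesgue_on \<Omega>)"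
    by (rule nn_integral_cong_AE) (use ae in \<open>eventually_elim, simp\<close>)
  also have "\<dots> = ennreal (LINT x|lebesgue_on \<Omega>. (f x)\<^sup>2)"
    using f by (intro nn_integral_eq_integral) (auto simp: Lq_space_2)
  also have "\<dots> \<le> ennreal (c\<^sup>2)"
  proof (rule ennreal_leI)
    have "0 \<le> Lq_norm 2 \<Omega> f" by (simp add: Lq_norm_2)
    then show "(LINT x|lebesgue_on \<Omega>. (f x)\<^sup>2) \<le> c\<^sup>2"
      unfolding Lq_norm_2_sq[symmetric] using c by (intro power_mono)
  qed
  finally show ?thesis .
qed

lemma Lq_norm_le_H1_norm: "Lq_norm 2 \<Omega> f \<le> H1_norm \<Omega> f"
  unfolding H1_norm_def by (rule real_le_rsqrt) simp

lemma H1_norm_le_H2_norm: "H1_norm \<Omega> f \<le> H2_norm \<Omega> f"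
  unfolding H2_norm_def by (rule real_le_rsqrt) (simp add: sum_nonneg)

text \<open>Cauchy-Schwarz over the coordinates produces the factor sqrt N, and the pure second
  derivative in direction i is one of the summands in the gradient norm of the i-th
  derivative.\<close>

lemma laplacian_norm_le:
  fixes \<Omega> :: "'a::euclidean_space set"
  assumes \<Omega>: "open \<Omega>" and f: "f \<in> H2 \<Omega>"
  shows "Lq_norm 2 \<Omega> (laplacian \<Omega> f) \<le> sqrt DIM('a) * H2_norm \<Omega> f"
proof -
  let ?M = "lebesgue_on \<Omega>"
  let ?DD = "\<lambda>i. weak_deriv \<Omega> i (weak_deriv \<Omega> i f)"
  have D: "weak_deriv \<Omega> i f \<in> H1 \<Omega>" if "i \<in> Basis" for i using f that by (simp add: H2_def)
  have DD: "?DD i \<in> Lq_space 2 \<Omega>" if "i \<in> Basis" for i by (rule H1_weak_deriv(2)[OF \<Omega> D[OF that] that])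
  have "(LINT x|?M. (laplacian \<Omega> f x)\<^sup>2) \<le> (LINT x|?M. DIM('a) * (\<Sum>i\<in>Basis. (?DD i x)\<^sup>2))"
  proof (rule integral_mono)
    show "integrable ?M (\<lambda>x. (laplacian \<Omega> f x)\<^sup>2)" using laplacian_L2[OF \<Omega> f] by (simp add: Lq_space_2)
    show "integrable ?M (\<lambda>x. DIM('a) * (\<Sum>i\<in>Basis. (?DD i x)\<^sup>2))" using DD by (simp add: Lq_space_2)
    fix x
    show "(laplacian \<Omega> f x)\<^sup>2 \<le> DIM('a) * (\<Sum>i\<in>Basis. (?DD i x)\<^sup>2)"
      using Cauchy_Schwarz_ineq_sum[of "\<lambda>_. 1" "\<lambda>i. ?DD i x" "Basis :: 'a set"] by (simp add: laplacian_def)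
  qed
  also have "\<dots> = DIM('a) * (\<Sum>i\<in>Basis. LINT x|?M. (?DD i x)\<^sup>2)" using DD by (simp add: Lq_space_2)
  also have "\<dots> \<le> DIM('a) * (\<Sum>i\<in>Basis. (grad_norm \<Omega> (weak_deriv \<Omega> i f))\<^sup>2)"
  proof (intro mult_left_mono sum_mono)
    fix i :: 'a assume i: "i \<in> Basis"
    show "(LINT x|?M. (?DD i x)\<^sup>2) \<le> (grad_norm \<Omega> (weak_deriv \<Omega> i f))\<^sup>2"
      unfolding grad_norm_sq[OF \<Omega> D[OF i]]
      by (rule member_le_sum[OF i, of "\<lambda>j. LINT x|?M. (weak_deriv \<Omega> j (weak_deriv \<Omega> i f) x)\<^sup>2"]) auto
  qed simp
  also have "\<dots> \<le> DIM('a) * (H2_norm \<Omega> f)\<^sup>2"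
    by (intro mult_left_mono) (auto simp: H2_norm_def sum_nonneg)
  finally have "Lq_norm 2 \<Omega> (laplacian \<Omega> f) \<le> sqrt (DIM('a) * (H2_norm \<Omega> f)\<^sup>2)"
    unfolding Lq_norm_2 by (rule real_sqrt_le_mono)
  moreover have "0 \<le> H2_norm \<Omega> f" by (simp add: H2_norm_def sum_nonneg)
  ultimately show ?thesis by (simp add: real_sqrt_mult)
qed

section \<open>From a solution to the abstract equation, and the lifespan\<close>

text \<open>Borel versions of u, its two time derivatives and its Laplacian form an instance of
  \<open>damped_wave\<close> over Lebesgue measure on the domain. All constants are fixed before the
  solution, so the bound serves every solution with these data.\<close>

lemma solution_existence_time_bound:
  fixes \<Omega> :: "'a::euclidean_space set" and \<alpha> \<kappa> \<epsilon> p :: real and u0 u1 :: "'a \<Rightarrow> real"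
  defines "\<mu> \<equiv> measure (lebesgue_on \<Omega>) \<Omega>"
  defines "\<Lambda>0 \<equiv> (- initial_energy \<Omega> p u0 u1) powr (1 - \<alpha>) + \<epsilon> * (LINT x|lebesgue_on \<Omega>. u0 x * u1 x)"
  assumes \<Omega>: "open \<Omega>" "bounded \<Omega>" and p: "2 < p"
    and u0: "u0 \<in> H2 \<Omega> \<inter> H10 \<Omega>" and u1: "u1 \<in> H10 \<Omega>" and E: "initial_energy \<Omega> p u0 u1 < 0"
    and \<alpha>: "\<alpha> = 1 / 2 - 1 / p" and \<kappa>: "\<kappa> = (1 + \<mu>) / (2 * \<alpha>\<^sup>2)"
    and \<epsilon>: "0 < \<epsilon>" "\<epsilon> * \<kappa> \<le> 2 * (1 - \<alpha>)" and \<Lambda>0: "0 < \<Lambda>0"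
    and T: "0 < T" and sol: "is_solution \<Omega> p u0 u1 T u"
  shows "T \<le> \<Lambda>0 powr (- (\<alpha> / (1 - \<alpha>))) / (\<alpha> / (1 - \<alpha>) * (\<epsilon> * \<alpha> / (1 + \<epsilon> * (1 + \<mu>)) powr (1 / (1 - \<alpha>))))"
proof -
  let ?M = "lebesgue_on \<Omega>" and ?Q = "\<Omega> \<times> {0<..<T}"
  have \<Omega>l: "\<Omega> \<in> lmeasurable" using \<Omega> by (intro bounded_set_imp_lmeasurable) auto
  interpret fM: finite_measure ?M by (rule finite_measure_lebesgue_on[OF \<Omega>l])
  obtain v w L where wd: "has_weak_deriv ?Q (0, 1) u v" "has_weak_deriv ?Q (0, 1) v w"
    and lap: "has_weak_laplacian ?Q u L"
    and B: "(\<lambda>t x. u (x, t)) \<in> Linfty_Bochner T (H2 \<Omega> \<inter> H10 \<Omega>) (H2_norm \<Omega>)"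
      "(\<lambda>t x. v (x, t)) \<in> Linfty_Bochner T (H10 \<Omega>) (H1_norm \<Omega>)"
      "(\<lambda>t x. w (x, t)) \<in> Linfty_Bochner T (Lq_space 2 \<Omega>) (Lq_norm 2 \<Omega>)"
    and eq: "AE z in lebesgue_on ?Q. w z - L z + v z * ln (1 + (v z)\<^sup>2) = \<bar>u z\<bar> powr (p - 2) * u z"
    and iv: "has_initial_value \<Omega> T u u0" "has_initial_value \<Omega> T v u1"
    using sol unfolding is_solution_def by blast
  obtain G H where GH: "\<And>i. i \<in> Basis \<Longrightarrow> has_weak_deriv ?Q (i, 0) u (G i)" "\<And>i. i \<in> Basis \<Longrightarrow> has_weak_deriv ?Q (i, 0) (G i) (H i)"
    and L: "L = (\<lambda>z. \<Sum>i\<in>Basis. H i z)"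
    using lap unfolding has_weak_laplacian_def by blast
  have li: "locally_integrable ?Q u" "locally_integrable ?Q v" "locally_integrable ?Q w"
    using wd by (auto simp: has_weak_deriv_def)
  have liH: "locally_integrable ?Q (H i)" if "i \<in> Basis" for i using GH(2)[OF that] by (simp add: has_weak_deriv_def)
  obtain ug where ug: "borel_version \<Omega> T u ug" by (rule ex_borel_version[OF \<Omega>(1) li(1)])
  obtain vg where vg: "borel_version \<Omega> T v vg" by (rule ex_borel_version[OF \<Omega>(1) li(2)])
  obtain wg where wg: "borel_version \<Omega> T w wg" by (rule ex_borel_version[OF \<Omega>(1) li(3)])
  have "\<forall>i\<in>Basis. \<exists>h. borel_version \<Omega> T (H i) h" using ex_borel_version[OF \<Omega>(1) liH] by metis
  then obtain Hg where Hg: "\<And>i. i \<in> Basis \<Longrightarrow> borel_version \<Omega> T (H i) (Hg i)" by metis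
  define Lg where "Lg t x = (\<Sum>i\<in>Basis. Hg i t x)" for t x
  obtain C1 where C1: "AE t in lborel. t \<in> {0<..<T} \<longrightarrow> (\<lambda>x. u (x, t)) \<in> H2 \<Omega> \<inter> H10 \<Omega> \<and> H2_norm \<Omega> (\<lambda>x. u (x, t)) \<le> C1"
    by (rule Linfty_BochnerD[OF B(1)])
  obtain C2 where C2: "AE t in lborel. t \<in> {0<..<T} \<longrightarrow> (\<lambda>x. v (x, t)) \<in> H10 \<Omega> \<and> H1_norm \<Omega> (\<lambda>x. v (x, t)) \<le> C2"
    by (rule Linfty_BochnerD[OF B(2)])
  obtain C3 where C3: "AE t in lborel. t \<in> {0<..<T} \<longrightarrow> (\<lambda>x. w (x, t)) \<in> Lq_space 2 \<Omega> \<and> Lq_norm 2 \<Omega> (\<lambda>x. w (x, t)) \<le> C3"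
    by (rule Linfty_BochnerD[OF B(3)])
  have slu: "AE t in lborel. t \<in> {0<..<T} \<longrightarrow> (AE x in ?M. u (x, t) = ug t x)" by (rule borel_version_slice[OF \<Omega>(1) ug])
  have slv: "AE t in lborel. t \<in> {0<..<T} \<longrightarrow> (AE x in ?M. v (x, t) = vg t x)" by (rule borel_version_slice[OF \<Omega>(1) vg])
  have slw: "AE t in lborel. t \<in> {0<..<T} \<longrightarrow> (AE x in ?M. w (x, t) = wg t x)" by (rule borel_version_slice[OF \<Omega>(1) wg])
  have slH: "AE t in lborel. \<forall>i\<in>Basis. t \<in> {0<..<T} \<longrightarrow> (AE x in ?M. H i (x, t) = Hg i t x)"
    by (intro AE_finite_allI finite_Basis borel_version_slice[OF \<Omega>(1)] Hg)
  have "AE t in lborel. t \<in> {0<..<T} \<longrightarrow> (\<lambda>x. u (x, t)) \<in> H2 \<Omega>" using C1 by eventually_elim simp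
  note sd = second_weak_deriv_slice[OF \<Omega>(1) _ GH ug Hg this]
  have slD: "AE t in lborel. \<forall>i\<in>Basis. t \<in> {0<..<T} \<longrightarrow> (AE x in ?M. Hg i t x = weak_deriv \<Omega> i (weak_deriv \<Omega> i (\<lambda>x. u (x, t))) x)"
    by (intro AE_finite_allI finite_Basis sd)
  have slL: "AE t in lborel. t \<in> {0<..<T} \<longrightarrow> (AE x in ?M. laplacian \<Omega> (\<lambda>x. u (x, t)) x = Lg t x)"
    using slD
  proof eventually_elim
    case (elim t)
    show ?case
    proof
      assume "t \<in> {0<..<T}"
      then have "AE x in ?M. \<forall>i\<in>Basis. Hg i t x = weak_deriv \<Omega> i (weak_deriv \<Omega> i (\<lambda>x. u (x, t))) x"
        using elim by (subst AE_ball_countable) (auto intro: countable_finite)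
      then show "AE x in ?M. laplacian \<Omega> (\<lambda>x. u (x, t)) x = Lg t x"
        by eventually_elim (simp add: laplacian_def Lg_def)
    qed
  qed
  have "\<exists>K. \<forall>f. f \<in> H10 \<Omega> \<longrightarrow> H1_norm \<Omega> f \<le> C2 \<longrightarrow>
    (\<integral>\<^sup>+x. ennreal (\<bar>f x\<bar> powr (2 + 2 / DIM('a))) \<partial>?M) \<le> ennreal K"
    by (rule H10_higher_integrability[OF \<Omega>, where C = C2]) blast
  then obtain C4 where C4: "\<And>f. f \<in> H10 \<Omega> \<Longrightarrow> H1_norm \<Omega> f \<le> C2 \<Longrightarrow>
    (\<integral>\<^sup>+x. ennreal (\<bar>f x\<bar> powr (2 + 2 / DIM('a))) \<partial>?M) \<le> ennreal C4" by blast
  \<comment> \<open>One constant for all slice bounds, as the locale has a single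
    \<open>C\<close>.\<close>
  define C where "C = max (C1\<^sup>2) (max (C2\<^sup>2) (max (C3\<^sup>2) (max C4 ((sqrt DIM('a) * C1)\<^sup>2))))"
  have Cge: "C1\<^sup>2 \<le> C" "C2\<^sup>2 \<le> C" "C3\<^sup>2 \<le> C" "C4 \<le> C" "(sqrt DIM('a) * C1)\<^sup>2 \<le> C" unfolding C_def by linarith+
  have bu: "AE t in lborel. t \<in> {0<..<T} \<longrightarrow> (\<integral>\<^sup>+x. ennreal ((ug t x)\<^sup>2) \<partial>?M) \<le> ennreal C"
    using C1 slu
  proof eventually_elim
    case (elim t)
    show ?case
    proof
      assume t: "t \<in> {0<..<T}"
      have f: "(\<lambda>x. u (x, t)) \<in> Lq_space 2 \<Omega>" using elim(1) t by (simp add: H2_def H1_def)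
      have "Lq_norm 2 \<Omega> (\<lambda>x. u (x, t)) \<le> C1"
        using elim(1) t Lq_norm_le_H1_norm[of \<Omega> "\<lambda>x. u (x, t)"] H1_norm_le_H2_norm[of \<Omega> "\<lambda>x. u (x, t)"] by auto
      from nn_integral_sq_le[OF f this] show "(\<integral>\<^sup>+x. ennreal ((ug t x)\<^sup>2) \<partial>?M) \<le> ennreal C"
        using elim(2) t Cge(1) by (meson order_trans ennreal_leI)
    qed
  qed
  have bv: "AE t in lborel. t \<in> {0<..<T} \<longrightarrow> (\<integral>\<^sup>+x. ennreal ((vg t x)\<^sup>2) \<partial>?M) \<le> ennreal C"
    using C2 slv
  proof eventually_elim
    case (elim t)
    show ?case
    proof
      assume t: "t \<in> {0<..<T}"
      have f: "(\<lambda>x. v (x, t)) \<in> Lq_space 2 \<Omega>" using elim(1) t by (simp add: H10_def H1_def)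
      have "Lq_norm 2 \<Omega> (\<lambda>x. v (x, t)) \<le> C2"
        using elim(1) t Lq_norm_le_H1_norm[of \<Omega> "\<lambda>x. v (x, t)"] by auto
      from nn_integral_sq_le[OF f this] show "(\<integral>\<^sup>+x. ennreal ((vg t x)\<^sup>2) \<partial>?M) \<le> ennreal C"
        using elim(2) t Cge(2) by (meson order_trans ennreal_leI)
    qed
  qed
  have bw: "AE t in lborel. t \<in> {0<..<T} \<longrightarrow> (\<integral>\<^sup>+x. ennreal ((wg t x)\<^sup>2) \<partial>?M) \<le> ennreal C"
    using C3 slw
  proof eventually_elim
    case (elim t)
    show ?case
    proof
      assume t: "t \<in> {0<..<T}"
      then have "(\<lambda>x. w (x, t)) \<in> Lq_space 2 \<Omega>" "Lq_norm 2 \<Omega> (\<lambda>x. w (x, t)) \<le> C3" using elim(1) by auto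
      from nn_integral_sq_le[OF this] show "(\<integral>\<^sup>+x. ennreal ((wg t x)\<^sup>2) \<partial>?M) \<le> ennreal C"
        using elim(2) t Cge(3) by (meson order_trans ennreal_leI)
    qed
  qed
  have bL: "AE t in lborel. t \<in> {0<..<T} \<longrightarrow> (\<integral>\<^sup>+x. ennreal ((Lg t x)\<^sup>2) \<partial>?M) \<le> ennreal C"
    using C1 slL
  proof eventually_elim
    case (elim t)
    show ?case
    proof
      assume t: "t \<in> {0<..<T}"
      have f: "(\<lambda>x. u (x, t)) \<in> H2 \<Omega>" and n: "H2_norm \<Omega> (\<lambda>x. u (x, t)) \<le> C1" using elim(1) t by auto
      have "Lq_norm 2 \<Omega> (laplacian \<Omega> (\<lambda>x. u (x, t))) \<le> sqrt DIM('a) * C1"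
        by (rule order_trans[OF laplacian_norm_le[OF \<Omega>(1) f] mult_left_mono[OF n]]) simp
      from nn_integral_sq_le[OF laplacian_L2[OF \<Omega>(1) f] this] show "(\<integral>\<^sup>+x. ennreal ((Lg t x)\<^sup>2) \<partial>?M) \<le> ennreal C"
        using elim(2) t Cge(5) by (meson order_trans ennreal_leI)
    qed
  qed
  have bq: "AE t in lborel. t \<in> {0<..<T} \<longrightarrow> (\<integral>\<^sup>+x. ennreal (\<bar>vg t x\<bar> powr (2 + 2 / DIM('a))) \<partial>?M) \<le> ennreal C"
    using C2 slv
  proof eventually_elim
    case (elim t)
    show ?case
    proof
      assume t: "t \<in> {0<..<T}"
      have ae: "AE x in ?M. v (x, t) = vg t x" using elim(2) t by blast
      have "(\<integral>\<^sup>+x. ennreal (\<bar>vg t x\<bar> powr (2 + 2 / DIM('a))) \<partial>?M) = (\<integral>\<^sup>+x. ennreal (\<bar>v (x, t)\<bar> powr (2 + 2 / DIM('a))) \<partial>?M)"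
        by (rule nn_integral_cong_AE) (use ae in \<open>eventually_elim, simp\<close>)
      also have "\<dots> \<le> ennreal C4" using C4 elim(1) t by blast
      also have "\<dots> \<le> ennreal C" by (rule ennreal_leI[OF Cge(4)])
      finally show "(\<integral>\<^sup>+x. ennreal (\<bar>vg t x\<bar> powr (2 + 2 / DIM('a))) \<partial>?M) \<le> ennreal C" .
    qed
  qed
  have u0L: "u0 \<in> Lq_space 2 \<Omega>" and u1L: "u1 \<in> Lq_space 2 \<Omega>" using u0 u1 by (auto simp: H10_def H1_def)
  have L0L: "laplacian \<Omega> u0 \<in> Lq_space 2 \<Omega>" using laplacian_L2[OF \<Omega>(1)] u0 by blast
  have ur: "AE t in lborel. t \<in> {0<..<T} \<longrightarrow> (AE x in ?M. ug t x = u0 x + (LBINT s:{0..t}. vg s x))"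
    by (rule time_representation[OF \<Omega> T wd(1) ug vg bu bv iv(1) u0L])
  have vr: "AE t in lborel. t \<in> {0<..<T} \<longrightarrow> (AE x in ?M. vg t x = u1 x + (LBINT s:{0..t}. wg s x))"
    by (rule time_representation[OF \<Omega> T wd(2) vg wg bv bw iv(2) u1L])
  have equation: "AE t in lborel. t \<in> {0<..<T} \<longrightarrow> (AE x in ?M. wg t x - Lg t x + vg t x * ln (1 + (vg t x)\<^sup>2) = \<bar>ug t x\<bar> powr (p - 2) * ug t x)"
    using slice_AE[OF \<Omega>(1) eq] slu slv slw slH
  proof eventually_elim
    case (elim t)
    show ?case
    proof
      assume t: "t \<in> {0<..<T}"
      have "AE x in ?M. \<forall>i\<in>Basis. H i (x, t) = Hg i t x"
        using elim(5) t by (subst AE_ball_countable) (auto intro: countable_finite)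
      moreover have "AE x in ?M. w (x, t) - L (x, t) + v (x, t) * ln (1 + (v (x, t))\<^sup>2) = \<bar>u (x, t)\<bar> powr (p - 2) * u (x, t)"
        "AE x in ?M. u (x, t) = ug t x" "AE x in ?M. v (x, t) = vg t x" "AE x in ?M. w (x, t) = wg t x"
        using elim t by auto
      ultimately show "AE x in ?M. wg t x - Lg t x + vg t x * ln (1 + (vg t x)\<^sup>2) = \<bar>ug t x\<bar> powr (p - 2) * ug t x"
        by eventually_elim (simp add: L Lg_def)
    qed
  qed
  \<comment> \<open>Times at which the slice itself is regular and agrees with the Borel versions:
    there the symmetry of the Laplacian, known for genuine slices, transfers to \<open>ug\<close>
    and \<open>Lg\<close>.\<close>
  define S where "S = {t \<in> {0<..<T}. (\<lambda>x. u (x, t)) \<in> H2 \<Omega> \<inter> H10 \<Omega> \<and> (AE x in ?M. u (x, t) = ug t x) \<and>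
    (AE x in ?M. laplacian \<Omega> (\<lambda>x. u (x, t)) x = Lg t x)}"
  have S: "AE t in lborel. t \<in> {0<..<T} \<longrightarrow> t \<in> S"
    using C1 slu slL by eventually_elim (simp add: S_def)
  have ugm: "(\<lambda>(t, x). ug t x) \<in> borel_measurable (lborel \<Otimes>\<^sub>M ?M)" by (rule borel_version_measurable[OF ug])
  have vgm: "(\<lambda>(t, x). vg t x) \<in> borel_measurable (lborel \<Otimes>\<^sub>M ?M)" by (rule borel_version_measurable[OF vg])
  have wgm: "(\<lambda>(t, x). wg t x) \<in> borel_measurable (lborel \<Otimes>\<^sub>M ?M)" by (rule borel_version_measurable[OF wg])
  have Lgm: "(\<lambda>(t, x). Lg t x) \<in> borel_measurable (lborel \<Otimes>\<^sub>M ?M)"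
    using borel_measurable_sum[of Basis "\<lambda>i z. Hg i (fst z) (snd z)" "lborel \<Otimes>\<^sub>M ?M"] borel_version_measurable[OF Hg]
    by (simp add: Lg_def case_prod_beta')
  have sm: "ug t \<in> borel_measurable ?M" "Lg t \<in> borel_measurable ?M" for t
    using measurable_compose[OF measurable_Pair1' ugm, of t] measurable_compose[OF measurable_Pair1' Lgm, of t] by simp_all
  have slice: "(LINT x|?M. Lg s x * ug t x) = (LINT x|?M. laplacian \<Omega> (\<lambda>x. u (x, s)) x * u (x, t))" if "s \<in> S" "t \<in> S" for s t
  proof (rule integral_cong_AE)
    have "AE x in ?M. u (x, t) = ug t x" "AE x in ?M. laplacian \<Omega> (\<lambda>x. u (x, s)) x = Lg s x" using that by (auto simp: S_def)
    then show "AE x in ?M. Lg s x * ug t x = laplacian \<Omega> (\<lambda>x. u (x, s)) x * u (x, t)" by eventually_elim simp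
    have "(\<lambda>x. u (x, t)) \<in> Lq_space 2 \<Omega>" "laplacian \<Omega> (\<lambda>x. u (x, s)) \<in> Lq_space 2 \<Omega>"
      using that laplacian_L2[OF \<Omega>(1)] by (auto simp: S_def H2_def H1_def)
    then show "(\<lambda>x. laplacian \<Omega> (\<lambda>x. u (x, s)) x * u (x, t)) \<in> borel_measurable ?M" by (intro borel_measurable_times) (simp_all add: Lq_space_2)
  qed (intro borel_measurable_times sm)
  have sym: "(LINT x|?M. Lg s x * ug t x) = (LINT x|?M. Lg t x * ug s x)" if "s \<in> S" "t \<in> S" for s t
    using laplacian_symmetric[OF \<Omega>(1), of "\<lambda>x. u (x, s)" "\<lambda>x. u (x, t)"] that slice[OF that] slice[OF that(2,1)]
    by (simp add: S_def mult.commute)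
  have sym0: "(LINT x|?M. laplacian \<Omega> u0 x * ug t x) = (LINT x|?M. Lg t x * u0 x)" if t: "t \<in> S" for t
  proof -
    have m: "(\<lambda>x. u (x, t)) \<in> borel_measurable ?M" "laplacian \<Omega> (\<lambda>x. u (x, t)) \<in> borel_measurable ?M"
      "u0 \<in> borel_measurable ?M" "laplacian \<Omega> u0 \<in> borel_measurable ?M"
      using t laplacian_L2[OF \<Omega>(1)] u0L L0L by (auto simp: S_def H2_def H1_def Lq_space_2)
    have "(LINT x|?M. laplacian \<Omega> u0 x * ug t x) = (LINT x|?M. laplacian \<Omega> u0 x * u (x, t))"
    proof (rule integral_cong_AE)
      have "AE x in ?M. u (x, t) = ug t x" using t by (simp add: S_def)
      then show "AE x in ?M. laplacian \<Omega> u0 x * ug t x = laplacian \<Omega> u0 x * u (x, t)" by eventually_elim simp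
    qed (intro borel_measurable_times m sm)+
    also have "\<dots> = (LINT x|?M. u0 x * laplacian \<Omega> (\<lambda>x. u (x, t)) x)"
      using laplacian_symmetric[OF \<Omega>(1) u0, of "\<lambda>x. u (x, t)"] t by (simp add: S_def mult.commute)
    also have "\<dots> = (LINT x|?M. Lg t x * u0 x)"
    proof (rule integral_cong_AE)
      have "AE x in ?M. laplacian \<Omega> (\<lambda>x. u (x, t)) x = Lg t x" using t by (simp add: S_def)
      then show "AE x in ?M. u0 x * laplacian \<Omega> (\<lambda>x. u (x, t)) x = Lg t x * u0 x" by eventually_elim simp
    qed (intro borel_measurable_times m sm)+
    finally show ?thesis .
  qed
  interpret W: damped_wave ?M T p "2 + 2 / DIM('a)" C ug vg wg Lg u0 u1 "laplacian \<Omega> u0" S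
    by unfold_locales
       (use T p ugm vgm wgm Lgm u0L u1L L0L bu bv bw bL bq equation ur vr S sym sym0 in \<open>simp_all add: Lq_space_2\<close>)
  \<comment> \<open>Green's formula for \<open>u0\<close> identifies the abstract initial constant
    with the gradient norm, which makes \<open>W.H0\<close> equal to - E(0).\<close>
  have e0: "W.e0 = (grad_norm \<Omega> u0)\<^sup>2"
    using laplacian_grad_norm[OF \<Omega>(1) u0] by (simp add: W.e0_def mult.commute)
  have H0: "W.H0 = - initial_energy \<Omega> p u0 u1"
  proof -
    have "Lq_norm p \<Omega> u0 powr p = (LINT x|?M. \<bar>u0 x\<bar> powr p)"
      using p by (simp add: Lq_norm_def powr_powr)
    then show ?thesis by (simp add: W.H0_def initial_energy_def e0 Lq_norm_2_sq)
  qed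
  have sp: "space ?M = \<Omega>" by simp
  show ?thesis
    using W.blow_up_time_bound[of \<alpha> \<kappa> \<epsilon>] \<alpha> \<kappa> \<epsilon> E \<Lambda>0 unfolding H0 sp \<mu>_def \<Lambda>0_def by simp
qed

theorem theorem6:
  fixes \<Omega> :: "'a::euclidean_space set"
    and p :: real
    and u0 u1 :: "'a \<Rightarrow> real"
  assumes "bounded_smooth_domain \<Omega>"
    and "2 < p"
    and "DIM('a) > 4 \<Longrightarrow> p < real DIM('a) / (real DIM('a) - 4) + 1"
    and "u0 \<in> H2 \<Omega> \<inter> H10 \<Omega>"
    and "u1 \<in> H10 \<Omega>"
    and "initial_energy \<Omega> p u0 u1 < 0"
  shows "blows_up_in_finite_time \<Omega> p u0 u1"
proof -
  have \<Omega>: "open \<Omega>" "bounded \<Omega>" using assms(1) by (auto simp: bounded_smooth_domain_def)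
  define \<alpha> where "\<alpha> = 1 / 2 - 1 / p"
  define \<mu> where "\<mu> = measure (lebesgue_on \<Omega>) \<Omega>"
  define \<kappa> where "\<kappa> = (1 + \<mu>) / (2 * \<alpha>\<^sup>2)"
  define h where "h = (- initial_energy \<Omega> p u0 u1) powr (1 - \<alpha>)"
  define J where "J = (LINT x|lebesgue_on \<Omega>. u0 x * u1 x)"
  \<comment> \<open>The first bound lets the dissipation absorb the damping term; the second keeps
    \<epsilon> \<open>\<bar>J\<bar>\<close> below \<open>h\<close>, so the functional starts
    positive whatever the sign of \<open>J\<close>.\<close>
  define \<epsilon> where "\<epsilon> = min (2 * (1 - \<alpha>) / \<kappa>) (h / (2 * (\<bar>J\<bar> + 1)))"
  have \<alpha>: "0 < \<alpha>" "\<alpha> < 1 / 2" using assms(2) by (auto simp: \<alpha>_def field_simps)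
  have \<kappa>: "\<kappa> > 0" using \<alpha> by (auto simp: \<kappa>_def \<mu>_def intro!: divide_pos_pos add_pos_nonneg)
  have h: "h > 0" using assms(6) by (simp add: h_def)
  have \<epsilon>0: "\<epsilon> > 0" using \<alpha> \<kappa> h by (simp add: \<epsilon>_def)
  have "\<epsilon> * \<kappa> \<le> 2 * (1 - \<alpha>) / \<kappa> * \<kappa>" using \<kappa> by (intro mult_right_mono) (auto simp: \<epsilon>_def)
  then have \<epsilon>\<kappa>: "\<epsilon> * \<kappa> \<le> 2 * (1 - \<alpha>)" using \<kappa> by simp
  have "\<epsilon> * \<bar>J\<bar> \<le> h / (2 * (\<bar>J\<bar> + 1)) * (\<bar>J\<bar> + 1)" using \<epsilon>0 h by (intro mult_mono) (auto simp: \<epsilon>_def)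
  also have "\<dots> = h / 2" by (simp add: field_simps)
  finally have "\<epsilon> * \<bar>J\<bar> < h" using h by simp
  moreover have "- (\<epsilon> * \<bar>J\<bar>) \<le> \<epsilon> * J" using \<epsilon>0 mult_left_mono[of "- \<bar>J\<bar>" J \<epsilon>] by simp
  ultimately have \<Lambda>: "0 < h + \<epsilon> * J" by linarith
  define Tb where "Tb = (h + \<epsilon> * J) powr (- (\<alpha> / (1 - \<alpha>))) / (\<alpha> / (1 - \<alpha>) * (\<epsilon> * \<alpha> / (1 + \<epsilon> * (1 + \<mu>)) powr (1 / (1 - \<alpha>))))"
  have bound: "T \<le> Tb" if "0 < T" "is_solution \<Omega> p u0 u1 T u" for T u
    unfolding Tb_def h_def J_def \<mu>_def
    by (rule solution_existence_time_bound[OF \<Omega> assms(2,4,5,6) \<alpha>_def \<kappa>_def[unfolded \<mu>_def] \<epsilon>0 \<epsilon>\<kappa> \<Lambda>[unfolded h_def J_def] that])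
  show ?thesis
    unfolding blows_up_in_finite_time_def
  \<comment> \<open>The maximum with 1 makes the blow-up time visibly positive, and with it every
    larger \<open>T\<close>, as \<open>bound\<close> requires.\<close>
  proof (intro exI[of _ "max 1 Tb"] conjI allI impI notI)
    fix T assume T: "max 1 Tb < T" and "\<exists>u. is_solution \<Omega> p u0 u1 T u"
    then obtain u where "is_solution \<Omega> p u0 u1 T u" by blast
    with bound[of T u] T show False by simp
  qed simp
qed

end
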